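(* Let $\alpha,\beta\in(0,1)$ and let $\Phi^{(3)}_\alpha$ be the aggregated test of $f=g$ on $\mathbb{R}^d$ built from a family of (non necessarily integrable) approximation kernels $\{k_{m_1},m_1\in\mathbb{N}\setminus\{0\}\}$ and isotropic dyadic bandwidths, as described in the context. Assume that $\ln\ln n\ge1$. For any $\delta,R,R',R''>0$, if $$\mathcal{S}_d^\delta(R,R',R'')=\left\{(f,g)\ :\ (f-g)\in\mathcal{S}_d^\delta(R),\ \max(\|f\|_1,\|g\|_1)\le R',\ \max(\|f\|_\infty,\|g\|_\infty)\le R''\right\},$$ then $$\rho\left(\Phi^{(3)}_\alpha,\mathcal{S}_d^\delta(R,R',R''),\beta\right)\le C(\delta,\alpha,\beta,R,R',R'',d)\left(\frac{\ln\ln n}{n}\right)^{\frac{2\delta}{d+4\delta}},$$ where $C(\delta,\alpha,\beta,R,R',R'',d)$ denotes a positive constant that may depend on the indicated parameters.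
   Context: Setting: $\mathbb{X}=\mathbb{R}^d$, $\nu$ is the Lebesgue measure, $n$ is a positive number, $d\mu=n\,d\nu$. $N^1$ and $N^{-1}$ are independent Poisson processes on $\mathbb{X}$ with intensities $f$ and $g$ with respect to $\mu$; $\mathbb{P}_{f,g}$ is their joint distribution; $\|h\|_\infty=\sup|h|$, $\|h\|_1=\int|h|d\nu$, $\|h\|=(\int h^2d\nu)^{1/2}$. Standing assumption: $\|f\|_1,\|g\|_1,\|f\|_\infty,\|g\|_\infty<+\infty$. Uniform separation rate of a $\{0,1\}$-valued test $\Phi$ (rejecting $f=g$ when $\Phi=1$) over a class $\mathcal{S}$ of pairs $(f,g)$: $\rho(\Phi,\mathcal{S},\beta)=\inf\{\rho>0:\ \sup_{(f,g)\in\mathcal{S},\,\|f-g\|>\rho}\mathbb{P}_{f,g}(\Phi=0)\le\beta\}$. $N$ is the pooled process ($dN=dN^1+dN^{-1}$), with $N_n$ points $X_1,\ldots,X_{N_n}$; for $x\in N$, $\varepsilon^0_x=1$ if $x$ belongs to $N^1$ and $\varepsilon^0_x=-1$ if $x$ belongs to $N^{-1}$. $(\varepsilon_i)_{i\in\mathbb{N}}$ are i.i.d. Rademacher variables independent of $N$. For a symmetric kernel $K$, $\hat T_K=\sum_{x\ne x'\in N}K(x,x')\varepsilon^0_x\varepsilon^0_{x'}$ and $\hat T_K^{\varepsilon}=\sum_{i\ne i'\in\{1,\ldots,N_n\}}K(X_i,X_{i'})\varepsilon_i\varepsilon_{i'}$. Aggregated test associated with a family of symmetric kernels $\{K_m,m\in\mathcal{M}\}$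 and weights $w_m>0$ with $\sum_{m\in\mathcal{M}}e^{-w_m}\le1$: for $u\in(0,1)$, $q^{(N)}_{m,1-u}$ is the $(1-u)$ quantile of $\hat T_{K_m}^{\varepsilon}$ conditionally on $N$; $u_\alpha^{(N)}=\sup\{u>0:\mathbb{P}(\sup_{m\in\mathcal{M}}(\hat T_{K_m}^{\varepsilon}-q^{(N)}_{m,1-ue^{-w_m}})>0\,|\,N)\le\alpha\}$; the test is $\mathbf{1}_{\sup_{m\in\mathcal{M}}(\hat T_{K_m}-q^{(N)}_{m,1-u_\alpha^{(N)}e^{-w_m}})>0}$. Test $\Phi^{(3)}_\alpha$: let $\mathcal{M}_1=\mathbb{N}\setminus\{0\}$, $\mathcal{M}_2=\mathbb{N}$ (including $0$), $\mathcal{M}=\mathcal{M}_1\times\mathcal{M}_2$. For $m_1\in\mathcal{M}_1$, $k_{m_1}:\mathbb{R}^d\to\mathbb{R}$ is a kernel with $\int k_{m_1}^2d\nu<+\infty$, $k_{m_1}(x)=k_{m_1}(-x)$, non necessarily integrable, whose Fourier transform is $\widehat{k_{m_1}}(u)=\int_{\mathbb{R}^d}k_{m_1}(x)e^{i\langle x,u\rangle}d\nu_x$ when $k_{m_1}\in\mathbb{L}^1(\mathbb{R}^d)\cap\mathbb{L}^2(\mathbb{R}^d)$, extended to $\mathbb{L}^2(\mathbb{R}^d)$ in the Plancherel sense. It is assumed that for every $m_1\in\mathcal{M}_1$, $\|\widehat{k_{m_1}}\|_\infty<+\infty$ and $$\operatorname{ess\,sup}_{u\in\mathbb{R}^d\setminus\{0\}}\frac{|1-\widehat{k_{m_1}}(u)|}{\|u\|_d^{m_1}}\le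 C\quad\text{for some }C>0,$$ where $\|u\|_d$ is the Euclidean norm. For $m=(m_1,m_2)\in\mathcal{M}$, $K_m(x,x')=\frac{1}{2^{-dm_2}}k_{m_1}\left(\frac{x_1-x_1'}{2^{-m_2}},\ldots,\frac{x_d-x_d'}{2^{-m_2}}\right)$ and $w_{(m_1,m_2)}=2\left(\ln(m_1(m_2+1))+\ln(\pi^2/6)\right)$. $\Phi^{(3)}_\alpha$ is the aggregated test associated with $\{K_m,m\in\mathcal{M}\}$ and $\{w_m,m\in\mathcal{M}\}$. Sobolev ball: $\mathcal{S}_d^\delta(R)=\{s:\mathbb{R}^d\to\mathbb{R}\ :\ s\in\mathbb{L}^1(\mathbb{R}^d)\cap\mathbb{L}^2(\mathbb{R}^d),\ \int_{\mathbb{R}^d}\|u\|_d^{2\delta}|\hat s(u)|^2du\le(2\pi)^dR^2\}$, with $\hat s(u)=\int_{\mathbb{R}^d}s(x)e^{i\langle x,u\rangle}dx$. *)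

theory Defs
  imports "HOL-Analysis.Analysis" "HOL-Probability.Probability"
begin

section \<open>Norms and Fourier transforms on Euclidean space\<close>

definition in_L1 :: "('a::euclidean_space \<Rightarrow> real) \<Rightarrow> bool" where
  "in_L1 s \<longleftrightarrow> integrable lborel s"

definition in_L2 :: "('a::euclidean_space \<Rightarrow> 'b::real_normed_vector) \<Rightarrow> bool" where
  "in_L2 s \<longleftrightarrow> s \<in> borel_measurable borel \<and> integrable lborel (\<lambda>x. (norm (s x))\<^sup>2)"

definition L1_norm :: "('a::euclidean_space \<Rightarrow> real) \<Rightarrow> real" where
  "L1_norm h = (LINT x|lborel. \<bar>h x\<bar>)"

definition L2_norm :: "('a::euclidean_space \<Rightarrow> 'b::real_normed_vector) \<Rightarrow> real" where
  "L2_norm h = sqrt (LINT x|lborel. (norm (h x))\<^sup>2)"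

text \<open>A genuine supremum, not an essential one; meaningful only for bounded \<open>h\<close>.\<close>

definition sup_norm :: "('a \<Rightarrow> real) \<Rightarrow> real" where
  "sup_norm h = (SUP x. \<bar>h x\<bar>)"

definition fourier :: "('a::euclidean_space \<Rightarrow> real) \<Rightarrow> 'a \<Rightarrow> complex" where
  "fourier s u = (LINT x|lborel. complex_of_real (s x) * exp (\<i> * complex_of_real (x \<bullet> u)))"

text \<open>
  \<open>F\<close> is (a version of) the Plancherel extension of the Fourier transform at \<open>s \<in> L\<^sup>2\<close>: the
  \<open>L\<^sup>2\<close>-limit of the transforms of some sequence in \<open>L\<^sup>1 \<inter> L\<^sup>2\<close> that converges to \<open>s\<close> in \<open>L\<^sup>2\<close>.
  This determines \<open>F\<close> almost everywhere.
\<close>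

definition plancherel_transform ::
    "('a::euclidean_space \<Rightarrow> real) \<Rightarrow> ('a \<Rightarrow> complex) \<Rightarrow> bool" where
  "plancherel_transform s F \<longleftrightarrow> in_L2 s \<and> in_L2 F \<and>
     (\<exists>t. (\<forall>j::nat. in_L1 (t j) \<and> in_L2 (t j)) \<and>
        (\<lambda>j. L2_norm (\<lambda>x. t j x - s x)) \<longlonglongrightarrow> 0 \<and>
        (\<forall>j. in_L2 (\<lambda>u. fourier (t j) u - F u)) \<and>
        (\<lambda>j. L2_norm (\<lambda>u. fourier (t j) u - F u)) \<longlonglongrightarrow> 0)"

definition sobolev_ball :: "real \<Rightarrow> real \<Rightarrow> ('a::euclidean_space \<Rightarrow> real) set" where
  "sobolev_ball \<delta> R = {s. in_L1 s \<and> in_L2 s \<and>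
     (\<integral>\<^sup>+u. ennreal (norm u powr (2 * \<delta>) * (cmod (fourier s u))\<^sup>2) \<partial>lborel)
       \<le> ennreal ((2 * pi) ^ DIM('a) * R\<^sup>2)}"


section \<open>Poisson processes\<close>

text \<open>
  All intensity measures considered are finite and diffuse, so a Poisson process is a.s. a finite
  set of points without multiplicities. Configurations are therefore finite sets, with the
  \<open>\<sigma>\<close>-algebra generated by the counts of points in Borel sets.
\<close>

definition config_space :: "('a::euclidean_space) set measure" where
  "config_space = sigma {S. finite S}
     {{S. finite S \<and> card (S \<inter> B) = j} | B j. B \<in> sets borel}"

definition poisson_process ::
    "'w measure \<Rightarrow> ('w \<Rightarrow> ('a::euclidean_space) set) \<Rightarrow> 'a measure \<Rightarrow> bool" where
  "poisson_process M N \<Lambda> \<longleftrightarrow> prob_space M \<and> N \<in> M \<rightarrow>\<^sub>M config_space \<and>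
     (\<forall>B\<in>sets borel. emeasure \<Lambda> B < \<infinity> \<longrightarrow>
        (\<forall>j. measure M {\<omega> \<in> space M. card (N \<omega> \<inter> B) = j}
              = measure \<Lambda> B ^ j / fact j * exp (- measure \<Lambda> B))) \<and>
     (\<forall>(B :: nat \<Rightarrow> 'a set) J. finite J \<longrightarrow> (\<forall>i\<in>J. B i \<in> sets borel) \<longrightarrow>
        disjoint_family_on B J \<longrightarrow>
        prob_space.indep_vars M (\<lambda>_. count_space UNIV) (\<lambda>i \<omega>. card (N \<omega> \<inter> B i)) J)"

definition intensity :: "('a::euclidean_space \<Rightarrow> real) \<Rightarrow> bool" where
  "intensity f \<longleftrightarrow> (\<forall>x. 0 \<le> f x) \<and> integrable lborel f \<and> bdd_above (range f)"

text \<open>The intensity is \<open>f\<close> with respect to \<open>\<mu> = n \<cdot> \<nu>\<close>, \<open>\<nu>\<close> being Lebesgue measure.\<close>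

definition intensity_measure :: "real \<Rightarrow> ('a::euclidean_space \<Rightarrow> real) \<Rightarrow> 'a measure" where
  "intensity_measure n f = density (scale_measure (ennreal n) lborel) (\<lambda>x. ennreal (f x))"

text \<open>
  \<open>P f g\<close> is the joint distribution of the two independent processes, i.e. a probability
  measure on pairs of configurations for which the two projections are independent Poisson
  processes. This determines \<open>P f g\<close> uniquely for all \<open>f\<close>, \<open>g\<close> that are intensities.
\<close>

definition two_sample_model ::
    "real \<Rightarrow> (('a::euclidean_space \<Rightarrow> real) \<Rightarrow> ('a \<Rightarrow> real) \<Rightarrow> ('a set \<times> 'a set) measure) \<Rightarrow> bool"
where
  "two_sample_model n P \<longleftrightarrow> (\<forall>f g. intensity f \<longrightarrow> intensity g \<longrightarrow>
     prob_space (P f g) \<and>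
     sets (P f g) = sets (config_space \<Otimes>\<^sub>M config_space) \<and>
     poisson_process (P f g) fst (intensity_measure n f) \<and>
     poisson_process (P f g) snd (intensity_measure n g) \<and>
     prob_space.indep_var (P f g) config_space fst config_space snd)"


section \<open>Uniform separation rate\<close>

text \<open>A test is \<open>{0,1}\<close>-valued. Working in \<open>[0,\<infinity>]\<close> gives the conventions
  \<open>sup {} = 0\<close> for probabilities and \<open>inf {} = \<infinity>\<close> for rates.\<close>

definition separation_rate ::
    "(('a::euclidean_space \<Rightarrow> real) \<Rightarrow> ('a \<Rightarrow> real) \<Rightarrow> 'o measure) \<Rightarrow> ('o \<Rightarrow> nat)
       \<Rightarrow> (('a \<Rightarrow> real) \<times> ('a \<Rightarrow> real)) set \<Rightarrow> real \<Rightarrow> ennreal" where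
  "separation_rate P \<Phi> S \<beta> = Inf {ennreal \<rho> | \<rho>. 0 < \<rho> \<and>
     (SUP (f, g) \<in> {(f, g). (f, g) \<in> S \<and> L2_norm (\<lambda>x. f x - g x) > \<rho>}.
        emeasure (P f g) {\<omega> \<in> space (P f g). \<Phi> \<omega> = 0}) \<le> ennreal \<beta>}"

definition sobolev_class ::
    "real \<Rightarrow> real \<Rightarrow> real \<Rightarrow> real \<Rightarrow> (('a::euclidean_space \<Rightarrow> real) \<times> ('a \<Rightarrow> real)) set" where
  "sobolev_class \<delta> R R' R'' = {(f, g). intensity f \<and> intensity g \<and>
     (\<lambda>x. f x - g x) \<in> sobolev_ball \<delta> R \<and>
     max (L1_norm f) (L1_norm g) \<le> R' \<and> max (sup_norm f) (sup_norm g) \<le> R''}"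


section \<open>Aggregated wild-bootstrap tests\<close>

definition sign_form :: "('a \<Rightarrow> 'a \<Rightarrow> real) \<Rightarrow> 'a set \<Rightarrow> ('a \<Rightarrow> real) \<Rightarrow> real" where
  "sign_form K S e = (\<Sum>x\<in>S. \<Sum>x'\<in>S - {x}. K x x' * e x * e x')"

text \<open>Observed marks; a.s. no point belongs to both processes.\<close>

definition marks :: "'a set \<times> 'a set \<Rightarrow> 'a \<Rightarrow> real" where
  "marks N x = (if x \<in> fst N then 1 else - 1)"

definition T_hat :: "('a \<Rightarrow> 'a \<Rightarrow> real) \<Rightarrow> 'a set \<times> 'a set \<Rightarrow> real" where
  "T_hat K N = sign_form K (fst N \<union> snd N) (marks N)"

text \<open>
  Since the Rademacher signs are independent of the pooled process, conditioning on the latter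
  amounts to freezing the finite set \<open>S\<close> of its points and attaching an independent sign to each
  point; \<open>0\<close> is only the dummy value off \<open>S\<close>.
\<close>

definition rademacher_signs :: "'a set \<Rightarrow> ('a \<Rightarrow> real) pmf" where
  "rademacher_signs S = Pi_pmf S 0 (\<lambda>_. pmf_of_set {- 1, 1})"

text \<open>The generalised inverse of the distribution function, with value \<open>-\<infinity>\<close> for orders \<open>\<le> 0\<close>.\<close>

definition quantile :: "real pmf \<Rightarrow> real \<Rightarrow> ereal" where
  "quantile p r = Inf (ereal ` {t. r \<le> measure_pmf.prob p {..t}})"

definition bootstrap_quantile :: "('a \<Rightarrow> 'a \<Rightarrow> real) \<Rightarrow> 'a set \<Rightarrow> real \<Rightarrow> ereal" where
  "bootstrap_quantile K S r = quantile (map_pmf (sign_form K S) (rademacher_signs S)) r"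

text \<open>
  The set below contains \<open>\<alpha>\<close> if \<open>(\<Sum>m\<in>\<M>. exp (- w m)) \<le> 1\<close>. It is bounded above for
  \<open>\<alpha> < 1\<close> and nonempty \<open>\<M>\<close>: if \<open>u * exp (- w m) \<ge> 1\<close>, then the \<open>m\<close>-th quantile is \<open>-\<infinity>\<close>
  and the event is certain.
\<close>

definition u_level ::
    "'m set \<Rightarrow> ('m \<Rightarrow> 'a \<Rightarrow> 'a \<Rightarrow> real) \<Rightarrow> ('m \<Rightarrow> real) \<Rightarrow> real \<Rightarrow> 'a set \<Rightarrow> real" where
  "u_level \<M> K w \<alpha> S = Sup {u. 0 < u \<and>
     measure_pmf.prob (rademacher_signs S)
       {e. (SUP m\<in>\<M>. ereal (sign_form (K m) S e)
              - bootstrap_quantile (K m) S (1 - u * exp (- w m))) > 0} \<le> \<alpha>}"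

definition aggregated_test ::
    "'m set \<Rightarrow> ('m \<Rightarrow> 'a \<Rightarrow> 'a \<Rightarrow> real) \<Rightarrow> ('m \<Rightarrow> real) \<Rightarrow> real \<Rightarrow> 'a set \<times> 'a set \<Rightarrow> nat" where
  "aggregated_test \<M> K w \<alpha> N =
     (let S = fst N \<union> snd N in
      of_bool ((SUP m\<in>\<M>. ereal (T_hat (K m) N)
        - bootstrap_quantile (K m) S (1 - u_level \<M> K w \<alpha> S * exp (- w m))) > 0))"

definition scaled_kernel ::
    "(nat \<Rightarrow> 'a::euclidean_space \<Rightarrow> real) \<Rightarrow> nat \<times> nat \<Rightarrow> 'a \<Rightarrow> 'a \<Rightarrow> real" where
  "scaled_kernel k = (\<lambda>(m1, m2) x x'.
     1 / 2 powr (- real (DIM('a) * m2)) * k m1 ((x - x') /\<^sub>R 2 powr (- real m2)))"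

definition weight :: "nat \<times> nat \<Rightarrow> real" where
  "weight = (\<lambda>(m1, m2). 2 * (ln (real (m1 * (m2 + 1))) + ln (pi\<^sup>2 / 6)))"

definition Phi3 ::
    "(nat \<Rightarrow> 'a::euclidean_space \<Rightarrow> real) \<Rightarrow> real \<Rightarrow> 'a set \<times> 'a set \<Rightarrow> nat" where
  "Phi3 k \<alpha> = aggregated_test ({1..} \<times> UNIV) (scaled_kernel k) weight \<alpha>"

end

theory Submission
  imports Defs
begin

text \<open>
  Write \<open>h = f - g\<close>. The proof follows a single well-chosen member \<open>m = (m1, m2)\<close> of the family of
  kernels. The level \<open>u_level\<close> is at least \<open>\<alpha>\<close> by a union bound, so whenever the aggregated test
  accepts, the statistic of that member is at most its bootstrap quantile of order
  \<open>1 - \<alpha> * exp (- w m)\<close> (\<open>aggregated_test_eq_0D\<close>). It remains to show that, with probability at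
  least \<open>1 - \<beta>\<close>, the statistic exceeds this quantile as soon as \<open>h\<close> is large enough in
  \<open>L\<^sup>2\<close>. Let \<open>\<kappa>\<close> be the rescaled kernel, \<open>M = 2 ^ m2\<close> its inverse bandwidth, \<open>G\<close> the convolution
  of \<open>\<kappa>\<close> and \<open>h\<close>, and \<open>d\<close> the dimension. Three estimates are combined in \<open>second_kind_error\<close>.

  \<^item> Quantile. Given the points, the bootstrapped statistic is a homogeneous polynomial of degree two
    in independent signs. Bonami's hypercontractive inequality (\<open>rademacher_hypercontractivity\<close>) bounds
    its moment of order \<open>2 * p\<close>, and taking \<open>p\<close> of the order of \<open>w m\<close> bounds the quantile by a constant
    times \<open>p\<close> times the square root of the sum of \<open>\<kappa> (x - y)\<^sup>2\<close> over pairs of points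
    (\<open>bootstrap_quantile_le\<close>). By Campbell's formula that sum has expectation \<open>O (n\<^sup>2 * M ^ d)\<close>.

  \<^item> Mean and fluctuations. The statistic has mean
    \<open>n\<^sup>2 * \<langle>G, h\<rangle> = n\<^sup>2 / 2 * (\<parallel>h\<parallel>\<^sup>2 + \<parallel>G\<parallel>\<^sup>2 - \<parallel>h - G\<parallel>\<^sup>2)\<close>, and its deviation from the mean obeys
    Chebyshev's inequality with a variance of order \<open>n ^ 3 * \<parallel>G\<parallel>\<^sup>2 + n\<^sup>2 * M ^ d\<close>
    (\<open>signed_sum_tail\<close>). The first term of the variance is absorbed by the term \<open>\<parallel>G\<parallel>\<^sup>2\<close> of the mean, up
    to \<open>O (n)\<close>. The variance bound is first proved for kernels that are constant on the products of the
    cells of a finite partition and vanish on the diagonal blocks; there the statistic is a quadratic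
    form in independent Poisson counts. Such kernels are dense in \<open>L\<^sup>2\<close> (\<open>step_kernel_dense\<close>).

  \<^item> Bias. Plancherel's inequality, obtained by Gaussian regularisation (\<open>plancherel_le\<close>), bounds
    \<open>(2 * pi) ^ d * \<parallel>h - G\<parallel>\<^sup>2\<close> by the integral of \<open>4 * \<bar>1 - khat (u / M)\<bar>\<^sup>2 * \<bar>fourier h u\<bar>\<^sup>2\<close>.
    The hypotheses on \<open>khat\<close> give \<open>\<bar>1 - khat u\<bar> \<le> B * \<parallel>u\<parallel> powr \<delta>\<close> if \<open>\<delta> \<le> m1\<close>, and the Sobolev
    condition then yields \<open>O (M powr (- 2 * \<delta>))\<close> (\<open>bandwidth_bias\<close>).

  Hence the error of the second kind is at most \<open>\<beta>\<close> once \<open>\<parallel>h\<parallel>\<^sup>2\<close> exceeds a constant times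
  \<open>M powr (- 2 * \<delta>) + 1 / n + w m * M powr (d / 2) / n\<close>. Here \<open>m1\<close> is the least positive integer that
  is at least \<open>\<delta>\<close>, and \<open>M\<close> is the least power of two that is at least
  \<open>(n / ln (ln n)) powr (2 / (d + 4 * \<delta>))\<close>, which balances the outer terms. Since \<open>m2\<close> is of order \<open>ln n\<close> at most, \<open>w m\<close> is of order
  \<open>ln (ln n)\<close>, the price of adaptation that appears in the rate.
\<close>

section \<open>Hypercontractivity of Rademacher polynomials\<close>

text \<open>
  Passing from \<open>j\<close> to \<open>j + 1\<close> multiplies the left-hand side by
  \<open>(p - j) * (2 * p - 2 * j - 1) / ((j + 1) * (2 * j + 1))\<close> and the right-hand side by
  \<open>(p - j) * (2 * p - 1) / (j + 1)\<close>, which is at least as large.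
\<close>

lemma even_choose_le:
  fixes p j :: nat
  assumes "1 \<le> p"
  shows "(2 * p) choose (2 * j) \<le> (p choose j) * (2 * p - 1) ^ j"
proof (cases "j \<le> p")
  case False
  then show ?thesis by (simp add: binomial_eq_0)
next
  case True
  then show ?thesis
  proof (induction j)
    case 0
    then show ?case by simp
  next
    case (Suc j)
    then have jp: "j < p" and IH: "(2 * p) choose (2 * j) \<le> (p choose j) * (2 * p - 1) ^ j" by auto
    have b1: "Suc k * (n choose Suc k) = (n - k) * (n choose k)" for n k :: nat
      by (metis binomial_absorb_comp binomial_absorption mult.commute)
    define X where "X = (2 * p) choose (2 * j)"
    define Y where "Y = (2 * p) choose (Suc (2 * j))"
    define Z where "Z = (2 * p) choose (Suc (Suc (2 * j)))"
    have 1: "Suc (2*j) * Y = (2*p - 2*j) * X" unfolding X_def Y_def by (rule b1)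
    have 2: "Suc (Suc (2*j)) * Z = (2*p - Suc (2*j)) * Y" unfolding Y_def Z_def by (rule b1)
    have 3: "Suc j * (p choose Suc j) = (p - j) * (p choose j)" by (rule b1)
    have "(Suc (2*j) * Suc (Suc (2*j))) * Z = Suc (2*j) * ((2*p - Suc (2*j)) * Y)"
      using 2 by (simp only: mult.assoc)
    also have "\<dots> = (2*p - Suc (2*j)) * ((2*p - 2*j) * X)"
      using 1 by (metis mult.left_commute)
    also have "\<dots> \<le> (2*p - 1) * ((2*p - 2*j) * X)"
      by (intro mult_right_mono) auto
    also have "\<dots> \<le> (2*p - 1) * ((2*p - 2*j) * ((p choose j) * (2 * p - 1) ^ j))"
      using IH unfolding X_def by (intro mult_left_mono) auto
    also have "\<dots> = (2*p - 1) ^ Suc j * (2 * ((p - j) * (p choose j)))"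
    proof -
      have "2*p - 2*j = 2 * (p - j)" by simp
      then show ?thesis by (simp only: power_Suc mult_ac)
    qed
    also have "\<dots> = (2*p - 1) ^ Suc j * (2 * (Suc j * (p choose Suc j)))"
      by (simp only: 3)
    also have "\<dots> = Suc (Suc (2*j)) * ((p choose Suc j) * (2*p - 1) ^ Suc j)"
      by (simp add: algebra_simps)
    also have "\<dots> \<le> (Suc (2*j) * Suc (Suc (2*j))) * ((p choose Suc j) * (2*p - 1) ^ Suc j)"
      by (intro mult_right_mono) auto
    finally have "Z \<le> (p choose Suc j) * (2*p - 1) ^ Suc j"
      by (meson mult_le_cancel1 zero_less_Suc nat_0_less_mult_iff)
    then show ?case by (simp add: Z_def)
  qed
qed

lemma sum_even_terms:
  fixes F :: "nat \<Rightarrow> real"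
  shows "(\<Sum>k\<le>2*p. if even k then F k else 0) = (\<Sum>j\<le>p. F (2*j))"
proof -
  have "(\<Sum>k\<le>2*p. if even k then F k else 0) = (\<Sum>k\<in>{k\<in>{..2*p}. even k}. F k)"
    by (subst sum.inter_filter) auto
  also have "{k\<in>{..2*p}. even k} = (\<lambda>j. 2*j) ` {..p}" by (auto elim!: evenE)
  also have "(\<Sum>k\<in>(\<lambda>j. 2*j) ` {..p}. F k) = (\<Sum>j\<le>p. F (2*j))"
    by (subst sum.reindex) (auto simp: inj_on_def)
  finally show ?thesis .
qed

text \<open>
  Bonami's inequality for a single sign. The odd powers of \<open>b\<close> cancel on the left, so both sides are
  polynomials in \<open>b\<^sup>2\<close> and can be compared coefficient by coefficient.
\<close>

lemma two_point_inequality: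
  fixes a b :: real
  assumes "1 \<le> p"
  shows "((a + b) ^ (2*p) + (a - b) ^ (2*p)) / 2 \<le> (a\<^sup>2 + (2 * real p - 1) * b\<^sup>2) ^ p"
proof -
  let ?F = "\<lambda>k. real ((2*p) choose k) * b ^ k * a ^ (2*p - k)"
  have "(a + b) ^ (2*p) = (\<Sum>k\<le>2*p. ?F k)"
    by (subst add.commute, rule binomial_ring)
  moreover have "(a - b) ^ (2*p) = (\<Sum>k\<le>2*p. (-1)^k * ?F k)"
  proof -
    have "(a - b) ^ (2*p) = ((-b) + a) ^ (2*p)" by simp
    also have "\<dots> = (\<Sum>k\<le>2*p. real ((2*p) choose k) * (-b) ^ k * a ^ (2*p - k))"
      by (rule binomial_ring)
    also have "\<dots> = (\<Sum>k\<le>2*p. (-1)^k * ?F k)"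
      by (intro sum.cong refl) (subst power_minus, simp)
    finally show ?thesis .
  qed
  ultimately have "((a + b) ^ (2*p) + (a - b) ^ (2*p)) / 2 = (\<Sum>k\<le>2*p. (?F k + (-1)^k * ?F k) / 2)"
    by (simp add: sum.distrib sum_divide_distrib add_divide_distrib)
  also have "\<dots> = (\<Sum>k\<le>2*p. if even k then ?F k else 0)"
    by (intro sum.cong) auto
  also have "\<dots> = (\<Sum>j\<le>p. ?F (2*j))" by (rule sum_even_terms)
  also have "\<dots> \<le> (\<Sum>j\<le>p. real (p choose j) * ((2 * real p - 1) * b\<^sup>2) ^ j * (a\<^sup>2) ^ (p - j))"
  proof (intro sum_mono)
    fix j assume "j \<in> {..p}"
    then have jp: "j \<le> p" by simp
    have "real ((2*p) choose (2*j)) \<le> real ((p choose j) * (2 * p - 1) ^ j)"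
      using even_choose_le[OF assms, of j] by (simp only: of_nat_le_iff)
    also have "\<dots> = real (p choose j) * (2 * real p - 1) ^ j"
      using assms by (simp add: of_nat_diff)
    finally have c: "real ((2*p) choose (2*j)) \<le> real (p choose j) * (2 * real p - 1) ^ j" .
    have "a ^ (2*p - 2*j) = (a\<^sup>2) ^ (p - j)" "b ^ (2*j) = (b\<^sup>2)^j"
      by (simp_all add: power_mult [symmetric] diff_mult_distrib2)
    then have "?F (2*j) = real ((2*p) choose (2*j)) * ((b\<^sup>2)^j * (a\<^sup>2) ^ (p - j))" by simp
    also have "\<dots> \<le> (real (p choose j) * (2 * real p - 1) ^ j) * ((b\<^sup>2)^j * (a\<^sup>2) ^ (p - j))"
      by (intro mult_right_mono c) auto
    finally show "?F (2*j) \<le> real (p choose j) * ((2 * real p - 1) * b\<^sup>2) ^ j * (a\<^sup>2) ^ (p - j)"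
      by (simp add: power_mult_distrib mult_ac)
  qed
  also have "\<dots> = ((2 * real p - 1) * b\<^sup>2 + a\<^sup>2) ^ p" by (rule binomial_ring [symmetric])
  finally show ?thesis by (simp add: add.commute)
qed

text \<open>
  Convexity of \<open>t ^ p\<close>, with the weights chosen so that the right-hand side is \<open>(X + Y) ^ p\<close> as soon as
  \<open>a ^ p\<close> and \<open>b ^ p\<close> are replaced by averages bounded by \<open>X ^ p\<close> and \<open>Y ^ p\<close>. This plays the role of
  Minkowski's inequality in the proof of hypercontractivity.
\<close>

lemma power_convex_combination:
  fixes a b X Y :: real
  assumes "0 < X" "0 < Y" "0 \<le> a" "0 \<le> b" "1 \<le> p"
  shows "(a + b) ^ p \<le> (X + Y) ^ p * (X / (X + Y) * (a ^ p / X ^ p) + Y / (X + Y) * (b ^ p / Y ^ p))"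
proof -
  have cv: "convex_on {0..} (\<lambda>x::real. x ^ p)"
    using convex_power_odd convex_power_even convex_on_subset
    by (cases "even p") (blast, blast)
  have "((1 - Y / (X+Y)) *\<^sub>R (a / X) + (Y / (X+Y)) *\<^sub>R (b / Y)) ^ p
      \<le> (1 - Y / (X+Y)) * (a / X) ^ p + Y / (X+Y) * (b / Y) ^ p"
    by (rule convex_onD[OF cv]) (use assms in auto)
  moreover have "(1 - Y / (X+Y)) = X / (X+Y)" using assms by (simp add: field_simps)
  moreover have "(X / (X+Y)) *\<^sub>R (a / X) + (Y / (X+Y)) *\<^sub>R (b / Y) = (a + b) / (X + Y)"
    using assms by (simp add: add_divide_distrib)
  ultimately have "((a + b) / (X + Y)) ^ p \<le> X / (X+Y) * (a / X) ^ p + Y / (X+Y) * (b / Y) ^ p" by simp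
  then have "(X + Y) ^ p * ((a + b) / (X + Y)) ^ p
      \<le> (X + Y) ^ p * (X / (X+Y) * (a / X) ^ p + Y / (X+Y) * (b / Y) ^ p)"
    using assms by (intro mult_left_mono) auto
  then show ?thesis using assms by (simp add: power_divide)
qed

lemma finite_set_rademacher [simp]:
  "finite S \<Longrightarrow> finite (set_pmf (rademacher_signs S))"
  unfolding rademacher_signs_def by (simp add: set_Pi_pmf finite_PiE_dflt)

lemma rademacher_expectation_insert:
  fixes F :: "('a \<Rightarrow> real) \<Rightarrow> real"
  assumes "finite S" "x \<notin> S"
  shows "measure_pmf.expectation (rademacher_signs (insert x S)) F =
     measure_pmf.expectation (rademacher_signs S) (\<lambda>e. (F (e(x := 1)) + F (e(x := -1))) / 2)"
proof -
  let ?D = "rademacher_signs S" and ?U = "pmf_of_set {-1, 1::real}"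
  have "rademacher_signs (insert x S) = ?D \<bind> (\<lambda>e. ?U \<bind> (\<lambda>y. return_pmf (e(x := y))))"
    unfolding rademacher_signs_def by (subst Pi_pmf_insert'[OF assms], subst bind_commute_pmf, rule refl)
  then have "measure_pmf.expectation (rademacher_signs (insert x S)) F =
     (\<Sum>e\<in>set_pmf ?D. pmf ?D e *\<^sub>R measure_pmf.expectation (?U \<bind> (\<lambda>y. return_pmf (e(x := y)))) F)"
    by (simp only:) (rule pmf_expectation_bind, use assms in auto)
  also have "\<dots> = (\<Sum>e\<in>set_pmf ?D. pmf ?D e *\<^sub>R ((F (e(x := 1)) + F (e(x := -1))) / 2))"
  proof (intro sum.cong refl arg_cong2[where f="(*\<^sub>R)"])
    fix e
    have "measure_pmf.expectation (?U \<bind> (\<lambda>y. return_pmf (e(x := y)))) F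
       = (\<Sum>y\<in>{-1,1}. pmf ?U y *\<^sub>R measure_pmf.expectation (return_pmf (e(x := y))) F)"
      by (rule pmf_expectation_bind) auto
    then show "measure_pmf.expectation (?U \<bind> (\<lambda>y. return_pmf (e(x := y)))) F = (F (e(x := 1)) + F (e(x := -1))) / 2"
      by (simp add: pmf_of_set field_simps)
  qed
  also have "\<dots> = measure_pmf.expectation ?D (\<lambda>e. (F (e(x := 1)) + F (e(x := -1))) / 2)"
    by (rule integral_measure_pmf [symmetric]) (use assms in auto)
  finally show ?thesis .
qed

definition walsh_sum :: "('a set \<Rightarrow> real) \<Rightarrow> 'a set \<Rightarrow> ('a \<Rightarrow> real) \<Rightarrow> real" where
  "walsh_sum c S e = (\<Sum>A\<in>Pow S. c A * (\<Prod>x\<in>A. e x))"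

text \<open>
  The squared \<open>L\<^sup>2\<close> norm of the polynomial after its homogeneous part of degree \<open>k\<close> has been multiplied
  by \<open>r powr (k / 2)\<close>.
\<close>

definition walsh_norm :: "real \<Rightarrow> ('a set \<Rightarrow> real) \<Rightarrow> 'a set \<Rightarrow> real" where
  "walsh_norm r c S = (\<Sum>A\<in>Pow S. r ^ card A * (c A)\<^sup>2)"

lemma walsh_sum_insert:
  assumes "finite S" "x \<notin> S"
  shows "walsh_sum c (insert x S) (e(x := y)) = walsh_sum c S e + y * walsh_sum (\<lambda>A. c (insert x A)) S e"
proof -
  have "walsh_sum c (insert x S) (e(x := y))
     = walsh_sum c S (e(x := y)) + (\<Sum>A\<in>insert x ` Pow S. c A * (\<Prod>z\<in>A. (e(x := y)) z))"
    unfolding walsh_sum_def Pow_insert using assms by (subst sum.union_disjoint) auto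
  also have "walsh_sum c S (e(x := y)) = walsh_sum c S e"
    unfolding walsh_sum_def using assms by (intro sum.cong refl arg_cong2[where f="(*)"] prod.cong) auto
  also have "(\<Sum>A\<in>insert x ` Pow S. c A * (\<Prod>z\<in>A. (e(x := y)) z))
     = (\<Sum>A\<in>Pow S. c (insert x A) * (\<Prod>z\<in>insert x A. (e(x := y)) z))"
    using assms by (subst sum.reindex) (auto simp: inj_on_def)
  also have "\<dots> = (\<Sum>A\<in>Pow S. y * (c (insert x A) * (\<Prod>z\<in>A. e z)))"
  proof (intro sum.cong refl)
    fix A assume "A \<in> Pow S"
    then have "finite A" "x \<notin> A" using assms finite_subset by auto
    moreover have "(\<Prod>z\<in>A. (e(x := y)) z) = (\<Prod>z\<in>A. e z)" using \<open>x \<notin> A\<close> by (intro prod.cong) auto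
    ultimately show "c (insert x A) * (\<Prod>z\<in>insert x A. (e(x := y)) z) = y * (c (insert x A) * (\<Prod>z\<in>A. e z))"
      by simp
  qed
  finally show ?thesis by (simp add: walsh_sum_def sum_distrib_left)
qed

lemma walsh_norm_insert:
  assumes "finite S" "x \<notin> S"
  shows "walsh_norm r c (insert x S) = walsh_norm r c S + r * walsh_norm r (\<lambda>A. c (insert x A)) S"
proof -
  have "walsh_norm r c (insert x S)
     = walsh_norm r c S + (\<Sum>A\<in>insert x ` Pow S. r ^ card A * (c A)\<^sup>2)"
    unfolding walsh_norm_def Pow_insert using assms by (subst sum.union_disjoint) auto
  also have "(\<Sum>A\<in>insert x ` Pow S. r ^ card A * (c A)\<^sup>2)
     = (\<Sum>A\<in>Pow S. r ^ card (insert x A) * (c (insert x A))\<^sup>2)"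
    using assms by (subst sum.reindex) (auto simp: inj_on_def)
  also have "\<dots> = (\<Sum>A\<in>Pow S. r * (r ^ card A * (c (insert x A))\<^sup>2))"
  proof (intro sum.cong refl)
    fix A assume "A \<in> Pow S"
    then have "finite A" "x \<notin> A" using assms finite_subset by auto
    then show "r ^ card (insert x A) * (c (insert x A))\<^sup>2 = r * (r ^ card A * (c (insert x A))\<^sup>2)" by simp
  qed
  finally show ?thesis by (simp add: walsh_norm_def sum_distrib_left)
qed

lemma walsh_norm_nonneg: "0 \<le> r \<Longrightarrow> 0 \<le> walsh_norm r c S"
  unfolding walsh_norm_def by (intro sum_nonneg) auto

lemma walsh_norm_eq_0D:
  assumes "finite S" "0 < r" "walsh_norm r c S = 0"
  shows "walsh_sum c S e = 0"
proof -
  have "\<forall>A\<in>Pow S. r ^ card A * (c A)\<^sup>2 = 0"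
    using assms unfolding walsh_norm_def by (subst (asm) sum_nonneg_eq_0_iff) auto
  then show ?thesis using assms by (auto simp: walsh_sum_def intro!: sum.neutral)
qed

text \<open>
  Bonami's inequality for exponents \<open>2 * p\<close>, by induction on the number of signs. In the new sign \<open>e\<close>
  the polynomial is \<open>a + e * b\<close> with \<open>a\<close> and \<open>b\<close> depending on the other signs only. Averaging over \<open>e\<close>
  costs the two-point inequality, and the expectation of \<open>(a\<^sup>2 + r * b\<^sup>2) ^ p\<close> is at most
  \<open>(X + Y) ^ p\<close> because the induction hypothesis bounds those of \<open>(a\<^sup>2) ^ p\<close> and \<open>(r * b\<^sup>2) ^ p\<close>
  by \<open>X ^ p\<close> and \<open>Y ^ p\<close>.
\<close>

lemma rademacher_hypercontractivity:
  fixes S :: "'a set"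
  assumes "finite S" "1 \<le> p"
  shows "measure_pmf.expectation (rademacher_signs S) (\<lambda>e. (walsh_sum c S e) ^ (2*p))
       \<le> (walsh_norm (2 * real p - 1) c S) ^ p"
  using assms(1)
proof (induction S arbitrary: c rule: finite_induct)
  case empty
  then show ?case
    by (simp add: walsh_sum_def walsh_norm_def rademacher_signs_def power_mult)
next
  case (insert x S)
  define r where "r = 2 * real p - 1"
  have r: "r \<ge> 1" using assms by (simp add: r_def)
  define d where "d = (\<lambda>A. c (insert x A))"
  define X where "X = walsh_norm r c S"
  define Y where "Y = r * walsh_norm r d S"
  let ?D = "rademacher_signs S" let ?E = "measure_pmf.expectation ?D"
  have int: "integrable ?D F" for F :: "_ \<Rightarrow> real"
    using insert by (intro integrable_measure_pmf_finite) auto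
  have XY: "X \<ge> 0" "Y \<ge> 0" using r by (auto simp: X_def Y_def walsh_norm_nonneg)
  have IH1: "?E (\<lambda>e. (walsh_sum c S e)^(2*p)) \<le> X ^ p"
    using insert.IH[of c] by (simp add: X_def r_def)
  have IH2: "?E (\<lambda>e. (walsh_sum d S e)^(2*p)) \<le> (walsh_norm r d S) ^ p"
    using insert.IH[of d] by (simp add: r_def)
  have "measure_pmf.expectation (rademacher_signs (insert x S)) (\<lambda>e. (walsh_sum c (insert x S) e) ^ (2*p))
    = ?E (\<lambda>e. ((walsh_sum c S e + walsh_sum d S e)^(2*p) + (walsh_sum c S e - walsh_sum d S e)^(2*p)) / 2)"
    using insert by (simp add: rademacher_expectation_insert walsh_sum_insert d_def)
  also have "\<dots> \<le> ?E (\<lambda>e. ((walsh_sum c S e)\<^sup>2 + r * (walsh_sum d S e)\<^sup>2) ^ p)"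
    unfolding r_def by (intro integral_mono int two_point_inequality assms)
  also have "\<dots> \<le> (X + Y) ^ p"
  (* If X or Y is 0, the weights degenerate, but then one of the two polynomials vanishes. *)
  proof (cases "X = 0 \<or> Y = 0")
    case False
    then have pos: "X > 0" "Y > 0" using XY by auto
    have "?E (\<lambda>e. ((walsh_sum c S e)\<^sup>2 + r * (walsh_sum d S e)\<^sup>2) ^ p)
      \<le> ?E (\<lambda>e. (X + Y) ^ p * (X / (X + Y) * (((walsh_sum c S e)\<^sup>2) ^ p / X ^ p)
           + Y / (X + Y) * ((r * (walsh_sum d S e)\<^sup>2) ^ p / Y ^ p)))"
      using pos r assms by (intro integral_mono int power_convex_combination) auto
    also have "\<dots> = (X + Y) ^ p * (X / (X + Y) * (?E (\<lambda>e. (walsh_sum c S e) ^ (2*p)) / X ^ p)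
           + Y / (X + Y) * (r ^ p * ?E (\<lambda>e. (walsh_sum d S e) ^ (2*p)) / Y ^ p))"
      by (simp add: int power_mult power_mult_distrib)
    also have "\<dots> \<le> (X + Y) ^ p * (X / (X + Y) * 1 + Y / (X + Y) * 1)"
    proof (intro mult_left_mono add_mono)
      show "?E (\<lambda>e. (walsh_sum c S e) ^ (2*p)) / X ^ p \<le> 1"
        using IH1 pos by (simp add: divide_le_eq)
      have "r ^ p * ?E (\<lambda>e. (walsh_sum d S e) ^ (2*p)) \<le> r ^ p * walsh_norm r d S ^ p"
        using IH2 r by (intro mult_left_mono) auto
      then show "r ^ p * ?E (\<lambda>e. (walsh_sum d S e) ^ (2*p)) / Y ^ p \<le> 1"
        using zero_less_power[OF pos(2), of p]
        by (subst divide_le_eq_1_pos) (auto simp: Y_def power_mult_distrib)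
    qed (use pos in auto)
    also have "\<dots> = (X + Y) ^ p" using pos by (simp add: add_divide_distrib [symmetric])
    finally show ?thesis .
  next
    case True
    then show ?thesis
    proof
      assume "X = 0"
      then have "walsh_sum c S e = 0" for e
        using walsh_norm_eq_0D[of S r c e] insert r by (auto simp: X_def)
      then have "?E (\<lambda>e. ((walsh_sum c S e)\<^sup>2 + r * (walsh_sum d S e)\<^sup>2) ^ p)
        = r ^ p * ?E (\<lambda>e. (walsh_sum d S e) ^ (2*p))" using assms
        by (simp add: power_mult power_mult_distrib)
      also have "\<dots> \<le> r ^ p * (walsh_norm r d S) ^ p" using IH2 r by (intro mult_left_mono) auto
      finally show ?thesis using \<open>X = 0\<close> by (simp add: Y_def power_mult_distrib)
    next
      assume "Y = 0"
      then have "walsh_norm r d S = 0" using r by (auto simp: Y_def)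
      then have "walsh_sum d S e = 0" for e
        using walsh_norm_eq_0D[of S r d e] insert r by auto
      then have "?E (\<lambda>e. ((walsh_sum c S e)\<^sup>2 + r * (walsh_sum d S e)\<^sup>2) ^ p)
        = ?E (\<lambda>e. (walsh_sum c S e) ^ (2*p))" by (simp add: power_mult)
      then show ?thesis using IH1 \<open>Y = 0\<close> by simp
    qed
  qed
  finally show ?case
    using insert by (simp add: walsh_norm_insert X_def Y_def r_def d_def)
qed

section \<open>Bootstrap quantiles and the aggregated test\<close>

definition off_diagonal :: "'a set \<Rightarrow> ('a \<times> 'a) set" where
  "off_diagonal S = {(x, y). x \<in> S \<and> y \<in> S \<and> x \<noteq> y}"

lemma off_diagonal_sum:
  assumes "finite S"
  shows "(\<Sum>x\<in>S. \<Sum>y\<in>S - {x}. F x y) = (\<Sum>(x, y)\<in>off_diagonal S. F x y)"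
proof -
  have "off_diagonal S = Sigma S (\<lambda>x. S - {x})" by (auto simp: off_diagonal_def)
  then show ?thesis using assms by (simp add: sum.Sigma)
qed

lemma finite_off_diagonal [simp]:
  assumes "finite S"
  shows "finite (off_diagonal S)"
proof (rule finite_subset)
  show "off_diagonal S \<subseteq> S \<times> S" by (auto simp: off_diagonal_def)
qed (simp add: assms)

text \<open>
  The coefficient of the monomial \<open>A\<close> in a quadratic form of the signs: \<open>K x y + K y x\<close> for
  \<open>A = {x, y}\<close>, and \<open>0\<close> unless \<open>A\<close> is a two-element subset of \<open>S\<close>.
\<close>

definition pair_coeff :: "('a \<Rightarrow> 'a \<Rightarrow> real) \<Rightarrow> 'a set \<Rightarrow> 'a set \<Rightarrow> real" where
  "pair_coeff K S A = (\<Sum>(x, y)\<in>{(x, y)\<in>off_diagonal S. {x, y} = A}. K x y)"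

lemma sum_off_diagonal_fibres:
  fixes F :: "'a \<Rightarrow> 'a \<Rightarrow> real"
  assumes S: "finite S"
  shows "(\<Sum>(x, y)\<in>off_diagonal S. F x y)
     = (\<Sum>A\<in>Pow S. \<Sum>(x, y)\<in>{(x, y)\<in>off_diagonal S. {x, y} = A}. F x y)"
proof -
  let ?g = "\<lambda>(x, y). {x, y}"
  have "(\<Sum>A\<in>Pow S. \<Sum>z\<in>{z\<in>off_diagonal S. ?g z = A}. (case z of (x, y) \<Rightarrow> F x y))
     = (\<Sum>(x, y)\<in>off_diagonal S. F x y)"
  proof (rule sum.group)
    show "?g ` off_diagonal S \<subseteq> Pow S" by (auto simp: off_diagonal_def)
  qed (simp_all add: S)
  moreover have "{z\<in>off_diagonal S. ?g z = A} = {(x, y)\<in>off_diagonal S. {x, y} = A}" for A by auto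
  ultimately show ?thesis by simp
qed

lemma sign_form_eq_walsh_sum:
  assumes S: "finite S"
  shows "sign_form K S e = walsh_sum (pair_coeff K S) S e"
proof -
  have "sign_form K S e = (\<Sum>(x, y)\<in>off_diagonal S. K x y * e x * e y)"
    unfolding sign_form_def by (rule off_diagonal_sum[OF S])
  also have "\<dots> = (\<Sum>A\<in>Pow S. \<Sum>(x, y)\<in>{(x, y)\<in>off_diagonal S. {x, y} = A}. K x y * e x * e y)"
    by (rule sum_off_diagonal_fibres[OF S])
  also have "\<dots> = (\<Sum>A\<in>Pow S. \<Sum>(x, y)\<in>{(x, y)\<in>off_diagonal S. {x, y} = A}. K x y * (\<Prod>z\<in>A. e z))"
    by (intro sum.cong refl) (auto simp: off_diagonal_def)
  finally show ?thesis
    by (simp add: walsh_sum_def pair_coeff_def sum_distrib_right case_prod_beta)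
qed

lemma pair_coeff_nonzeroD:
  assumes "pair_coeff K S A \<noteq> 0"
  obtains x y where "x \<in> S" "y \<in> S" "x \<noteq> y" "A = {x, y}"
proof -
  have "{(x, y)\<in>off_diagonal S. {x, y} = A} \<noteq> {}" using assms unfolding pair_coeff_def by (metis sum.empty)
  then show ?thesis using that by (auto simp: off_diagonal_def)
qed

lemma pair_coeff_square_le:
  assumes S: "finite S"
  shows "(pair_coeff K S A)\<^sup>2 \<le> 2 * (\<Sum>(x, y)\<in>{(x, y)\<in>off_diagonal S. {x, y} = A}. (K x y)\<^sup>2)"
proof (cases "pair_coeff K S A = 0")
  case True
  then show ?thesis by (auto intro!: sum_nonneg)
next
  case False
  then obtain x y where xy: "A = {x, y}" by (rule pair_coeff_nonzeroD)
  let ?F = "{(x, y)\<in>off_diagonal S. {x, y} = A}"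
  have "?F \<subseteq> {(x, y), (y, x)}" using xy by (auto simp: doubleton_eq_iff)
  from card_mono[OF _ this] have "card ?F \<le> card {(x, y), (y, x)}" by simp
  also have "\<dots> \<le> 2" by (rule card_insert_le_m1) auto
  finally have "card ?F \<le> 2" .
  have "(pair_coeff K S A)\<^sup>2 \<le> (\<Sum>z\<in>?F. (case z of (x, y) \<Rightarrow> K x y)\<^sup>2) * real (card ?F)"
    unfolding pair_coeff_def using sum_squared_le_sum_of_squares[of _ ?F] by (simp add: mult.commute)
  also have "\<dots> \<le> (\<Sum>z\<in>?F. (case z of (x, y) \<Rightarrow> K x y)\<^sup>2) * 2"
    using \<open>card ?F \<le> 2\<close> by (intro mult_left_mono sum_nonneg) auto
  finally show ?thesis by (simp add: mult.commute case_prod_beta)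
qed

text \<open>
  All monomials have degree two, so hypercontractivity costs the factor \<open>2 * p - 1\<close> squared; the
  remaining factor 2 comes from merging the two orders of a pair.
\<close>

lemma rademacher_chaos_moment:
  assumes S: "finite S" and p: "1 \<le> p"
  shows "measure_pmf.expectation (rademacher_signs S) (\<lambda>e. (sign_form K S e) ^ (2*p))
     \<le> (2 * (2 * real p - 1)\<^sup>2 * (\<Sum>x\<in>S. \<Sum>y\<in>S - {x}. (K x y)\<^sup>2)) ^ p"
proof -
  let ?c = "pair_coeff K S" and ?r = "2 * real p - 1"
  have "walsh_norm ?r ?c S
      \<le> (\<Sum>A\<in>Pow S. ?r\<^sup>2 * (2 * (\<Sum>(x, y)\<in>{(x, y)\<in>off_diagonal S. {x, y} = A}. (K x y)\<^sup>2)))"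
    unfolding walsh_norm_def
  proof (intro sum_mono)
    fix A
    have "?r ^ card A * (?c A)\<^sup>2 = ?r\<^sup>2 * (?c A)\<^sup>2"
    proof (cases "?c A = 0")
      case False
      then show ?thesis by (auto elim!: pair_coeff_nonzeroD simp: power2_eq_square)
    qed simp
    also have "\<dots> \<le> ?r\<^sup>2 * (2 * (\<Sum>(x, y)\<in>{(x, y)\<in>off_diagonal S. {x, y} = A}. (K x y)\<^sup>2))"
      by (intro mult_left_mono pair_coeff_square_le S) simp
    finally show "?r ^ card A * (?c A)\<^sup>2
      \<le> ?r\<^sup>2 * (2 * (\<Sum>(x, y)\<in>{(x, y)\<in>off_diagonal S. {x, y} = A}. (K x y)\<^sup>2))" .
  qed
  also have "\<dots> = 2 * ?r\<^sup>2 * (\<Sum>x\<in>S. \<Sum>y\<in>S - {x}. (K x y)\<^sup>2)"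
    by (simp only: off_diagonal_sum[OF S] sum_off_diagonal_fibres[OF S] sum_distrib_left mult_ac)
  finally have "walsh_norm ?r ?c S ^ p \<le> (2 * ?r\<^sup>2 * (\<Sum>x\<in>S. \<Sum>y\<in>S - {x}. (K x y)\<^sup>2)) ^ p"
    using p by (intro power_mono walsh_norm_nonneg) auto
  then show ?thesis
    using rademacher_hypercontractivity[OF S p, of ?c] by (simp only: sign_form_eq_walsh_sum[OF S])
qed

lemma quantile_le:
  assumes "r \<le> measure_pmf.prob p {..t}"
  shows "quantile p r \<le> ereal t"
  unfolding quantile_def using assms by (intro Inf_lower) auto

lemma quantile_mono: "r \<le> s \<Longrightarrow> quantile p r \<le> quantile p s"
  unfolding quantile_def by (intro Inf_superset_mono) auto

text \<open>
  The infimum that defines the quantile need not be attained, so the bound is passed to the limit: along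
  \<open>q + 1 / i\<close> if the quantile is a real number \<open>q\<close>. If it is \<open>- \<infinity>\<close>, the distribution function is at
  least \<open>1 - v\<close> arbitrarily far to the left, which forces \<open>v \<ge> 1\<close>.
\<close>

lemma prob_gt_quantile_le:
  assumes "0 < v"
  shows "measure_pmf.prob p {x. ereal x > quantile p (1 - v)} \<le> v"
proof (cases "quantile p (1 - v)")
  case (real q)
  let ?A = "\<lambda>i::nat. {q + 1 / real (Suc i) <..}"
  have A: "measure_pmf.prob p (?A i) \<le> v" for i
  proof -
    have "quantile p (1 - v) < ereal (q + 1 / real (Suc i))" using real by simp
    then obtain t where t: "1 - v \<le> measure_pmf.prob p {..t}" "t < q + 1 / real (Suc i)"
      unfolding quantile_def Inf_less_iff by auto
    have "measure_pmf.prob p (?A i) \<le> measure_pmf.prob p (- {..t})"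
      using t by (intro measure_pmf.finite_measure_mono) auto
    also have "\<dots> = 1 - measure_pmf.prob p {..t}"
      using measure_pmf.prob_compl[of "{..t}" p] by (simp add: Compl_eq_Diff_UNIV)
    finally show ?thesis using t by simp
  qed
  have "incseq ?A"
    by (intro incseq_SucI) (auto simp: less_le_trans field_simps intro: le_less_trans[rotated])
  then have "(\<lambda>i. measure_pmf.prob p (?A i)) \<longlonglongrightarrow> measure_pmf.prob p (\<Union>i. ?A i)"
    by (intro measure_pmf.finite_Lim_measure_incseq) auto
  moreover have "(\<Union>i. ?A i) = {x. ereal x > quantile p (1 - v)}"
  proof (intro set_eqI iffI)
    fix x assume "x \<in> {x. ereal x > quantile p (1 - v)}"
    then have "0 < x - q" using real by simp
    then obtain i where "inverse (real (Suc i)) < x - q" using reals_Archimedean by blast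
    then show "x \<in> (\<Union>i. ?A i)" by (auto simp: inverse_eq_divide algebra_simps)
  next
    fix x assume "x \<in> (\<Union>i. ?A i)"
    then obtain i where "q + 1 / real (Suc i) < x" by auto
    moreover have "0 < 1 / real (Suc i)" by simp
    ultimately have "q < x" by linarith
    then show "x \<in> {x. ereal x > quantile p (1 - v)}" using real by simp
  qed
  ultimately show ?thesis using A by (intro LIMSEQ_le_const2) auto
next
  case PInf
  then show ?thesis using assms by simp
next
  case MInf
  have "1 - v \<le> 0"
  proof (rule ccontr)
    assume "\<not> 1 - v \<le> 0"
    then have v: "v < 1" by simp
    let ?A = "\<lambda>i::nat. {..- real i}"
    have "decseq ?A" by (intro decseq_SucI) auto
    then have "(\<lambda>i. measure_pmf.prob p (?A i)) \<longlonglongrightarrow> measure_pmf.prob p (\<Inter>i. ?A i)"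
      by (intro measure_pmf.finite_Lim_measure_decseq) auto
    moreover have "(\<Inter>i. ?A i) = {}"
    proof -
      have "\<exists>i. - real i < x" for x using reals_Archimedean2[of "-x"] by (auto simp: minus_less_iff)
      then have "x \<notin> (\<Inter>i. ?A i)" for x by (simp add: not_le)
      then show ?thesis by blast
    qed
    ultimately have "(\<lambda>i. measure_pmf.prob p (?A i)) \<longlonglongrightarrow> 0" by simp
    then obtain i where i: "measure_pmf.prob p (?A i) < 1 - v"
      using order_tendstoD(2)[of _ 0 sequentially "1 - v"] v by (auto simp: eventually_sequentially)
    have "quantile p (1 - v) < ereal (- real i)" using MInf by simp
    then obtain t where t: "1 - v \<le> measure_pmf.prob p {..t}" "t < - real i"
      unfolding quantile_def Inf_less_iff by auto
    then have "measure_pmf.prob p {..t} \<le> measure_pmf.prob p (?A i)"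
      by (intro measure_pmf.finite_measure_mono) auto
    then show False using i t by simp
  qed
  moreover have "measure_pmf.prob p {x. ereal x > quantile p (1 - v)} \<le> 1"
    by (rule measure_pmf.prob_le_1)
  ultimately show ?thesis by linarith
qed

text \<open>
  Markov's inequality for the moment of order \<open>2 * p\<close>. With \<open>p\<close> of the order of \<open>ln (1 / (1 - r))\<close>
  the quantile is bounded by \<open>2 * sqrt 2 * exp 1 * p\<close> times the square root of the sum of the squares
  of the kernel; the growth linear in \<open>p\<close> reflects the degree two of the form.
\<close>

lemma bootstrap_quantile_le:
  assumes S: "finite S" and p: "1 \<le> p" and t: "0 < t"
    and Q: "8 * (real p * exp 1)\<^sup>2 * (\<Sum>x\<in>S. \<Sum>y\<in>S - {x}. (K x y)\<^sup>2) \<le> t\<^sup>2"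
    and r: "exp (- 2 * real p) \<le> 1 - r"
  shows "bootstrap_quantile K S r \<le> ereal t"
proof -
  let ?Q = "\<Sum>x\<in>S. \<Sum>y\<in>S - {x}. (K x y)\<^sup>2"
  let ?D = "rademacher_signs S" and ?T = "sign_form K S"
  have int: "integrable ?D F" for F :: "_ \<Rightarrow> real"
    using S by (intro integrable_measure_pmf_finite) auto
  have Q0: "0 \<le> ?Q" by (intro sum_nonneg) auto
  have "measure_pmf.prob ?D {e. t < ?T e} \<le> measure_pmf.prob ?D {e \<in> space ?D. t ^ (2*p) \<le> (?T e) ^ (2*p)}"
    using t by (intro measure_pmf.finite_measure_mono) (auto intro!: power_mono)
  also have "\<dots> \<le> measure_pmf.expectation ?D (\<lambda>e. (?T e) ^ (2*p)) / t ^ (2*p)"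
    by (rule integral_Markov_inequality_measure[where A="{}"]) (use int t in \<open>auto simp: power_mult\<close>)
  also have "\<dots> \<le> (2 * (2 * real p - 1)\<^sup>2 * ?Q) ^ p / t ^ (2*p)"
    using rademacher_chaos_moment[OF S p, of K] t by (intro divide_right_mono) auto
  also have "\<dots> \<le> (8 * (real p)\<^sup>2 * ?Q) ^ p / t ^ (2*p)"
  proof -
    have "(2 * real p - 1)\<^sup>2 \<le> (2 * real p)\<^sup>2" using p by (intro power_mono) auto
    then show ?thesis using p t Q0
      by (intro divide_right_mono power_mono mult_right_mono) (auto simp: power_mult_distrib)
  qed
  also have "\<dots> \<le> exp (- 2 * real p)"
  proof -
    have "8 * (real p)\<^sup>2 * ?Q \<le> t\<^sup>2 * exp (-2)"
      using Q by (simp add: power_mult_distrib exp_minus field_simps power2_eq_square exp_add [symmetric])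
    then have "(8 * (real p)\<^sup>2 * ?Q) ^ p \<le> (t\<^sup>2 * exp (-2)) ^ p" using Q0 by (intro power_mono) auto
    also have "\<dots> = t ^ (2*p) * exp (- 2 * real p)"
      by (simp add: power_mult_distrib power_mult [symmetric] exp_of_nat_mult [symmetric] mult.commute)
    finally show ?thesis using t by (simp add: divide_le_eq mult.commute)
  qed
  finally have "measure_pmf.prob ?D {e. t < ?T e} \<le> 1 - r" using r by simp
  moreover have "measure_pmf.prob ?D {e. ?T e \<le> t} = 1 - measure_pmf.prob ?D {e. t < ?T e}"
  proof -
    have "{e. ?T e \<le> t} = space ?D - {e. t < ?T e}" by auto
    then show ?thesis using measure_pmf.prob_compl[of "{e. t < ?T e}" ?D] by simp
  qed
  ultimately have "r \<le> measure_pmf.prob (map_pmf ?T ?D) {..t}"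
    by (simp add: vimage_def)
  then show ?thesis unfolding bootstrap_quantile_def by (rule quantile_le)
qed

lemma ereal_diff_pos_iff: "0 < ereal x - q \<longleftrightarrow> q < ereal x"
  by (cases q) auto

text \<open>
  By a union bound, \<open>\<alpha>\<close> belongs to the set whose supremum is \<open>u_level\<close>. The set is bounded above by
  \<open>exp (w m)\<close> for any \<open>m\<close>: beyond that level the order of the \<open>m\<close>-th quantile is negative, the
  quantile is \<open>- \<infinity>\<close> and the event is certain.
\<close>

lemma u_level_ge:
  fixes w :: "'m \<Rightarrow> real"
  assumes M: "countable \<M>" "\<M> \<noteq> {}"
    and w: "(\<integral>\<^sup>+m. ennreal (exp (- w m)) \<partial>count_space \<M>) \<le> 1"
    and \<alpha>: "0 < \<alpha>" "\<alpha> < 1"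
  shows "\<alpha> \<le> u_level \<M> K w \<alpha> S"
  unfolding u_level_def
proof (rule cSup_upper)
  let ?D = "rademacher_signs S"
  let ?q = "\<lambda>u m. bootstrap_quantile (K m) S (1 - u * exp (- w m))"
  let ?E = "\<lambda>u. {e. 0 < (SUP m\<in>\<M>. ereal (sign_form (K m) S e) - ?q u m)}"
  have E: "?E u = (\<Union>m\<in>\<M>. {e. ?q u m < ereal (sign_form (K m) S e)})" for u
    by (auto simp: less_SUP_iff ereal_diff_pos_iff)
  let ?B = "\<lambda>m. {e. ?q \<alpha> m < ereal (sign_form (K m) S e)}"
  have B: "measure_pmf.prob ?D (?B m) \<le> \<alpha> * exp (- w m)" for m
    using prob_gt_quantile_le[of "\<alpha> * exp (- w m)" "map_pmf (sign_form (K m) S) ?D"] \<alpha>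
    by (simp add: bootstrap_quantile_def vimage_def)
  have "emeasure ?D (?E \<alpha>) = (\<integral>\<^sup>+e. indicator (\<Union>m\<in>\<M>. ?B m) e \<partial>?D)" by (subst E) simp
  also have "\<dots> \<le> (\<integral>\<^sup>+e. (\<integral>\<^sup>+m. indicator (?B m) e \<partial>count_space \<M>) \<partial>?D)"
  proof (intro nn_integral_mono)
    fix e
    show "indicator (\<Union>m\<in>\<M>. ?B m) e \<le> (\<integral>\<^sup>+m. (indicator (?B m) e :: ennreal) \<partial>count_space \<M>)"
    proof (cases "e \<in> (\<Union>m\<in>\<M>. ?B m)")
      case True
      then obtain m where m: "m \<in> \<M>" "e \<in> ?B m" by auto
      then have "indicator (?B m) e \<le> (\<integral>\<^sup>+m. (indicator (?B m) e :: ennreal) \<partial>count_space \<M>)"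
        by (intro nn_integral_ge_point) auto
      then show ?thesis using True m by simp
    qed simp
  qed
  also have "\<dots> = (\<integral>\<^sup>+m. emeasure ?D (?B m) \<partial>count_space \<M>)"
    by (subst nn_integral_count_space_nn_integral) (use M in auto)
  also have "\<dots> \<le> (\<integral>\<^sup>+m. ennreal \<alpha> * ennreal (exp (- w m)) \<partial>count_space \<M>)"
    using B \<alpha> by (intro nn_integral_mono)
      (simp add: measure_pmf.emeasure_eq_measure ennreal_mult' [symmetric] ennreal_leI)
  also have "\<dots> = ennreal \<alpha> * (\<integral>\<^sup>+m. ennreal (exp (- w m)) \<partial>count_space \<M>)"
    by (rule nn_integral_cmult) simp
  also have "\<dots> \<le> ennreal \<alpha> * 1" by (intro mult_left_mono w) simp
  finally have "measure_pmf.prob ?D (?E \<alpha>) \<le> \<alpha>"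
    using \<alpha> by (simp add: measure_pmf.emeasure_eq_measure)
  then show "\<alpha> \<in> {u. 0 < u \<and> measure_pmf.prob ?D (?E u) \<le> \<alpha>}" using \<alpha> by simp
  obtain m where m: "m \<in> \<M>" using M by auto
  show "bdd_above {u. 0 < u \<and> measure_pmf.prob ?D (?E u) \<le> \<alpha>}"
  proof (rule bdd_aboveI)
    fix u assume u: "u \<in> {u. 0 < u \<and> measure_pmf.prob ?D (?E u) \<le> \<alpha>}"
    show "u \<le> exp (w m)"
    proof (rule ccontr)
      assume "\<not> u \<le> exp (w m)"
      then have "1 - u * exp (- w m) \<le> 0" by (simp add: exp_minus field_simps)
      then have "1 - u * exp (- w m) \<le> measure_pmf.prob p {..t}" for p :: "real pmf" and t
        using order_trans measure_nonneg by blast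
      then have "?q u m \<le> ereal t" for t
        unfolding bootstrap_quantile_def by (intro quantile_le)
      then have "?q u m = -\<infinity>" by (rule ereal_bot)
      then have "?E u = UNIV" using m by (subst E) auto
      then show False using u \<alpha> by simp
    qed
  qed
qed

text \<open>
  Acceptance by the aggregated test implies acceptance by each of its members at level
  \<open>\<alpha> * exp (- w m)\<close>. The error of the second kind may therefore be studied for one \<open>m\<close> that is chosen
  in dependence on the unknown smoothness.
\<close>

lemma aggregated_test_eq_0D:
  assumes M: "countable \<M>" "m \<in> \<M>"
    and w: "(\<integral>\<^sup>+m. ennreal (exp (- w m)) \<partial>count_space \<M>) \<le> 1"
    and \<alpha>: "0 < \<alpha>" "\<alpha> < 1"
    and zero: "aggregated_test \<M> K w \<alpha> N = 0"
  shows "ereal (T_hat (K m) N) \<le> bootstrap_quantile (K m) (fst N \<union> snd N) (1 - \<alpha> * exp (- w m))"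
proof -
  let ?S = "fst N \<union> snd N" let ?u = "u_level \<M> K w \<alpha> ?S"
  let ?F = "\<lambda>m. ereal (T_hat (K m) N) - bootstrap_quantile (K m) ?S (1 - ?u * exp (- w m))"
  have "\<not> 0 < (SUP m\<in>\<M>. ?F m)"
    using zero by (simp only: aggregated_test_def Let_def of_bool_eq_0_iff not_False_eq_True)
  then have "\<not> 0 < ?F m"
    using SUP_upper[OF M(2), of ?F] by (meson less_le_trans)
  then have "ereal (T_hat (K m) N) \<le> bootstrap_quantile (K m) ?S (1 - ?u * exp (- w m))"
    by (simp only: ereal_diff_pos_iff not_less)
  also have "\<dots> \<le> bootstrap_quantile (K m) ?S (1 - \<alpha> * exp (- w m))"
    unfolding bootstrap_quantile_def
  proof (intro quantile_mono)
    have "\<alpha> \<le> ?u" by (rule u_level_ge[OF M(1) _ w \<alpha>]) (use M(2) in auto)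
    then show "1 - ?u * exp (- w m) \<le> 1 - \<alpha> * exp (- w m)" by (simp add: mult_right_mono)
  qed
  finally show ?thesis .
qed

text \<open>
  The weights come from the product of the series of inverse squares over \<open>m1 \<ge> 1\<close> and \<open>m2 + 1 \<ge> 1\<close>,
  each with sum \<open>pi\<^sup>2 / 6\<close>.
\<close>

lemma exp_neg_weight:
  assumes "1 \<le> m1"
  shows "exp (- weight (m1, m2)) = (6 / pi\<^sup>2)\<^sup>2 * (1 / (real m1)\<^sup>2 * (1 / (real m2 + 1)\<^sup>2))"
proof -
  have "weight (m1, m2) = 2 * ln (real m1 * (real m2 + 1) * (pi\<^sup>2 / 6))"
  proof -
    have "ln (real m1 * (real m2 + 1) * (pi\<^sup>2 / 6)) = ln (real m1 * (real m2 + 1)) + ln (pi\<^sup>2 / 6)"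
      using assms by (intro ln_mult_pos) auto
    moreover have "real (m1 * (m2 + 1)) = real m1 * (real m2 + 1)" by (simp add: algebra_simps)
    ultimately show ?thesis by (simp only: weight_def prod.case)
  qed
  then have "exp (weight (m1, m2)) = (exp (ln (real m1 * (real m2 + 1) * (pi\<^sup>2 / 6))))\<^sup>2"
    by (simp only: exp_double)
  also have "\<dots> = (real m1 * (real m2 + 1) * (pi\<^sup>2 / 6))\<^sup>2"
    using assms by (subst exp_ln) (auto intro!: mult_pos_pos)
  finally have e: "exp (weight (m1, m2)) = (real m1 * (real m2 + 1) * (pi\<^sup>2 / 6))\<^sup>2" .
  have "inverse ((x * y * (c / 6))\<^sup>2) = (6 / c)\<^sup>2 * (1 / x\<^sup>2 * (1 / y\<^sup>2))" for x y c :: real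
    by (simp add: power2_eq_square divide_simps)
  then show ?thesis unfolding exp_minus e .
qed

lemma nn_integral_exp_neg_weight:
  "(\<integral>\<^sup>+m. ennreal (exp (- weight m)) \<partial>count_space ({1..} \<times> UNIV)) \<le> 1"
proof -
  let ?s = "\<lambda>n::nat. 1 / (real n + 1)\<^sup>2"
  have s: "(\<integral>\<^sup>+n. ennreal (?s n) \<partial>count_space UNIV) = ennreal (pi\<^sup>2 / 6)"
    using inverse_squares_sums
    by (subst nn_integral_count_space_nat, intro suminf_ennreal_eq) (auto simp: add.commute)
  have bij: "bij_betw (\<lambda>(i, j). (Suc i, j)) UNIV ({1..} \<times> (UNIV :: nat set))"
    by (rule bij_betwI[where g="\<lambda>(i, j). (i - 1, j)"]) auto
  have "(\<integral>\<^sup>+m. ennreal (exp (- weight m)) \<partial>count_space ({1..} \<times> UNIV))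
    = (\<integral>\<^sup>+z. ennreal (exp (- weight (case z of (i, j) \<Rightarrow> (Suc i, j)))) \<partial>count_space UNIV)"
    by (rule nn_integral_bij_count_space [OF bij, symmetric])
  also have "\<dots> = (\<integral>\<^sup>+z. ennreal (case z of (i, j) \<Rightarrow> (6 / pi\<^sup>2)\<^sup>2 * (?s i * ?s j)) \<partial>count_space UNIV)"
    by (intro nn_integral_cong arg_cong[where f=ennreal])
       (auto simp: exp_neg_weight algebra_simps split: prod.splits)
  also have "\<dots> = (\<integral>\<^sup>+i. \<integral>\<^sup>+j. ennreal ((6 / pi\<^sup>2)\<^sup>2 * (?s i * ?s j)) \<partial>count_space UNIV \<partial>count_space UNIV)"
    by (subst nn_integral_fst_count_space [symmetric]) simp
  also have "\<dots> = (\<integral>\<^sup>+i. ennreal ((6 / pi\<^sup>2)\<^sup>2 * (pi\<^sup>2 / 6)) * ennreal (?s i) \<partial>count_space UNIV)"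
  proof (intro nn_integral_cong)
    fix i :: nat
    have "(\<integral>\<^sup>+j. ennreal ((6 / pi\<^sup>2)\<^sup>2 * (?s i * ?s j)) \<partial>count_space UNIV)
      = (\<integral>\<^sup>+j. ennreal ((6 / pi\<^sup>2)\<^sup>2 * ?s i) * ennreal (?s j) \<partial>count_space UNIV)"
      by (intro nn_integral_cong) (subst ennreal_mult [symmetric], auto)
    also have "\<dots> = ennreal ((6 / pi\<^sup>2)\<^sup>2 * ?s i) * ennreal (pi\<^sup>2 / 6)"
      by (subst nn_integral_cmult) (auto simp: s)
    also have "\<dots> = ennreal ((6 / pi\<^sup>2)\<^sup>2 * (pi\<^sup>2 / 6)) * ennreal (?s i)"
      by (subst (1 2) ennreal_mult [symmetric]) (auto simp: mult_ac)
    finally show "(\<integral>\<^sup>+j. ennreal ((6 / pi\<^sup>2)\<^sup>2 * (?s i * ?s j)) \<partial>count_space UNIV)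
       = ennreal ((6 / pi\<^sup>2)\<^sup>2 * (pi\<^sup>2 / 6)) * ennreal (?s i)" .
  qed
  also have "\<dots> = ennreal ((6 / pi\<^sup>2)\<^sup>2 * (pi\<^sup>2 / 6)) * ennreal (pi\<^sup>2 / 6)"
    by (subst nn_integral_cmult) (auto simp: s)
  also have "\<dots> = 1"
    by (subst ennreal_mult [symmetric]) (auto simp: power2_eq_square)
  finally show ?thesis by simp
qed

section \<open>Pairs of points of two independent Poisson processes\<close>

lemma space_config_space: "space config_space = {S. finite S}"
  unfolding config_space_def by (rule space_measure_of) auto

lemma measurable_card_Int [measurable]:
  assumes "B \<in> sets borel"
  shows "(\<lambda>S. card (S \<inter> B)) \<in> config_space \<rightarrow>\<^sub>M count_space UNIV"
proof (subst measurable_count_space_eq2_countable, intro conjI ballI)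
  fix j :: nat
  have "(\<lambda>S. card (S \<inter> B)) -` {j} \<inter> space config_space = {S. finite S \<and> card (S \<inter> B) = j}"
    by (auto simp: space_config_space)
  also have "\<dots> \<in> sets config_space"
    unfolding config_space_def using assms
    by (subst sets_measure_of) (auto intro!: sigma_sets.Basic)
  finally show "(\<lambda>S. card (S \<inter> B)) -` {j} \<inter> space config_space \<in> sets config_space" .
qed auto

text \<open>
  The two processes are indexed by \<open>bool\<close>, so that statements about the pooled process become sums over
  \<open>bool\<close>.
\<close>

definition proc :: "bool \<Rightarrow> 'a set \<times> 'a set \<Rightarrow> 'a set" where
  "proc b = (if b then fst else snd)"

text \<open>
  Diagonal pairs are removed within one process only. A coincidence between the two processes would be
  kept, but has probability 0.
\<close>

definition point_pairs :: "bool \<Rightarrow> bool \<Rightarrow> 'a set \<times> 'a set \<Rightarrow> ('a \<times> 'a) set" where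
  "point_pairs b c N = {(x, y). x \<in> proc b N \<and> y \<in> proc c N \<and> (b = c \<longrightarrow> x \<noteq> y)}"

locale poisson_pair =
  fixes P :: "('a::euclidean_space set \<times> 'a set) measure" and L :: "bool \<Rightarrow> 'a measure"
  assumes prob_P: "prob_space P"
    and sets_P: "sets P = sets (config_space \<Otimes>\<^sub>M config_space)"
    and poisson: "poisson_process P (proc b) (L b)"
    and indep: "prob_space.indep_var P config_space fst config_space snd"
    and sets_L [measurable_cong]: "sets (L b) = sets borel"
    and finite_L: "finite_measure (L b)"
begin

sublocale prob_space P by (rule prob_P)

lemma space_P: "space P = {S. finite S} \<times> {S. finite S}"
  using sets_eq_imp_space_eq[OF sets_P] by (simp add: space_pair_measure space_config_space)

lemma finite_proc: "N \<in> space P \<Longrightarrow> finite (proc b N)"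
  by (auto simp: space_P proc_def)

lemma finite_point_pairs: "N \<in> space P \<Longrightarrow> finite (point_pairs b c N)"
proof (rule finite_subset)
  show "point_pairs b c N \<subseteq> proc b N \<times> proc c N" by (auto simp: point_pairs_def)
qed (simp add: finite_proc)

lemma measurable_proc [measurable]: "proc b \<in> P \<rightarrow>\<^sub>M config_space"
  using poisson by (simp add: poisson_process_def)

lemma measurable_count [measurable]:
  "B \<in> sets borel \<Longrightarrow> (\<lambda>N. card (proc b N \<inter> B)) \<in> P \<rightarrow>\<^sub>M count_space UNIV"
  using measurable_compose[OF measurable_proc measurable_card_Int] by blast

lemma prob_count:
  assumes "B \<in> sets borel"
  shows "prob {N \<in> space P. card (proc b N \<inter> B) = j}
       = measure (L b) B ^ j / fact j * exp (- measure (L b) B)"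
proof -
  interpret L: finite_measure "L b" by (rule finite_L)
  have "emeasure (L b) B < \<infinity>" by (simp add: L.emeasure_eq_measure)
  then show ?thesis using poisson[of b] assms by (auto simp: poisson_process_def)
qed

text \<open>
  Reduces the expectation of a function of a Poisson count to the summation of a power series.
\<close>

lemma nn_integral_count:
  assumes B[measurable]: "B \<in> sets borel" and F: "\<And>j. 0 \<le> F j"
    and s: "(\<lambda>j. F j * (measure (L b) B ^ j / fact j)) sums (s * exp (measure (L b) B))"
  shows "(\<integral>\<^sup>+N. ennreal (F (card (proc b N \<inter> B))) \<partial>P) = ennreal s"
proof -
  let ?X = "\<lambda>N. card (proc b N \<inter> B)" let ?l = "measure (L b) B"
  have "(\<integral>\<^sup>+N. ennreal (F (?X N)) \<partial>P)
      = (\<integral>\<^sup>+N. (\<Sum>j. ennreal (F j) * indicator {N \<in> space P. ?X N = j} N) \<partial>P)"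
  proof (intro nn_integral_cong)
    fix N assume N: "N \<in> space P"
    have "(\<Sum>j. ennreal (F j) * indicator {N \<in> space P. ?X N = j} N)
        = (\<Sum>j\<in>{?X N}. ennreal (F j) * indicator {N \<in> space P. ?X N = j} N)"
      by (rule suminf_finite) auto
    then show "ennreal (F (?X N)) = (\<Sum>j. ennreal (F j) * indicator {N \<in> space P. ?X N = j} N)"
      using N by simp
  qed
  also have "\<dots> = (\<Sum>j. \<integral>\<^sup>+N. ennreal (F j) * indicator {N \<in> space P. ?X N = j} N \<partial>P)"
    by (rule nn_integral_suminf) measurable
  also have "\<dots> = (\<Sum>j. ennreal (F j * (?l ^ j / fact j) * exp (- ?l)))"
  proof (intro suminf_cong)
    fix j
    have "(\<integral>\<^sup>+N. ennreal (F j) * indicator {N \<in> space P. ?X N = j} N \<partial>P)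
       = ennreal (F j) * emeasure P {N \<in> space P. ?X N = j}"
      by (rule nn_integral_cmult_indicator) measurable
    also have "\<dots> = ennreal (F j) * ennreal (?l ^ j / fact j * exp (- ?l))"
      by (simp only: emeasure_eq_measure prob_count[OF B])
    finally show "(\<integral>\<^sup>+N. ennreal (F j) * indicator {N \<in> space P. ?X N = j} N \<partial>P)
       = ennreal (F j * (?l ^ j / fact j) * exp (- ?l))"
      using F by (simp add: ennreal_mult' [symmetric] mult.assoc)
  qed
  also have "\<dots> = ennreal s"
    using F sums_mult2[OF s, of "exp (- ?l)"]
    by (intro suminf_ennreal_eq) (auto simp: exp_minus field_simps)
  finally show ?thesis .
qed

lemma nn_integral_count_mean:
  assumes "B \<in> sets borel"
  shows "(\<integral>\<^sup>+N. of_nat (card (proc b N \<inter> B)) \<partial>P) = emeasure (L b) B"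
proof -
  interpret L: finite_measure "L b" by (rule finite_L)
  let ?l = "measure (L b) B"
  have "(\<lambda>j. ?l ^ j / fact j) sums exp ?l"
    using exp_converges[of ?l] by (simp add: field_simps)
  from sums_mult[OF this, of ?l]
  have "(\<lambda>j. real (Suc j) * (?l ^ Suc j / fact (Suc j))) sums (?l * exp ?l)"
    by (simp add: field_simps del: of_nat_Suc)
  then have "(\<lambda>j. real j * (?l ^ j / fact j)) sums (?l * exp ?l)"
    by (subst (asm) sums_Suc_iff) simp
  from nn_integral_count[OF assms _ this]
  show ?thesis by (simp add: L.emeasure_eq_measure ennreal_of_nat_eq_real_of_nat)
qed

lemma nn_integral_count_factorial_moment:
  assumes "B \<in> sets borel"
  shows "(\<integral>\<^sup>+N. of_nat (card (proc b N \<inter> B) * (card (proc b N \<inter> B) - 1)) \<partial>P)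
     = emeasure (L b) B * emeasure (L b) B"
proof -
  interpret L: finite_measure "L b" by (rule finite_L)
  let ?l = "measure (L b) B" let ?F = "\<lambda>j::nat. real (j * (j - 1))"
  let ?t = "\<lambda>j. ?F j * (?l ^ j / fact j)"
  have "(\<lambda>j. ?l ^ j / fact j) sums exp ?l"
    using exp_converges[of ?l] by (simp add: field_simps)
  from sums_mult[OF this, of "?l\<^sup>2"]
  have "(\<lambda>j. ?t (Suc (Suc j))) sums (?l\<^sup>2 * exp ?l)"
  proof (rule sums_cong[THEN iffD1, rotated])
    fix j
    have "?F (Suc (Suc j)) = real (Suc (Suc j)) * real (Suc j)" by (simp only: of_nat_mult diff_Suc_1)
    then show "?l\<^sup>2 * (?l ^ j / fact j) = ?t (Suc (Suc j))"
      by (simp add: power2_eq_square field_simps del: of_nat_Suc)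
  qed
  then have "?t sums (?l\<^sup>2 * exp ?l)"
    by (subst (asm) sums_Suc_iff, subst (asm) sums_Suc_iff) simp
  from nn_integral_count[OF assms _ this]
  have "(\<integral>\<^sup>+N. ennreal (?F (card (proc b N \<inter> B))) \<partial>P) = ennreal (?l\<^sup>2)" by simp
  then show ?thesis
    by (simp add: L.emeasure_eq_measure ennreal_of_nat_eq_real_of_nat power2_eq_square ennreal_mult' del: of_nat_mult)
qed

lemma P_eq_pair: "P = distr P config_space fst \<Otimes>\<^sub>M distr P config_space snd"
proof -
  have "distr P config_space fst \<Otimes>\<^sub>M distr P config_space snd
      = distr P (config_space \<Otimes>\<^sub>M config_space) (\<lambda>x. (fst x, snd x))"
    using indep by (simp add: indep_var_distribution_eq)
  also have "\<dots> = P" using sets_P by (simp add: distr_id2)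
  finally show ?thesis by simp
qed

lemma nn_integral_indep:
  assumes [measurable]: "F \<in> borel_measurable config_space" "G \<in> borel_measurable config_space"
    and "b \<noteq> c"
  shows "(\<integral>\<^sup>+N. F (proc b N) * G (proc c N) \<partial>P) = (\<integral>\<^sup>+N. F (proc b N) \<partial>P) * (\<integral>\<^sup>+N. G (proc c N) \<partial>P)"
proof -
  have *: "(\<integral>\<^sup>+N. F (proc True N) * G (proc False N) \<partial>P)
     = (\<integral>\<^sup>+N. F (proc True N) \<partial>P) * (\<integral>\<^sup>+N. G (proc False N) \<partial>P)"
    if [measurable]: "F \<in> borel_measurable config_space" "G \<in> borel_measurable config_space" for F G
  proof -
    let ?P1 = "distr P config_space fst" and ?P2 = "distr P config_space snd"
    have m [measurable]: "fst \<in> P \<rightarrow>\<^sub>M config_space" "snd \<in> P \<rightarrow>\<^sub>M config_space"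
      using measurable_proc[of True] measurable_proc[of False] by (simp_all add: proc_def)
    interpret P2: prob_space ?P2 by (rule prob_space_distr) measurable
    have "(\<integral>\<^sup>+N. F (proc True N) * G (proc False N) \<partial>P) = (\<integral>\<^sup>+N. F (fst N) * G (snd N) \<partial>(?P1 \<Otimes>\<^sub>M ?P2))"
      by (subst P_eq_pair [symmetric]) (simp add: proc_def)
    also have "\<dots> = (\<integral>\<^sup>+x. \<integral>\<^sup>+y. F x * G y \<partial>?P2 \<partial>?P1)"
      by (subst P2.nn_integral_fst [symmetric]) auto
    also have "\<dots> = (\<integral>\<^sup>+x. F x \<partial>?P1) * (\<integral>\<^sup>+y. G y \<partial>?P2)"
      by (simp add: nn_integral_cmult nn_integral_multc)
    finally show ?thesis by (simp add: nn_integral_distr proc_def)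
  qed
  show ?thesis
    using *[of F G] *[of G F] \<open>b \<noteq> c\<close> by (cases b; cases c) (simp_all add: mult.commute)
qed

lemma indep_counts:
  assumes "finite J" "\<And>i. i \<in> J \<Longrightarrow> B i \<in> sets borel" "disjoint_family_on B J"
  shows "indep_vars (\<lambda>_. count_space UNIV) (\<lambda>i N. card (proc b N \<inter> B i)) (J :: nat set)"
  using poisson[of b] assms unfolding poisson_process_def by blast

lemma nn_integral_count_disjoint:
  assumes [measurable]: "A \<in> sets borel" "B \<in> sets borel" and "A \<inter> B = {}"
  shows "(\<integral>\<^sup>+N. of_nat (card (proc b N \<inter> A)) * of_nat (card (proc b N \<inter> B)) \<partial>P)
      = emeasure (L b) A * emeasure (L b) B"
proof -
  let ?C = "\<lambda>i::nat. if i = 0 then A else B"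
  have "indep_vars (\<lambda>_. count_space UNIV) (\<lambda>i N. card (proc b N \<inter> ?C i)) {0, 1}"
    by (rule indep_counts) (use assms in \<open>auto simp: disjoint_family_on_def\<close>)
  then have "indep_vars (\<lambda>_. borel) (\<lambda>i N. of_nat (card (proc b N \<inter> ?C i)) :: ennreal) {0, 1}"
    by (rule indep_vars_compose2) auto
  from indep_vars_nn_integral[OF _ this]
  have "(\<integral>\<^sup>+N. (\<Prod>i\<in>{0, 1}. of_nat (card (proc b N \<inter> ?C i))) \<partial>P)
     = (\<Prod>i\<in>{0, 1}. \<integral>\<^sup>+N. of_nat (card (proc b N \<inter> ?C i)) \<partial>P)"
    by auto
  then show ?thesis by (simp add: nn_integral_count_mean)
qed

lemma card_point_pairs_rectangle_neq:
  assumes "N \<in> space P" "b \<noteq> c"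
  shows "card (point_pairs b c N \<inter> A \<times> B) = card (proc b N \<inter> A) * card (proc c N \<inter> B)"
proof -
  have "point_pairs b c N \<inter> A \<times> B = (proc b N \<inter> A) \<times> (proc c N \<inter> B)"
    using assms by (auto simp: point_pairs_def)
  then show ?thesis by (simp add: card_cartesian_product)
qed

text \<open>
  Splitting \<open>A\<close> and \<open>B\<close> along their intersection expresses the number of pairs by counts in pairwise
  disjoint sets, which are independent, and by a falling factorial, whose mean is known.
\<close>

lemma card_point_pairs_rectangle_eq:
  assumes "N \<in> space P"
  shows "card (point_pairs b b N \<inter> A \<times> B)
     = card (proc b N \<inter> (A \<inter> B)) * (card (proc b N \<inter> (A \<inter> B)) - 1)
      + card (proc b N \<inter> (A \<inter> B)) * card (proc b N \<inter> (B - A))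
      + card (proc b N \<inter> (A - B)) * card (proc b N \<inter> (A \<inter> B))
      + card (proc b N \<inter> (A - B)) * card (proc b N \<inter> (B - A))"
proof -
  let ?S = "proc b N" let ?C = "?S \<inter> (A \<inter> B)" let ?D = "?S \<inter> (A - B)" let ?E = "?S \<inter> (B - A)"
  have fin: "finite ?S" using assms by (rule finite_proc)
  have "?S \<inter> A = ?C \<union> ?D" "?S \<inter> B = ?C \<union> ?E" by auto
  then have ab: "card (?S \<inter> A) = card ?C + card ?D" "card (?S \<inter> B) = card ?C + card ?E"
    using fin by (auto intro!: card_Un_disjoint simp del: Int_Un_distrib)
  have "(?S \<inter> A) \<times> (?S \<inter> B) = (point_pairs b b N \<inter> A \<times> B) \<union> (\<lambda>x. (x, x)) ` ?C"
    by (auto simp: point_pairs_def)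
  moreover have "(point_pairs b b N \<inter> A \<times> B) \<inter> (\<lambda>x. (x, x)) ` ?C = {}"
    by (auto simp: point_pairs_def)
  ultimately have "card ((?S \<inter> A) \<times> (?S \<inter> B)) = card (point_pairs b b N \<inter> A \<times> B) + card ((\<lambda>x. (x, x)) ` ?C)"
    using fin finite_point_pairs[OF assms] by (simp add: card_Un_disjoint)
  moreover have "card ((\<lambda>x. (x, x)) ` ?C) = card ?C" by (rule card_image) (auto simp: inj_on_def)
  ultimately have "card (?S \<inter> A) * card (?S \<inter> B) = card (point_pairs b b N \<inter> A \<times> B) + card ?C"
    by (simp add: card_cartesian_product)
  then have 1: "card (point_pairs b b N \<inter> A \<times> B) + card ?C = (card ?C + card ?D) * (card ?C + card ?E)"
    by (simp only: ab)
  have 2: "c * (c - 1) + c = c * c" for c :: nat by (cases c) auto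
  have "card (point_pairs b b N \<inter> A \<times> B) + card ?C
     = (card ?C * (card ?C - 1) + card ?C * card ?E + card ?D * card ?C + card ?D * card ?E) + card ?C"
  proof -
    have "(c + d) * (c + e) = (c * (c - 1) + c * e + d * c + d * e) + c" for c d e :: nat
      using 2[of c] by (simp add: distrib_left distrib_right)
    then show ?thesis unfolding 1 .
  qed
  then show ?thesis by (simp only: add_right_cancel)
qed

text \<open>
  Campbell's formula for pairs of points: their mean measure is the product of the intensities, both for
  two different processes and for distinct points of one process. Rectangles are settled by the moments
  of Poisson counts and generate the product \<open>\<sigma>\<close>-algebra, and Dynkin's theorem does the rest.
  Measurability of the count is not evident for general sets and is carried through the same induction.
\<close>

lemma point_pairs_moment_set:
  assumes "C \<in> sets (borel \<Otimes>\<^sub>M borel)"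
  shows "(\<lambda>N. of_nat (card (point_pairs b c N \<inter> C)) :: ennreal) \<in> borel_measurable P \<and>
    (\<integral>\<^sup>+N. of_nat (card (point_pairs b c N \<inter> C)) \<partial>P) = emeasure (L b \<Otimes>\<^sub>M L c) C"
proof -
  let ?F = "\<lambda>C N. of_nat (card (point_pairs b c N \<inter> C)) :: ennreal"
  let ?G = "{A \<times> B | A B. A \<in> sets (borel :: 'a measure) \<and> B \<in> sets (borel :: 'a measure)}"
  interpret Lb: finite_measure "L b" by (rule finite_L)
  interpret Lc: finite_measure "L c" by (rule finite_L)
  interpret pair_sigma_finite "L b" "L c" ..
  have fin: "emeasure (L b \<Otimes>\<^sub>M L c) X \<noteq> \<infinity>" for X
  proof -
    have "finite_measure (L b \<Otimes>\<^sub>M L c)" by (rule finite_measure_pair_measure) unfold_locales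
    then show ?thesis by (simp add: finite_measure.emeasure_eq_measure)
  qed
  have Lspace: "space (L d) = UNIV" for d using sets_eq_imp_space_eq[OF sets_L] by simp
  have sets_LL: "sets (L b \<Otimes>\<^sub>M L c) = sets (borel \<Otimes>\<^sub>M borel)"
    by (intro sets_pair_measure_cong sets_L)
  have rect: "?F (A \<times> B) \<in> borel_measurable P \<and> integral\<^sup>N P (?F (A \<times> B)) = emeasure (L b \<Otimes>\<^sub>M L c) (A \<times> B)"
    if [measurable]: "A \<in> sets borel" "B \<in> sets borel" for A B
  proof -
    have e: "emeasure (L b \<Otimes>\<^sub>M L c) (A \<times> B) = emeasure (L b) A * emeasure (L c) B"
      by (rule Lc.emeasure_pair_measure_Times) (simp_all add: sets_L)
    show ?thesis
    proof (cases "b = c")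
      case False
      have "?F (A \<times> B) N = of_nat (card (proc b N \<inter> A)) * of_nat (card (proc c N \<inter> B))" if "N \<in> space P" for N
        using card_point_pairs_rectangle_neq[OF that False] by simp
      moreover have "(\<integral>\<^sup>+N. of_nat (card (proc b N \<inter> A)) * of_nat (card (proc c N \<inter> B)) \<partial>P)
         = emeasure (L b) A * emeasure (L c) B"
        by (subst nn_integral_indep[OF _ _ False]) (simp_all add: nn_integral_count_mean)
      ultimately show ?thesis
        by (simp add: e cong: nn_integral_cong measurable_cong)
    next
      case True
      let ?C = "A \<inter> B" and ?D = "A - B" and ?E = "B - A"
      let ?n = "\<lambda>X N. card (proc b N \<inter> X)"
      let ?H = "\<lambda>N. of_nat (?n ?C N * (?n ?C N - 1)) + of_nat (?n ?C N) * of_nat (?n ?E N)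
         + of_nat (?n ?D N) * of_nat (?n ?C N) + of_nat (?n ?D N) * of_nat (?n ?E N) :: ennreal"
      have "?F (A \<times> B) N = ?H N" if "N \<in> space P" for N
        using card_point_pairs_rectangle_eq[OF that, of b A B] True by simp
      moreover have "integral\<^sup>N P ?H = emeasure (L b) ?C * emeasure (L b) ?C + emeasure (L b) ?C * emeasure (L b) ?E
          + emeasure (L b) ?D * emeasure (L b) ?C + emeasure (L b) ?D * emeasure (L b) ?E"
      proof -
        have *: "?C \<inter> ?E = {}" "?D \<inter> ?C = {}" "?D \<inter> ?E = {}" by auto
        have m [measurable]: "A \<inter> B \<in> sets borel" "A - B \<in> sets borel" "B - A \<in> sets borel" by auto
        have "integral\<^sup>N P ?H = (\<integral>\<^sup>+N. of_nat (?n ?C N * (?n ?C N - 1)) \<partial>P) + (\<integral>\<^sup>+N. of_nat (?n ?C N) * of_nat (?n ?E N) \<partial>P)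
         + (\<integral>\<^sup>+N. of_nat (?n ?D N) * of_nat (?n ?C N) \<partial>P) + (\<integral>\<^sup>+N. of_nat (?n ?D N) * of_nat (?n ?E N) \<partial>P)"
          by (subst nn_integral_add; (subst nn_integral_add)?; (subst nn_integral_add)?) (simp_all del: of_nat_mult)
        then show ?thesis
          unfolding nn_integral_count_disjoint[OF m(1) m(3) *(1)] nn_integral_count_disjoint[OF m(2) m(1) *(2)]
            nn_integral_count_disjoint[OF m(2) m(3) *(3)] nn_integral_count_factorial_moment[OF m(1)] .
      qed
      moreover have "\<dots> = emeasure (L b) A * emeasure (L b) B"
      proof -
        have "emeasure (L b) A = emeasure (L b) (?C \<union> ?D)" "emeasure (L b) B = emeasure (L b) (?C \<union> ?E)"
          by (auto intro!: arg_cong[where f="emeasure (L b)"])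
        then have "emeasure (L b) A = emeasure (L b) ?C + emeasure (L b) ?D"
          "emeasure (L b) B = emeasure (L b) ?C + emeasure (L b) ?E"
        proof -
          have "emeasure (L b) (?C \<union> ?D) = emeasure (L b) ?C + emeasure (L b) ?D"
            "emeasure (L b) (?C \<union> ?E) = emeasure (L b) ?C + emeasure (L b) ?E"
            by (rule plus_emeasure [symmetric]; auto simp: sets_L)+
          then show "emeasure (L b) A = emeasure (L b) ?C + emeasure (L b) ?D"
            "emeasure (L b) B = emeasure (L b) ?C + emeasure (L b) ?E"
            using \<open>emeasure (L b) A = emeasure (L b) (?C \<union> ?D)\<close> \<open>emeasure (L b) B = emeasure (L b) (?C \<union> ?E)\<close>
            by (simp_all only:)
        qed
        then show ?thesis by (simp add: algebra_simps)
      qed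
      moreover have "?H \<in> borel_measurable P" by measurable
      ultimately show ?thesis using True e
        by (simp cong: nn_integral_cong measurable_cong)
    qed
  qed
  have finc: "finite (point_pairs b c N)" if "N \<in> space P" for N using that by (rule finite_point_pairs)
  have "Int_stable ?G"
  proof (rule Int_stableI)
    fix X Y assume "X \<in> ?G" "Y \<in> ?G"
    then obtain A B A' B' where "X = A \<times> B" "Y = A' \<times> B'" "A \<inter> A' \<in> sets borel" "B \<inter> B' \<in> sets borel"
      by blast
    then show "X \<inter> Y \<in> ?G" by (auto simp: Times_Int_Times)
  qed
  with assms have "Int_stable ?G" "C \<in> sigma_sets UNIV ?G" by (auto simp: sets_pair_measure)
  from this(1) subset_UNIV[of ?G, folded Pow_UNIV] this(2) show ?thesis
  proof (induction rule: sigma_sets_induct_disjoint)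
    case (basic A) then show ?case using rect by auto
  next
    case empty then show ?case by simp
  next
    case (compl A)
    let ?U = "UNIV :: ('a \<times> 'a) set"
    have A: "A \<in> sets (borel \<Otimes>\<^sub>M borel)" using compl(1) by (simp add: sets_pair_measure)
    have U: "?F ?U \<in> borel_measurable P" "integral\<^sup>N P (?F ?U) = emeasure (L b \<Otimes>\<^sub>M L c) ?U"
      using rect[of UNIV UNIV] by simp_all
    have IH: "?F A \<in> borel_measurable P" "integral\<^sup>N P (?F A) = emeasure (L b \<Otimes>\<^sub>M L c) A"
      using compl(2) by blast+
    have eq: "?F (UNIV - A) N = ?F ?U N - ?F A N" if "N \<in> space P" for N
    proof -
      have "card (point_pairs b c N \<inter> (UNIV - A)) = card (point_pairs b c N) - card (point_pairs b c N \<inter> A)"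
        using finc[OF that] by (subst card_Diff_subset_Int [symmetric]) (auto intro!: arg_cong[where f=card])
      moreover have "of_nat (m - n) = (of_nat m - of_nat n :: ennreal)" if "n \<le> m" for m n :: nat
        using that by (simp add: ennreal_of_nat_eq_real_of_nat ennreal_minus of_nat_diff)
      moreover have "card (point_pairs b c N \<inter> A) \<le> card (point_pairs b c N)"
        using finc[OF that] by (intro card_mono) auto
      ultimately show ?thesis by simp
    qed
    have "integral\<^sup>N P (?F (UNIV - A)) = (\<integral>\<^sup>+N. ?F ?U N - ?F A N \<partial>P)"
      by (intro nn_integral_cong eq)
    also have "\<dots> = integral\<^sup>N P (?F ?U) - integral\<^sup>N P (?F A)"
      by (rule nn_integral_diff)
         (use U IH fin finc in \<open>auto intro!: AE_I2 card_mono simp: of_nat_le_iff\<close>)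
    also have "\<dots> = emeasure (L b \<Otimes>\<^sub>M L c) (UNIV - A)"
      using U IH fin[of A] A sets_LL emeasure_compl[of A "L b \<Otimes>\<^sub>M L c"]
      by (simp add: space_pair_measure Lspace)
    finally show ?case
      using U IH eq by (simp cong: measurable_cong)
  next
    case (union A)
    have A: "A i \<in> sets (borel \<Otimes>\<^sub>M borel)" for i using union(2) by (auto simp: sets_pair_measure)
    have IH: "?F (A i) \<in> borel_measurable P" "integral\<^sup>N P (?F (A i)) = emeasure (L b \<Otimes>\<^sub>M L c) (A i)" for i
      using union(3) by blast+
    have eq: "?F (\<Union>i. A i) N = (\<Sum>i. ?F (A i) N)" if "N \<in> space P" for N
    proof -
      let ?M = "count_space (point_pairs b c N)"
      have *: "emeasure ?M (point_pairs b c N \<inter> X) = ?F X N" for X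
        using finc[OF that] by (subst emeasure_count_space_finite) auto
      have "(\<Sum>i. emeasure ?M (point_pairs b c N \<inter> A i)) = emeasure ?M (\<Union>i. point_pairs b c N \<inter> A i)"
        by (rule suminf_emeasure) (use union(1) in \<open>auto simp: disjoint_family_on_def\<close>)
      moreover have "(\<Union>i. point_pairs b c N \<inter> A i) = point_pairs b c N \<inter> (\<Union>i. A i)" by auto
      ultimately show ?thesis by (simp only: *)
    qed
    have "integral\<^sup>N P (?F (\<Union>i. A i)) = (\<integral>\<^sup>+N. (\<Sum>i. ?F (A i) N) \<partial>P)"
      by (intro nn_integral_cong eq)
    also have "\<dots> = (\<Sum>i. integral\<^sup>N P (?F (A i)))" by (rule nn_integral_suminf) (rule IH)
    also have "\<dots> = emeasure (L b \<Otimes>\<^sub>M L c) (\<Union>i. A i)"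
      unfolding IH by (rule suminf_emeasure) (use union(1) A sets_LL in auto)
    finally show ?case using IH eq by (simp cong: measurable_cong)
  qed
qed

end

definition sg :: "bool \<Rightarrow> real" where "sg b = (if b then 1 else -1)"

definition pair_sum :: "bool \<Rightarrow> bool \<Rightarrow> ('a \<times> 'a \<Rightarrow> real) \<Rightarrow> 'a set \<times> 'a set \<Rightarrow> real" where
  "pair_sum b c K N = (\<Sum>z\<in>point_pairs b c N. K z)"

definition signed_sum :: "('a \<times> 'a \<Rightarrow> real) \<Rightarrow> 'a set \<times> 'a set \<Rightarrow> real" where
  "signed_sum K N = (\<Sum>b\<in>UNIV. \<Sum>c\<in>UNIV. sg b * sg c * pair_sum b c K N)"

context poisson_pair
begin

lemma borel_measurable_pair_L:
  "f \<in> borel_measurable (borel \<Otimes>\<^sub>M borel) \<Longrightarrow> f \<in> borel_measurable (L b \<Otimes>\<^sub>M L c)"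
  by (subst measurable_cong_sets[OF sets_pair_measure_cong[OF sets_L sets_L] refl])

lemma point_pairs_moment:
  assumes "\<phi> \<in> borel_measurable (borel \<Otimes>\<^sub>M borel)"
  shows "(\<lambda>N. \<Sum>z\<in>point_pairs b c N. \<phi> z :: ennreal) \<in> borel_measurable P \<and>
    (\<integral>\<^sup>+N. (\<Sum>z\<in>point_pairs b c N. \<phi> z) \<partial>P) = (\<integral>\<^sup>+z. \<phi> z \<partial>(L b \<Otimes>\<^sub>M L c))"
  using assms
proof (induction rule: borel_measurable_induct)
  case (cong f g)
  then have "f = g" by (auto simp: space_pair_measure)
  then show ?case using cong by simp
next
  case (set C)
  have "(\<Sum>z\<in>point_pairs b c N. indicator C z :: ennreal) = of_nat (card (point_pairs b c N \<inter> C))"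
    if "N \<in> space P" for N
    using finite_point_pairs[OF that, of b c]
    by (simp add: indicator_def of_bool_def sum.If_cases Int_def)
  moreover have "C \<in> sets (L b \<Otimes>\<^sub>M L c)"
    using set sets_pair_measure_cong[OF sets_L[of b] sets_L[of c]] by simp
  ultimately show ?case using point_pairs_moment_set[OF set, of b c]
    by (simp cong: measurable_cong nn_integral_cong)
next
  case (mult u c)
  then show ?case
    by (auto simp: sum_distrib_left [symmetric] nn_integral_cmult borel_measurable_pair_L)
next
  case (add u v)
  then show ?case
    by (auto simp: sum.distrib nn_integral_add borel_measurable_pair_L)
next
  case (seq U)
  have S: "(SUP i. U i) z = (SUP i. U i z)" for z by (rule SUP_apply)
  have inc: "incseq (\<lambda>i. U i z)" for z using seq by (auto simp: incseq_def intro: le_funD)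
  have eq: "(\<Sum>z\<in>point_pairs b c N. (SUP i. U i) z) = (SUP i. \<Sum>z\<in>point_pairs b c N. U i z)" for N
    unfolding S using inc by (intro ennreal_SUP_sum [symmetric])
  have "(\<integral>\<^sup>+N. (SUP i. \<Sum>z\<in>point_pairs b c N. U i z) \<partial>P) = (SUP i. \<integral>\<^sup>+N. (\<Sum>z\<in>point_pairs b c N. U i z) \<partial>P)"
    by (rule nn_integral_monotone_convergence_SUP)
       (use seq in \<open>auto simp: incseq_def le_fun_def intro!: sum_mono\<close>)
  also have "\<dots> = (SUP i. \<integral>\<^sup>+z. U i z \<partial>(L b \<Otimes>\<^sub>M L c))" using seq by simp
  also have "\<dots> = (\<integral>\<^sup>+z. (SUP i. U i z) \<partial>(L b \<Otimes>\<^sub>M L c))"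
    by (rule nn_integral_monotone_convergence_SUP [symmetric])
       (use seq in \<open>auto simp: borel_measurable_pair_L\<close>)
  finally have "(\<integral>\<^sup>+N. (SUP i. \<Sum>z\<in>point_pairs b c N. U i z) \<partial>P) = (\<integral>\<^sup>+z. (SUP i. U i z) \<partial>(L b \<Otimes>\<^sub>M L c))" .
  moreover have "(\<lambda>N. SUP i. \<Sum>z\<in>point_pairs b c N. U i z) \<in> borel_measurable P"
    by (intro borel_measurable_SUP) (use seq in auto)
  ultimately have "(\<lambda>N. \<Sum>z\<in>point_pairs b c N. (SUP i. U i) z) \<in> borel_measurable P \<and>
    (\<integral>\<^sup>+N. (\<Sum>z\<in>point_pairs b c N. (SUP i. U i) z) \<partial>P) = (\<integral>\<^sup>+z. (SUP i. U i) z \<partial>(L b \<Otimes>\<^sub>M L c))"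
    by (simp only: eq) (simp only: S simp_thms)
  then show ?case using seq by simp
qed

lemma measurable_pair_sum [measurable]:
  assumes [measurable]: "K \<in> borel_measurable (borel \<Otimes>\<^sub>M borel)"
  shows "pair_sum b c K \<in> borel_measurable P"
proof -
  have "pair_sum b c K N = enn2real (\<Sum>z\<in>point_pairs b c N. ennreal (K z))
      - enn2real (\<Sum>z\<in>point_pairs b c N. ennreal (- K z))" for N
  proof -
    have *: "enn2real (\<Sum>z\<in>point_pairs b c N. ennreal (F z)) = (\<Sum>z\<in>point_pairs b c N. max 0 (F z))" for F :: "_ \<Rightarrow> real"
    proof -
      have "(\<Sum>z\<in>point_pairs b c N. ennreal (F z)) = (\<Sum>z\<in>point_pairs b c N. ennreal (max 0 (F z)))"
        by (intro sum.cong refl) (auto simp: max_def ennreal_neg)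
      also have "\<dots> = ennreal (\<Sum>z\<in>point_pairs b c N. max 0 (F z))" by (rule sum_ennreal) auto
      finally have "enn2real (\<Sum>z\<in>point_pairs b c N. ennreal (F z))
        = enn2real (ennreal (\<Sum>z\<in>point_pairs b c N. max 0 (F z)))" by (rule arg_cong)
      then show ?thesis by (subst (asm) enn2real_ennreal) (auto intro: sum_nonneg)
    qed
    show ?thesis unfolding * pair_sum_def sum_subtractf [symmetric] by (intro sum.cong refl) auto
  qed
  moreover have "(\<lambda>N. \<Sum>z\<in>point_pairs b c N. ennreal (K z)) \<in> borel_measurable P"
    "(\<lambda>N. \<Sum>z\<in>point_pairs b c N. ennreal (- K z)) \<in> borel_measurable P"
    using point_pairs_moment[of "\<lambda>z. ennreal (K z)" b c] point_pairs_moment[of "\<lambda>z. ennreal (- K z)" b c] by auto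
  ultimately show ?thesis by (simp cong: measurable_cong)
qed

lemma nn_integral_pair_sum:
  assumes [measurable]: "K \<in> borel_measurable (borel \<Otimes>\<^sub>M borel)" and "\<And>z. 0 \<le> K z"
  shows "(\<integral>\<^sup>+N. ennreal (pair_sum b c K N) \<partial>P) = (\<integral>\<^sup>+z. ennreal (K z) \<partial>(L b \<Otimes>\<^sub>M L c))"
  using point_pairs_moment[of "\<lambda>z. ennreal (K z)" b c] assms by (simp add: pair_sum_def)

lemma measurable_signed_sum [measurable]:
  assumes [measurable]: "K \<in> borel_measurable (borel \<Otimes>\<^sub>M borel)"
  shows "signed_sum K \<in> borel_measurable P"
  unfolding signed_sum_def by measurable

lemma abs_signed_sum_diff_le:
  "\<bar>signed_sum K N - signed_sum K' N\<bar> \<le> (\<Sum>b\<in>UNIV. \<Sum>c\<in>UNIV. pair_sum b c (\<lambda>z. \<bar>K z - K' z\<bar>) N)"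
proof -
  have "signed_sum K N - signed_sum K' N
     = (\<Sum>b\<in>UNIV. \<Sum>c\<in>UNIV. sg b * sg c * pair_sum b c (\<lambda>z. K z - K' z) N)"
    by (simp add: signed_sum_def pair_sum_def sum_subtractf algebra_simps)
  also have "\<bar>\<dots>\<bar> \<le> (\<Sum>b\<in>UNIV. \<Sum>c\<in>UNIV. \<bar>sg b * sg c * pair_sum b c (\<lambda>z. K z - K' z) N\<bar>)"
    by (intro order_trans[OF sum_abs] sum_mono sum_abs)
  also have "\<dots> \<le> (\<Sum>b\<in>UNIV. \<Sum>c\<in>UNIV. pair_sum b c (\<lambda>z. \<bar>K z - K' z\<bar>) N)"
    by (intro sum_mono) (auto simp: abs_mult sg_def pair_sum_def intro!: sum_abs)
  finally show ?thesis .
qed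

end

section \<open>Square-integrable functions\<close>

text \<open>
  Squared \<open>L\<^sup>2\<close> distances are written as nonnegative integrals, so that they can be manipulated before
  integrability is known.
\<close>

lemma L2_dominated_limit:
  fixes u :: "nat \<Rightarrow> 'b \<Rightarrow> real"
  assumes [measurable]: "\<And>j. u j \<in> borel_measurable M" "v \<in> borel_measurable M" "w \<in> borel_measurable M"
    and lim: "AE z in M. (\<lambda>j. u j z) \<longlonglongrightarrow> v z"
    and dom: "\<And>j. AE z in M. \<bar>v z - u j z\<bar> \<le> w z"
    and fin: "(\<integral>\<^sup>+z. ennreal ((w z)\<^sup>2) \<partial>M) < \<infinity>"
  shows "(\<lambda>j. \<integral>\<^sup>+z. ennreal ((v z - u j z)\<^sup>2) \<partial>M) \<longlonglongrightarrow> 0"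
proof -
  have "(\<lambda>j. \<integral>\<^sup>+z. ennreal ((v z - u j z)\<^sup>2) \<partial>M) \<longlonglongrightarrow> (\<integral>\<^sup>+z. 0 \<partial>M)"
  proof (rule nn_integral_dominated_convergence[where w="\<lambda>z. ennreal ((w z)\<^sup>2)"])
    show "AE z in M. ennreal ((v z - u j z)\<^sup>2) \<le> ennreal ((w z)\<^sup>2)" for j
      using dom[of j]
    proof eventually_elim
      case (elim z)
      then have "\<bar>v z - u j z\<bar>\<^sup>2 \<le> (w z)\<^sup>2" by (intro power_mono) auto
      then show ?case by (intro ennreal_leI) simp
    qed
    show "AE z in M. (\<lambda>j. ennreal ((v z - u j z)\<^sup>2)) \<longlonglongrightarrow> 0"
      using lim
    proof eventually_elim
      case (elim z)
      have "(\<lambda>j. ennreal ((v z - u j z)\<^sup>2)) \<longlonglongrightarrow> ennreal ((v z - v z)\<^sup>2)"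
        by (intro tendsto_ennrealI tendsto_intros elim)
      then show ?case by simp
    qed
  qed (use fin in auto)
  then show ?thesis by simp
qed

lemma L2_limit_exists:
  fixes u :: "nat \<Rightarrow> 'b \<Rightarrow> real"
  assumes "(\<lambda>j. \<integral>\<^sup>+z. ennreal ((v z - u j z)\<^sup>2) \<partial>M) \<longlonglongrightarrow> 0" "0 < \<epsilon>"
  shows "\<exists>j. (\<integral>\<^sup>+z. ennreal ((v z - u j z)\<^sup>2) \<partial>M) \<le> ennreal \<epsilon>"
proof -
  have "eventually (\<lambda>j. (\<integral>\<^sup>+z. ennreal ((v z - u j z)\<^sup>2) \<partial>M) < ennreal \<epsilon>) sequentially"
    using assms by (intro order_tendstoD(2)) auto
  then show ?thesis unfolding eventually_sequentially by (meson less_imp_le order_refl)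
qed

lemma power2_sum_le: "(a + b)\<^sup>2 \<le> 2 * a\<^sup>2 + 2 * (b\<^sup>2 :: real)"
  using zero_le_power2[of "a - b"] unfolding power2_sum power2_diff by linarith

lemma L2_triangle:
  assumes [measurable]: "f \<in> borel_measurable M" "g \<in> borel_measurable M"
  shows "(\<integral>\<^sup>+x. ennreal ((f x + g x)\<^sup>2) \<partial>M) \<le> 2 * (\<integral>\<^sup>+x. ennreal ((f x)\<^sup>2) \<partial>M) + 2 * (\<integral>\<^sup>+x. ennreal ((g x)\<^sup>2) \<partial>M)"
proof -
  have "(\<integral>\<^sup>+x. ennreal ((f x + g x)\<^sup>2) \<partial>M) \<le> (\<integral>\<^sup>+x. 2 * ennreal ((f x)\<^sup>2) + 2 * ennreal ((g x)\<^sup>2) \<partial>M)"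
  proof (intro nn_integral_mono)
    fix x
    have "ennreal ((f x + g x)\<^sup>2) \<le> ennreal (2 * (f x)\<^sup>2 + 2 * (g x)\<^sup>2)" by (intro ennreal_leI power2_sum_le)
    then show "ennreal ((f x + g x)\<^sup>2) \<le> 2 * ennreal ((f x)\<^sup>2) + 2 * ennreal ((g x)\<^sup>2)" by (simp add: ennreal_mult')
  qed
  then show ?thesis by (simp add: nn_integral_add nn_integral_cmult)
qed

section \<open>Quadratic forms in independent variables\<close>

context prob_space
begin

context
  fixes \<xi> :: "'i \<Rightarrow> 'a \<Rightarrow> real" and v :: "'i \<Rightarrow> real" and I :: "'i set"
  assumes I: "finite I" and ind: "indep_vars (\<lambda>_. borel) \<xi> I"
    and int: "\<And>i. i \<in> I \<Longrightarrow> integrable M (\<xi> i)" "\<And>i. i \<in> I \<Longrightarrow> integrable M (\<lambda>\<omega>. (\<xi> i \<omega>)\<^sup>2)"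
    and mean: "\<And>i. i \<in> I \<Longrightarrow> expectation (\<xi> i) = 0"
    and var: "\<And>i. i \<in> I \<Longrightarrow> expectation (\<lambda>\<omega>. (\<xi> i \<omega>)\<^sup>2) = v i"
begin

text \<open>
  Orthogonality of multilinear monomials: a variable that occurs in exactly one of \<open>A\<close> and \<open>B\<close>
  contributes its mean, which is 0.
\<close>

lemma expectation_monomials:
  assumes AB: "A \<subseteq> I" "B \<subseteq> I"
  shows "integrable M (\<lambda>\<omega>. (\<Prod>i\<in>A. \<xi> i \<omega>) * (\<Prod>i\<in>B. \<xi> i \<omega>))"
    and "expectation (\<lambda>\<omega>. (\<Prod>i\<in>A. \<xi> i \<omega>) * (\<Prod>i\<in>B. \<xi> i \<omega>)) = (if A = B then \<Prod>i\<in>A. v i else 0)"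
proof -
  define e :: "'i \<Rightarrow> nat" where "e = (\<lambda>i. of_bool (i \<in> A) + of_bool (i \<in> B))"
  have P: "(\<Prod>i\<in>A. \<xi> i \<omega>) * (\<Prod>i\<in>B. \<xi> i \<omega>) = (\<Prod>i\<in>I. \<xi> i \<omega> ^ e i)" for \<omega>
  proof -
    have "(\<Prod>i\<in>C. \<xi> i \<omega>) = (\<Prod>i\<in>I. if i \<in> C then \<xi> i \<omega> else 1)" if "C \<subseteq> I" for C
      using that I by (simp add: prod.inter_restrict [symmetric] Int_absorb1)
    then show ?thesis using AB
      by (simp add: prod.distrib [symmetric]) (auto intro!: prod.cong simp: e_def)
  qed
  have ind': "indep_vars (\<lambda>_. borel) (\<lambda>i \<omega>. \<xi> i \<omega> ^ e i) I"
    by (rule indep_vars_compose2[OF ind]) auto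
  have int': "integrable M (\<lambda>\<omega>. \<xi> i \<omega> ^ e i)" if "i \<in> I" for i
  proof -
    have "e i = 0 \<or> e i = 1 \<or> e i = 2" by (auto simp: e_def)
    then show ?thesis using int[OF that] by auto
  qed
  show "integrable M (\<lambda>\<omega>. (\<Prod>i\<in>A. \<xi> i \<omega>) * (\<Prod>i\<in>B. \<xi> i \<omega>))"
    unfolding P by (rule indep_vars_integrable[OF I ind' int'])
  have "expectation (\<lambda>\<omega>. (\<Prod>i\<in>A. \<xi> i \<omega>) * (\<Prod>i\<in>B. \<xi> i \<omega>)) = (\<Prod>i\<in>I. expectation (\<lambda>\<omega>. \<xi> i \<omega> ^ e i))"
    unfolding P by (rule indep_vars_lebesgue_integral[OF I ind' int'])
  also have "\<dots> = (if A = B then \<Prod>i\<in>A. v i else 0)"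
  proof (cases "A = B")
    case True
    have "(\<Prod>i\<in>I. expectation (\<lambda>\<omega>. \<xi> i \<omega> ^ e i)) = (\<Prod>i\<in>I. if i \<in> A then v i else 1)"
      by (intro prod.cong refl) (auto simp: e_def True var[unfolded power2_eq_square] prob_space)
    then show ?thesis using True AB I by (simp add: prod.inter_restrict [symmetric] Int_absorb1)
  next
    case False
    then obtain i where i: "i \<in> I" "(i \<in> A) \<noteq> (i \<in> B)" using AB by blast
    then have "e i = 1" by (auto simp: e_def)
    then have "expectation (\<lambda>\<omega>. \<xi> i \<omega> ^ e i) = 0" using mean[OF i(1)] by simp
    then show ?thesis using False i(1) I by (auto intro: prod_zero)
  qed
  finally show "expectation (\<lambda>\<omega>. (\<Prod>i\<in>A. \<xi> i \<omega>) * (\<Prod>i\<in>B. \<xi> i \<omega>)) = (if A = B then \<Prod>i\<in>A. v i else 0)" .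
qed

lemma expectation_walsh_sum_square:
  shows "integrable M (\<lambda>\<omega>. (walsh_sum c I (\<lambda>i. \<xi> i \<omega>))\<^sup>2)"
    and "expectation (\<lambda>\<omega>. (walsh_sum c I (\<lambda>i. \<xi> i \<omega>))\<^sup>2) = (\<Sum>A\<in>Pow I. (c A)\<^sup>2 * (\<Prod>i\<in>A. v i))"
proof -
  have sq: "(walsh_sum c I (\<lambda>i. \<xi> i \<omega>))\<^sup>2
      = (\<Sum>A\<in>Pow I. \<Sum>B\<in>Pow I. c A * c B * ((\<Prod>i\<in>A. \<xi> i \<omega>) * (\<Prod>i\<in>B. \<xi> i \<omega>)))" for \<omega>
    unfolding walsh_sum_def power2_eq_square sum_product by (intro sum.cong refl) simp
  note m = expectation_monomials
  show "integrable M (\<lambda>\<omega>. (walsh_sum c I (\<lambda>i. \<xi> i \<omega>))\<^sup>2)"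
    unfolding sq by (intro Bochner_Integration.integrable_sum integrable_mult_right m) auto
  have "expectation (\<lambda>\<omega>. (walsh_sum c I (\<lambda>i. \<xi> i \<omega>))\<^sup>2)
     = (\<Sum>A\<in>Pow I. \<Sum>B\<in>Pow I. c A * c B * (if A = B then \<Prod>i\<in>A. v i else 0))"
    unfolding sq
    by (subst Bochner_Integration.integral_sum, (intro Bochner_Integration.integrable_sum integrable_mult_right m; auto),
        intro sum.cong refl,
        subst Bochner_Integration.integral_sum, (intro integrable_mult_right m; auto),
        intro sum.cong refl, subst integral_mult_right_zero, subst m(2), auto)
  also have "\<dots> = (\<Sum>A\<in>Pow I. \<Sum>B\<in>Pow I. if A = B then c A * c A * (\<Prod>i\<in>A. v i) else 0)"
    by (intro sum.cong refl) auto
  also have "\<dots> = (\<Sum>A\<in>Pow I. (c A)\<^sup>2 * (\<Prod>i\<in>A. v i))"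
    using I by (intro sum.cong refl) (simp add: sum.delta power2_eq_square)
  finally show "expectation (\<lambda>\<omega>. (walsh_sum c I (\<lambda>i. \<xi> i \<omega>))\<^sup>2) = (\<Sum>A\<in>Pow I. (c A)\<^sup>2 * (\<Prod>i\<in>A. v i))" .
qed

text \<open>
  The factor 2 is the price of symmetrising \<open>C\<close>.
\<close>

lemma expectation_chaos_square_le:
  shows "integrable M (\<lambda>\<omega>. (sign_form C I (\<lambda>i. \<xi> i \<omega>))\<^sup>2)"
    and "expectation (\<lambda>\<omega>. (sign_form C I (\<lambda>i. \<xi> i \<omega>))\<^sup>2) \<le> 2 * (\<Sum>i\<in>I. \<Sum>j\<in>I. (C i j)\<^sup>2 * v i * v j)"
proof -
  note w = expectation_walsh_sum_square[of "pair_coeff C I"]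
  have v: "0 \<le> v i" if "i \<in> I" for i unfolding var[OF that, symmetric] by (rule Bochner_Integration.integral_nonneg) simp
  show "integrable M (\<lambda>\<omega>. (sign_form C I (\<lambda>i. \<xi> i \<omega>))\<^sup>2)"
    using w(1) by (simp only: sign_form_eq_walsh_sum[OF I])
  have "expectation (\<lambda>\<omega>. (sign_form C I (\<lambda>i. \<xi> i \<omega>))\<^sup>2) = (\<Sum>A\<in>Pow I. (pair_coeff C I A)\<^sup>2 * (\<Prod>i\<in>A. v i))"
    using w(2) by (simp only: sign_form_eq_walsh_sum[OF I])
  also have "\<dots> \<le> (\<Sum>A\<in>Pow I. 2 * (\<Sum>(i, j)\<in>{(i, j)\<in>off_diagonal I. {i, j} = A}. (C i j)\<^sup>2 * v i * v j))"
  proof (intro sum_mono)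
    fix A assume "A \<in> Pow I"
    then have "(pair_coeff C I A)\<^sup>2 * (\<Prod>i\<in>A. v i)
       \<le> (2 * (\<Sum>(i, j)\<in>{(i, j)\<in>off_diagonal I. {i, j} = A}. (C i j)\<^sup>2)) * (\<Prod>i\<in>A. v i)"
      by (intro mult_right_mono pair_coeff_square_le I prod_nonneg) (use v in auto)
    also have "\<dots> = 2 * (\<Sum>(i, j)\<in>{(i, j)\<in>off_diagonal I. {i, j} = A}. (C i j)\<^sup>2 * (\<Prod>i\<in>A. v i))"
      by (simp add: sum_distrib_right case_prod_beta)
    also have "\<dots> = 2 * (\<Sum>(i, j)\<in>{(i, j)\<in>off_diagonal I. {i, j} = A}. (C i j)\<^sup>2 * v i * v j)"
      by (intro arg_cong[where f="(*) 2"] sum.cong refl) (auto simp: off_diagonal_def)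
    finally show "(pair_coeff C I A)\<^sup>2 * (\<Prod>i\<in>A. v i)
       \<le> 2 * (\<Sum>(i, j)\<in>{(i, j)\<in>off_diagonal I. {i, j} = A}. (C i j)\<^sup>2 * v i * v j)" .
  qed
  also have "\<dots> = 2 * (\<Sum>i\<in>I. \<Sum>j\<in>I - {i}. (C i j)\<^sup>2 * v i * v j)"
    by (simp only: off_diagonal_sum[OF I] sum_off_diagonal_fibres[OF I] sum_distrib_left)
  also have "\<dots> \<le> 2 * (\<Sum>i\<in>I. \<Sum>j\<in>I. (C i j)\<^sup>2 * v i * v j)"
    by (intro mult_left_mono sum_mono sum_mono2) (use I v in auto)
  finally show "expectation (\<lambda>\<omega>. (sign_form C I (\<lambda>i. \<xi> i \<omega>))\<^sup>2) \<le> 2 * (\<Sum>i\<in>I. \<Sum>j\<in>I. (C i j)\<^sup>2 * v i * v j)" .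
qed

lemma expectation_linear_square:
  shows "integrable M (\<lambda>\<omega>. (\<Sum>i\<in>I. l i * \<xi> i \<omega>)\<^sup>2)"
    and "expectation (\<lambda>\<omega>. (\<Sum>i\<in>I. l i * \<xi> i \<omega>)\<^sup>2) = (\<Sum>i\<in>I. (l i)\<^sup>2 * v i)"
proof -
  have sq: "(\<Sum>i\<in>I. l i * \<xi> i \<omega>)\<^sup>2 = (\<Sum>i\<in>I. \<Sum>j\<in>I. l i * l j * (\<xi> i \<omega> * \<xi> j \<omega>))" for \<omega>
    unfolding power2_eq_square sum_product by (intro sum.cong refl) simp
  have m: "integrable M (\<lambda>\<omega>. \<xi> i \<omega> * \<xi> j \<omega>)" "expectation (\<lambda>\<omega>. \<xi> i \<omega> * \<xi> j \<omega>) = (if i = j then v i else 0)"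
    if "i \<in> I" "j \<in> I" for i j
    using expectation_monomials[of "{i}" "{j}"] that by auto
  show "integrable M (\<lambda>\<omega>. (\<Sum>i\<in>I. l i * \<xi> i \<omega>)\<^sup>2)"
    unfolding sq by (intro Bochner_Integration.integrable_sum integrable_mult_right m)
  have "expectation (\<lambda>\<omega>. (\<Sum>i\<in>I. l i * \<xi> i \<omega>)\<^sup>2)
     = (\<Sum>i\<in>I. \<Sum>j\<in>I. l i * l j * (if i = j then v i else 0))"
    unfolding sq using m by (simp add: Bochner_Integration.integral_sum)
  also have "\<dots> = (\<Sum>i\<in>I. \<Sum>j\<in>I. if i = j then l i * l i * v i else 0)"
    by (intro sum.cong refl) auto
  also have "\<dots> = (\<Sum>i\<in>I. (l i)\<^sup>2 * v i)"
    using I by (intro sum.cong refl) (simp add: power2_eq_square)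
  finally show "expectation (\<lambda>\<omega>. (\<Sum>i\<in>I. l i * \<xi> i \<omega>)\<^sup>2) = (\<Sum>i\<in>I. (l i)\<^sup>2 * v i)" .
qed

end

lemma centered_moments:
  fixes X :: "'a \<Rightarrow> real"
  assumes "integrable M X" "integrable M (\<lambda>\<omega>. (X \<omega>)\<^sup>2)" "expectation X = e" "expectation (\<lambda>\<omega>. (X \<omega>)\<^sup>2) = e\<^sup>2 + v"
  shows "integrable M (\<lambda>\<omega>. X \<omega> - e) \<and> integrable M (\<lambda>\<omega>. (X \<omega> - e)\<^sup>2) \<and> expectation (\<lambda>\<omega>. X \<omega> - e) = 0 \<and>
    expectation (\<lambda>\<omega>. (X \<omega> - e)\<^sup>2) = v"
  using assms by (simp add: power2_diff prob_space power2_eq_square[of e])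

text \<open>
  Hoeffding's decomposition: inserting \<open>X i = e i + \<xi> i\<close> splits the form minus its mean into a linear and
  a purely quadratic part in the centred variables \<open>\<xi> i\<close>. The second moments of both are given by
  orthogonality.
\<close>

lemma quadratic_form_second_moment_le:
  fixes X :: "'i \<Rightarrow> 'a \<Rightarrow> real"
  assumes I: "finite I" and ind: "indep_vars (\<lambda>_. borel) X I"
    and int: "\<And>i. i \<in> I \<Longrightarrow> integrable M (X i)" "\<And>i. i \<in> I \<Longrightarrow> integrable M (\<lambda>\<omega>. (X i \<omega>)\<^sup>2)"
    and mean: "\<And>i. i \<in> I \<Longrightarrow> expectation (X i) = e i"
    and var: "\<And>i. i \<in> I \<Longrightarrow> expectation (\<lambda>\<omega>. (X i \<omega>)\<^sup>2) = (e i)\<^sup>2 + v i"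
    and C: "\<And>i. i \<in> I \<Longrightarrow> C i i = 0"
  shows "(\<integral>\<^sup>+\<omega>. ennreal (((\<Sum>i\<in>I. \<Sum>j\<in>I. C i j * X i \<omega> * X j \<omega>) - (\<Sum>i\<in>I. \<Sum>j\<in>I. C i j * e i * e j))\<^sup>2) \<partial>M)
    \<le> ennreal (2 * (\<Sum>i\<in>I. (\<Sum>j\<in>I. (C i j + C j i) * e j)\<^sup>2 * v i)
          + 4 * (\<Sum>i\<in>I. \<Sum>j\<in>I. (C i j)\<^sup>2 * v i * v j))"
proof -
  define \<xi> where "\<xi> = (\<lambda>i \<omega>. X i \<omega> - e i)"
  define l where "l = (\<lambda>i. \<Sum>j\<in>I. (C i j + C j i) * e j)"
  have ind': "indep_vars (\<lambda>_. borel) \<xi> I"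
    unfolding \<xi>_def by (rule indep_vars_compose2[OF ind]) auto
  have 1: "integrable M (\<xi> i)" "integrable M (\<lambda>\<omega>. (\<xi> i \<omega>)\<^sup>2)" "expectation (\<xi> i) = 0"
    "expectation (\<lambda>\<omega>. (\<xi> i \<omega>)\<^sup>2) = v i" if i: "i \<in> I" for i
    using centered_moments[OF int(1)[OF i] int(2)[OF i] mean[OF i] var[OF i]] unfolding \<xi>_def by blast+
  have off: "sign_form C I f = (\<Sum>i\<in>I. \<Sum>j\<in>I. C i j * f i * f j)" for f
    unfolding sign_form_def
  proof (rule sum.cong[OF refl])
    fix i assume i: "i \<in> I"
    show "(\<Sum>j\<in>I - {i}. C i j * f i * f j) = (\<Sum>j\<in>I. C i j * f i * f j)"
      using sum.remove[OF I i, of "\<lambda>j. C i j * f i * f j"] C[OF i] by simp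
  qed
  have decomp: "(\<Sum>i\<in>I. \<Sum>j\<in>I. C i j * X i \<omega> * X j \<omega>) - (\<Sum>i\<in>I. \<Sum>j\<in>I. C i j * e i * e j)
     = (\<Sum>i\<in>I. l i * \<xi> i \<omega>) + sign_form C I (\<lambda>i. \<xi> i \<omega>)" for \<omega>
  proof -
    have X: "X i \<omega> = e i + \<xi> i \<omega>" for i by (simp add: \<xi>_def)
    have "(\<Sum>i\<in>I. \<Sum>j\<in>I. C i j * X i \<omega> * X j \<omega>) = (\<Sum>i\<in>I. \<Sum>j\<in>I. C i j * e i * e j)
       + (\<Sum>i\<in>I. \<Sum>j\<in>I. C i j * e j * \<xi> i \<omega>) + (\<Sum>i\<in>I. \<Sum>j\<in>I. C i j * e i * \<xi> j \<omega>)
       + (\<Sum>i\<in>I. \<Sum>j\<in>I. C i j * \<xi> i \<omega> * \<xi> j \<omega>)"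
      unfolding X sum.distrib [symmetric] by (intro sum.cong refl) (simp add: algebra_simps)
    also have "(\<Sum>i\<in>I. \<Sum>j\<in>I. C i j * e i * \<xi> j \<omega>) = (\<Sum>i\<in>I. \<Sum>j\<in>I. C j i * e j * \<xi> i \<omega>)"
      by (rule sum.swap)
    moreover have "(\<Sum>i\<in>I. l i * \<xi> i \<omega>)
       = (\<Sum>i\<in>I. \<Sum>j\<in>I. C i j * e j * \<xi> i \<omega>) + (\<Sum>i\<in>I. \<Sum>j\<in>I. C j i * e j * \<xi> i \<omega>)"
      unfolding l_def sum_distrib_right sum.distrib [symmetric] by (intro sum.cong refl) (simp add: algebra_simps)
    ultimately show ?thesis unfolding off by linarith
  qed
  note L = expectation_linear_square[OF I ind' 1(1) 1(2) 1(3) 1(4), of l]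
  note Q = expectation_chaos_square_le[OF I ind' 1(1) 1(2) 1(3) 1(4), of C]
  have "(\<integral>\<^sup>+\<omega>. ennreal (((\<Sum>i\<in>I. \<Sum>j\<in>I. C i j * X i \<omega> * X j \<omega>) - (\<Sum>i\<in>I. \<Sum>j\<in>I. C i j * e i * e j))\<^sup>2) \<partial>M)
     \<le> (\<integral>\<^sup>+\<omega>. ennreal (2 * (\<Sum>i\<in>I. l i * \<xi> i \<omega>)\<^sup>2 + 2 * (sign_form C I (\<lambda>i. \<xi> i \<omega>))\<^sup>2) \<partial>M)"
    unfolding decomp by (intro nn_integral_mono ennreal_leI power2_sum_le)
  also have "\<dots> = ennreal (expectation (\<lambda>\<omega>. 2 * (\<Sum>i\<in>I. l i * \<xi> i \<omega>)\<^sup>2 + 2 * (sign_form C I (\<lambda>i. \<xi> i \<omega>))\<^sup>2))"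
    by (intro nn_integral_eq_integral) (use L(1) Q(1) in auto)
  also have "\<dots> \<le> ennreal (2 * (\<Sum>i\<in>I. (l i)\<^sup>2 * v i) + 4 * (\<Sum>i\<in>I. \<Sum>j\<in>I. (C i j)\<^sup>2 * v i * v j))"
  proof (intro ennreal_leI)
    have "expectation (\<lambda>\<omega>. 2 * (\<Sum>i\<in>I. l i * \<xi> i \<omega>)\<^sup>2 + 2 * (sign_form C I (\<lambda>i. \<xi> i \<omega>))\<^sup>2)
       = 2 * expectation (\<lambda>\<omega>. (\<Sum>i\<in>I. l i * \<xi> i \<omega>)\<^sup>2) + 2 * expectation (\<lambda>\<omega>. (sign_form C I (\<lambda>i. \<xi> i \<omega>))\<^sup>2)"
      using L(1) Q(1) by (subst Bochner_Integration.integral_add) auto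
    then show "expectation (\<lambda>\<omega>. 2 * (\<Sum>i\<in>I. l i * \<xi> i \<omega>)\<^sup>2 + 2 * (sign_form C I (\<lambda>i. \<xi> i \<omega>))\<^sup>2)
      \<le> 2 * (\<Sum>i\<in>I. (l i)\<^sup>2 * v i) + 4 * (\<Sum>i\<in>I. \<Sum>j\<in>I. (C i j)\<^sup>2 * v i * v j)"
      using L(2) Q(2) by linarith
  qed
  finally show ?thesis by (simp only: l_def)
qed

end

section \<open>Signed sums of step kernels\<close>

context poisson_pair
begin

lemma count_moments:
  fixes b :: bool
  assumes [measurable]: "A \<in> sets borel"
  defines "X \<equiv> \<lambda>N. real (card (proc b N \<inter> A))"
  shows "integrable P X" "integrable P (\<lambda>N. (X N)\<^sup>2)" "expectation X = measure (L b) A"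
    "expectation (\<lambda>N. (X N)\<^sup>2) = (measure (L b) A)\<^sup>2 + measure (L b) A"
proof -
  interpret L: finite_measure "L b" by (rule finite_L)
  have m [measurable]: "X \<in> borel_measurable P" unfolding X_def by measurable
  have "(\<integral>\<^sup>+N. ennreal (X N) \<partial>P) = ennreal (measure (L b) A)"
    using nn_integral_count_mean[of A b] by (simp add: X_def L.emeasure_eq_measure ennreal_of_nat_eq_real_of_nat)
  then have "integrable P X \<and> expectation X = measure (L b) A"
    by (subst (asm) nn_integral_eq_integrable) (auto simp: X_def)
  then show "integrable P X" "expectation X = measure (L b) A" by auto
  have "(\<integral>\<^sup>+N. ennreal ((X N)\<^sup>2) \<partial>P)
     = (\<integral>\<^sup>+N. of_nat (card (proc b N \<inter> A) * (card (proc b N \<inter> A) - 1)) + of_nat (card (proc b N \<inter> A)) \<partial>P)"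
  proof (intro nn_integral_cong)
    fix N
    have "c * c = c * (c - 1) + c" for c :: nat by (cases c) auto
    then have "(X N)\<^sup>2 = real (card (proc b N \<inter> A) * (card (proc b N \<inter> A) - 1) + card (proc b N \<inter> A))"
      unfolding X_def power2_eq_square of_nat_mult [symmetric] by (rule arg_cong)
    then show "ennreal ((X N)\<^sup>2) = of_nat (card (proc b N \<inter> A) * (card (proc b N \<inter> A) - 1)) + of_nat (card (proc b N \<inter> A))"
      by (simp add: ennreal_of_nat_eq_real_of_nat del: of_nat_mult)
  qed
  also have "\<dots> = emeasure (L b) A * emeasure (L b) A + emeasure (L b) A"
    by (subst nn_integral_add)
       (auto simp: nn_integral_count_mean nn_integral_count_factorial_moment[simplified One_nat_def]
         simp del: of_nat_mult)
  also have "\<dots> = ennreal ((measure (L b) A)\<^sup>2 + measure (L b) A)"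
    by (simp add: L.emeasure_eq_measure ennreal_mult' power2_eq_square)
  finally have "integrable P (\<lambda>N. (X N)\<^sup>2) \<and> expectation (\<lambda>N. (X N)\<^sup>2) = (measure (L b) A)\<^sup>2 + measure (L b) A"
    by (subst (asm) nn_integral_eq_integrable) auto
  then show "integrable P (\<lambda>N. (X N)\<^sup>2)" "expectation (\<lambda>N. (X N)\<^sup>2) = (measure (L b) A)\<^sup>2 + measure (L b) A" by auto
qed

text \<open>
  Within one process the counts are independent because the cells are disjoint, and across the two
  processes because the processes are.
\<close>

lemma indep_counts_cells:
  fixes A :: "nat \<Rightarrow> 'a set" and n :: nat
  assumes A: "\<And>i. A i \<in> sets borel" and dis: "disjoint_family_on A {..<n}" and n: "0 < n"
  shows "indep_vars (\<lambda>_. count_space UNIV) (\<lambda>p N. card (proc (fst p) N \<inter> A (snd p))) (UNIV \<times> {..<n})"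
  unfolding indep_vars_def2
proof (intro conjI ballI)
  let ?I = "(UNIV :: bool set) \<times> {..<n}" and ?X = "\<lambda>p N. card (proc (fst p) N \<inter> A (snd p))"
  show m: "?X p \<in> P \<rightarrow>\<^sub>M count_space UNIV" for p by (rule measurable_count[OF A])
  let ?F = "\<lambda>p. {?X p -` E \<inter> space P | E. E \<in> sets (count_space UNIV)}"
  show "indep_sets ?F ?I"
  proof (subst indep_sets_finite)
    show "?I \<noteq> {}" using n by auto
    show "finite ?I" by (intro finite_cartesian_product) auto
    fix p assume "p \<in> ?I"
    show "?F p \<subseteq> events" using measurable_sets[OF m] by auto
    show "space P \<in> ?F p" by (auto intro!: exI[of _ UNIV])
  next
    show "\<forall>B\<in>Pi ?I ?F. prob (\<Inter>p\<in>?I. B p) = (\<Prod>p\<in>?I. prob (B p))"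
    proof
      fix B assume "B \<in> Pi ?I ?F"
      then have "\<forall>p\<in>?I. \<exists>E. B p = ?X p -` E \<inter> space P" by (auto simp: Pi_iff)
      then obtain E where E: "\<And>p. p \<in> ?I \<Longrightarrow> B p = ?X p -` E p \<inter> space P" by metis
      define D where "D = (\<lambda>b. {S \<in> space config_space. \<forall>i<n. card (S \<inter> A i) \<in> E (b, i)})"
      have D: "D b \<in> sets config_space" for b
        unfolding D_def using A by measurable
      have pm: "proc b N \<in> space config_space" if "N \<in> space P" for b N
        using measurable_space[OF measurable_proc that] .
      have C: "proc b -` D b \<inter> space P = (\<Inter>i\<in>{..<n}. B (b, i))" for b
        using E n pm by (auto simp: D_def)
      have pC: "prob (\<Inter>i\<in>{..<n}. B (b, i)) = (\<Prod>i<n. prob (B (b, i)))" for b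
      proof -
        have "prob (\<Inter>i\<in>{..<n}. (\<lambda>N. card (proc b N \<inter> A i)) -` E (b, i) \<inter> space P)
           = (\<Prod>i<n. prob ((\<lambda>N. card (proc b N \<inter> A i)) -` E (b, i) \<inter> space P))"
          by (rule indep_varsD[OF indep_counts]) (use A dis n in auto)
        then show ?thesis using E n by simp
      qed
      have "(\<Inter>p\<in>?I. B p) = (\<lambda>N. (fst N, snd N)) -` (D True \<times> D False) \<inter> space P"
      proof -
        have "(\<Inter>p\<in>?I. B p) = (\<Inter>b\<in>UNIV. \<Inter>i\<in>{..<n}. B (b, i))" by auto
        also have "\<dots> = (proc False -` D False \<inter> space P) \<inter> (proc True -` D True \<inter> space P)"
          unfolding C UNIV_bool by simp
        finally show ?thesis by (auto simp: proc_def)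
      qed
      then have "prob (\<Inter>p\<in>?I. B p) = prob (fst -` D True \<inter> space P) * prob (snd -` D False \<inter> space P)"
        using indep_varD[OF indep D[of True] D[of False]] by simp
      also have "\<dots> = (\<Prod>i<n. prob (B (True, i))) * (\<Prod>i<n. prob (B (False, i)))"
        using C[of True] C[of False] pC by (simp add: proc_def)
      also have "\<dots> = (\<Prod>b\<in>UNIV. \<Prod>i<n. prob (B (b, i)))" by (simp add: UNIV_bool mult.commute)
      also have "\<dots> = (\<Prod>p\<in>?I. prob (B p))" by (subst prod.cartesian_product) simp
      finally show "prob (\<Inter>p\<in>?I. B p) = (\<Prod>p\<in>?I. prob (B p))" .
    qed
  qed
qed

lemma pair_sum_step:
  fixes \<kappa> :: "'a \<Rightarrow> nat" and k :: "nat \<Rightarrow> nat \<Rightarrow> real"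
  assumes N: "N \<in> space P" and \<kappa>: "\<And>x. \<kappa> x < n" and k: "\<And>i. k i i = 0"
  shows "pair_sum b c (\<lambda>z. k (\<kappa> (fst z)) (\<kappa> (snd z))) N
    = (\<Sum>i<n. \<Sum>j<n. k i j * real (card (proc b N \<inter> \<kappa> -` {i})) * real (card (proc c N \<inter> \<kappa> -` {j})))"
proof -
  let ?P = "point_pairs b c N" and ?g = "\<lambda>z. (\<kappa> (fst z), \<kappa> (snd z))"
  let ?K = "\<lambda>z. k (\<kappa> (fst z)) (\<kappa> (snd z))"
  have "pair_sum b c ?K N = (\<Sum>p\<in>{..<n} \<times> {..<n}. \<Sum>z\<in>{z\<in>?P. ?g z = p}. ?K z)"
    unfolding pair_sum_def using finite_point_pairs[OF N, of b c] \<kappa>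
    by (intro sum.group [symmetric] finite_cartesian_product) auto
  also have "\<dots> = (\<Sum>(i, j)\<in>{..<n} \<times> {..<n}. k i j * real (card (proc b N \<inter> \<kappa> -` {i})) * real (card (proc c N \<inter> \<kappa> -` {j})))"
  proof (intro sum.cong refl, clarify)
    fix i j
    show "(\<Sum>z\<in>{z\<in>?P. ?g z = (i, j)}. ?K z)
       = k i j * real (card (proc b N \<inter> \<kappa> -` {i})) * real (card (proc c N \<inter> \<kappa> -` {j}))"
    proof (cases "i = j")
      case True
      then show ?thesis using k by (auto intro: sum.neutral)
    next
      case False
      then have "{z\<in>?P. ?g z = (i, j)} = (proc b N \<inter> \<kappa> -` {i}) \<times> (proc c N \<inter> \<kappa> -` {j})"
        by (auto simp: point_pairs_def)
      moreover have "(\<Sum>z\<in>{z\<in>?P. ?g z = (i, j)}. ?K z) = (\<Sum>z\<in>{z\<in>?P. ?g z = (i, j)}. k i j)"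
        by (intro sum.cong) auto
      ultimately show ?thesis by (simp add: card_cartesian_product)
    qed
  qed
  finally show ?thesis by (simp add: sum.cartesian_product)
qed

text \<open>
  If the kernel depends only on the cells of its arguments and vanishes when these agree, the signed sum
  is a quadratic form with zero diagonal in the counts of the cells. These are independent, and the
  variance of a Poisson count is its mean; \<open>\<eta>\<close> and \<open>\<mu>\<close> are the signed and the total intensity of
  the cells.
\<close>

lemma signed_sum_step_second_moment:
  fixes \<kappa> :: "'a \<Rightarrow> nat" and k :: "nat \<Rightarrow> nat \<Rightarrow> real"
  assumes \<kappa>: "\<And>x. \<kappa> x < n" and \<kappa>m [measurable]: "\<kappa> \<in> borel \<rightarrow>\<^sub>M count_space UNIV" and k: "\<And>i. k i i = 0"
  defines "\<eta> \<equiv> \<lambda>i. measure (L True) (\<kappa> -` {i}) - measure (L False) (\<kappa> -` {i})"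
    and "\<mu> \<equiv> \<lambda>i. measure (L True) (\<kappa> -` {i}) + measure (L False) (\<kappa> -` {i})"
  shows "(\<integral>\<^sup>+N. ennreal ((signed_sum (\<lambda>z. k (\<kappa> (fst z)) (\<kappa> (snd z))) N - (\<Sum>i<n. \<Sum>j<n. k i j * \<eta> i * \<eta> j))\<^sup>2) \<partial>P)
    \<le> ennreal (2 * (\<Sum>i<n. (\<Sum>j<n. (k i j + k j i) * \<eta> j)\<^sup>2 * \<mu> i) + 4 * (\<Sum>i<n. \<Sum>j<n. (k i j)\<^sup>2 * \<mu> i * \<mu> j))"
proof -
  let ?I = "(UNIV :: bool set) \<times> {..<n}"
  define A where "A = (\<lambda>i. \<kappa> -` {i})"
  define X where "X = (\<lambda>p N. real (card (proc (fst p) N \<inter> A (snd p))))"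
  define e where "e = (\<lambda>p. measure (L (fst p)) (A (snd p)))"
  define C where "C = (\<lambda>p q. sg (fst p) * sg (fst q) * k (snd p) (snd q))"
  have A: "A i \<in> sets borel" for i
  proof -
    have "\<kappa> -` {i} \<inter> space borel \<in> sets borel" by (rule measurable_sets[OF \<kappa>m]) simp
    then show ?thesis by (simp add: A_def)
  qed
  have n: "0 < n" using \<kappa> by (metis less_nat_zero_code neq0_conv)
  have dis: "disjoint_family_on A {..<n}" by (auto simp: disjoint_family_on_def A_def)
  have ind: "indep_vars (\<lambda>_. borel) X ?I"
    unfolding X_def by (rule indep_vars_compose2[OF indep_counts_cells[OF A dis n]]) auto
  have sI: "(\<Sum>p\<in>?I. F p) = (\<Sum>i<n. F (True, i) + F (False, i))" for F :: "bool \<times> nat \<Rightarrow> real"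
    by (subst sum.cartesian_product' , simp add: UNIV_bool sum.distrib)
  have 0: "(\<integral>\<^sup>+N. ennreal (((\<Sum>p\<in>?I. \<Sum>q\<in>?I. C p q * X p N * X q N) - (\<Sum>p\<in>?I. \<Sum>q\<in>?I. C p q * e p * e q))\<^sup>2) \<partial>P)
    \<le> ennreal (2 * (\<Sum>p\<in>?I. (\<Sum>q\<in>?I. (C p q + C q p) * e q)\<^sup>2 * e p)
          + 4 * (\<Sum>p\<in>?I. \<Sum>q\<in>?I. (C p q)\<^sup>2 * e p * e q))"
    by (rule quadratic_form_second_moment_le[OF finite_cartesian_product ind])
       (use count_moments[OF A] in \<open>auto simp: X_def e_def C_def k\<close>)
  have 1: "(\<Sum>p\<in>?I. \<Sum>q\<in>?I. C p q * X p N * X q N) = signed_sum (\<lambda>z. k (\<kappa> (fst z)) (\<kappa> (snd z))) N"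
    if N: "N \<in> space P" for N
    unfolding signed_sum_def pair_sum_step[where k=k and \<kappa>=\<kappa>, OF N \<kappa> k] sI
    by (simp add: UNIV_bool C_def X_def A_def sg_def sum.distrib sum_subtractf sum_negf algebra_simps)
  have 2: "(\<Sum>p\<in>?I. \<Sum>q\<in>?I. C p q * e p * e q) = (\<Sum>i<n. \<Sum>j<n. k i j * \<eta> i * \<eta> j)"
    unfolding sI sum.distrib [symmetric]
    by (intro sum.cong refl) (simp add: C_def e_def A_def sg_def \<eta>_def algebra_simps)
  have 3: "(\<Sum>q\<in>?I. (C p q + C q p) * e q) = sg (fst p) * (\<Sum>j<n. (k (snd p) j + k j (snd p)) * \<eta> j)" for p
    unfolding sI sum_distrib_left
    by (intro sum.cong refl) (simp add: C_def e_def A_def sg_def \<eta>_def algebra_simps)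
  have 4: "(\<Sum>p\<in>?I. (\<Sum>q\<in>?I. (C p q + C q p) * e q)\<^sup>2 * e p) = (\<Sum>i<n. (\<Sum>j<n. (k i j + k j i) * \<eta> j)\<^sup>2 * \<mu> i)"
    unfolding 3 sI
    by (intro sum.cong refl) (simp add: e_def A_def sg_def \<mu>_def algebra_simps)
  have 5: "(\<Sum>p\<in>?I. \<Sum>q\<in>?I. (C p q)\<^sup>2 * e p * e q) = (\<Sum>i<n. \<Sum>j<n. (k i j)\<^sup>2 * \<mu> i * \<mu> j)"
    unfolding sI sum.distrib [symmetric]
    by (intro sum.cong refl) (simp add: C_def e_def A_def sg_def \<mu>_def algebra_simps)
  show ?thesis
    using 0 unfolding 2 4 5 by (simp add: 1 cong: nn_integral_cong)
qed

end

section \<open>Approximation by step kernels\<close>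

text \<open>
  This is the definition of measurability in the theory of the Henstock-Kurzweil integral, which is
  equivalent to Lebesgue measurability.
\<close>

lemma borel_measurable_continuous_approx:
  fixes K :: "'b::euclidean_space \<Rightarrow> real"
  assumes K: "K \<in> borel_measurable borel"
  obtains g where "\<And>n::nat. continuous_on UNIV (g n)" "AE z in lborel. (\<lambda>n. g n z) \<longlonglongrightarrow> K z"
proof -
  have "K \<in> borel_measurable lebesgue" using K by (simp add: measurable_completion)
  then have "K measurable_on UNIV" by (rule lebesgue_measurable_imp_measurable_on) simp
  then obtain N g where N: "negligible N" and g: "\<And>n::nat. continuous_on UNIV (g n)"
    "\<And>z. z \<notin> N \<Longrightarrow> (\<lambda>n. g n z) \<longlonglongrightarrow> K z"
    unfolding measurable_on_def by auto
  have "N \<in> null_sets lebesgue" using N by (simp add: negligible_iff_null_sets)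
  then obtain N' where "N' \<in> null_sets lborel" "N \<subseteq> N'"
    by (auto simp: null_sets_completion_iff2)
  then have "AE z in lborel. z \<notin> N" by (auto dest!: AE_not_in)
  then have "AE z in lborel. (\<lambda>n. g n z) \<longlonglongrightarrow> K z" by eventually_elim (rule g(2))
  with g(1) show ?thesis by (rule that)
qed

locale finite_density =
  fixes l :: "'a::euclidean_space \<Rightarrow> real"
  assumes l_nonneg: "\<And>x. 0 \<le> l x" and l_integrable: "integrable lborel l"
begin

definition Lam :: "'a measure" where "Lam = density lborel (\<lambda>x. ennreal (l x))"

lemma l_measurable [measurable]: "l \<in> borel_measurable borel"
  using borel_measurable_integrable[OF l_integrable] by simp

lemma sets_Lam [measurable_cong, simp]: "sets Lam = sets borel" by (simp add: Lam_def)
lemma space_Lam [simp]: "space Lam = UNIV" by (simp add: Lam_def)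

sublocale Lam: finite_measure Lam
proof
  have "emeasure Lam (space Lam) = (\<integral>\<^sup>+x. ennreal (l x) \<partial>lborel)" by (simp add: Lam_def emeasure_density)
  also have "\<dots> = ennreal (integral\<^sup>L lborel l)"
    using l_nonneg l_integrable by (intro nn_integral_eq_integral) auto
  finally show "emeasure Lam (space Lam) \<noteq> \<infinity>" by simp
qed

sublocale LL: pair_sigma_finite Lam Lam ..

abbreviation "LL \<equiv> Lam \<Otimes>\<^sub>M Lam"

sublocale LL: finite_measure LL
  by (rule finite_measure_pair_measure) unfold_locales

lemma sets_LL [measurable_cong]: "sets LL = sets (borel \<Otimes>\<^sub>M borel)"
  by (intro sets_pair_measure_cong sets_Lam)

lemma space_LL [simp]: "space LL = UNIV" by (simp add: space_pair_measure)

lemma measurable_LL: "f \<in> borel_measurable (borel \<Otimes>\<^sub>M borel) \<Longrightarrow> f \<in> borel_measurable LL"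
  by (subst measurable_cong_sets[OF sets_LL refl])

lemma LL_density: "LL = density lborel (\<lambda>z. ennreal (l (fst z)) * ennreal (l (snd z)))"
proof -
  have "LL = density (lborel \<Otimes>\<^sub>M lborel) (\<lambda>(x, y). ennreal (l x) * ennreal (l y))"
    unfolding Lam_def
    by (rule pair_measure_density) (auto intro: sigma_finite_lborel Lam.sigma_finite_measure_axioms[unfolded Lam_def])
  then show ?thesis by (simp add: lborel_prod case_prod_unfold)
qed

lemma AE_LL: "(AE z in lborel. Q z) \<Longrightarrow> AE z in LL. Q z"
proof -
  assume Q: "AE z in lborel. Q z"
  have "(\<lambda>z. ennreal (l (fst z)) * ennreal (l (snd z))) \<in> borel_measurable (borel \<Otimes>\<^sub>M borel)" by measurable
  then have "(\<lambda>z. ennreal (l (fst z)) * ennreal (l (snd z))) \<in> borel_measurable lborel" by (simp add: borel_prod)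
  then show ?thesis unfolding LL_density using Q by (subst AE_density) (auto elim: AE_mp)
qed

lemma AE_LL_off_diagonal: "AE z in LL. fst z \<noteq> snd z"
proof (subst AE_iff_measurable)
  let ?D = "{z. fst z = (snd z :: 'a)}"
  have "closed ?D" by (intro closed_Collect_eq continuous_intros)
  then have D: "?D \<in> sets (borel \<Otimes>\<^sub>M borel)" unfolding borel_prod by (rule borel_closed)
  then show "?D \<in> sets LL" by (simp only: sets_LL)
  have "emeasure Lam {x} = 0" for x
    by (simp add: Lam_def emeasure_density nn_integral_0_iff_AE AE_lborel_singleton)
  moreover have "Pair x -` ?D = {x}" for x by auto
  ultimately show "emeasure LL ?D = 0"
    using D by (subst Lam.emeasure_pair_measure_alt) (auto simp: sets_LL)
qed auto

definition step_kernel :: "('a \<Rightarrow> nat) \<Rightarrow> (nat \<Rightarrow> nat \<Rightarrow> real) \<Rightarrow> 'a \<times> 'a \<Rightarrow> real" where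
  "step_kernel \<kappa> k z = k (\<kappa> (fst z)) (\<kappa> (snd z))"

lemma simple_function_eq_step:
  assumes q: "simple_function borel (q :: 'a \<Rightarrow> 'a)"
  shows "\<exists>n (\<kappa> :: 'a \<Rightarrow> nat) r. (\<forall>x. \<kappa> x < n) \<and> \<kappa> \<in> borel \<rightarrow>\<^sub>M count_space UNIV \<and>
    (\<forall>x. r (\<kappa> x) = q x) \<and> (\<forall>x y. \<kappa> x = \<kappa> y \<longleftrightarrow> q x = q y)"
proof -
  have "finite (range q)" using simple_functionD(1)[OF q] by simp
  then obtain h :: "'a \<Rightarrow> nat" where h: "bij_betw h (range q) {0..<card (range q)}"
    using ex_bij_betw_finite_nat by blast
  have inj: "inj_on h (range q)" using h by (rule bij_betw_imp_inj_on)
  define \<kappa> where "\<kappa> = (\<lambda>x. h (q x))"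
  show ?thesis
  proof (intro exI[of _ "card (range q)"] exI[of _ \<kappa>] exI[of _ "the_inv_into (range q) h"] conjI allI)
    show "\<kappa> x < card (range q)" for x using h by (auto simp: \<kappa>_def bij_betw_def)
    show "the_inv_into (range q) h (\<kappa> x) = q x" for x
      unfolding \<kappa>_def using inj by (rule the_inv_into_f_f) simp
    show "\<kappa> x = \<kappa> y \<longleftrightarrow> q x = q y" for x y using inj by (auto simp: \<kappa>_def inj_on_def)
    have "simple_function borel \<kappa>" unfolding \<kappa>_def using simple_function_compose[OF q, of h] by (simp add: comp_def)
    then show "\<kappa> \<in> borel \<rightarrow>\<^sub>M count_space UNIV" by (rule measurable_simple_function)
  qed
qed

lemma L2_limit_le:
  fixes u :: "nat \<Rightarrow> 'a \<times> 'a \<Rightarrow> real"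
  assumes [measurable]: "\<And>j. u j \<in> borel_measurable (borel \<Otimes>\<^sub>M borel)" "v \<in> borel_measurable (borel \<Otimes>\<^sub>M borel)"
    "w \<in> borel_measurable (borel \<Otimes>\<^sub>M borel)"
    and lim: "AE z in LL. (\<lambda>j. u j z) \<longlonglongrightarrow> v z"
    and dom: "\<And>j. AE z in LL. \<bar>v z - u j z\<bar> \<le> w z"
    and fin: "(\<integral>\<^sup>+z. ennreal ((w z)\<^sup>2) \<partial>LL) < \<infinity>" and "0 < \<epsilon>"
  shows "\<exists>j. (\<integral>\<^sup>+z. ennreal ((v z - u j z)\<^sup>2) \<partial>LL) \<le> ennreal \<epsilon>"
proof (rule L2_limit_exists[OF L2_dominated_limit[OF _ _ _ lim dom fin] \<open>0 < \<epsilon>\<close>])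
  show "u j \<in> borel_measurable LL" "v \<in> borel_measurable LL" "w \<in> borel_measurable LL" for j
    by (rule measurable_LL, measurable)+
qed

lemma measurable_step_kernel:
  assumes [measurable]: "\<kappa> \<in> borel \<rightarrow>\<^sub>M count_space UNIV"
  shows "step_kernel \<kappa> k \<in> borel_measurable (borel \<Otimes>\<^sub>M borel)"
  unfolding step_kernel_def by measurable

text \<open>
  The kernel is truncated, the truncation is approximated almost everywhere by continuous functions, and
  the arguments of a continuous function are discretised by simple functions that converge to the
  identity. Dominated convergence applies each time. Setting the discretised kernel to 0 on the diagonal
  blocks does not disturb the limit, because a point off the diagonal leaves these blocks eventually and
  the diagonal is a null set.
\<close>

lemma step_kernel_dense:
  assumes K [measurable]: "K \<in> borel_measurable (borel \<Otimes>\<^sub>M borel)"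
    and fin: "(\<integral>\<^sup>+z. ennreal ((K z)\<^sup>2) \<partial>LL) < \<infinity>" and \<epsilon>: "0 < \<epsilon>"
  shows "\<exists>n \<kappa> k. (\<forall>x. \<kappa> x < (n::nat)) \<and> \<kappa> \<in> borel \<rightarrow>\<^sub>M count_space UNIV \<and> (\<forall>i. k i i = 0) \<and>
    (\<integral>\<^sup>+z. ennreal ((K z - step_kernel \<kappa> k z)\<^sup>2) \<partial>LL) \<le> ennreal \<epsilon>"
proof -
  define cl where "cl = (\<lambda>(B::real) t. max (- B) (min B t))"
  have cl_bound: "\<bar>cl B t\<bar> \<le> B" if "0 \<le> B" for B t using that by (auto simp: cl_def)
  have cont_cl: "continuous_on UNIV (cl B)" for B unfolding cl_def by (intro continuous_intros)
  have cl_meas [measurable]: "cl B \<in> borel_measurable borel" for B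
    by (rule borel_measurable_continuous_onI[OF cont_cl])
  have fin_const: "(\<integral>\<^sup>+z. ennreal (c\<^sup>2) \<partial>LL) < \<infinity>" for c :: real
  proof -
    have "emeasure LL UNIV < top" using LL.emeasure_finite[of UNIV] by (simp add: less_top [symmetric])
    then show ?thesis by (simp add: ennreal_mult_less_top)
  qed
  (* Three approximation errors, each entering with the factor 3 of
     (a + b + c)^2 \<le> 3 (a^2 + b^2 + c^2). *)
  have \<epsilon>9: "0 < \<epsilon> / 9" using \<epsilon> by simp
  have "\<exists>B. (\<integral>\<^sup>+z. ennreal ((K z - cl (real B) (K z))\<^sup>2) \<partial>LL) \<le> ennreal (\<epsilon> / 9)"
  proof (rule L2_limit_le[of "\<lambda>j z. cl (real j) (K z)" K "\<lambda>z. \<bar>K z\<bar>" "\<epsilon> / 9"])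
    show "AE z in LL. (\<lambda>j. cl (real j) (K z)) \<longlonglongrightarrow> K z"
    proof (rule AE_I2)
      fix z
      obtain m :: nat where "\<bar>K z\<bar> \<le> real m" using real_arch_simple by blast
      then have "cl (real j) (K z) = K z" if "m \<le> j" for j using that by (auto simp: cl_def)
      then show "(\<lambda>j. cl (real j) (K z)) \<longlonglongrightarrow> K z"
        by (intro tendsto_eventually) (auto simp: eventually_sequentially)
    qed
    show "AE z in LL. \<bar>K z - cl (real j) (K z)\<bar> \<le> \<bar>K z\<bar>" for j
      by (intro AE_I2) (auto simp: cl_def)
    show "(\<integral>\<^sup>+z. ennreal (\<bar>K z\<bar>\<^sup>2) \<partial>LL) < \<infinity>" using fin by simp
  qed (measurable, rule \<epsilon>9)
  then obtain B where B: "(\<integral>\<^sup>+z. ennreal ((K z - cl (real B) (K z))\<^sup>2) \<partial>LL) \<le> ennreal (\<epsilon> / 9)" ..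
  define KB where "KB = (\<lambda>z. cl (real B) (K z))"
  have KB [measurable]: "KB \<in> borel_measurable (borel \<Otimes>\<^sub>M borel)" unfolding KB_def by measurable
  then have "KB \<in> borel_measurable borel" by (simp add: borel_prod)
  then obtain g where g: "\<And>n::nat. continuous_on UNIV (g n)" "AE z in lborel. (\<lambda>n. g n z) \<longlonglongrightarrow> KB z"
    using borel_measurable_continuous_approx[of KB] by blast
  have cg: "continuous_on UNIV (\<lambda>z. cl (real B) (g n z))" for n
    by (rule continuous_on_compose2[OF cont_cl g(1)]) auto
  have cgm [measurable]: "(\<lambda>z. cl (real B) (g n z)) \<in> borel_measurable (borel \<Otimes>\<^sub>M borel)" for n
    using borel_measurable_continuous_onI[OF cg] by (simp add: borel_prod)
  have clcl: "cl (real B) (KB z) = KB z" for z by (auto simp: KB_def cl_def)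
  have "\<exists>N. (\<integral>\<^sup>+z. ennreal ((KB z - cl (real B) (g N z))\<^sup>2) \<partial>LL) \<le> ennreal (\<epsilon> / 9)"
  proof (rule L2_limit_le[of "\<lambda>j z. cl (real B) (g j z)" KB "\<lambda>z. 2 * real B" "\<epsilon> / 9"])
    show "AE z in LL. (\<lambda>j. cl (real B) (g j z)) \<longlonglongrightarrow> KB z"
      using AE_LL[OF g(2)]
    proof eventually_elim
      case (elim z)
      have "isCont (cl (real B)) (KB z)" using cont_cl by (simp add: continuous_on_eq_continuous_at)
      from isCont_tendsto_compose[OF this elim] show ?case by (simp add: clcl)
    qed
    show "AE z in LL. \<bar>KB z - cl (real B) (g j z)\<bar> \<le> 2 * real B" for j
    proof (rule AE_I2)
      fix z
      have "\<bar>KB z\<bar> \<le> real B" "\<bar>cl (real B) (g j z)\<bar> \<le> real B" unfolding KB_def by (rule cl_bound, simp)+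
      then show "\<bar>KB z - cl (real B) (g j z)\<bar> \<le> 2 * real B" by linarith
    qed
    show "(\<integral>\<^sup>+z. ennreal ((2 * real B)\<^sup>2) \<partial>LL) < \<infinity>" by (rule fin_const)
  qed (rule cgm KB borel_measurable_const \<epsilon>9)+
  then obtain N where N: "(\<integral>\<^sup>+z. ennreal ((KB z - cl (real B) (g N z))\<^sup>2) \<partial>LL) \<le> ennreal (\<epsilon> / 9)" ..
  define G where "G = (\<lambda>z. cl (real B) (g N z))"
  have G_bound: "\<bar>G z\<bar> \<le> real B" for z unfolding G_def by (rule cl_bound) simp
  obtain q where q: "\<And>i. simple_function borel (q i)" "\<And>x::'a. (\<lambda>i. q i x) \<longlonglongrightarrow> x"
    using borel_measurable_implies_sequence_metric[of "\<lambda>x::'a. x" borel 0] by auto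
  define Q where "Q = (\<lambda>i z. if q i (fst z) = q i (snd z) then 0 else G (q i (fst z), q i (snd z)))"
  have step: "\<exists>n \<kappa> k. (\<forall>x. \<kappa> x < (n::nat)) \<and> \<kappa> \<in> borel \<rightarrow>\<^sub>M count_space UNIV \<and> (\<forall>i. k i i = 0) \<and> Q i = step_kernel \<kappa> k" for i
  proof -
    obtain n and \<kappa> :: "'a \<Rightarrow> nat" and r where *: "\<forall>x. \<kappa> x < n" "\<kappa> \<in> borel \<rightarrow>\<^sub>M count_space UNIV" "\<forall>x. r (\<kappa> x) = q i x"
      "\<forall>x y. \<kappa> x = \<kappa> y \<longleftrightarrow> q i x = q i y"
      using simple_function_eq_step[OF q(1)[of i]] by blast
    define k where "k = (\<lambda>a b. if a = b then 0 else G (r a, r b))"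
    have "Q i = step_kernel \<kappa> k" by (auto simp: fun_eq_iff Q_def step_kernel_def k_def *)
    moreover have "\<forall>i. k i i = 0" by (simp add: k_def)
    ultimately show ?thesis using *(1,2) by blast
  qed
  have Qm: "Q i \<in> borel_measurable (borel \<Otimes>\<^sub>M borel)" for i
    using step[of i] measurable_step_kernel by auto
  have Gm: "G \<in> borel_measurable (borel \<Otimes>\<^sub>M borel)" unfolding G_def by (rule cgm)
  have "\<exists>i. (\<integral>\<^sup>+z. ennreal ((G z - Q i z)\<^sup>2) \<partial>LL) \<le> ennreal (\<epsilon> / 9)"
  proof (rule L2_limit_le[of Q G "\<lambda>z. 2 * real B" "\<epsilon> / 9"])
    show "AE z in LL. (\<lambda>j. Q j z) \<longlonglongrightarrow> G z"
      using AE_LL_off_diagonal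
    proof eventually_elim
      case (elim z)
      have t: "(\<lambda>j. (q j (fst z), q j (snd z))) \<longlonglongrightarrow> (fst z, snd z)" by (intro tendsto_Pair q)
      have "isCont G z" using cg[of N] unfolding G_def continuous_on_eq_continuous_at[OF open_UNIV] by blast
      then have "(\<lambda>j. G (q j (fst z), q j (snd z))) \<longlonglongrightarrow> G z"
        using isCont_tendsto_compose[of "(fst z, snd z)" G, OF _ t] by simp
      moreover have "eventually (\<lambda>j. q j (fst z) \<noteq> q j (snd z)) sequentially"
      proof -
        have "(\<lambda>j. dist (q j (fst z)) (q j (snd z))) \<longlonglongrightarrow> dist (fst z) (snd z)" by (intro tendsto_dist q)
        moreover have "0 < dist (fst z) (snd z)" using elim by simp
        ultimately have "eventually (\<lambda>j. 0 < dist (q j (fst z)) (q j (snd z))) sequentially"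
          by (rule order_tendstoD)
        then show ?thesis by eventually_elim auto
      qed
      ultimately show ?case
        by (elim Lim_transform_eventually) (auto elim!: eventually_mono simp: Q_def)
    qed
    show "AE z in LL. \<bar>G z - Q j z\<bar> \<le> 2 * real B" for j
    proof (rule AE_I2)
      fix z
      have "\<bar>Q j z\<bar> \<le> real B" using G_bound by (auto simp: Q_def)
      then show "\<bar>G z - Q j z\<bar> \<le> 2 * real B" using G_bound[of z] by linarith
    qed
    show "(\<integral>\<^sup>+z. ennreal ((2 * real B)\<^sup>2) \<partial>LL) < \<infinity>" by (rule fin_const)
  qed (rule Qm Gm borel_measurable_const \<epsilon>9)+
  then obtain i where i: "(\<integral>\<^sup>+z. ennreal ((G z - Q i z)\<^sup>2) \<partial>LL) \<le> ennreal (\<epsilon> / 9)" ..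
  have "(\<integral>\<^sup>+z. ennreal ((K z - Q i z)\<^sup>2) \<partial>LL)
     \<le> (\<integral>\<^sup>+z. 3 * ennreal ((K z - KB z)\<^sup>2) + (3 * ennreal ((KB z - G z)\<^sup>2) + 3 * ennreal ((G z - Q i z)\<^sup>2)) \<partial>LL)"
  proof (intro nn_integral_mono)
    fix z
    have "(a + b + c)\<^sup>2 \<le> 3 * a\<^sup>2 + (3 * b\<^sup>2 + 3 * c\<^sup>2)" for a b c :: real
      using zero_le_power2[of "a - b"] zero_le_power2[of "a - c"] zero_le_power2[of "b - c"]
      by (simp add: power2_eq_square algebra_simps)
    from this[of "K z - KB z" "KB z - G z" "G z - Q i z"]
    have "ennreal ((K z - Q i z)\<^sup>2) \<le> ennreal (3 * (K z - KB z)\<^sup>2 + (3 * (KB z - G z)\<^sup>2 + 3 * (G z - Q i z)\<^sup>2))"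
      by (intro ennreal_leI) simp
    also have "\<dots> = 3 * ennreal ((K z - KB z)\<^sup>2) + (3 * ennreal ((KB z - G z)\<^sup>2) + 3 * ennreal ((G z - Q i z)\<^sup>2))"
      by (simp add: ennreal_mult')
    finally show "ennreal ((K z - Q i z)\<^sup>2) \<le> 3 * ennreal ((K z - KB z)\<^sup>2) + (3 * ennreal ((KB z - G z)\<^sup>2) + 3 * ennreal ((G z - Q i z)\<^sup>2))" .
  qed
  also have "\<dots> = 3 * (\<integral>\<^sup>+z. ennreal ((K z - KB z)\<^sup>2) \<partial>LL)
     + (3 * (\<integral>\<^sup>+z. ennreal ((KB z - G z)\<^sup>2) \<partial>LL) + 3 * (\<integral>\<^sup>+z. ennreal ((G z - Q i z)\<^sup>2) \<partial>LL))"
  proof -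
    have [measurable]: "K \<in> borel_measurable LL" "KB \<in> borel_measurable LL" "G \<in> borel_measurable LL" "Q i \<in> borel_measurable LL"
      using K KB Gm Qm[of i] by (auto intro: measurable_LL)
    show ?thesis by (simp add: nn_integral_add nn_integral_cmult)
  qed
  also have "\<dots> \<le> 3 * ennreal (\<epsilon> / 9) + (3 * ennreal (\<epsilon> / 9) + 3 * ennreal (\<epsilon> / 9))"
  proof -
    have "(\<integral>\<^sup>+z. ennreal ((K z - KB z)\<^sup>2) \<partial>LL) \<le> ennreal (\<epsilon> / 9)" using B by (simp only: KB_def)
    moreover have "(\<integral>\<^sup>+z. ennreal ((KB z - G z)\<^sup>2) \<partial>LL) \<le> ennreal (\<epsilon> / 9)" using N by (simp only: G_def)
    ultimately show ?thesis using i by (intro add_mono mult_left_mono) simp_all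
  qed
  also have "\<dots> = ennreal \<epsilon>"
  proof -
    have "3 * ennreal (\<epsilon> / 9) = ennreal (\<epsilon> / 3)"
      using \<epsilon> by (subst ennreal_numeral [symmetric], subst ennreal_mult [symmetric]) auto
    moreover have "ennreal (\<epsilon> / 3) + (ennreal (\<epsilon> / 3) + ennreal (\<epsilon> / 3)) = ennreal (\<epsilon> / 3 + (\<epsilon> / 3 + \<epsilon> / 3))"
      using \<epsilon> by (simp flip: ennreal_plus)
    moreover have "\<epsilon> / 3 + (\<epsilon> / 3 + \<epsilon> / 3) = \<epsilon>" by simp
    ultimately show ?thesis by (simp only:)
  qed
  finally have "(\<integral>\<^sup>+z. ennreal ((K z - Q i z)\<^sup>2) \<partial>LL) \<le> ennreal \<epsilon>" .
  moreover obtain n \<kappa> k where "\<forall>x. \<kappa> x < (n::nat)" "\<kappa> \<in> borel \<rightarrow>\<^sub>M count_space UNIV" "\<forall>i. k i i = 0" "Q i = step_kernel \<kappa> k"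
    using step[of i] by blast
  ultimately show ?thesis by (intro exI[of _ n] exI[of _ \<kappa>] exI[of _ k]) simp
qed

end

section \<open>Mean and linear part of a signed sum\<close>

text \<open>
  Both intensities are expressed by their sum \<open>Lam\<close>: the measure with density \<open>\<theta>\<close> with respect to
  \<open>Lam\<close> is the difference of the two intensities.
\<close>

locale signed_poisson_pair = poisson_pair P L + finite_density l
  for P :: "('a::euclidean_space set \<times> 'a set) measure" and L :: "bool \<Rightarrow> 'a measure" and l :: "'a \<Rightarrow> real" +
  fixes \<theta> :: "'a \<Rightarrow> real"
  assumes theta_measurable [measurable]: "\<theta> \<in> borel_measurable borel"
    and theta_bound: "\<And>x. \<bar>\<theta> x\<bar> \<le> 1"
    and L_eq: "\<And>b. L b = density Lam (\<lambda>x. ennreal ((1 + sg b * \<theta> x) / 2))"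
begin

lemma sg_theta: "0 \<le> (1 + sg b * \<theta> x) / 2"
  using theta_bound[of x] by (cases b) (auto simp: sg_def)

lemma nn_integral_L:
  assumes [measurable]: "F \<in> borel_measurable borel"
  shows "(\<integral>\<^sup>+x. F x \<partial>L b) = (\<integral>\<^sup>+x. ennreal ((1 + sg b * \<theta> x) / 2) * F x \<partial>Lam)"
  unfolding L_eq by (subst nn_integral_density) (auto cong: measurable_cong_sets)

lemma nn_integral_L_sum:
  assumes [measurable]: "F \<in> borel_measurable borel"
  shows "(\<Sum>b\<in>UNIV. \<integral>\<^sup>+x. F x \<partial>L b) = (\<integral>\<^sup>+x. F x \<partial>Lam)"
proof -
  have "(\<Sum>b\<in>UNIV. \<integral>\<^sup>+x. F x \<partial>L b) = (\<integral>\<^sup>+x. (\<Sum>b\<in>UNIV. ennreal ((1 + sg b * \<theta> x) / 2) * F x) \<partial>Lam)"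
    unfolding nn_integral_L[OF assms] by (subst nn_integral_sum) (auto cong: measurable_cong_sets)
  also have "\<dots> = (\<integral>\<^sup>+x. F x \<partial>Lam)"
  proof (intro nn_integral_cong)
    fix x
    have "(\<Sum>b\<in>UNIV. ennreal ((1 + sg b * \<theta> x) / 2) * F x) = (\<Sum>b\<in>UNIV. ennreal ((1 + sg b * \<theta> x) / 2)) * F x"
      by (rule sum_distrib_right [symmetric])
    also have "(\<Sum>b\<in>UNIV. ennreal ((1 + sg b * \<theta> x) / 2)) = ennreal (\<Sum>b\<in>UNIV. (1 + sg b * \<theta> x) / 2)"
      by (rule sum_ennreal) (rule sg_theta)
    also have "(\<Sum>b\<in>UNIV. (1 + sg b * \<theta> x) / 2) = 1" by (simp add: UNIV_bool sg_def add_divide_distrib [symmetric])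
    finally show "(\<Sum>b\<in>UNIV. ennreal ((1 + sg b * \<theta> x) / 2) * F x) = F x" by simp
  qed
  finally show ?thesis .
qed

lemma nn_integral_LL_sum:
  assumes \<phi> [measurable]: "\<phi> \<in> borel_measurable (borel \<Otimes>\<^sub>M borel)"
  shows "(\<Sum>b\<in>UNIV. \<Sum>c\<in>UNIV. \<integral>\<^sup>+z. \<phi> z \<partial>(L b \<Otimes>\<^sub>M L c)) = (\<integral>\<^sup>+z. \<phi> z \<partial>LL)"
proof -
  have sf: "sigma_finite_measure (L c)" for c
    using finite_L[of c] by (rule finite_measure.sigma_finite_measure)
  have m: "(\<lambda>x. \<integral>\<^sup>+y. \<phi> (x, y) \<partial>L c) \<in> borel_measurable borel" for c
  proof -
    interpret sigma_finite_measure "L c" by (rule sf)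
    have "(\<lambda>x. \<integral>\<^sup>+y. \<phi> (x, y) \<partial>L c) \<in> borel_measurable (borel :: 'a measure)"
      by (intro borel_measurable_nn_integral_fst) (use \<phi> in \<open>simp cong: measurable_cong_sets sets_pair_measure_cong add: sets_L\<close>)
    then show ?thesis .
  qed
  have "(\<Sum>b\<in>UNIV. \<Sum>c\<in>UNIV. \<integral>\<^sup>+z. \<phi> z \<partial>(L b \<Otimes>\<^sub>M L c)) = (\<Sum>b\<in>UNIV. \<Sum>c\<in>UNIV. \<integral>\<^sup>+x. \<integral>\<^sup>+y. \<phi> (x, y) \<partial>L c \<partial>L b)"
    by (intro sum.cong refl sigma_finite_measure.nn_integral_fst [symmetric] sf borel_measurable_pair_L \<phi>)
  also have "\<dots> = (\<Sum>b\<in>UNIV. \<integral>\<^sup>+x. (\<Sum>c\<in>UNIV. \<integral>\<^sup>+y. \<phi> (x, y) \<partial>L c) \<partial>L b)"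
    by (subst nn_integral_sum) (use m in \<open>auto cong: measurable_cong_sets simp: sets_L\<close>)
  also have "\<dots> = (\<Sum>b\<in>UNIV. \<integral>\<^sup>+x. (\<integral>\<^sup>+y. \<phi> (x, y) \<partial>Lam) \<partial>L b)"
    by (subst nn_integral_L_sum) auto
  also have "\<dots> = (\<integral>\<^sup>+x. (\<integral>\<^sup>+y. \<phi> (x, y) \<partial>Lam) \<partial>Lam)"
  proof (rule nn_integral_L_sum)
    show "(\<lambda>x. \<integral>\<^sup>+y. \<phi> (x, y) \<partial>Lam) \<in> borel_measurable borel"
      by (intro Lam.borel_measurable_nn_integral_fst) (use \<phi> in \<open>simp cong: measurable_cong_sets sets_pair_measure_cong\<close>)
  qed
  also have "\<dots> = (\<integral>\<^sup>+z. \<phi> z \<partial>LL)" by (intro Lam.nn_integral_fst measurable_LL \<phi>)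
  finally show ?thesis .
qed

lemma nn_integral_pair_sums:
  assumes [measurable]: "K \<in> borel_measurable (borel \<Otimes>\<^sub>M borel)" and "\<And>z. 0 \<le> K z"
  shows "(\<integral>\<^sup>+N. ennreal (\<Sum>b\<in>UNIV. \<Sum>c\<in>UNIV. pair_sum b c K N) \<partial>P) = (\<integral>\<^sup>+z. ennreal (K z) \<partial>LL)"
proof -
  have nn: "0 \<le> pair_sum b c K N" for b c N unfolding pair_sum_def using assms by (intro sum_nonneg) auto
  have "(\<integral>\<^sup>+N. ennreal (\<Sum>b\<in>UNIV. \<Sum>c\<in>UNIV. pair_sum b c K N) \<partial>P)
    = (\<integral>\<^sup>+N. (\<Sum>b\<in>UNIV. \<Sum>c\<in>UNIV. ennreal (pair_sum b c K N)) \<partial>P)"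
    using nn by (simp add: sum_nonneg)
  also have "\<dots> = (\<Sum>b\<in>UNIV. \<Sum>c\<in>UNIV. \<integral>\<^sup>+N. ennreal (pair_sum b c K N) \<partial>P)"
    by (simp add: nn_integral_sum)
  also have "\<dots> = (\<integral>\<^sup>+z. ennreal (K z) \<partial>LL)"
    using assms by (simp add: nn_integral_pair_sum nn_integral_LL_sum)
  finally show ?thesis .
qed

text \<open>
  The expected number of coincidences is the mass of the diagonal under the product of the intensities,
  which is 0.
\<close>

lemma AE_disjoint: "AE N in P. fst N \<inter> snd N = {}"
proof -
  let ?D = "{z. fst z = (snd z :: 'a)}"
  have "closed ?D" by (intro closed_Collect_eq continuous_intros)
  then have [measurable]: "?D \<in> sets (borel \<Otimes>\<^sub>M borel)" unfolding borel_prod by (rule borel_closed)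
  have "(\<integral>\<^sup>+N. ennreal (\<Sum>b\<in>UNIV. \<Sum>c\<in>UNIV. pair_sum b c (indicator ?D) N) \<partial>P) = (\<integral>\<^sup>+z. ennreal (indicator ?D z) \<partial>LL)"
    by (rule nn_integral_pair_sums) auto
  also have "\<dots> = 0"
    using AE_LL_off_diagonal by (subst nn_integral_0_iff_AE) (auto intro!: measurable_LL simp: ennreal_indicator elim!: AE_mp)
  finally have "AE N in P. ennreal (\<Sum>b\<in>UNIV. \<Sum>c\<in>UNIV. pair_sum b c (indicator ?D) N) = 0"
    by (subst (asm) nn_integral_0_iff_AE) auto
  moreover have "AE N in P. N \<in> space P" by (rule AE_space)
  ultimately show ?thesis
  proof eventually_elim
    case (elim N)
    have nn: "0 \<le> pair_sum b c (indicator ?D) N" for b c unfolding pair_sum_def by (intro sum_nonneg) auto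
    have "pair_sum True False (indicator ?D) N \<le> (\<Sum>b\<in>UNIV. \<Sum>c\<in>UNIV. pair_sum b c (indicator ?D) N)"
      using nn by (simp add: UNIV_bool)
    also have "\<dots> \<le> 0" using elim(1) by (simp only: ennreal_eq_0_iff)
    finally have "pair_sum True False (indicator ?D) N = 0" using nn[of True False] by simp
    then have "\<forall>z\<in>point_pairs True False N. indicator ?D z = (0::real)"
      unfolding pair_sum_def using finite_point_pairs[OF elim(2)]
      by (subst (asm) sum_nonneg_eq_0_iff) auto
    then have "(x, x) \<notin> point_pairs True False N" for x by auto
    then show ?case by (auto simp: point_pairs_def proc_def)
  qed
qed

text \<open>
  The expectation of \<open>signed_sum K\<close>.
\<close>

definition mean_form :: "('a \<times> 'a \<Rightarrow> real) \<Rightarrow> real" where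
  "mean_form K = (LINT z|LL. K z * \<theta> (fst z) * \<theta> (snd z))"

text \<open>
  The function whose integral against the centred signed point measure is the linear term in Hoeffding's
  decomposition of \<open>signed_sum K\<close>.
\<close>

definition linear_part :: "('a \<times> 'a \<Rightarrow> real) \<Rightarrow> 'a \<Rightarrow> real" where
  "linear_part K x = (LINT y|Lam. (K (x, y) + K (y, x)) * \<theta> y)"

lemma cell_integral:
  fixes F :: "nat \<Rightarrow> real"
  assumes \<kappa>: "\<And>x. \<kappa> x < n" and [measurable]: "\<kappa> \<in> borel \<rightarrow>\<^sub>M count_space UNIV"
    and g: "integrable Lam g"
  shows "integrable Lam (\<lambda>x. F (\<kappa> x) * g x)"
    and "(LINT x|Lam. F (\<kappa> x) * g x) = (\<Sum>i<n. F i * (LINT x|Lam. indicator (\<kappa> -` {i}) x * g x))"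
proof -
  have A: "\<kappa> -` {i} \<in> sets Lam" for i
    using measurable_sets[of \<kappa> borel "count_space UNIV" "{i}"] by simp
  have eq: "F (\<kappa> x) * g x = (\<Sum>i<n. F i * (indicator (\<kappa> -` {i}) x * g x))" for x
  proof -
    have "(\<Sum>i<n. F i * (indicator (\<kappa> -` {i}) x * g x)) = (\<Sum>i<n. if i = \<kappa> x then F i * g x else 0)"
      by (intro sum.cong) (auto simp: indicator_def)
    then show ?thesis using \<kappa> by simp
  qed
  have int: "integrable Lam (\<lambda>x. indicator (\<kappa> -` {i}) x * g x)" for i
    using integrable_mult_indicator[OF A g] by simp
  show "integrable Lam (\<lambda>x. F (\<kappa> x) * g x)"
    unfolding eq by (intro Bochner_Integration.integrable_sum integrable_mult_right int)
  show "(LINT x|Lam. F (\<kappa> x) * g x) = (\<Sum>i<n. F i * (LINT x|Lam. indicator (\<kappa> -` {i}) x * g x))"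
    unfolding eq using int by (simp add: Bochner_Integration.integral_sum)
qed

lemma cell_double_integral:
  fixes k :: "nat \<Rightarrow> nat \<Rightarrow> real"
  assumes \<kappa>: "\<And>x. \<kappa> x < n" and [measurable]: "\<kappa> \<in> borel \<rightarrow>\<^sub>M count_space UNIV"
    and g [measurable]: "g \<in> borel_measurable borel" and gb: "\<And>x. \<bar>g x\<bar> \<le> 1"
  defines "\<gamma> \<equiv> \<lambda>i. LINT x|Lam. indicator (\<kappa> -` {i}) x * g x"
  shows "(LINT z|LL. k (\<kappa> (fst z)) (\<kappa> (snd z)) * g (fst z) * g (snd z)) = (\<Sum>i<n. \<Sum>j<n. k i j * \<gamma> i * \<gamma> j)"
    and "integrable LL (\<lambda>z. k (\<kappa> (fst z)) (\<kappa> (snd z)) * g (fst z) * g (snd z))"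
proof -
  have gi: "integrable Lam g"
    by (rule Lam.integrable_const_bound[of _ 1]) (use gb in auto)
  let ?f = "\<lambda>z. k (\<kappa> (fst z)) (\<kappa> (snd z)) * g (fst z) * g (snd z)"
  define B where "B = (\<Sum>i<n. \<Sum>j<n. \<bar>k i j\<bar>)"
  have B: "\<bar>k (\<kappa> x) (\<kappa> y)\<bar> \<le> B" for x y
  proof -
    have "\<bar>k (\<kappa> x) (\<kappa> y)\<bar> \<le> (\<Sum>j<n. \<bar>k (\<kappa> x) j\<bar>)" using \<kappa> by (intro member_le_sum) auto
    also have "\<dots> \<le> B" unfolding B_def using \<kappa> by (intro member_le_sum[of "\<kappa> x" _ "\<lambda>i. \<Sum>j<n. \<bar>k i j\<bar>"]) (auto intro: sum_nonneg)
    finally show ?thesis .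
  qed
  have meas: "?f \<in> borel_measurable LL" by (rule measurable_LL) measurable
  show int: "integrable LL ?f"
  proof (rule LL.integrable_const_bound[of _ B])
    show "AE z in LL. norm (?f z) \<le> B"
    proof (rule AE_I2)
      fix z
      have "\<bar>k (\<kappa> (fst z)) (\<kappa> (snd z))\<bar> * \<bar>g (fst z)\<bar> * \<bar>g (snd z)\<bar> \<le> B * 1 * 1"
        using B gb order_trans[OF abs_ge_zero B] by (intro mult_mono) auto
      then show "norm (?f z) \<le> B" by (simp add: abs_mult)
    qed
  qed (rule meas)
  have "(LINT z|LL. ?f z) = (LINT x|Lam. LINT y|Lam. k (\<kappa> x) (\<kappa> y) * g x * g y)"
    using LL.integral_fst'[OF int] by simp
  also have "\<dots> = (LINT x|Lam. (\<Sum>j<n. k (\<kappa> x) j * \<gamma> j) * g x)"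
  proof (intro Bochner_Integration.integral_cong refl)
    fix x
    have "(LINT y|Lam. k (\<kappa> x) (\<kappa> y) * g x * g y) = g x * (LINT y|Lam. k (\<kappa> x) (\<kappa> y) * g y)"
      by (subst integral_mult_right_zero [symmetric]) (simp add: mult_ac)
    also have "(LINT y|Lam. k (\<kappa> x) (\<kappa> y) * g y) = (\<Sum>j<n. k (\<kappa> x) j * \<gamma> j)"
      unfolding \<gamma>_def by (rule cell_integral(2)[OF \<kappa> _ gi]) measurable
    finally show "(LINT y|Lam. k (\<kappa> x) (\<kappa> y) * g x * g y) = (\<Sum>j<n. k (\<kappa> x) j * \<gamma> j) * g x" by simp
  qed
  also have "\<dots> = (\<Sum>i<n. (\<Sum>j<n. k i j * \<gamma> j) * \<gamma> i)"
    unfolding \<gamma>_def by (rule cell_integral(2)[where F="\<lambda>i. \<Sum>j<n. k i j * (LINT x|Lam. indicator (\<kappa> -` {j}) x * g x)", OF \<kappa> _ gi]) measurable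
  also have "\<dots> = (\<Sum>i<n. \<Sum>j<n. k i j * \<gamma> i * \<gamma> j)"
    unfolding sum_distrib_right by (intro sum.cong refl) simp
  finally show "(LINT z|LL. ?f z) = (\<Sum>i<n. \<Sum>j<n. k i j * \<gamma> i * \<gamma> j)" .
qed

lemma measure_L:
  assumes [measurable]: "A \<in> sets borel"
  shows "measure (L b) A = (LINT x|Lam. indicator A x * ((1 + sg b * \<theta> x) / 2))"
proof -
  have int: "integrable Lam (\<lambda>x. indicator A x * ((1 + sg b * \<theta> x) / 2))"
  proof (rule Lam.integrable_const_bound[of _ 1])
    show "AE x in Lam. norm (indicator A x * ((1 + sg b * \<theta> x) / 2)) \<le> 1"
    proof (rule AE_I2)
      fix x
      show "norm (indicator A x * ((1 + sg b * \<theta> x) / 2)) \<le> 1"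
        using theta_bound[of x] sg_theta[of b x] by (cases b) (auto simp: indicator_def sg_def)
    qed
  qed measurable
  have "emeasure (L b) A = (\<integral>\<^sup>+x. ennreal (indicator A x * ((1 + sg b * \<theta> x) / 2)) \<partial>Lam)"
    unfolding L_eq by (subst emeasure_density) (auto intro!: nn_integral_cong simp: indicator_def)
  also have "\<dots> = ennreal (LINT x|Lam. indicator A x * ((1 + sg b * \<theta> x) / 2))"
    using sg_theta by (intro nn_integral_eq_integral int) auto
  finally show ?thesis
    using sg_theta by (simp add: measure_def integral_nonneg_AE)
qed

text \<open>
  The variance bound for step kernels in terms of integrals alone, a form that is stable under
  approximation of the kernel.
\<close>

lemma step_second_moment:
  assumes \<kappa>: "\<And>x. \<kappa> x < n" and \<kappa>m [measurable]: "\<kappa> \<in> borel \<rightarrow>\<^sub>M count_space UNIV" and k: "\<And>i. k i i = 0"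
  defines "K \<equiv> step_kernel \<kappa> k"
  shows "(\<integral>\<^sup>+N. ennreal ((signed_sum K N - mean_form K)\<^sup>2) \<partial>P)
    \<le> 2 * (\<integral>\<^sup>+x. ennreal ((linear_part K x)\<^sup>2) \<partial>Lam) + 4 * (\<integral>\<^sup>+z. ennreal ((K z)\<^sup>2) \<partial>LL)"
proof -
  let ?A = "\<lambda>i. \<kappa> -` {i}"
  have A: "?A i \<in> sets borel" for i
    using measurable_sets[OF \<kappa>m, of "{i}"] by simp
  define \<eta> where "\<eta> = (\<lambda>i. LINT x|Lam. indicator (?A i) x * \<theta> x)"
  define \<mu> where "\<mu> = (\<lambda>i. LINT x|Lam. indicator (?A i) x * (1::real))"
  have ti: "integrable Lam \<theta>"
    by (rule Lam.integrable_const_bound[of _ 1]) (use theta_bound in auto)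
  have i1: "integrable Lam (\<lambda>x. indicator (?A i) x * \<theta> x)" "integrable Lam (\<lambda>x. indicator (?A i) x * (1::real))" for i
    using integrable_mult_indicator[OF _ ti, of "?A i"] integrable_mult_indicator[OF _ Lam.integrable_const[of "1::real"], of "?A i"] A
    by simp_all
  have mL: "measure (L b) (?A i) = (\<mu> i + sg b * \<eta> i) / 2" for b i
  proof -
    have "measure (L b) (?A i) = (LINT x|Lam. (indicator (?A i) x * 1 + sg b * (indicator (?A i) x * \<theta> x)) / 2)"
      unfolding measure_L[OF A] by (intro Bochner_Integration.integral_cong refl) (simp add: algebra_simps)
    also have "\<dots> = (\<mu> i + sg b * \<eta> i) / 2"
      unfolding \<mu>_def \<eta>_def using i1[of i] by (simp del: mult_1_right)
    finally show ?thesis .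
  qed
  have \<eta>': "measure (L True) (?A i) - measure (L False) (?A i) = \<eta> i"
    and \<mu>': "measure (L True) (?A i) + measure (L False) (?A i) = \<mu> i" for i
    unfolding mL by (simp_all add: sg_def field_simps)
  have mean: "mean_form K = (\<Sum>i<n. \<Sum>j<n. k i j * \<eta> i * \<eta> j)"
    unfolding mean_form_def K_def step_kernel_def \<eta>_def
    by (rule cell_double_integral(1)[OF \<kappa> \<kappa>m theta_measurable theta_bound])
  have lin: "linear_part K x = (\<Sum>j<n. (k (\<kappa> x) j + k j (\<kappa> x)) * \<eta> j)" for x
    unfolding linear_part_def K_def step_kernel_def \<eta>_def fst_conv snd_conv
    by (rule cell_integral(2)[OF \<kappa> \<kappa>m ti, of "\<lambda>j. k (\<kappa> x) j + k j (\<kappa> x)"])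
  let ?w = "\<lambda>i. (\<Sum>j<n. (k i j + k j i) * \<eta> j)\<^sup>2"
  note c = cell_integral[OF \<kappa> \<kappa>m Lam.integrable_const[of "1::real"], of ?w]
  have W: "(\<integral>\<^sup>+x. ennreal ((linear_part K x)\<^sup>2) \<partial>Lam) = ennreal (\<Sum>i<n. ?w i * \<mu> i)"
    unfolding lin using c by (subst nn_integral_eq_integral) (auto simp: \<mu>_def)
  note d = cell_double_integral[OF \<kappa> \<kappa>m, of "\<lambda>_. 1" "\<lambda>i j. (k i j)\<^sup>2"]
  have S: "(\<integral>\<^sup>+z. ennreal ((K z)\<^sup>2) \<partial>LL) = ennreal (\<Sum>i<n. \<Sum>j<n. (k i j)\<^sup>2 * \<mu> i * \<mu> j)"
    unfolding K_def step_kernel_def using d by (subst nn_integral_eq_integral) (auto simp: \<mu>_def)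
  have "(\<integral>\<^sup>+N. ennreal ((signed_sum K N - mean_form K)\<^sup>2) \<partial>P)
    \<le> ennreal (2 * (\<Sum>i<n. ?w i * \<mu> i) + 4 * (\<Sum>i<n. \<Sum>j<n. (k i j)\<^sup>2 * \<mu> i * \<mu> j))"
    using signed_sum_step_second_moment[where \<kappa>=\<kappa> and k=k, OF \<kappa> \<kappa>m k]
    unfolding \<eta>' \<mu>' mean unfolding K_def step_kernel_def .
  also have "\<dots> = 2 * ennreal (\<Sum>i<n. ?w i * \<mu> i) + 4 * ennreal (\<Sum>i<n. \<Sum>j<n. (k i j)\<^sup>2 * \<mu> i * \<mu> j)"
  proof -
    have "0 \<le> \<mu> i" for i unfolding \<mu>'[symmetric] by simp
    then show ?thesis by (simp add: ennreal_mult' ennreal_plus sum_nonneg)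
  qed
  finally show ?thesis unfolding W S .
qed

end

section \<open>Deviation of a signed sum from its mean\<close>

lemma ennreal_le_sqrt_of_square_le:
  assumes "x\<^sup>2 \<le> ennreal c" "0 \<le> c"
  shows "x \<le> ennreal (sqrt c)"
proof (cases x)
  case (real r)
  then have "ennreal (r\<^sup>2) \<le> ennreal c" using assms by (simp add: ennreal_power)
  then have "r\<^sup>2 \<le> c" using assms by (simp add: ennreal_le_iff)
  then show ?thesis using real by (auto intro!: ennreal_leI real_le_rsqrt)
next
  case top
  then show ?thesis using assms by (simp add: top_unique power2_eq_square ennreal_mult_top)
qed

lemma (in finite_measure) nn_integral_square_le:
  assumes [measurable]: "g \<in> borel_measurable M"
  shows "(\<integral>\<^sup>+x. g x \<partial>M)\<^sup>2 \<le> (\<integral>\<^sup>+x. (g x)\<^sup>2 \<partial>M) * ennreal (measure M (space M))"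
  using Cauchy_Schwarz_nn_integral[of g M "\<lambda>_. 1"] by (simp add: emeasure_eq_measure)

lemma (in finite_measure) integrable_of_square:
  fixes g :: "'a \<Rightarrow> real"
  assumes [measurable]: "g \<in> borel_measurable M" and fin: "(\<integral>\<^sup>+x. ennreal ((g x)\<^sup>2) \<partial>M) < \<infinity>"
  shows "integrable M g"
proof (rule square_integrable_imp_integrable)
  show "integrable M (\<lambda>x. (g x)\<^sup>2)" by (rule integrableI_bounded) (use fin in auto)
qed simp

context signed_poisson_pair
begin

text \<open>
  By Cauchy-Schwarz for the finite measure \<open>Lam\<close>, the linear part depends continuously on the kernel in
  \<open>L\<^sup>2\<close>.
\<close>

lemma linear_part_perturbation:
  assumes K [measurable]: "K \<in> borel_measurable (borel \<Otimes>\<^sub>M borel)" and D [measurable]: "D \<in> borel_measurable (borel \<Otimes>\<^sub>M borel)"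
    and Kfin: "(\<integral>\<^sup>+z. ennreal ((K z)\<^sup>2) \<partial>LL) < \<infinity>" and Dfin: "(\<integral>\<^sup>+z. ennreal ((D z)\<^sup>2) \<partial>LL) < \<infinity>"
  shows "(\<integral>\<^sup>+x. ennreal ((linear_part (\<lambda>z. K z - D z) x)\<^sup>2) \<partial>Lam)
    \<le> 2 * (\<integral>\<^sup>+x. ennreal ((linear_part K x)\<^sup>2) \<partial>Lam) + 8 * ennreal (measure Lam UNIV) * (\<integral>\<^sup>+z. ennreal ((D z)\<^sup>2) \<partial>LL)"
proof -
  define R where "R = (\<lambda>x. \<integral>\<^sup>+y. ennreal (\<bar>D (x, y)\<bar> + \<bar>D (y, x)\<bar>) \<partial>Lam)"
  have Ki: "integrable LL K" using K Kfin by (intro LL.integrable_of_square measurable_LL)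
  have Di: "integrable LL D" using D Dfin by (intro LL.integrable_of_square measurable_LL)
  have slices: "AE x in Lam. integrable Lam (\<lambda>y. F (x, y)) \<and> integrable Lam (\<lambda>y. F (y, x))"
    if "integrable LL F" for F :: "'a \<times> 'a \<Rightarrow> real"
    using LL.AE_integrable_fst'[OF that] LL.AE_integrable_fst'[OF LL.integrable_product_swap[OF that]] by auto
  have sw [measurable]: "(\<lambda>z. D (snd z, fst z)) \<in> borel_measurable (borel \<Otimes>\<^sub>M borel)" by measurable
  have lm: "linear_part F \<in> borel_measurable Lam" if [measurable]: "F \<in> borel_measurable (borel \<Otimes>\<^sub>M borel)" for F
  proof -
    have "(\<lambda>(x, y). (F (x, y) + F (y, x)) * \<theta> y) \<in> borel_measurable (borel \<Otimes>\<^sub>M borel)" by measurable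
    then have "(\<lambda>(x, y). (F (x, y) + F (y, x)) * \<theta> y) \<in> borel_measurable LL" by (rule measurable_LL)
    then show ?thesis unfolding linear_part_def[abs_def] by (rule Lam.borel_measurable_lebesgue_integral)
  qed
  have Rm [measurable]: "R \<in> borel_measurable Lam"
  proof -
    have "(\<lambda>z. ennreal (\<bar>D z\<bar> + \<bar>D (snd z, fst z)\<bar>)) \<in> borel_measurable LL" by (rule measurable_LL) measurable
    from Lam.borel_measurable_nn_integral_fst[OF this] show ?thesis by (simp add: R_def)
  qed
  have "(\<integral>\<^sup>+x. ennreal ((linear_part (\<lambda>z. K z - D z) x)\<^sup>2) \<partial>Lam)
     \<le> (\<integral>\<^sup>+x. 2 * ennreal ((linear_part K x)\<^sup>2) + 2 * (R x)\<^sup>2 \<partial>Lam)"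
  proof (rule nn_integral_mono_AE)
    show "AE x in Lam. ennreal ((linear_part (\<lambda>z. K z - D z) x)\<^sup>2) \<le> 2 * ennreal ((linear_part K x)\<^sup>2) + 2 * (R x)\<^sup>2"
      using slices[OF Ki] slices[OF Di]
    proof eventually_elim
      case (elim x)
      have th: "integrable Lam (\<lambda>y. g y * \<theta> y)" if "integrable Lam g" for g :: "'a \<Rightarrow> real"
      proof (rule Bochner_Integration.integrable_bound[OF that])
        show "AE y in Lam. norm (g y * \<theta> y) \<le> norm (g y)"
          using theta_bound by (intro AE_I2) (simp add: abs_mult mult_left_le)
      qed (use borel_measurable_integrable[OF that] in measurable)
      let ?g = "\<lambda>y. (D (x, y) + D (y, x)) * \<theta> y"
      have gi: "integrable Lam ?g" using elim by (intro th) auto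
      have "linear_part (\<lambda>z. K z - D z) x = (LINT y|Lam. (K (x, y) + K (y, x)) * \<theta> y - ?g y)"
        unfolding linear_part_def by (intro Bochner_Integration.integral_cong) (auto simp: algebra_simps)
      also have "\<dots> = linear_part K x - (LINT y|Lam. ?g y)"
        unfolding linear_part_def using elim gi by (subst Bochner_Integration.integral_diff) (auto intro!: th)
      finally have e: "linear_part (\<lambda>z. K z - D z) x = linear_part K x - (LINT y|Lam. ?g y)" .
      have "ennreal \<bar>LINT y|Lam. ?g y\<bar> \<le> (\<integral>\<^sup>+y. ennreal \<bar>?g y\<bar> \<partial>Lam)"
        using integral_norm_bound_ennreal[OF gi] by simp
      also have "\<dots> \<le> R x" unfolding R_def
      proof (intro nn_integral_mono ennreal_leI)
        fix y
        have "\<bar>?g y\<bar> \<le> \<bar>D (x, y) + D (y, x)\<bar>"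
          using theta_bound[of y] by (simp add: abs_mult mult_left_le)
        then show "\<bar>?g y\<bar> \<le> \<bar>D (x, y)\<bar> + \<bar>D (y, x)\<bar>" by linarith
      qed
      finally have "(ennreal \<bar>LINT y|Lam. ?g y\<bar>)\<^sup>2 \<le> (R x)\<^sup>2" by (intro power_mono) auto
      then have r: "ennreal ((LINT y|Lam. ?g y)\<^sup>2) \<le> (R x)\<^sup>2" by (simp add: ennreal_power)
      have "(a - b)\<^sup>2 \<le> 2 * a\<^sup>2 + 2 * b\<^sup>2" for a b :: real
        using zero_le_power2[of "a + b"] unfolding power2_sum power2_diff by linarith
      then have "ennreal ((linear_part (\<lambda>z. K z - D z) x)\<^sup>2)
          \<le> ennreal (2 * (linear_part K x)\<^sup>2 + 2 * (LINT y|Lam. ?g y)\<^sup>2)"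
        unfolding e by (rule ennreal_leI)
      also have "\<dots> = 2 * ennreal ((linear_part K x)\<^sup>2) + 2 * ennreal ((LINT y|Lam. ?g y)\<^sup>2)"
        by (simp add: ennreal_mult')
      also have "\<dots> \<le> 2 * ennreal ((linear_part K x)\<^sup>2) + 2 * (R x)\<^sup>2"
        by (intro add_left_mono mult_left_mono r) simp
      finally show ?case .
    qed
  qed
  also have "\<dots> = 2 * (\<integral>\<^sup>+x. ennreal ((linear_part K x)\<^sup>2) \<partial>Lam) + 2 * (\<integral>\<^sup>+x. (R x)\<^sup>2 \<partial>Lam)"
    using lm[OF K] by (simp add: nn_integral_add nn_integral_cmult)
  also have "(\<integral>\<^sup>+x. (R x)\<^sup>2 \<partial>Lam) \<le> 4 * ennreal (measure Lam UNIV) * (\<integral>\<^sup>+z. ennreal ((D z)\<^sup>2) \<partial>LL)"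
  proof -
    let ?h = "\<lambda>z. ennreal ((\<bar>D z\<bar> + \<bar>D (snd z, fst z)\<bar>)\<^sup>2)"
    have hm: "?h \<in> borel_measurable LL" by (rule measurable_LL) measurable
    have "(R x)\<^sup>2 \<le> (\<integral>\<^sup>+y. ?h (x, y) \<partial>Lam) * ennreal (measure Lam UNIV)" for x
    proof -
      have "(\<lambda>y. D (x, y)) \<in> borel_measurable borel" "(\<lambda>y. D (y, x)) \<in> borel_measurable borel" by measurable
      then have "(\<lambda>y. ennreal (\<bar>D (x, y)\<bar> + \<bar>D (y, x)\<bar>)) \<in> borel_measurable Lam" by measurable
      from Lam.nn_integral_square_le[OF this] show ?thesis by (simp add: R_def ennreal_power del: ennreal_plus)
    qed
    then have "(\<integral>\<^sup>+x. (R x)\<^sup>2 \<partial>Lam) \<le> (\<integral>\<^sup>+x. (\<integral>\<^sup>+y. ?h (x, y) \<partial>Lam) * ennreal (measure Lam UNIV) \<partial>Lam)"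
      by (intro nn_integral_mono)
    also have "\<dots> = (\<integral>\<^sup>+x. (\<integral>\<^sup>+y. ?h (x, y) \<partial>Lam) \<partial>Lam) * ennreal (measure Lam UNIV)"
      by (rule nn_integral_multc) (rule Lam.borel_measurable_nn_integral_fst[OF hm])
    also have "(\<integral>\<^sup>+x. (\<integral>\<^sup>+y. ?h (x, y) \<partial>Lam) \<partial>Lam) = (\<integral>\<^sup>+z. ?h z \<partial>LL)"
      by (rule Lam.nn_integral_fst[OF hm])
    finally have R1: "(\<integral>\<^sup>+x. (R x)\<^sup>2 \<partial>Lam) \<le> (\<integral>\<^sup>+z. ?h z \<partial>LL) * ennreal (measure Lam UNIV)" .
    have "(\<integral>\<^sup>+z. ?h z \<partial>LL) \<le> (\<integral>\<^sup>+z. 2 * ennreal ((D z)\<^sup>2) + 2 * ennreal ((D (snd z, fst z))\<^sup>2) \<partial>LL)"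
    proof (intro nn_integral_mono)
      fix z
      have "(\<bar>a\<bar> + \<bar>b\<bar>)\<^sup>2 \<le> 2 * a\<^sup>2 + 2 * b\<^sup>2" for a b :: real
        using zero_le_power2[of "\<bar>a\<bar> - \<bar>b\<bar>"] unfolding power2_sum power2_diff by simp
      then have "?h z \<le> ennreal (2 * (D z)\<^sup>2 + 2 * (D (snd z, fst z))\<^sup>2)" by (rule ennreal_leI)
      then show "?h z \<le> 2 * ennreal ((D z)\<^sup>2) + 2 * ennreal ((D (snd z, fst z))\<^sup>2)" by (simp add: ennreal_mult')
    qed
    also have "\<dots> = 2 * (\<integral>\<^sup>+z. ennreal ((D z)\<^sup>2) \<partial>LL) + 2 * (\<integral>\<^sup>+z. ennreal ((D (snd z, fst z))\<^sup>2) \<partial>LL)"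
    proof -
      have [measurable]: "D \<in> borel_measurable LL" "(\<lambda>z. D (snd z, fst z)) \<in> borel_measurable LL"
        by (rule measurable_LL, measurable)+
      show ?thesis by (simp add: nn_integral_add nn_integral_cmult)
    qed
    also have "(\<integral>\<^sup>+z. ennreal ((D (snd z, fst z))\<^sup>2) \<partial>LL) = (\<integral>\<^sup>+z. ennreal ((D z)\<^sup>2) \<partial>LL)"
    proof -
      have Dm: "(\<lambda>z. ennreal ((D z)\<^sup>2)) \<in> borel_measurable LL" "(\<lambda>z. ennreal ((D (snd z, fst z))\<^sup>2)) \<in> borel_measurable LL"
        by (rule measurable_LL, measurable)+
      show ?thesis
        using LL.nn_integral_snd[OF Dm(1)] Lam.nn_integral_fst[OF Dm(2)] by simp
    qed
    finally have "(\<integral>\<^sup>+x. (R x)\<^sup>2 \<partial>Lam)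
       \<le> (2 * (\<integral>\<^sup>+z. ennreal ((D z)\<^sup>2) \<partial>LL) + 2 * (\<integral>\<^sup>+z. ennreal ((D z)\<^sup>2) \<partial>LL)) * ennreal (measure Lam UNIV)"
      by (intro order_trans[OF R1] mult_right_mono) simp_all
    moreover have "(2 * I + 2 * I) * c = 4 * c * I" for I c :: ennreal
    proof -
      have "2 * I + 2 * I = (2 + 2) * I" by (rule distrib_right [symmetric])
      also have "(2 + 2 :: ennreal) = 4" by simp
      finally show ?thesis by (simp only: mult_ac)
    qed
    ultimately show ?thesis by simp
  qed
  finally have "(\<integral>\<^sup>+x. ennreal ((linear_part (\<lambda>z. K z - D z) x)\<^sup>2) \<partial>Lam)
    \<le> 2 * (\<integral>\<^sup>+x. ennreal ((linear_part K x)\<^sup>2) \<partial>Lam)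
      + 2 * (4 * ennreal (measure Lam UNIV) * (\<integral>\<^sup>+z. ennreal ((D z)\<^sup>2) \<partial>LL))"
    by (simp add: add_left_mono mult_left_mono)
  moreover have "2 * (4 * c * I) = 8 * c * I" for c I :: ennreal
  proof -
    have "2 * (4 * c * I) = (2 * 4) * c * I" by (simp only: mult.assoc)
    also have "(2 * 4 :: ennreal) = 8" by simp
    finally show ?thesis .
  qed
  ultimately show ?thesis by simp
qed

lemma mean_form_perturbation:
  assumes K: "integrable LL K" and K': "integrable LL K'"
  shows "ennreal \<bar>mean_form K - mean_form K'\<bar> \<le> (\<integral>\<^sup>+z. ennreal \<bar>K z - K' z\<bar> \<partial>LL)"
proof -
  let ?t = "\<lambda>z. \<theta> (fst z) * \<theta> (snd z)"
  have tb: "\<bar>?t z\<bar> \<le> 1" for z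
    using theta_bound[of "fst z"] theta_bound[of "snd z"] by (simp add: abs_mult mult_le_one)
  have tm: "?t \<in> borel_measurable LL" by (rule measurable_LL) measurable
  have th: "integrable LL (\<lambda>z. g z * ?t z)" if "integrable LL g" for g :: "'a \<times> 'a \<Rightarrow> real"
  proof (rule Bochner_Integration.integrable_bound[OF that])
    show "AE z in LL. norm (g z * ?t z) \<le> norm (g z)"
    proof (rule AE_I2)
      fix z show "norm (g z * ?t z) \<le> norm (g z)"
        using mult_left_mono[OF tb[of z], of "\<bar>g z\<bar>"] by (simp add: abs_mult)
    qed
    show "(\<lambda>z. g z * ?t z) \<in> borel_measurable LL"
      using borel_measurable_integrable[OF that] tm by (rule borel_measurable_times)
  qed
  have "mean_form K - mean_form K' = (LINT z|LL. (K z - K' z) * ?t z)"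
    unfolding mean_form_def using th[OF K] th[OF K']
    by (subst Bochner_Integration.integral_diff [symmetric]) (auto simp: algebra_simps)
  then have "ennreal \<bar>mean_form K - mean_form K'\<bar> \<le> (\<integral>\<^sup>+z. ennreal (norm ((K z - K' z) * ?t z)) \<partial>LL)"
    using integral_norm_bound_ennreal[OF th[OF Bochner_Integration.integrable_diff[OF K K']]] by simp
  also have "\<dots> \<le> (\<integral>\<^sup>+z. ennreal \<bar>K z - K' z\<bar> \<partial>LL)"
  proof (intro nn_integral_mono ennreal_leI)
    fix z show "norm ((K z - K' z) * ?t z) \<le> \<bar>K z - K' z\<bar>"
      using mult_left_mono[OF tb[of z], of "\<bar>K z - K' z\<bar>"] by (simp add: abs_mult)
  qed
  finally show ?thesis .
qed

text \<open>
  Chebyshev's inequality for a general square-integrable kernel \<open>K\<close>. A step kernel \<open>K'\<close> close to \<open>K\<close>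
  obeys the variance bound, with \<open>w\<close> and \<open>s\<close> doubled and a small error added. Campbell's formula
  bounds the expectation of \<open>\<bar>signed_sum K - signed_sum K'\<bar>\<close> by the \<open>L\<^sup>1\<close> distance of the kernels,
  which is small since the intensities are finite. The deviation \<open>3 * a\<close> is divided evenly among the
  fluctuation of \<open>K'\<close>, the difference of the sums and the difference of the means.
\<close>

lemma signed_sum_tail:
  assumes K [measurable]: "K \<in> borel_measurable (borel \<Otimes>\<^sub>M borel)"
    and s: "(\<integral>\<^sup>+z. ennreal ((K z)\<^sup>2) \<partial>LL) \<le> ennreal s" "0 \<le> s"
    and w: "(\<integral>\<^sup>+x. ennreal ((linear_part K x)\<^sup>2) \<partial>Lam) \<le> ennreal w" "0 \<le> w"
    and a: "0 < a"
  shows "prob {N \<in> space P. 3 * a \<le> \<bar>signed_sum K N - mean_form K\<bar>} \<le> (4 * w + 8 * s) / a\<^sup>2"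
proof -
  define m where "m = measure LL UNIV" define M1 where "M1 = measure Lam UNIV"
  have m0: "0 \<le> m" "0 \<le> M1" by (simp_all add: m_def M1_def)
  (* The bound that results from a step kernel at squared L2 distance at most \<epsilon>. *)
  define bnd where "bnd = (\<lambda>\<epsilon>. (4 * w + 8 * s + (16 * M1 + 8) * \<epsilon>) / a\<^sup>2 + sqrt (\<epsilon> * m) / a)"
  have Kfin: "(\<integral>\<^sup>+z. ennreal ((K z)\<^sup>2) \<partial>LL) < \<infinity>" using s by (simp add: le_less_trans less_top)
  have Ki: "integrable LL K" using K Kfin by (intro LL.integrable_of_square measurable_LL)
  let ?E = "{N \<in> space P. 3 * a \<le> \<bar>signed_sum K N - mean_form K\<bar>}"
  have main: "prob ?E \<le> bnd \<epsilon>" if \<epsilon>: "0 < \<epsilon>" and small: "sqrt (\<epsilon> * m) < a" for \<epsilon>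
  proof -
    obtain n \<kappa> k where \<kappa>': "\<forall>x. \<kappa> x < (n::nat)" and \<kappa>m [measurable]: "\<kappa> \<in> borel \<rightarrow>\<^sub>M count_space UNIV"
      and k': "\<forall>i. k i i = 0" and app: "(\<integral>\<^sup>+z. ennreal ((K z - step_kernel \<kappa> k z)\<^sup>2) \<partial>LL) \<le> ennreal \<epsilon>"
      using step_kernel_dense[OF K Kfin \<epsilon>] by (elim exE conjE) (rule that)
    have \<kappa>: "\<kappa> x < n" for x using \<kappa>' by blast
    have k: "k i i = 0" for i using k' by blast
    define K' where "K' = step_kernel \<kappa> k"
    have K'm [measurable]: "K' \<in> borel_measurable (borel \<Otimes>\<^sub>M borel)"
      unfolding K'_def by (rule measurable_step_kernel[OF \<kappa>m])
    define D where "D = (\<lambda>z. K z - K' z)"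
    have Dm [measurable]: "D \<in> borel_measurable (borel \<Otimes>\<^sub>M borel)" unfolding D_def by measurable
    have D\<epsilon>: "(\<integral>\<^sup>+z. ennreal ((D z)\<^sup>2) \<partial>LL) \<le> ennreal \<epsilon>" using app by (simp add: D_def K'_def)
    have Dfin: "(\<integral>\<^sup>+z. ennreal ((D z)\<^sup>2) \<partial>LL) < \<infinity>" using D\<epsilon> by (simp add: le_less_trans less_top)
    have Di: "integrable LL D" using Dm Dfin by (intro LL.integrable_of_square measurable_LL)
    have K'D: "K' z = K z - D z" for z by (simp add: D_def)
    have K'i: "integrable LL K'" unfolding K'D[abs_def] using Ki Di by simp
    have LLm [measurable]: "K \<in> borel_measurable LL" "D \<in> borel_measurable LL" "K' \<in> borel_measurable LL"
      by (rule measurable_LL, measurable)+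
    have D1: "(\<integral>\<^sup>+z. ennreal \<bar>D z\<bar> \<partial>LL) \<le> ennreal (sqrt (\<epsilon> * m))"
    proof (rule ennreal_le_sqrt_of_square_le)
      have "(\<integral>\<^sup>+z. ennreal \<bar>D z\<bar> \<partial>LL)\<^sup>2 \<le> (\<integral>\<^sup>+z. (ennreal \<bar>D z\<bar>)\<^sup>2 \<partial>LL) * ennreal m"
        unfolding m_def space_LL[symmetric] by (rule LL.nn_integral_square_le) measurable
      also have "\<dots> \<le> ennreal \<epsilon> * ennreal m"
        using D\<epsilon> by (intro mult_right_mono) (simp_all add: ennreal_power)
      finally show "(\<integral>\<^sup>+z. ennreal \<bar>D z\<bar> \<partial>LL)\<^sup>2 \<le> ennreal (\<epsilon> * m)" using \<epsilon> m0 by (simp add: ennreal_mult')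
    qed (use \<epsilon> m0 in auto)
    have mean: "\<bar>mean_form K - mean_form K'\<bar> < a"
    proof -
      have "ennreal \<bar>mean_form K - mean_form K'\<bar> \<le> ennreal (sqrt (\<epsilon> * m))"
        using order_trans[OF mean_form_perturbation[OF Ki K'i]] D1 by (simp add: D_def)
      then show ?thesis using small \<epsilon> m0 by (simp add: ennreal_le_iff)
    qed
    let ?T = "\<lambda>N. signed_sum K N - signed_sum K' N"
    let ?U = "\<lambda>N. signed_sum K' N - mean_form K'"
    have E1: "prob {N \<in> space P. a \<le> \<bar>?T N\<bar>} \<le> sqrt (\<epsilon> * m) / a"
    proof -
      have "(\<integral>\<^sup>+N. ennreal \<bar>?T N\<bar> \<partial>P) \<le> (\<integral>\<^sup>+N. ennreal (\<Sum>b\<in>UNIV. \<Sum>c\<in>UNIV. pair_sum b c (\<lambda>z. \<bar>K z - K' z\<bar>) N) \<partial>P)"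
        by (intro nn_integral_mono ennreal_leI abs_signed_sum_diff_le)
      also have "\<dots> = (\<integral>\<^sup>+z. ennreal \<bar>D z\<bar> \<partial>LL)"
        unfolding D_def by (rule nn_integral_pair_sums) auto
      finally have I: "(\<integral>\<^sup>+N. ennreal \<bar>?T N\<bar> \<partial>P) \<le> ennreal (sqrt (\<epsilon> * m))" using D1 by (rule order_trans)
      have "emeasure P {N \<in> space P. a \<le> \<bar>?T N\<bar>} = emeasure P {N \<in> space P. 1 \<le> ennreal (1 / a) * ennreal \<bar>?T N\<bar>}"
        using a by (intro arg_cong[where f="emeasure P"]) (auto simp: ennreal_mult' [symmetric] le_divide_eq)
      also have "\<dots> \<le> ennreal (1 / a) * (\<integral>\<^sup>+N. ennreal \<bar>?T N\<bar> * indicator (space P) N \<partial>P)"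
        using nn_integral_Markov_inequality[of "\<lambda>N. ennreal \<bar>?T N\<bar>" "space P" P "ennreal (1 / a)"]
        by simp
      also have "(\<integral>\<^sup>+N. ennreal \<bar>?T N\<bar> * indicator (space P) N \<partial>P) = (\<integral>\<^sup>+N. ennreal \<bar>?T N\<bar> \<partial>P)"
        by (intro nn_integral_cong) simp
      also have "ennreal (1 / a) * \<dots> \<le> ennreal (1 / a) * ennreal (sqrt (\<epsilon> * m))"
        by (intro mult_left_mono I) simp
      also have "\<dots> = ennreal (sqrt (\<epsilon> * m) / a)" using a by (simp add: ennreal_mult' [symmetric])
      finally show ?thesis using a \<epsilon> m0 by (simp add: emeasure_eq_measure)
    qed
    have "2 * (\<integral>\<^sup>+x. ennreal ((linear_part K' x)\<^sup>2) \<partial>Lam) \<le> 2 * (2 * ennreal w + 8 * ennreal M1 * ennreal \<epsilon>)"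
    proof (rule mult_left_mono)
      have "(\<integral>\<^sup>+x. ennreal ((linear_part K' x)\<^sup>2) \<partial>Lam)
        \<le> 2 * (\<integral>\<^sup>+x. ennreal ((linear_part K x)\<^sup>2) \<partial>Lam) + 8 * ennreal M1 * (\<integral>\<^sup>+z. ennreal ((D z)\<^sup>2) \<partial>LL)"
        using linear_part_perturbation[OF K Dm Kfin Dfin] unfolding M1_def K'D[abs_def] .
      also have "\<dots> \<le> 2 * ennreal w + 8 * ennreal M1 * ennreal \<epsilon>"
        using w D\<epsilon> by (intro add_mono mult_left_mono) auto
      finally show "(\<integral>\<^sup>+x. ennreal ((linear_part K' x)\<^sup>2) \<partial>Lam) \<le> 2 * ennreal w + 8 * ennreal M1 * ennreal \<epsilon>" .
    qed simp
    moreover have "4 * (\<integral>\<^sup>+z. ennreal ((K' z)\<^sup>2) \<partial>LL) \<le> 4 * (2 * ennreal s + 2 * ennreal \<epsilon>)"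
    proof (rule mult_left_mono)
      have "(\<integral>\<^sup>+z. ennreal ((K' z)\<^sup>2) \<partial>LL) \<le> (\<integral>\<^sup>+z. 2 * ennreal ((K z)\<^sup>2) + 2 * ennreal ((D z)\<^sup>2) \<partial>LL)"
      proof (intro nn_integral_mono)
        fix z
        have "(a - b)\<^sup>2 \<le> 2 * a\<^sup>2 + 2 * b\<^sup>2" for a b :: real
          using zero_le_power2[of "a + b"] unfolding power2_sum power2_diff by linarith
        then have "ennreal ((K' z)\<^sup>2) \<le> ennreal (2 * (K z)\<^sup>2 + 2 * (D z)\<^sup>2)" unfolding K'D by (rule ennreal_leI)
        then show "ennreal ((K' z)\<^sup>2) \<le> 2 * ennreal ((K z)\<^sup>2) + 2 * ennreal ((D z)\<^sup>2)" by (simp add: ennreal_mult')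
      qed
      also have "\<dots> = 2 * (\<integral>\<^sup>+z. ennreal ((K z)\<^sup>2) \<partial>LL) + 2 * (\<integral>\<^sup>+z. ennreal ((D z)\<^sup>2) \<partial>LL)"
        by (simp add: nn_integral_add nn_integral_cmult)
      also have "\<dots> \<le> 2 * ennreal s + 2 * ennreal \<epsilon>" using s D\<epsilon> by (intro add_mono mult_left_mono) auto
      finally show "(\<integral>\<^sup>+z. ennreal ((K' z)\<^sup>2) \<partial>LL) \<le> 2 * ennreal s + 2 * ennreal \<epsilon>" .
    qed simp
    ultimately have "(\<integral>\<^sup>+N. ennreal ((?U N)\<^sup>2) \<partial>P)
       \<le> 2 * (2 * ennreal w + 8 * ennreal M1 * ennreal \<epsilon>) + 4 * (2 * ennreal s + 2 * ennreal \<epsilon>)"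
      using step_second_moment[where \<kappa>=\<kappa> and k=k, OF \<kappa> \<kappa>m k] unfolding K'_def [symmetric]
      by (meson add_mono order_trans)
    also have "\<dots> = ennreal (4 * w + 8 * s + (16 * M1 + 8) * \<epsilon>)"
    proof -
      have 1: "4 * w + 8 * s + (16 * M1 + 8) * \<epsilon> = 2 * (2 * w + 8 * M1 * \<epsilon>) + 4 * (2 * s + 2 * \<epsilon>)"
        by (simp add: algebra_simps)
      have 2: "8 * ennreal M1 * ennreal \<epsilon> = ennreal (8 * M1 * \<epsilon>)"
      proof -
        have "8 * ennreal M1 = ennreal (8 * M1)" using m0(2) by (rule numeral_mult_ennreal)
        then show ?thesis using \<epsilon> m0 by (simp only: ennreal_mult [symmetric] mult_nonneg_nonneg zero_le_numeral less_imp_le)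
      qed
      have 3: "2 * (2 * ennreal x + ennreal y) + 4 * (2 * ennreal u + 2 * ennreal v) = ennreal (2 * (2 * x + y) + 4 * (2 * u + 2 * v))"
        if "0 \<le> x" "0 \<le> y" "0 \<le> u" "0 \<le> v" for x y u v :: real
        using that by (simp only: numeral_mult_ennreal ennreal_plus [symmetric] add_nonneg_nonneg mult_nonneg_nonneg zero_le_numeral)
      have "0 \<le> 8 * M1 * \<epsilon>" using \<epsilon> m0 by simp
      then show ?thesis unfolding 1 2 by (intro 3 w(2) s(2)) (use \<epsilon> in auto)
    qed
    finally have V: "(\<integral>\<^sup>+N. ennreal ((?U N)\<^sup>2) \<partial>P) \<le> ennreal (4 * w + 8 * s + (16 * M1 + 8) * \<epsilon>)" .
    have E2: "prob {N \<in> space P. a \<le> \<bar>?U N\<bar>} \<le> (4 * w + 8 * s + (16 * M1 + 8) * \<epsilon>) / a\<^sup>2"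
    proof -
      have eqv: "1 \<le> ennreal (1 / a\<^sup>2) * ennreal (t\<^sup>2) \<longleftrightarrow> a \<le> \<bar>t\<bar>" for t
      proof -
        have "1 \<le> ennreal (1 / a\<^sup>2) * ennreal (t\<^sup>2) \<longleftrightarrow> a\<^sup>2 \<le> t\<^sup>2"
          using a by (simp add: ennreal_mult' [symmetric] le_divide_eq)
        also have "\<dots> \<longleftrightarrow> a \<le> \<bar>t\<bar>" using a abs_le_square_iff[of a t] by simp
        finally show ?thesis .
      qed
      have "emeasure P {N \<in> space P. a \<le> \<bar>?U N\<bar>} \<le> ennreal (1 / a\<^sup>2) * (\<integral>\<^sup>+N. ennreal ((?U N)\<^sup>2) * indicator (space P) N \<partial>P)"
        using nn_integral_Markov_inequality[of "\<lambda>N. ennreal ((?U N)\<^sup>2)" "space P" P "ennreal (1 / a\<^sup>2)"]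
        unfolding eqv by simp
      also have "(\<integral>\<^sup>+N. ennreal ((?U N)\<^sup>2) * indicator (space P) N \<partial>P) = (\<integral>\<^sup>+N. ennreal ((?U N)\<^sup>2) \<partial>P)"
        by (intro nn_integral_cong) simp
      also have "ennreal (1 / a\<^sup>2) * \<dots> \<le> ennreal (1 / a\<^sup>2) * ennreal (4 * w + 8 * s + (16 * M1 + 8) * \<epsilon>)"
        by (intro mult_left_mono V) simp
      also have "\<dots> = ennreal ((4 * w + 8 * s + (16 * M1 + 8) * \<epsilon>) / a\<^sup>2)" using a by (simp add: ennreal_mult' [symmetric])
      finally show ?thesis using a \<epsilon> m0 w s by (simp add: emeasure_eq_measure)
    qed
    have "prob ?E \<le> prob ({N \<in> space P. a \<le> \<bar>?U N\<bar>} \<union> {N \<in> space P. a \<le> \<bar>?T N\<bar>})"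
    proof (rule finite_measure_mono)
      show "?E \<subseteq> {N \<in> space P. a \<le> \<bar>?U N\<bar>} \<union> {N \<in> space P. a \<le> \<bar>?T N\<bar>}"
      proof (intro subsetI)
        fix N assume N: "N \<in> ?E"
        have "\<bar>signed_sum K N - mean_form K\<bar> \<le> \<bar>?T N\<bar> + \<bar>?U N\<bar> + \<bar>mean_form K - mean_form K'\<bar>" by linarith
        then show "N \<in> {N \<in> space P. a \<le> \<bar>?U N\<bar>} \<union> {N \<in> space P. a \<le> \<bar>?T N\<bar>}" using N mean by auto
      qed
    qed measurable
    also have "\<dots> \<le> prob {N \<in> space P. a \<le> \<bar>?U N\<bar>} + prob {N \<in> space P. a \<le> \<bar>?T N\<bar>}"
      by (rule measure_Un_le) measurable
    finally show ?thesis using E1 E2 by (simp add: bnd_def)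
  qed
  have "(bnd \<longlongrightarrow> (4 * w + 8 * s + (16 * M1 + 8) * 0) / a\<^sup>2 + sqrt (0 * m) / a) (at_right 0)"
    unfolding bnd_def using a by (intro tendsto_intros) auto
  moreover have "eventually (\<lambda>\<epsilon>. prob ?E \<le> bnd \<epsilon>) (at_right 0)"
  proof -
    have "((\<lambda>\<epsilon>. sqrt (\<epsilon> * m)) \<longlongrightarrow> sqrt (0 * m)) (at_right 0)" by (intro tendsto_intros)
    then have "eventually (\<lambda>\<epsilon>. sqrt (\<epsilon> * m) < a) (at_right 0)" using a by (intro order_tendstoD(2)) auto
    moreover have "eventually (\<lambda>\<epsilon>::real. 0 < \<epsilon>) (at_right 0)" by (rule eventually_at_right_less)
    ultimately show ?thesis by eventually_elim (rule main)
  qed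
  ultimately have "prob ?E \<le> (4 * w + 8 * s + (16 * M1 + 8) * 0) / a\<^sup>2 + sqrt (0 * m) / a"
    by (rule tendsto_lowerbound) simp
  then show ?thesis by simp
qed

end

section \<open>Affine changes of variables and Gaussian integrals\<close>

lemma nn_integral_affine:
  fixes f :: "'a::euclidean_space \<Rightarrow> ennreal"
  assumes [measurable]: "f \<in> borel_measurable borel" and c: "c \<noteq> 0"
  shows "(\<integral>\<^sup>+x. f x \<partial>lborel) = ennreal (\<bar>c\<bar> ^ DIM('a)) * (\<integral>\<^sup>+x. f (t + c *\<^sub>R x) \<partial>lborel)"
  by (subst lborel_affine[OF c, of t])
     (simp add: nn_integral_density nn_integral_distr nn_integral_cmult)

lemma integral_affine:
  fixes f :: "'a::euclidean_space \<Rightarrow> 'b::{banach, second_countable_topology}"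
  assumes [measurable]: "f \<in> borel_measurable borel" and c: "c \<noteq> 0"
  shows "(LINT x|lborel. f x) = (\<bar>c\<bar> ^ DIM('a)) *\<^sub>R (LINT x|lborel. f (t + c *\<^sub>R x))"
  by (subst lborel_affine[OF c, of t])
     (simp add: integral_density integral_distr)

lemma nn_integral_translate:
  fixes f :: "'a::euclidean_space \<Rightarrow> ennreal"
  assumes "f \<in> borel_measurable borel"
  shows "(\<integral>\<^sup>+x. f (x + t) \<partial>lborel) = (\<integral>\<^sup>+x. f x \<partial>lborel)"
  using nn_integral_affine[OF assms, of 1 t] by (simp add: add.commute)

lemma integral_translate:
  fixes f :: "'a::euclidean_space \<Rightarrow> 'b::{banach, second_countable_topology}"
  assumes "f \<in> borel_measurable borel"
  shows "(LINT x|lborel. f (x + t)) = (LINT x|lborel. f x)"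
  using integral_affine[OF assms, of 1 t] by (simp add: add.commute)

lemma integrable_translate:
  fixes f :: "'a::euclidean_space \<Rightarrow> 'b::{banach, second_countable_topology}"
  assumes f: "integrable lborel f"
  shows "integrable lborel (\<lambda>x. f (x + t))"
proof (rule integrableI_bounded)
  have [measurable]: "f \<in> borel_measurable borel" using borel_measurable_integrable[OF f] by simp
  show "(\<lambda>x. f (x + t)) \<in> borel_measurable lborel" by measurable
  show "(\<integral>\<^sup>+x. ennreal (norm (f (x + t))) \<partial>lborel) < \<infinity>"
    using f by (subst nn_integral_translate[of "\<lambda>x. ennreal (norm (f x))"]) (auto simp: integrable_iff_bounded)
qed

lemma nn_integral_reflect:
  fixes f :: "'a::euclidean_space \<Rightarrow> ennreal"
  assumes "f \<in> borel_measurable borel"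
  shows "(\<integral>\<^sup>+x. f (t - x) \<partial>lborel) = (\<integral>\<^sup>+x. f x \<partial>lborel)"
  using nn_integral_affine[OF assms, of "-1" t] by simp

lemma (in pair_sigma_finite) product_integral:
  fixes f :: "'a \<Rightarrow> 'c::{real_normed_field, banach, second_countable_topology}"
  assumes f: "integrable M1 f" and g: "integrable M2 g"
  shows "integrable (M1 \<Otimes>\<^sub>M M2) (\<lambda>z. f (fst z) * g (snd z))"
    and "(LINT z|(M1 \<Otimes>\<^sub>M M2). f (fst z) * g (snd z)) = (LINT x|M1. f x) * (LINT y|M2. g y)"
proof -
  have [measurable]: "f \<in> borel_measurable M1" "g \<in> borel_measurable M2" using f g by auto
  show int: "integrable (M1 \<Otimes>\<^sub>M M2) (\<lambda>z. f (fst z) * g (snd z))"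
  proof (rule Fubini_integrable)
    show "integrable M1 (\<lambda>x. LINT y|M2. norm (f (fst (x, y)) * g (snd (x, y))))"
      using f g by (simp add: norm_mult integrable_norm)
    show "AE x in M1. integrable M2 (\<lambda>y. f (fst (x, y)) * g (snd (x, y)))"
      using g by (intro AE_I2) simp
  qed measurable
  show "(LINT z|(M1 \<Otimes>\<^sub>M M2). f (fst z) * g (snd z)) = (LINT x|M1. f x) * (LINT y|M2. g y)"
    using integral_fst'[OF int] f g by simp
qed

text \<open>
  Fubini's theorem for functions that factor over the coordinates; it reduces the Gaussian transform to
  dimension one.
\<close>

lemma lborel_prod_integral:
  fixes f :: "'a::euclidean_space \<Rightarrow> real \<Rightarrow> complex"
  assumes int: "\<And>b. b \<in> Basis \<Longrightarrow> integrable lborel (f b)"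
  shows "integrable lborel (\<lambda>x. \<Prod>b\<in>Basis. f b (x \<bullet> b))"
    and "(LINT x|lborel. (\<Prod>b\<in>Basis. f b (x \<bullet> b))) = (\<Prod>b\<in>Basis. LINT t|lborel. f b t)"
proof -
  let ?S = "\<lambda>g. \<Sum>b\<in>Basis. g b *\<^sub>R (b :: 'a)"
  have L: "(lborel :: 'a measure) = distr (\<Pi>\<^sub>M b\<in>Basis. lborel) borel ?S"
    by (rule lborel_eq)
  interpret product_sigma_finite "\<lambda>_ :: 'a. (lborel :: real measure)" ..
  have S [measurable]: "?S \<in> (\<Pi>\<^sub>M b\<in>Basis. lborel) \<rightarrow>\<^sub>M borel" by measurable
  have fm: "f b \<in> borel_measurable borel" if "b \<in> Basis" for b
    using borel_measurable_integrable[OF int[OF that]] by simp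
  have m: "(\<lambda>x :: 'a. \<Prod>b\<in>Basis. f b (x \<bullet> b)) \<in> borel_measurable borel"
    by (intro borel_measurable_prod measurable_compose[OF _ fm]) auto
  have e: "(\<Prod>b\<in>Basis. f b (?S g \<bullet> b)) = (\<Prod>b\<in>Basis. f b (g b))" for g
    by (intro prod.cong refl) simp
  have i: "integrable (\<Pi>\<^sub>M b\<in>Basis. lborel) (\<lambda>g. \<Prod>b\<in>Basis. f b (g b))"
    by (rule product_integrable_prod) (use int in auto)
  show "integrable lborel (\<lambda>x. \<Prod>b\<in>Basis. f b (x \<bullet> b))"
    unfolding L using m i by (subst integrable_distr_eq) (auto simp: e)
  show "(LINT x|lborel. (\<Prod>b\<in>Basis. f b (x \<bullet> b))) = (\<Prod>b\<in>Basis. LINT t|lborel. f b t)"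
    unfolding L using m
    by (subst integral_distr) (auto simp: e intro!: product_integral_prod int)
qed

definition gauss :: "'a::euclidean_space \<Rightarrow> real" where
  "gauss u = exp (- (norm u)\<^sup>2 / 2)"

lemma gauss_measurable [measurable]: "gauss \<in> borel_measurable borel"
  unfolding gauss_def by measurable

lemma gauss_bounds: "0 < gauss u" "gauss u \<le> 1" by (simp_all add: gauss_def)

text \<open>
  This is the characteristic function of the standard normal distribution.
\<close>

lemma gauss_fourier_real:
  "integrable lborel (\<lambda>t. complex_of_real (exp (- t\<^sup>2 / 2)) * iexp (a * t))"
  "(LINT t|lborel. complex_of_real (exp (- t\<^sup>2 / 2)) * iexp (a * t)) = complex_of_real (sqrt (2 * pi) * exp (- a\<^sup>2 / 2))"
proof -
  have d: "complex_of_real (exp (- t\<^sup>2 / 2)) * iexp (a * t)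
      = complex_of_real (sqrt (2 * pi)) * (std_normal_density t *\<^sub>R iexp (a * t))" for t
    by (simp add: std_normal_density_def scaleR_conv_of_real)
  have i: "integrable lborel (\<lambda>t. std_normal_density t *\<^sub>R iexp (a * t))"
  proof (rule Bochner_Integration.integrable_bound)
    show "integrable lborel std_normal_density" by (rule integrable_normal_density) simp
  qed auto
  show "integrable lborel (\<lambda>t. complex_of_real (exp (- t\<^sup>2 / 2)) * iexp (a * t))"
    unfolding d using i by (intro integrable_mult_right)
  have "(LINT t|lborel. std_normal_density t *\<^sub>R iexp (a * t)) = char std_normal_distribution a"
    unfolding char_def by (subst integral_density) auto
  also have "\<dots> = complex_of_real (exp (- a\<^sup>2 / 2))" by (simp add: char_std_normal_distribution)
  finally show "(LINT t|lborel. complex_of_real (exp (- t\<^sup>2 / 2)) * iexp (a * t)) = complex_of_real (sqrt (2 * pi) * exp (- a\<^sup>2 / 2))"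
    unfolding d by (simp only: integral_mult_right_zero of_real_mult)
qed

lemma gauss_fourier:
  fixes w :: "'a::euclidean_space"
  shows "integrable lborel (\<lambda>u. complex_of_real (gauss u) * iexp (w \<bullet> u))"
    and "(LINT u|lborel. complex_of_real (gauss u) * iexp (w \<bullet> u)) = complex_of_real (sqrt (2 * pi) ^ DIM('a) * gauss w)"
proof -
  have g: "gauss u = (\<Prod>b\<in>Basis. exp (- (u \<bullet> b)\<^sup>2 / 2))" for u :: 'a
  proof -
    have "(norm u)\<^sup>2 = (\<Sum>b\<in>Basis. (u \<bullet> b)\<^sup>2)"
      unfolding power2_norm_eq_inner by (subst euclidean_inner) (simp add: power2_eq_square)
    then have "- (norm u)\<^sup>2 / 2 = (\<Sum>b\<in>Basis. - (u \<bullet> b)\<^sup>2 / 2)" by (simp add: sum_negf sum_divide_distrib)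
    then show ?thesis unfolding gauss_def by (simp only: exp_sum[OF finite_Basis])
  qed
  have e: "complex_of_real (gauss u) * iexp (w \<bullet> u)
     = (\<Prod>b\<in>Basis. complex_of_real (exp (- (u \<bullet> b)\<^sup>2 / 2)) * iexp ((w \<bullet> b) * (u \<bullet> b)))" for u
  proof -
    have "iexp (w \<bullet> u) = (\<Prod>b\<in>Basis. iexp ((w \<bullet> b) * (u \<bullet> b)))"
      by (subst euclidean_inner) (simp add: sum_distrib_left exp_sum)
    then show ?thesis by (simp add: g prod.distrib)
  qed
  note l = lborel_prod_integral[of "\<lambda>b t. complex_of_real (exp (- t\<^sup>2 / 2)) * iexp ((w \<bullet> b) * t)", OF gauss_fourier_real(1)]
  show "integrable lborel (\<lambda>u. complex_of_real (gauss u) * iexp (w \<bullet> u))"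
    unfolding e by (rule l(1))
  have "(LINT u|lborel. complex_of_real (gauss u) * iexp (w \<bullet> u))
     = (\<Prod>b\<in>Basis. complex_of_real (sqrt (2 * pi) * exp (- (w \<bullet> b)\<^sup>2 / 2)))"
    unfolding e l(2) gauss_fourier_real(2) ..
  also have "\<dots> = complex_of_real (sqrt (2 * pi) ^ DIM('a) * gauss w)"
    by (simp add: g prod.distrib)
  finally show "(LINT u|lborel. complex_of_real (gauss u) * iexp (w \<bullet> u)) = complex_of_real (sqrt (2 * pi) ^ DIM('a) * gauss w)" .
qed

lemma gauss_integrable: "integrable lborel (gauss :: 'a::euclidean_space \<Rightarrow> real)"
  and gauss_integral: "(LINT u|lborel. gauss (u :: 'a)) = sqrt (2 * pi) ^ DIM('a)"
proof -
  have "integrable lborel (\<lambda>u::'a. complex_of_real (gauss u))"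
    "(LINT u::'a|lborel. complex_of_real (gauss u)) = complex_of_real (sqrt (2 * pi) ^ DIM('a))"
    using gauss_fourier[of "0::'a"] by (simp_all add: gauss_def)
  then show "integrable lborel (gauss :: 'a \<Rightarrow> real)" "(LINT u|lborel. gauss (u :: 'a)) = sqrt (2 * pi) ^ DIM('a)"
    by (simp_all add: integral_complex_of_real complex_of_real_integrable_eq flip: of_real_power)
qed

section \<open>Translations in the space of square-integrable functions\<close>

text \<open>
  The function is truncated in value by \<open>cl\<close> and in space by \<open>cut\<close>; inside the truncation it is replaced
  by continuous functions converging to it almost everywhere.
\<close>

lemma continuous_compact_support_dense:
  fixes s :: "'a::euclidean_space \<Rightarrow> real"
  assumes s [measurable]: "s \<in> borel_measurable borel" and fin: "(\<integral>\<^sup>+x. ennreal ((s x)\<^sup>2) \<partial>lborel) < \<infinity>" and \<epsilon>: "0 < \<epsilon>"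
  shows "\<exists>g B. 0 \<le> B \<and> continuous_on UNIV g \<and> (\<forall>x. \<bar>g x\<bar> \<le> B * indicator (cball (0::'a) B) x) \<and>
    (\<integral>\<^sup>+x. ennreal ((s x - g x)\<^sup>2) \<partial>lborel) \<le> ennreal \<epsilon>"
proof -
  define cl where "cl = (\<lambda>(B::real) t. max (- B) (min B t))"
  have cl_bound: "\<bar>cl B t\<bar> \<le> B" if "0 \<le> B" for B t using that by (auto simp: cl_def)
  have cont_cl: "continuous_on UNIV (cl B)" for B unfolding cl_def by (intro continuous_intros)
  have cl_meas [measurable]: "cl B \<in> borel_measurable borel" for B
    by (rule borel_measurable_continuous_onI[OF cont_cl])
  define cut where "cut = (\<lambda>B (x::'a). max 0 (min 1 (B - norm x)))"
  have cont_cut: "continuous_on UNIV (cut B)" for B unfolding cut_def by (intro continuous_intros)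
  have cut_meas [measurable]: "cut B \<in> borel_measurable borel" for B
    by (rule borel_measurable_continuous_onI[OF cont_cut])
  have cut: "0 \<le> cut B x" "cut B x \<le> 1" "norm x \<ge> B \<Longrightarrow> cut B x = 0" "norm x \<le> B - 1 \<Longrightarrow> cut B x = 1" for B x
    by (auto simp: cut_def)
  let ?u = "\<lambda>j x. cl (real j) (s x) * cut (real j) x"
  have "(\<lambda>j. \<integral>\<^sup>+x. ennreal ((s x - ?u j x)\<^sup>2) \<partial>lborel) \<longlonglongrightarrow> 0"
  proof (rule L2_dominated_limit[where w="\<lambda>x. \<bar>s x\<bar>"])
    show "AE x in lborel. (\<lambda>j. ?u j x) \<longlonglongrightarrow> s x"
    proof (rule AE_I2)
      fix x
      obtain m :: nat where m: "\<bar>s x\<bar> + norm x + 1 \<le> real m" using real_arch_simple by blast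
      have "?u j x = s x" if "m \<le> j" for j
      proof -
        have *: "\<bar>s x\<bar> + norm x + 1 \<le> real j" using m that by linarith
        then have "cut (real j) x = 1" by (intro cut(4)) (use abs_ge_zero[of "s x"] in linarith)
        moreover have "cl (real j) (s x) = s x" proof -
          have "\<bar>s x\<bar> \<le> real j" using * norm_ge_zero[of x] by linarith
          then show ?thesis by (auto simp: cl_def)
        qed
        ultimately show ?thesis by simp
      qed
      then show "(\<lambda>j. ?u j x) \<longlonglongrightarrow> s x"
        by (intro tendsto_eventually) (auto simp: eventually_sequentially)
    qed
    show "AE x in lborel. \<bar>s x - ?u j x\<bar> \<le> \<bar>s x\<bar>" for j
    proof (rule AE_I2)
      fix x
      have c: "0 \<le> cl (real j) (s x) \<and> cl (real j) (s x) \<le> s x \<or> s x \<le> cl (real j) (s x) \<and> cl (real j) (s x) \<le> 0"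
        by (auto simp: cl_def)
      have "\<bar>cl (real j) (s x) * cut (real j) x\<bar> \<le> \<bar>cl (real j) (s x)\<bar>"
        using cut(1,2)[of "real j" x] by (simp add: abs_mult mult_left_le)
      then show "\<bar>s x - ?u j x\<bar> \<le> \<bar>s x\<bar>"
        using c cut(1)[of "real j" x] by (auto simp: abs_le_iff mult_nonpos_nonneg split: abs_split)
    qed
    show "(\<integral>\<^sup>+x. ennreal (\<bar>s x\<bar>\<^sup>2) \<partial>lborel) < \<infinity>" using fin by simp
  qed measurable
  from L2_limit_exists[OF this, of "\<epsilon> / 4"] \<epsilon>
  obtain j where j: "(\<integral>\<^sup>+x. ennreal ((s x - ?u j x)\<^sup>2) \<partial>lborel) \<le> ennreal (\<epsilon> / 4)" by auto
  define B where "B = real j"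
  have B0: "0 \<le> B" by (simp add: B_def)
  obtain g where g: "\<And>n::nat. continuous_on UNIV (g n)" "AE x in lborel. (\<lambda>n. g n x) \<longlonglongrightarrow> s x"
    using borel_measurable_continuous_approx[OF s] by blast
  let ?v = "\<lambda>n x. cl B (g n x) * cut B x"
  have cont_v: "continuous_on UNIV (?v n)" for n
    by (intro continuous_on_mult cont_cut continuous_on_compose2[OF cont_cl g(1)]) auto
  have v_meas [measurable]: "?v n \<in> borel_measurable borel" for n
    by (rule borel_measurable_continuous_onI[OF cont_v])
  have v_bound: "\<bar>cl B t * cut B x\<bar> \<le> B * indicator (cball (0::'a) B) x" for t x
    using cut(1,2)[of B x] cut(3)[of B x] cl_bound[OF B0, of t] B0
    by (cases "norm x \<le> B") (auto simp: abs_mult indicator_def intro: mult_left_le order_trans mult_mono[of _ B _ 1, simplified])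
  have "(\<lambda>n. \<integral>\<^sup>+x. ennreal ((?u j x - ?v n x)\<^sup>2) \<partial>lborel) \<longlonglongrightarrow> 0"
  proof (rule L2_dominated_limit[where w="\<lambda>x. 2 * B * indicator (cball (0::'a) B) x"])
    show "AE x in lborel. (\<lambda>n. ?v n x) \<longlonglongrightarrow> ?u j x"
      using g(2)
    proof eventually_elim
      case (elim x)
      have "isCont (cl B) (s x)" using cont_cl by (simp add: continuous_on_eq_continuous_at)
      then have "(\<lambda>n. cl B (g n x)) \<longlonglongrightarrow> cl B (s x)" using elim by (rule isCont_tendsto_compose)
      then show ?case unfolding B_def by (intro tendsto_intros)
    qed
    show "AE x in lborel. \<bar>?u j x - ?v n x\<bar> \<le> 2 * B * indicator (cball (0::'a) B) x" for n
    proof (rule AE_I2)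
      fix x show "\<bar>?u j x - ?v n x\<bar> \<le> 2 * B * indicator (cball (0::'a) B) x"
        using v_bound[of "s x" x] v_bound[of "g n x" x] unfolding B_def by linarith
    qed
    have "(\<integral>\<^sup>+x. ennreal ((2 * B * indicator (cball (0::'a) B) x)\<^sup>2) \<partial>lborel) = (\<integral>\<^sup>+x. ennreal ((2 * B)\<^sup>2) * indicator (cball (0::'a) B) x \<partial>lborel)"
      by (intro nn_integral_cong) (auto simp: indicator_def)
    also have "\<dots> = ennreal ((2 * B)\<^sup>2) * emeasure lborel (cball (0::'a) B)"
      by (rule nn_integral_cmult_indicator) simp
    also have "\<dots> < \<infinity>" using emeasure_lborel_cball_finite[of "0::'a" B] by (simp add: ennreal_mult_less_top)
    finally show "(\<integral>\<^sup>+x. ennreal ((2 * B * indicator (cball (0::'a) B) x)\<^sup>2) \<partial>lborel) < \<infinity>" .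
    show "?v n \<in> borel_measurable lborel" for n using v_meas by simp
    show "?u j \<in> borel_measurable lborel" by measurable
    show "(\<lambda>x. 2 * B * indicator (cball (0::'a) B) x) \<in> borel_measurable lborel" by (simp add: borel_measurable_times borel_measurable_indicator borel_closed)
  qed
  from L2_limit_exists[OF this, of "\<epsilon> / 4"] \<epsilon>
  obtain n where n: "(\<integral>\<^sup>+x. ennreal ((?u j x - ?v n x)\<^sup>2) \<partial>lborel) \<le> ennreal (\<epsilon> / 4)" by auto
  have "(\<integral>\<^sup>+x. ennreal ((s x - ?v n x)\<^sup>2) \<partial>lborel) = (\<integral>\<^sup>+x. ennreal (((s x - ?u j x) + (?u j x - ?v n x))\<^sup>2) \<partial>lborel)"
    by simp
  also have "\<dots> \<le> 2 * (\<integral>\<^sup>+x. ennreal ((s x - ?u j x)\<^sup>2) \<partial>lborel) + 2 * (\<integral>\<^sup>+x. ennreal ((?u j x - ?v n x)\<^sup>2) \<partial>lborel)"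
    by (rule L2_triangle) measurable
  also have "\<dots> \<le> 2 * ennreal (\<epsilon> / 4) + 2 * ennreal (\<epsilon> / 4)"
    by (intro add_mono mult_left_mono j n) auto
  also have "\<dots> = ennreal \<epsilon>"
  proof -
    have "2 * ennreal (\<epsilon> / 4) = ennreal (\<epsilon> / 2)" using \<epsilon> by (subst numeral_mult_ennreal) auto
    then show ?thesis using \<epsilon> by (simp flip: ennreal_plus)
  qed
  finally show ?thesis using cont_v v_bound B0 by blast
qed

text \<open>
  For continuous functions of compact support this is dominated convergence. The general case follows by
  density, since translations are isometries.
\<close>

lemma L2_translation_continuous:
  fixes s :: "'a::euclidean_space \<Rightarrow> real"
  assumes s [measurable]: "s \<in> borel_measurable borel" and fin: "(\<integral>\<^sup>+x. ennreal ((s x)\<^sup>2) \<partial>lborel) < \<infinity>"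
    and z: "z \<longlonglongrightarrow> 0"
  shows "(\<lambda>n. \<integral>\<^sup>+x. ennreal ((s (x + z n) - s x)\<^sup>2) \<partial>lborel) \<longlonglongrightarrow> 0"
proof (rule tendsto_0_if_Limsup_eq_0_ennreal, rule antisym)
  show "0 \<le> limsup (\<lambda>n. \<integral>\<^sup>+x. ennreal ((s (x + z n) - s x)\<^sup>2) \<partial>lborel)" by simp
  show "limsup (\<lambda>n. \<integral>\<^sup>+x. ennreal ((s (x + z n) - s x)\<^sup>2) \<partial>lborel) \<le> 0"
  proof (rule ennreal_le_epsilon)
    fix \<epsilon> :: real assume \<epsilon>: "0 < \<epsilon>"
    (* Approximation of the translate, continuity of g, and approximation of s contribute
       at most 2, 4 and 4 times \<epsilon> / 12. *)
    obtain g B where B0: "0 \<le> B" and g: "continuous_on UNIV g" and gB: "\<forall>x. \<bar>g x\<bar> \<le> B * indicator (cball (0::'a) B) x"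
      and app: "(\<integral>\<^sup>+x. ennreal ((s x - g x)\<^sup>2) \<partial>lborel) \<le> ennreal (\<epsilon> / 12)"
      using continuous_compact_support_dense[OF s fin, of "\<epsilon> / 12"] \<epsilon> by auto
    have gm [measurable]: "g \<in> borel_measurable borel" by (rule borel_measurable_continuous_onI[OF g])
    obtain Z where Z: "\<And>n. norm (z n) \<le> Z"
      using convergent_imp_Bseq[of z] z by (auto simp: convergent_def Bseq_def)
    have "(\<lambda>n. \<integral>\<^sup>+x. ennreal ((g x - g (x + z n))\<^sup>2) \<partial>lborel) \<longlonglongrightarrow> 0"
    proof (rule L2_dominated_limit[where w="\<lambda>x. 2 * B * indicator (cball (0::'a) (B + Z)) x"])
      show "AE x in lborel. (\<lambda>n. g (x + z n)) \<longlonglongrightarrow> g x"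
      proof (rule AE_I2)
        fix x
        have "isCont g x" using g by (simp add: continuous_on_eq_continuous_at)
        moreover have "(\<lambda>n. x + z n) \<longlonglongrightarrow> x" using tendsto_add[OF tendsto_const z, of x] by simp
        ultimately show "(\<lambda>n. g (x + z n)) \<longlonglongrightarrow> g x" by (rule isCont_tendsto_compose)
      qed
      show "AE x in lborel. \<bar>g x - g (x + z n)\<bar> \<le> 2 * B * indicator (cball (0::'a) (B + Z)) x" for n
      proof (rule AE_I2)
        fix x
        have Z0: "0 \<le> Z" using Z[of 0] norm_ge_zero[of "z 0"] by linarith
        have 1: "\<bar>g x\<bar> \<le> B * indicator (cball (0::'a) (B + Z)) x"
          using gB[rule_format, of x] B0 Z0 by (cases "norm x \<le> B") (auto simp: indicator_def)
        have "norm x \<le> norm (x + z n) + norm (z n)" using norm_triangle_ineq4[of "x + z n" "z n"] by simp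
        then have 2: "\<bar>g (x + z n)\<bar> \<le> B * indicator (cball (0::'a) (B + Z)) x"
          using gB[rule_format, of "x + z n"] B0 Z[of n] by (cases "norm (x + z n) \<le> B") (auto simp: indicator_def)
        show "\<bar>g x - g (x + z n)\<bar> \<le> 2 * B * indicator (cball (0::'a) (B + Z)) x" using 1 2 by linarith
      qed
      have "(\<integral>\<^sup>+x. ennreal ((2 * B * indicator (cball (0::'a) (B + Z)) x)\<^sup>2) \<partial>lborel)
         = (\<integral>\<^sup>+x. ennreal ((2 * B)\<^sup>2) * indicator (cball (0::'a) (B + Z)) x \<partial>lborel)"
        by (intro nn_integral_cong) (auto simp: indicator_def)
      also have "\<dots> = ennreal ((2 * B)\<^sup>2) * emeasure lborel (cball (0::'a) (B + Z))"
        by (rule nn_integral_cmult_indicator) simp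
      also have "\<dots> < \<infinity>" using emeasure_lborel_cball_finite[of "0::'a" "B + Z"] by (simp add: ennreal_mult_less_top)
      finally show "(\<integral>\<^sup>+x. ennreal ((2 * B * indicator (cball (0::'a) (B + Z)) x)\<^sup>2) \<partial>lborel) < \<infinity>" .
      show "(\<lambda>x. g (x + z n)) \<in> borel_measurable lborel" for n by measurable
      show "g \<in> borel_measurable lborel" by simp
      show "(\<lambda>x. 2 * B * indicator (cball (0::'a) (B + Z)) x) \<in> borel_measurable lborel" by (simp add: borel_measurable_times borel_measurable_indicator borel_closed)
    qed
    then have ev: "eventually (\<lambda>n. (\<integral>\<^sup>+x. ennreal ((g x - g (x + z n))\<^sup>2) \<partial>lborel) < ennreal (\<epsilon> / 12)) sequentially"
      using \<epsilon> by (intro order_tendstoD(2)) auto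
    have "limsup (\<lambda>n. \<integral>\<^sup>+x. ennreal ((s (x + z n) - s x)\<^sup>2) \<partial>lborel) \<le> ennreal \<epsilon>"
    proof (rule Limsup_bounded, use ev in eventually_elim)
      case (elim n)
      have "(\<integral>\<^sup>+x. ennreal ((s (x + z n) - s x)\<^sup>2) \<partial>lborel)
          = (\<integral>\<^sup>+x. ennreal (((s (x + z n) - g (x + z n)) + (- (g x - g (x + z n)) + - (s x - g x)))\<^sup>2) \<partial>lborel)"
        by (intro nn_integral_cong) (simp add: algebra_simps)
      also have "\<dots> \<le> 2 * (\<integral>\<^sup>+x. ennreal ((s (x + z n) - g (x + z n))\<^sup>2) \<partial>lborel)
          + 2 * (\<integral>\<^sup>+x. ennreal ((- (g x - g (x + z n)) + - (s x - g x))\<^sup>2) \<partial>lborel)"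
        by (rule L2_triangle) measurable
      also have "\<dots> \<le> 2 * (\<integral>\<^sup>+x. ennreal ((s (x + z n) - g (x + z n))\<^sup>2) \<partial>lborel)
          + 2 * (2 * (\<integral>\<^sup>+x. ennreal ((- (g x - g (x + z n)))\<^sup>2) \<partial>lborel) + 2 * (\<integral>\<^sup>+x. ennreal ((- (s x - g x))\<^sup>2) \<partial>lborel))"
        by (intro add_left_mono mult_left_mono L2_triangle) measurable
      also have "(\<integral>\<^sup>+x. ennreal ((s (x + z n) - g (x + z n))\<^sup>2) \<partial>lborel) = (\<integral>\<^sup>+x. ennreal ((s x - g x)\<^sup>2) \<partial>lborel)"
        by (rule nn_integral_translate[of "\<lambda>x. ennreal ((s x - g x)\<^sup>2)"]) measurable
      also have "2 * (\<integral>\<^sup>+x. ennreal ((s x - g x)\<^sup>2) \<partial>lborel)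
          + 2 * (2 * (\<integral>\<^sup>+x. ennreal ((- (g x - g (x + z n)))\<^sup>2) \<partial>lborel) + 2 * (\<integral>\<^sup>+x. ennreal ((- (s x - g x))\<^sup>2) \<partial>lborel))
         \<le> 2 * ennreal (\<epsilon> / 12) + 2 * (2 * ennreal (\<epsilon> / 12) + 2 * ennreal (\<epsilon> / 12))"
        unfolding power2_minus using elim app by (intro add_mono mult_left_mono) auto
      also have "\<dots> = ennreal (2 * (\<epsilon> / 12) + 2 * (2 * (\<epsilon> / 12) + 2 * (\<epsilon> / 12)))"
        using \<epsilon> by (simp only: numeral_mult_ennreal ennreal_plus [symmetric] add_nonneg_nonneg mult_nonneg_nonneg
            zero_le_numeral divide_nonneg_nonneg less_imp_le)
      also have "\<dots> \<le> ennreal \<epsilon>" using \<epsilon> by (intro ennreal_leI) simp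
      finally show ?case .
    qed
    then show "limsup (\<lambda>n. \<integral>\<^sup>+x. ennreal ((s (x + z n) - s x)\<^sup>2) \<partial>lborel) \<le> 0 + ennreal \<epsilon>" by simp
  qed
qed

section \<open>Plancherel's inequality\<close>

lemma fourier_measurable [measurable]:
  fixes s :: "'a::euclidean_space \<Rightarrow> real"
  assumes [measurable]: "s \<in> borel_measurable borel"
  shows "fourier s \<in> borel_measurable borel"
proof -
  have "(\<lambda>(u, x). complex_of_real (s x) * iexp (x \<bullet> u)) \<in> borel_measurable (borel \<Otimes>\<^sub>M lborel)" by measurable
  from lborel.borel_measurable_lebesgue_integral[OF this] show ?thesis
    unfolding fourier_def[abs_def] .
qed

lemma fourier_integrable:
  fixes s :: "'a::euclidean_space \<Rightarrow> real"
  assumes s: "integrable lborel s"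
  shows "integrable lborel (\<lambda>x. complex_of_real (s x) * iexp (x \<bullet> u))"
proof (rule Bochner_Integration.integrable_bound[OF s])
  have [measurable]: "s \<in> borel_measurable borel" using borel_measurable_integrable[OF s] by simp
  show "(\<lambda>x. complex_of_real (s x) * iexp (x \<bullet> u)) \<in> borel_measurable lborel" by measurable
qed (simp add: norm_mult)

lemma fourier_bound:
  assumes s: "integrable lborel s"
  shows "cmod (fourier s u) \<le> L1_norm s"
proof -
  have "cmod (fourier s u) \<le> (LINT x|lborel. norm (complex_of_real (s x) * iexp (x \<bullet> u)))"
    unfolding fourier_def by (rule integral_norm_bound)
  then show ?thesis by (simp add: norm_mult L1_norm_def)
qed

lemma gauss_fourier_scaled:
  fixes z :: "'a::euclidean_space"
  assumes d: "0 < d"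
  shows "integrable lborel (\<lambda>u. complex_of_real (gauss (d *\<^sub>R u)) * iexp (z \<bullet> u))"
    and "(LINT u|lborel. complex_of_real (gauss (d *\<^sub>R u)) * iexp (z \<bullet> u))
      = complex_of_real (inverse d ^ DIM('a) * (sqrt (2 * pi) ^ DIM('a) * gauss (z /\<^sub>R d)))"
proof -
  let ?f = "\<lambda>u. complex_of_real (gauss u) * iexp ((z /\<^sub>R d) \<bullet> u)"
  have fm [measurable]: "?f \<in> borel_measurable borel" by measurable
  have e: "complex_of_real (gauss (d *\<^sub>R u)) * iexp (z \<bullet> u) = ?f (0 + d *\<^sub>R u)" for u
    using d by (simp add: field_simps)
  have "(LINT u|lborel. ?f u) = (\<bar>d\<bar> ^ DIM('a)) *\<^sub>R (LINT u|lborel. ?f (0 + d *\<^sub>R u))"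
    by (rule integral_affine) (use d in auto)
  then have "(LINT u|lborel. ?f (0 + d *\<^sub>R u)) = (inverse d ^ DIM('a)) *\<^sub>R (LINT u|lborel. ?f u)"
    using d by (simp add: power_inverse)
  then show "(LINT u|lborel. complex_of_real (gauss (d *\<^sub>R u)) * iexp (z \<bullet> u))
      = complex_of_real (inverse d ^ DIM('a) * (sqrt (2 * pi) ^ DIM('a) * gauss (z /\<^sub>R d)))"
    unfolding e gauss_fourier(2) by (simp only: scaleR_conv_of_real of_real_mult)
  show "integrable lborel (\<lambda>u. complex_of_real (gauss (d *\<^sub>R u)) * iexp (z \<bullet> u))"
  proof (rule integrableI_bounded)
    have "(\<integral>\<^sup>+u. ennreal (norm (?f u)) \<partial>lborel) < \<infinity>"
      using gauss_fourier(1)[of "z /\<^sub>R d"] unfolding integrable_iff_bounded by blast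
    then have "ennreal (\<bar>d\<bar> ^ DIM('a)) * (\<integral>\<^sup>+u. ennreal (norm (?f (0 + d *\<^sub>R u))) \<partial>lborel) < \<infinity>"
      by (subst (asm) nn_integral_affine[where c=d and t=0]) (use d in auto)
    then show "(\<integral>\<^sup>+u. ennreal (norm (complex_of_real (gauss (d *\<^sub>R u)) * iexp (z \<bullet> u))) \<partial>lborel) < \<infinity>"
      unfolding e using d by (auto simp: ennreal_mult_less_top)
  qed measurable
qed

text \<open>
  The Gaussian weight makes the energy of \<open>fourier s\<close> an absolutely convergent triple integral for every
  integrable \<open>s\<close>. Fubini's theorem and the Fourier transform of the Gaussian turn it into an average of
  the autocorrelation of \<open>s\<close> over shifts of size \<open>d\<close>.
\<close>

lemma fourier_gauss_energy:
  fixes s :: "'a::euclidean_space \<Rightarrow> real"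
  assumes s: "integrable lborel s" and d: "0 < d"
  shows "(LINT u|lborel. gauss (d *\<^sub>R u) * (cmod (fourier s u))\<^sup>2)
     = sqrt (2 * pi) ^ DIM('a) * (LINT y|lborel. LINT w|lborel. s (y + d *\<^sub>R w) * s y * gauss w)"
proof -
  have sm [measurable]: "s \<in> borel_measurable borel" using borel_measurable_integrable[OF s] by simp
  let ?p = "\<lambda>z. complex_of_real (s (fst z) * s (snd z))"
  let ?F = "\<lambda>u z. complex_of_real (gauss (d *\<^sub>R u)) * (?p z * iexp ((fst z - snd z) \<bullet> u))"
  have pm: "(\<lambda>z. s (fst z)) \<in> borel_measurable (borel :: ('a \<times> 'a) measure)"
    "(\<lambda>z. s (snd z)) \<in> borel_measurable (borel :: ('a \<times> 'a) measure)"
    by (intro measurable_compose[OF _ sm] borel_measurable_continuous_onI continuous_intros)+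
  note [measurable] = pm
  have si: "integrable lborel (\<lambda>x. \<bar>s x\<bar>)" using s by simp
  have pi': "integrable lborel (\<lambda>z :: 'a \<times> 'a. \<bar>s (fst z)\<bar> * \<bar>s (snd z)\<bar>)"
    using lborel_pair.product_integral(1)[OF si si] by (simp add: lborel_prod)
  have inner_u: "(LINT z|lborel. ?F u z) = complex_of_real (gauss (d *\<^sub>R u) * (cmod (fourier s u))\<^sup>2)" for u
  proof -
    have f1: "integrable lborel (\<lambda>x. complex_of_real (s x) * iexp (x \<bullet> u))" by (rule fourier_integrable[OF s])
    have f2: "integrable lborel (\<lambda>x. cnj (complex_of_real (s x) * iexp (x \<bullet> u)))" using f1 by (simp only: integrable_cnj)
    have e: "?F u z = complex_of_real (gauss (d *\<^sub>R u))
        * ((complex_of_real (s (fst z)) * iexp (fst z \<bullet> u)) * cnj (complex_of_real (s (snd z)) * iexp (snd z \<bullet> u)))" for z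
    proof -
      have "iexp ((fst z - snd z) \<bullet> u) = iexp (fst z \<bullet> u) * cnj (iexp (snd z \<bullet> u))"
        by (simp add: exp_cnj inner_diff_left right_diff_distrib exp_diff exp_minus divide_inverse)
      then show ?thesis by simp
    qed
    have "(LINT z|lborel. ?F u z) = complex_of_real (gauss (d *\<^sub>R u)) * (fourier s u * cnj (fourier s u))"
    proof -
      have c1: "(LINT x|lborel. complex_of_real (s x) * iexp (x \<bullet> u)) = fourier s u" by (simp only: fourier_def)
      have c2: "(LINT x|lborel. cnj (complex_of_real (s x) * iexp (x \<bullet> u))) = cnj (fourier s u)"
        unfolding c1 [symmetric] by (rule Bochner_Integration.integral_cnj)
      show ?thesis
        using lborel_pair.product_integral(2)[OF f1 f2] unfolding e integral_mult_right_zero c1 c2 lborel_prod by simp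
    qed
    then show ?thesis by (simp only: complex_norm_square of_real_mult)
  qed
  have int: "integrable (lborel \<Otimes>\<^sub>M lborel) (\<lambda>(u, z). ?F u z)"
  proof (rule Bochner_Integration.integrable_bound)
    have gi: "integrable lborel (\<lambda>u :: 'a. gauss (d *\<^sub>R u))"
    proof -
      have "\<bar>gauss (d *\<^sub>R u)\<bar> = gauss (d *\<^sub>R u)" for u :: 'a using gauss_bounds(1)[of "d *\<^sub>R u"] by simp
      then show ?thesis using integrable_norm[OF gauss_fourier_scaled(1)[OF d, of "0::'a"]] by simp
    qed
    show "integrable (lborel \<Otimes>\<^sub>M lborel) (\<lambda>v :: 'a \<times> 'a \<times> 'a. gauss (d *\<^sub>R fst v) * (\<bar>s (fst (snd v))\<bar> * \<bar>s (snd (snd v))\<bar>))"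
      using lborel_pair.product_integral(1)[OF gi pi'] by simp
    have "(\<lambda>v :: 'a \<times> 'a \<times> 'a. s (fst (snd v))) \<in> borel_measurable borel"
      "(\<lambda>v :: 'a \<times> 'a \<times> 'a. s (snd (snd v))) \<in> borel_measurable borel"
      by (intro measurable_compose[OF _ sm] borel_measurable_continuous_onI continuous_intros)+
    moreover have "(\<lambda>v :: 'a \<times> 'a \<times> 'a. gauss (d *\<^sub>R fst v)) \<in> borel_measurable borel"
      by (intro measurable_compose[OF _ gauss_measurable] borel_measurable_continuous_onI continuous_intros)
    moreover have "(\<lambda>v :: 'a \<times> 'a \<times> 'a. iexp ((fst (snd v) - snd (snd v)) \<bullet> fst v)) \<in> borel_measurable borel"
      by (intro borel_measurable_continuous_onI continuous_intros)
    moreover have c: "complex_of_real \<in> borel_measurable borel" by measurable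
    ultimately show "(\<lambda>(u, z). ?F u z) \<in> borel_measurable (lborel \<Otimes>\<^sub>M lborel)"
      unfolding lborel_prod measurable_lborel2 case_prod_unfold
      by (intro borel_measurable_times measurable_compose[OF _ c])
  qed (auto simp: norm_mult abs_mult gauss_bounds less_imp_le)
  have "complex_of_real (LINT u|lborel. gauss (d *\<^sub>R u) * (cmod (fourier s u))\<^sup>2) = (LINT u|lborel. LINT z|lborel. ?F u z)"
    unfolding inner_u by (rule integral_complex_of_real [symmetric])
  also have "\<dots> = (LINT z|lborel. LINT u|lborel. ?F u z)"
    using lborel_pair.Fubini_integral[OF int] by simp
  also have "\<dots> = (LINT z|lborel. complex_of_real (s (fst z) * s (snd z)
      * (inverse d ^ DIM('a) * (sqrt (2 * pi) ^ DIM('a) * gauss ((fst z - snd z) /\<^sub>R d)))))"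
  proof (intro Bochner_Integration.integral_cong refl)
    fix z :: "'a \<times> 'a"
    have "(LINT u|lborel. ?F u z) = (LINT u|lborel. ?p z * (complex_of_real (gauss (d *\<^sub>R u)) * iexp ((fst z - snd z) \<bullet> u)))"
      by (intro Bochner_Integration.integral_cong refl) (simp add: mult_ac)
    also have "\<dots> = ?p z * (LINT u|lborel. complex_of_real (gauss (d *\<^sub>R u)) * iexp ((fst z - snd z) \<bullet> u))"
      by (rule integral_mult_right_zero)
    finally show "(LINT u|lborel. ?F u z) = complex_of_real (s (fst z) * s (snd z)
      * (inverse d ^ DIM('a) * (sqrt (2 * pi) ^ DIM('a) * gauss ((fst z - snd z) /\<^sub>R d))))"
      unfolding gauss_fourier_scaled(2)[OF d] by (simp only: of_real_mult)
  qed
  also have "\<dots> = complex_of_real (LINT z|lborel. s (fst z) * s (snd z)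
      * (inverse d ^ DIM('a) * (sqrt (2 * pi) ^ DIM('a) * gauss ((fst z - snd z) /\<^sub>R d))))"
    by (rule integral_complex_of_real)
  finally have "(LINT u|lborel. gauss (d *\<^sub>R u) * (cmod (fourier s u))\<^sup>2)
     = (LINT z|lborel. s (fst z) * s (snd z) * (inverse d ^ DIM('a) * (sqrt (2 * pi) ^ DIM('a) * gauss ((fst z - snd z) /\<^sub>R d))))"
    by (simp only: of_real_eq_iff)
  also have "\<dots> = (LINT y|lborel. LINT x|lborel. s x * s y * (inverse d ^ DIM('a) * (sqrt (2 * pi) ^ DIM('a) * gauss ((x - y) /\<^sub>R d))))"
  proof -
    let ?H = "\<lambda>z :: 'a \<times> 'a. s (fst z) * s (snd z) * (inverse d ^ DIM('a) * (sqrt (2 * pi) ^ DIM('a) * gauss ((fst z - snd z) /\<^sub>R d)))"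
    have "integrable lborel ?H"
    proof (rule Bochner_Integration.integrable_bound)
      show "integrable lborel (\<lambda>z :: 'a \<times> 'a. inverse d ^ DIM('a) * sqrt (2 * pi) ^ DIM('a) * (\<bar>s (fst z)\<bar> * \<bar>s (snd z)\<bar>))"
        using pi' by (rule integrable_mult_right)
      have "(\<lambda>z :: 'a \<times> 'a. (fst z - snd z) /\<^sub>R d) \<in> borel_measurable borel"
        by (intro borel_measurable_continuous_onI continuous_intros)
      from measurable_compose[OF this gauss_measurable] show "?H \<in> borel_measurable lborel" by simp
      show "AE z in lborel. norm (?H z) \<le> norm (inverse d ^ DIM('a) * sqrt (2 * pi) ^ DIM('a) * (\<bar>s (fst z)\<bar> * \<bar>s (snd z)\<bar>))"
      proof (rule AE_I2)
        fix z :: "'a \<times> 'a"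
        have g: "\<bar>gauss ((fst z - snd z) /\<^sub>R d)\<bar> \<le> 1"
          using gauss_bounds[of "(fst z - snd z) /\<^sub>R d"] by simp
        have "norm (?H z) = (inverse d ^ DIM('a) * sqrt (2 * pi) ^ DIM('a) * (\<bar>s (fst z)\<bar> * \<bar>s (snd z)\<bar>)) * \<bar>gauss ((fst z - snd z) /\<^sub>R d)\<bar>"
          using d by (simp add: abs_mult mult_ac)
        also have "\<dots> \<le> inverse d ^ DIM('a) * sqrt (2 * pi) ^ DIM('a) * (\<bar>s (fst z)\<bar> * \<bar>s (snd z)\<bar>)"
          using d g by (intro mult_left_le) auto
        finally show "norm (?H z) \<le> norm (inverse d ^ DIM('a) * sqrt (2 * pi) ^ DIM('a) * (\<bar>s (fst z)\<bar> * \<bar>s (snd z)\<bar>))"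
          by simp
      qed
    qed
    then show ?thesis
      using lborel_pair.integral_snd[of "\<lambda>x y. ?H (x, y)"] by (simp add: lborel_prod case_prod_unfold)
  qed
  also have "\<dots> = (LINT y|lborel. LINT w|lborel. sqrt (2 * pi) ^ DIM('a) * (s (y + d *\<^sub>R w) * s y * gauss w))"
  proof (rule Bochner_Integration.integral_cong[OF refl])
    fix y :: 'a
    let ?h = "\<lambda>x. s x * s y * (inverse d ^ DIM('a) * (sqrt (2 * pi) ^ DIM('a) * gauss ((x - y) /\<^sub>R d)))"
    have "(LINT x|lborel. ?h x) = (\<bar>d\<bar> ^ DIM('a)) *\<^sub>R (LINT w|lborel. ?h (y + d *\<^sub>R w))"
      by (rule integral_affine) (use d in auto)
    also have "\<dots> = (LINT w|lborel. (\<bar>d\<bar> ^ DIM('a)) *\<^sub>R ?h (y + d *\<^sub>R w))" by simp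
    also have "\<dots> = (LINT w|lborel. sqrt (2 * pi) ^ DIM('a) * (s (y + d *\<^sub>R w) * s y * gauss w))"
      using d by (intro Bochner_Integration.integral_cong refl) (simp add: power_inverse)
    finally show "(LINT x|lborel. ?h x) = (LINT w|lborel. sqrt (2 * pi) ^ DIM('a) * (s (y + d *\<^sub>R w) * s y * gauss w))" .
  qed
  finally show ?thesis by simp
qed

text \<open>
  Let \<open>d\<close> tend to 0 in the preceding identity. The left-hand side stays below the energy of
  \<open>fourier s\<close>. The autocorrelation \<open>A\<close> of \<open>s\<close> is bounded, and continuous at 0 because translations are
  continuous in \<open>L\<^sup>2\<close>, so the right-hand side converges to \<open>(2 * pi) ^ DIM('a) * A 0\<close>.
\<close>

lemma plancherel_le:
  fixes s :: "'a::euclidean_space \<Rightarrow> real"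
  assumes s: "integrable lborel s" and s2: "integrable lborel (\<lambda>x. (s x)\<^sup>2)"
  shows "ennreal ((2 * pi) ^ DIM('a)) * (\<integral>\<^sup>+x. ennreal ((s x)\<^sup>2) \<partial>lborel)
    \<le> (\<integral>\<^sup>+u. ennreal ((cmod (fourier s u))\<^sup>2) \<partial>lborel)"
proof -
  have sm [measurable]: "s \<in> borel_measurable borel" using borel_measurable_integrable[OF s] by simp
  have S: "(\<integral>\<^sup>+x. ennreal ((s x)\<^sup>2) \<partial>lborel) = ennreal (LINT x|lborel. (s x)\<^sup>2)"
    using s2 by (intro nn_integral_eq_integral) auto
  define E where "E = (LINT x|lborel. (s x)\<^sup>2)"
  have E0: "0 \<le> E" unfolding E_def by (rule Bochner_Integration.integral_nonneg) simp
  define d where "d = (\<lambda>n::nat. 1 / real (Suc n))"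
  have d: "0 < d n" for n by (simp add: d_def)
  have d_lim: "d \<longlonglongrightarrow> 0" unfolding d_def by (rule LIMSEQ_Suc) (rule lim_1_over_n)
  define A where "A = (\<lambda>z. LINT y|lborel. s (y + z) * s y)"
  have shift2: "integrable lborel (\<lambda>y. (s (y + z))\<^sup>2)" for z
    using integrable_translate[OF s2, of z] .
  have prod_int: "integrable lborel (\<lambda>y. s (y + z) * s y)" for z
  proof (rule Bochner_Integration.integrable_bound)
    show "integrable lborel (\<lambda>y. (s (y + z))\<^sup>2 + (s y)\<^sup>2)" by (intro Bochner_Integration.integrable_add shift2 s2)
    show "AE y in lborel. norm (s (y + z) * s y) \<le> norm ((s (y + z))\<^sup>2 + (s y)\<^sup>2)"
    proof (rule AE_I2)
      fix y
      have "2 * (\<bar>s (y + z)\<bar> * \<bar>s y\<bar>) \<le> (s (y + z))\<^sup>2 + (s y)\<^sup>2"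
        using sum_squares_bound[of "\<bar>s (y + z)\<bar>" "\<bar>s y\<bar>"] by (simp add: mult.assoc)
      moreover have "0 \<le> \<bar>s (y + z)\<bar> * \<bar>s y\<bar>" by simp
      ultimately have "\<bar>s (y + z)\<bar> * \<bar>s y\<bar> \<le> (s (y + z))\<^sup>2 + (s y)\<^sup>2" by linarith
      then show "norm (s (y + z) * s y) \<le> norm ((s (y + z))\<^sup>2 + (s y)\<^sup>2)" by (simp add: abs_mult)
    qed
  qed measurable
  have sq_int: "integrable lborel (\<lambda>y. (s (y + z) - s y)\<^sup>2)" for z
  proof -
    have "integrable lborel (\<lambda>y. (s (y + z))\<^sup>2 + (s y)\<^sup>2 - 2 * (s (y + z) * s y))"
      by (intro Bochner_Integration.integrable_add Bochner_Integration.integrable_diff shift2 s2 integrable_mult_right prod_int)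
    then show ?thesis by (simp add: power2_diff mult.assoc)
  qed
  have A_eq: "A z = E - (LINT y|lborel. (s (y + z) - s y)\<^sup>2) / 2" for z
  proof -
    have "(LINT y|lborel. (s (y + z) - s y)\<^sup>2) = (LINT y|lborel. (s (y + z))\<^sup>2 + (s y)\<^sup>2 - 2 * (s (y + z) * s y))"
      by (simp add: power2_diff mult.assoc)
    also have "\<dots> = (LINT y|lborel. (s (y + z))\<^sup>2) + E - 2 * A z"
      unfolding E_def A_def using shift2[of z] s2 prod_int[of z] by simp
    also have "(LINT y|lborel. (s (y + z))\<^sup>2) = E"
      unfolding E_def by (rule integral_translate[of "\<lambda>y. (s y)\<^sup>2"]) measurable
    finally show ?thesis by (simp add: field_simps)
  qed
  have abs_bound: "(LINT y|lborel. \<bar>s (y + z) * s y\<bar>) \<le> E" for z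
  proof -
    have "(LINT y|lborel. \<bar>s (y + z) * s y\<bar>) \<le> (LINT y|lborel. ((s (y + z))\<^sup>2 + (s y)\<^sup>2) / 2)"
    proof (intro integral_mono)
      show "integrable lborel (\<lambda>y. ((s (y + z))\<^sup>2 + (s y)\<^sup>2) / 2)" using shift2[of z] s2 by simp
      fix y show "\<bar>s (y + z) * s y\<bar> \<le> ((s (y + z))\<^sup>2 + (s y)\<^sup>2) / 2"
        using sum_squares_bound[of "\<bar>s (y + z)\<bar>" "\<bar>s y\<bar>"] by (simp add: abs_mult mult.assoc)
    qed (use prod_int[of z] in simp)
    also have "\<dots> = ((LINT y|lborel. (s (y + z))\<^sup>2) + E) / 2" unfolding E_def using shift2[of z] s2 by simp
    also have "(LINT y|lborel. (s (y + z))\<^sup>2) = E"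
      unfolding E_def by (rule integral_translate[of "\<lambda>y. (s y)\<^sup>2"]) measurable
    finally show ?thesis by simp
  qed
  have A_bound: "\<bar>A z\<bar> \<le> E" for z
    unfolding A_def using integral_abs_bound abs_bound[of z] by (rule order_trans)
  have A_lim: "(\<lambda>n. A (z n)) \<longlonglongrightarrow> E" if z: "z \<longlonglongrightarrow> 0" for z :: "nat \<Rightarrow> 'a"
  proof -
    have "(\<lambda>n. \<integral>\<^sup>+x. ennreal ((s (x + z n) - s x)\<^sup>2) \<partial>lborel) \<longlonglongrightarrow> 0"
      by (rule L2_translation_continuous[OF sm _ z]) (simp add: S)
    moreover have "(\<integral>\<^sup>+x. ennreal ((s (x + z n) - s x)\<^sup>2) \<partial>lborel) = ennreal (LINT x|lborel. (s (x + z n) - s x)\<^sup>2)" for n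
      by (intro nn_integral_eq_integral sq_int) simp
    ultimately have "(\<lambda>n. ennreal (LINT x|lborel. (s (x + z n) - s x)\<^sup>2)) \<longlonglongrightarrow> ennreal 0" by simp
    then have "(\<lambda>n. LINT x|lborel. (s (x + z n) - s x)\<^sup>2) \<longlonglongrightarrow> 0"
      by (subst (asm) tendsto_ennreal_iff) (auto intro!: always_eventually Bochner_Integration.integral_nonneg)
    then have "(\<lambda>n. E - (LINT x|lborel. (s (x + z n) - s x)\<^sup>2) / 2) \<longlonglongrightarrow> E - 0 / 2" by (intro tendsto_intros) auto
    then show ?thesis unfolding A_eq by simp
  qed
  let ?c = "sqrt (2 * pi) ^ DIM('a)"
  have Am [measurable]: "A \<in> borel_measurable borel"
  proof -
    have "(\<lambda>(z, y). s (y + z) * s y) \<in> borel_measurable (borel \<Otimes>\<^sub>M lborel)" by measurable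
    from lborel.borel_measurable_lebesgue_integral[OF this] show ?thesis unfolding A_def[abs_def] .
  qed
  have energy: "(LINT u|lborel. gauss (d n *\<^sub>R u) * (cmod (fourier s u))\<^sup>2) = ?c * (LINT w|lborel. A (d n *\<^sub>R w) * gauss w)" for n
  proof -
    let ?F = "\<lambda>w y. s (y + d n *\<^sub>R w) * s y * gauss w"
    have "integrable (lborel \<Otimes>\<^sub>M lborel) (\<lambda>(w, y). ?F w y)"
    proof (rule lborel_pair.Fubini_integrable)
      show m: "(\<lambda>(w, y). ?F w y) \<in> borel_measurable (lborel \<Otimes>\<^sub>M lborel)" by measurable
      show "AE w in lborel. integrable lborel (\<lambda>y. case (w, y) of (w, y) \<Rightarrow> ?F w y)"
        using prod_int by (intro AE_I2) simp
      show "integrable lborel (\<lambda>w. LINT y|lborel. norm (case (w, y) of (w, y) \<Rightarrow> ?F w y))"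
      proof (rule Bochner_Integration.integrable_bound)
        show "integrable lborel (\<lambda>w :: 'a. E * gauss w)" by (intro integrable_mult_right gauss_integrable)
        have "(\<lambda>(w, y). norm (?F w y)) \<in> borel_measurable (lborel \<Otimes>\<^sub>M lborel)" by measurable
        from lborel.borel_measurable_lebesgue_integral[OF this]
        show "(\<lambda>w. LINT y|lborel. norm (case (w, y) of (w, y) \<Rightarrow> ?F w y)) \<in> borel_measurable lborel" by simp
        show "AE w in lborel. norm (LINT y|lborel. norm (case (w, y) of (w, y) \<Rightarrow> ?F w y)) \<le> norm (E * gauss w)"
        proof (rule AE_I2)
          fix w :: 'a
          have "(LINT y|lborel. norm (?F w y)) = (LINT y|lborel. \<bar>s (y + d n *\<^sub>R w) * s y\<bar>) * gauss w"
            using gauss_bounds(1)[of w] by (simp add: abs_mult)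
          also have "\<dots> \<le> E * gauss w"
            using abs_bound[of "d n *\<^sub>R w"] gauss_bounds(1)[of w] by (intro mult_right_mono) auto
          finally have "(LINT y|lborel. norm (?F w y)) \<le> E * gauss w" .
          moreover have "0 \<le> (LINT y|lborel. norm (?F w y))" by (intro Bochner_Integration.integral_nonneg) simp
          ultimately show "norm (LINT y|lborel. norm (case (w, y) of (w, y) \<Rightarrow> ?F w y)) \<le> norm (E * gauss w)" by simp
        qed
      qed
    qed
    then have "(LINT y|lborel. LINT w|lborel. ?F w y) = (LINT w|lborel. LINT y|lborel. ?F w y)"
      by (rule lborel_pair.Fubini_integral)
    also have "\<dots> = (LINT w|lborel. A (d n *\<^sub>R w) * gauss w)" unfolding A_def by simp
    finally show ?thesis using fourier_gauss_energy[OF s d, of n] by simp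
  qed
  have lim: "(\<lambda>n. LINT w|lborel. A (d n *\<^sub>R w) * gauss w) \<longlonglongrightarrow> (LINT w|lborel. E * gauss (w :: 'a))"
  proof (rule integral_dominated_convergence[where w="\<lambda>w. E * gauss w"])
    show "integrable lborel (\<lambda>w :: 'a. E * gauss w)" by (intro integrable_mult_right gauss_integrable)
    show "AE w in lborel. (\<lambda>n. A (d n *\<^sub>R w) * gauss w) \<longlonglongrightarrow> E * gauss w"
    proof (rule AE_I2)
      fix w :: 'a
      have "(\<lambda>n. d n *\<^sub>R w) \<longlonglongrightarrow> 0 *\<^sub>R w" by (intro tendsto_intros d_lim)
      then have "(\<lambda>n. d n *\<^sub>R w) \<longlonglongrightarrow> 0" by simp
      from tendsto_mult[OF A_lim[OF this] tendsto_const] show "(\<lambda>n. A (d n *\<^sub>R w) * gauss w) \<longlonglongrightarrow> E * gauss w" .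
    qed
    show "AE w in lborel. norm (A (d n *\<^sub>R w) * gauss w) \<le> E * gauss w" for n
    proof (rule AE_I2)
      fix w :: 'a
      have "\<bar>A (d n *\<^sub>R w)\<bar> * gauss w \<le> E * gauss w"
        using A_bound gauss_bounds(1)[of w] by (intro mult_right_mono) auto
      then show "norm (A (d n *\<^sub>R w) * gauss w) \<le> E * gauss w"
        using gauss_bounds(1)[of w] by (simp add: abs_mult)
    qed
  qed measurable
  have cc: "?c * ?c = (2 * pi) ^ DIM('a)"
  proof -
    have "?c * ?c = (sqrt (2 * pi) * sqrt (2 * pi)) ^ DIM('a)" by (rule power_mult_distrib [symmetric])
    also have "sqrt (2 * pi) * sqrt (2 * pi) = 2 * pi" by (rule real_sqrt_mult_self[THEN trans]) simp
    finally show ?thesis .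
  qed
  have "(\<lambda>n. ?c * (LINT w|lborel. A (d n *\<^sub>R w) * gauss w)) \<longlonglongrightarrow> ?c * (LINT w|lborel. E * gauss (w :: 'a))"
    by (intro tendsto_intros lim)
  also have "?c * (LINT w|lborel. E * gauss (w :: 'a)) = (2 * pi) ^ DIM('a) * E"
  proof -
    have "?c * (LINT w|lborel. E * gauss (w :: 'a)) = (?c * ?c) * E"
      by (simp only: integral_mult_right_zero gauss_integral mult_ac)
    then show ?thesis by (simp only: cc)
  qed
  finally have "(\<lambda>n. ennreal (?c * (LINT w|lborel. A (d n *\<^sub>R w) * gauss w))) \<longlonglongrightarrow> ennreal ((2 * pi) ^ DIM('a) * E)"
    by (rule tendsto_ennrealI)
  moreover have "ennreal (?c * (LINT w|lborel. A (d n *\<^sub>R w) * gauss w)) \<le> (\<integral>\<^sup>+u. ennreal ((cmod (fourier s u))\<^sup>2) \<partial>lborel)" for n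
  proof -
    let ?g = "\<lambda>u. gauss (d n *\<^sub>R u) * (cmod (fourier s u))\<^sup>2"
    have g0: "0 \<le> ?g u" "?g u \<le> (cmod (fourier s u))\<^sup>2" for u
      using gauss_bounds[of "d n *\<^sub>R u"] by (auto intro: mult_left_le_one_le less_imp_le)
    have "ennreal (LINT u|lborel. ?g u) \<le> (\<integral>\<^sup>+u. ennreal (?g u) \<partial>lborel)"
    proof (cases "integrable lborel ?g")
      case True
      then have "(\<integral>\<^sup>+u. ennreal (?g u) \<partial>lborel) = ennreal (LINT u|lborel. ?g u)"
        by (rule nn_integral_eq_integral) (intro AE_I2 g0(1))
      then show ?thesis by (simp only: order_refl)
    next
      case False
      then have "(LINT u|lborel. ?g u) = 0" by (rule not_integrable_integral_eq)
      then show ?thesis by (simp only: ennreal_0 zero_le)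
    qed
    also have "\<dots> \<le> (\<integral>\<^sup>+u. ennreal ((cmod (fourier s u))\<^sup>2) \<partial>lborel)" by (intro nn_integral_mono ennreal_leI g0)
    finally show ?thesis unfolding energy .
  qed
  ultimately have "ennreal ((2 * pi) ^ DIM('a) * E) \<le> (\<integral>\<^sup>+u. ennreal ((cmod (fourier s u))\<^sup>2) \<partial>lborel)"
    by (intro LIMSEQ_le_const2) auto
  then show ?thesis unfolding S E_def [symmetric] using E0 by (simp add: ennreal_mult)
qed

section \<open>Convolution and its approximation error\<close>

definition convol :: "('a::euclidean_space \<Rightarrow> real) \<Rightarrow> ('a \<Rightarrow> real) \<Rightarrow> 'a \<Rightarrow> real" where
  "convol t h x = (LINT y|lborel. t (x - y) * h y)"

lemma convol_measurable [measurable]: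
  assumes [measurable]: "t \<in> borel_measurable borel" "h \<in> borel_measurable borel"
  shows "convol t h \<in> borel_measurable borel"
proof -
  have "(\<lambda>(x, y). t (x - y) * h y) \<in> borel_measurable (borel \<Otimes>\<^sub>M lborel)" by measurable
  from lborel.borel_measurable_lebesgue_integral[OF this] show ?thesis unfolding convol_def[abs_def] .
qed

lemma convol_L1_bound:
  fixes t h :: "'a::euclidean_space \<Rightarrow> real"
  assumes [measurable]: "t \<in> borel_measurable borel" "h \<in> borel_measurable borel"
  shows "(\<integral>\<^sup>+x. (\<integral>\<^sup>+y. ennreal \<bar>t (x - y)\<bar> * ennreal \<bar>h y\<bar> \<partial>lborel) \<partial>lborel)
     = (\<integral>\<^sup>+x. ennreal \<bar>t x\<bar> \<partial>lborel) * (\<integral>\<^sup>+y. ennreal \<bar>h y\<bar> \<partial>lborel)"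
proof -
  have "(\<integral>\<^sup>+x. (\<integral>\<^sup>+y. ennreal \<bar>t (x - y)\<bar> * ennreal \<bar>h y\<bar> \<partial>lborel) \<partial>lborel)
      = (\<integral>\<^sup>+y. (\<integral>\<^sup>+x. ennreal \<bar>t (x - y)\<bar> * ennreal \<bar>h y\<bar> \<partial>lborel) \<partial>lborel)"
    by (rule lborel_pair.Fubini'[symmetric]) measurable
  also have "\<dots> = (\<integral>\<^sup>+y. (\<integral>\<^sup>+x. ennreal \<bar>t x\<bar> \<partial>lborel) * ennreal \<bar>h y\<bar> \<partial>lborel)"
  proof (intro nn_integral_cong)
    fix y
    have "(\<integral>\<^sup>+x. ennreal \<bar>t (x - y)\<bar> * ennreal \<bar>h y\<bar> \<partial>lborel) = (\<integral>\<^sup>+x. ennreal \<bar>t (x + - y)\<bar> \<partial>lborel) * ennreal \<bar>h y\<bar>"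
      by (simp add: nn_integral_multc)
    also have "(\<integral>\<^sup>+x. ennreal \<bar>t (x + - y)\<bar> \<partial>lborel) = (\<integral>\<^sup>+x. ennreal \<bar>t x\<bar> \<partial>lborel)"
      by (rule nn_integral_translate[of "\<lambda>x. ennreal \<bar>t x\<bar>"]) measurable
    finally show "(\<integral>\<^sup>+x. ennreal \<bar>t (x - y)\<bar> * ennreal \<bar>h y\<bar> \<partial>lborel) = (\<integral>\<^sup>+x. ennreal \<bar>t x\<bar> \<partial>lborel) * ennreal \<bar>h y\<bar>" .
  qed
  also have "\<dots> = (\<integral>\<^sup>+x. ennreal \<bar>t x\<bar> \<partial>lborel) * (\<integral>\<^sup>+y. ennreal \<bar>h y\<bar> \<partial>lborel)"
    by (rule nn_integral_cmult) measurable
  finally show ?thesis .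
qed

text \<open>
  Young's inequality for the exponents 2 and 1: apply Cauchy-Schwarz to the factorisation
  \<open>\<bar>t\<bar> * \<bar>h\<bar> = (\<bar>t\<bar> * sqrt \<bar>h\<bar>) * sqrt \<bar>h\<bar>\<close> of the inner integrand, then integrate in \<open>x\<close> first.
\<close>

lemma convol_young:
  fixes t h :: "'a::euclidean_space \<Rightarrow> real"
  assumes [measurable]: "t \<in> borel_measurable borel" "h \<in> borel_measurable borel"
  shows "(\<integral>\<^sup>+x. (\<integral>\<^sup>+y. ennreal \<bar>t (x - y)\<bar> * ennreal \<bar>h y\<bar> \<partial>lborel)\<^sup>2 \<partial>lborel)
     \<le> (\<integral>\<^sup>+x. ennreal ((t x)\<^sup>2) \<partial>lborel) * (\<integral>\<^sup>+y. ennreal \<bar>h y\<bar> \<partial>lborel)\<^sup>2"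
proof -
  let ?H = "\<integral>\<^sup>+y. ennreal \<bar>h y\<bar> \<partial>lborel"
  have "(\<integral>\<^sup>+y. ennreal \<bar>t (x - y)\<bar> * ennreal \<bar>h y\<bar> \<partial>lborel)\<^sup>2
     \<le> (\<integral>\<^sup>+y. ennreal \<bar>(t (x - y))\<^sup>2\<bar> * ennreal \<bar>h y\<bar> \<partial>lborel) * ?H" for x
  proof -
    have "(\<integral>\<^sup>+y. ennreal (\<bar>t (x - y)\<bar> * sqrt \<bar>h y\<bar>) * ennreal (sqrt \<bar>h y\<bar>) \<partial>lborel)\<^sup>2
      \<le> (\<integral>\<^sup>+y. (ennreal (\<bar>t (x - y)\<bar> * sqrt \<bar>h y\<bar>))\<^sup>2 \<partial>lborel) * (\<integral>\<^sup>+y. (ennreal (sqrt \<bar>h y\<bar>))\<^sup>2 \<partial>lborel)"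
      by (rule Cauchy_Schwarz_nn_integral) measurable
    moreover have "ennreal (\<bar>t (x - y)\<bar> * sqrt \<bar>h y\<bar>) * ennreal (sqrt \<bar>h y\<bar>) = ennreal \<bar>t (x - y)\<bar> * ennreal \<bar>h y\<bar>" for y
      by (simp flip: ennreal_mult' add: mult.assoc)
    moreover have "(ennreal (\<bar>t (x - y)\<bar> * sqrt \<bar>h y\<bar>))\<^sup>2 = ennreal \<bar>(t (x - y))\<^sup>2\<bar> * ennreal \<bar>h y\<bar>" for y
      by (simp add: ennreal_power power_mult_distrib ennreal_mult)
    moreover have "(ennreal (sqrt \<bar>h y\<bar>))\<^sup>2 = ennreal \<bar>h y\<bar>" for y
      by (simp add: ennreal_power)
    ultimately show ?thesis by (simp only:)
  qed
  then have "(\<integral>\<^sup>+x. (\<integral>\<^sup>+y. ennreal \<bar>t (x - y)\<bar> * ennreal \<bar>h y\<bar> \<partial>lborel)\<^sup>2 \<partial>lborel)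
      \<le> (\<integral>\<^sup>+x. (\<integral>\<^sup>+y. ennreal \<bar>(t (x - y))\<^sup>2\<bar> * ennreal \<bar>h y\<bar> \<partial>lborel) * ?H \<partial>lborel)"
    by (intro nn_integral_mono)
  also have "\<dots> = (\<integral>\<^sup>+x. (\<integral>\<^sup>+y. ennreal \<bar>(t (x - y))\<^sup>2\<bar> * ennreal \<bar>h y\<bar> \<partial>lborel) \<partial>lborel) * ?H"
    by (rule nn_integral_multc) measurable
  also have "\<dots> = ((\<integral>\<^sup>+x. ennreal \<bar>(t x)\<^sup>2\<bar> \<partial>lborel) * ?H) * ?H"
    by (subst convol_L1_bound[of "\<lambda>x. (t x)\<^sup>2" h]) auto
  finally show ?thesis by (simp add: power2_eq_square mult.assoc)
qed

lemma convol_AE_integrable: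
  fixes t h :: "'a::euclidean_space \<Rightarrow> real"
  assumes [measurable]: "t \<in> borel_measurable borel" and h: "integrable lborel h"
    and t2: "(\<integral>\<^sup>+x. ennreal ((t x)\<^sup>2) \<partial>lborel) < \<infinity>"
  shows "AE x in lborel. integrable lborel (\<lambda>y. t (x - y) * h y)"
proof -
  have [measurable]: "h \<in> borel_measurable borel" using borel_measurable_integrable[OF h] by simp
  have H: "(\<integral>\<^sup>+y. ennreal \<bar>h y\<bar> \<partial>lborel) < \<infinity>" using h by (simp add: integrable_iff_bounded)
  have "(\<integral>\<^sup>+x. (\<integral>\<^sup>+y. ennreal \<bar>t (x - y)\<bar> * ennreal \<bar>h y\<bar> \<partial>lborel)\<^sup>2 \<partial>lborel) < \<infinity>"
    by (rule le_less_trans[OF convol_young]) (use t2 H in \<open>auto simp: ennreal_mult_less_top power2_eq_square\<close>)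
  then have "AE x in lborel. (\<integral>\<^sup>+y. ennreal \<bar>t (x - y)\<bar> * ennreal \<bar>h y\<bar> \<partial>lborel)\<^sup>2 \<noteq> \<infinity>"
    by (intro nn_integral_PInf_AE) auto
  then show ?thesis
  proof eventually_elim
    case (elim x)
    show ?case
    proof (rule integrableI_bounded)
      have "(\<integral>\<^sup>+y. ennreal \<bar>t (x - y)\<bar> * ennreal \<bar>h y\<bar> \<partial>lborel) < \<infinity>"
        using elim by (auto simp: less_top power2_eq_square ennreal_mult_eq_top_iff)
      then show "(\<integral>\<^sup>+y. ennreal (norm (t (x - y) * h y)) \<partial>lborel) < \<infinity>" by (simp add: abs_mult ennreal_mult')
    qed measurable
  qed
qed

lemma convol_L2_bound:
  fixes t h :: "'a::euclidean_space \<Rightarrow> real"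
  assumes [measurable]: "t \<in> borel_measurable borel" and h: "integrable lborel h"
  shows "(\<integral>\<^sup>+x. ennreal ((convol t h x)\<^sup>2) \<partial>lborel) \<le> (\<integral>\<^sup>+x. ennreal ((t x)\<^sup>2) \<partial>lborel) * ennreal ((L1_norm h)\<^sup>2)"
proof -
  have [measurable]: "h \<in> borel_measurable borel" using borel_measurable_integrable[OF h] by simp
  have "(\<integral>\<^sup>+x. ennreal ((convol t h x)\<^sup>2) \<partial>lborel)
     \<le> (\<integral>\<^sup>+x. (\<integral>\<^sup>+y. ennreal \<bar>t (x - y)\<bar> * ennreal \<bar>h y\<bar> \<partial>lborel)\<^sup>2 \<partial>lborel)"
  proof (intro nn_integral_mono)
    fix x
    have "ennreal \<bar>convol t h x\<bar> \<le> (\<integral>\<^sup>+y. ennreal \<bar>t (x - y)\<bar> * ennreal \<bar>h y\<bar> \<partial>lborel)"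
    proof (cases "integrable lborel (\<lambda>y. t (x - y) * h y)")
      case True
      then show ?thesis
        using integral_norm_bound_ennreal[OF True] by (simp add: convol_def abs_mult ennreal_mult')
    qed (simp add: convol_def not_integrable_integral_eq)
    then have "(ennreal \<bar>convol t h x\<bar>)\<^sup>2 \<le> (\<integral>\<^sup>+y. ennreal \<bar>t (x - y)\<bar> * ennreal \<bar>h y\<bar> \<partial>lborel)\<^sup>2"
      by (intro power_mono) auto
    then show "ennreal ((convol t h x)\<^sup>2) \<le> (\<integral>\<^sup>+y. ennreal \<bar>t (x - y)\<bar> * ennreal \<bar>h y\<bar> \<partial>lborel)\<^sup>2"
      by (simp add: ennreal_power)
  qed
  also have "\<dots> \<le> (\<integral>\<^sup>+x. ennreal ((t x)\<^sup>2) \<partial>lborel) * (\<integral>\<^sup>+y. ennreal \<bar>h y\<bar> \<partial>lborel)\<^sup>2"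
    by (rule convol_young) measurable
  also have "(\<integral>\<^sup>+y. ennreal \<bar>h y\<bar> \<partial>lborel) = ennreal (L1_norm h)"
    unfolding L1_norm_def using h by (intro nn_integral_eq_integral) auto
  also have "(ennreal (L1_norm h))\<^sup>2 = ennreal ((L1_norm h)\<^sup>2)"
    by (rule ennreal_power) (simp add: L1_norm_def)
  finally show ?thesis .
qed

lemma convol_integrable:
  fixes t h :: "'a::euclidean_space \<Rightarrow> real"
  assumes t: "integrable lborel t" and h: "integrable lborel h"
  shows "integrable (lborel \<Otimes>\<^sub>M lborel) (\<lambda>(x, y). t (x - y) * h y)"
    and "integrable lborel (convol t h)"
    and "fourier (convol t h) u = fourier t u * fourier h u"
proof -
  have [measurable]: "h \<in> borel_measurable borel" "t \<in> borel_measurable borel"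
    using borel_measurable_integrable[OF h] borel_measurable_integrable[OF t] by simp_all
  have fin: "(\<integral>\<^sup>+x. (\<integral>\<^sup>+y. ennreal \<bar>t (x - y)\<bar> * ennreal \<bar>h y\<bar> \<partial>lborel) \<partial>lborel) < \<infinity>"
    using t h by (subst convol_L1_bound) (auto simp: integrable_iff_bounded ennreal_mult_less_top)
  show int: "integrable (lborel \<Otimes>\<^sub>M lborel) (\<lambda>(x, y). t (x - y) * h y)"
  proof (rule integrableI_bounded)
    have "(\<integral>\<^sup>+z. ennreal (norm (case z of (x, y) \<Rightarrow> t (x - y) * h y)) \<partial>(lborel \<Otimes>\<^sub>M lborel))
      = (\<integral>\<^sup>+x. (\<integral>\<^sup>+y. ennreal \<bar>t (x - y)\<bar> * ennreal \<bar>h y\<bar> \<partial>lborel) \<partial>lborel)"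
      by (subst lborel.nn_integral_fst [symmetric]) (auto simp: abs_mult ennreal_mult')
    then show "(\<integral>\<^sup>+z. ennreal (norm (case z of (x, y) \<Rightarrow> t (x - y) * h y)) \<partial>(lborel \<Otimes>\<^sub>M lborel)) < \<infinity>"
      using fin by simp
  qed measurable
  show "integrable lborel (convol t h)"
    using lborel_pair.integrable_fst[OF int] unfolding convol_def[abs_def] .
  let ?f = "\<lambda>x y. complex_of_real (t (x - y) * h y) * iexp (x \<bullet> u)"
  have fint: "integrable (lborel \<Otimes>\<^sub>M lborel) (\<lambda>(x, y). ?f x y)"
    by (rule Bochner_Integration.integrable_bound[OF int]) (auto simp: norm_mult)
  have "fourier (convol t h) u = (LINT x|lborel. LINT y|lborel. ?f x y)"
    unfolding fourier_def convol_def
    by (intro Bochner_Integration.integral_cong refl)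
       (simp only: integral_complex_of_real [symmetric] integral_mult_left_zero)
  also have "\<dots> = (LINT y|lborel. LINT x|lborel. ?f x y)"
    by (rule lborel_pair.Fubini_integral[OF fint, symmetric])
  also have "\<dots> = (LINT y|lborel. fourier t u * (complex_of_real (h y) * iexp (y \<bullet> u)))"
  proof (intro Bochner_Integration.integral_cong refl)
    fix y
    have "(LINT x|lborel. ?f x y) = (LINT x|lborel. ?f (x + y) y)"
      by (rule integral_translate[symmetric, of "\<lambda>x. ?f x y"]) measurable
    also have "\<dots> = (LINT x|lborel. (complex_of_real (t x) * iexp (x \<bullet> u)) * (complex_of_real (h y) * iexp (y \<bullet> u)))"
      by (intro Bochner_Integration.integral_cong refl)
         (simp add: inner_add_left distrib_left exp_add mult_ac)
    also have "\<dots> = fourier t u * (complex_of_real (h y) * iexp (y \<bullet> u))"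
      unfolding fourier_def by (rule integral_mult_left_zero)
    finally show "(LINT x|lborel. ?f x y) = fourier t u * (complex_of_real (h y) * iexp (y \<bullet> u))" .
  qed
  also have "\<dots> = fourier t u * fourier h u"
    unfolding fourier_def[of h] by (rule integral_mult_right_zero)
  finally show "fourier (convol t h) u = fourier t u * fourier h u" .
qed

lemma L2_normD:
  fixes f :: "'a::euclidean_space \<Rightarrow> 'b::real_normed_vector"
  assumes "in_L2 f"
  shows "(\<integral>\<^sup>+x. ennreal ((norm (f x))\<^sup>2) \<partial>lborel) = ennreal ((L2_norm f)\<^sup>2)"
proof -
  have "(\<integral>\<^sup>+x. ennreal ((norm (f x))\<^sup>2) \<partial>lborel) = ennreal (LINT x|lborel. (norm (f x))\<^sup>2)"
    using assms unfolding in_L2_def by (intro nn_integral_eq_integral) auto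
  also have "(LINT x|lborel. (norm (f x))\<^sup>2) = (L2_norm f)\<^sup>2"
    unfolding L2_norm_def by (subst real_sqrt_pow2) (auto intro!: Bochner_Integration.integral_nonneg)
  finally show ?thesis .
qed

lemma cmod_power2_sum_le: "(cmod (a + b))\<^sup>2 \<le> 2 * (cmod a)\<^sup>2 + 2 * (cmod b)\<^sup>2"
proof -
  have "(cmod (a + b))\<^sup>2 \<le> (cmod a + cmod b)\<^sup>2" by (intro power_mono norm_triangle_ineq) auto
  also have "\<dots> \<le> 2 * (cmod a)\<^sup>2 + 2 * (cmod b)\<^sup>2" by (rule power2_sum_le)
  finally show ?thesis .
qed

lemma in_L2_iff_nn:
  fixes f :: "'a::euclidean_space \<Rightarrow> real"
  shows "in_L2 f \<longleftrightarrow> f \<in> borel_measurable borel \<and> (\<integral>\<^sup>+x. ennreal ((f x)\<^sup>2) \<partial>lborel) < \<infinity>"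
  unfolding in_L2_def by (auto simp: integrable_iff_bounded)

text \<open>
  Let \<open>t j\<close> be the integrable functions that define the Plancherel transform \<open>F\<close> of \<open>k\<close>. For them the
  Fourier transform of \<open>h - convol (t j) h\<close> is \<open>(1 - fourier (t j)) * fourier h\<close>, and Plancherel's inequality
  applies. Replacing \<open>t j\<close> by \<open>k\<close> costs a term controlled by Young's inequality, and replacing
  \<open>fourier (t j)\<close> by \<open>F\<close> one controlled by \<open>\<bar>fourier h\<bar> \<le> L1_norm h\<close>. Each replacement doubles the main
  term, whence the factor 4.
\<close>

lemma convol_error_le:
  fixes k h :: "'a::euclidean_space \<Rightarrow> real"
  assumes k: "plancherel_transform k F" and h1: "in_L1 h" and h2: "in_L2 h"
  shows "ennreal ((2 * pi) ^ DIM('a)) * (\<integral>\<^sup>+x. ennreal ((h x - convol k h x)\<^sup>2) \<partial>lborel)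
    \<le> 4 * (\<integral>\<^sup>+u. ennreal ((cmod (1 - F u))\<^sup>2 * (cmod (fourier h u))\<^sup>2) \<partial>lborel)"
proof -
  let ?P = "ennreal ((2 * pi) ^ DIM('a))" and ?H = "(L1_norm h)\<^sup>2"
  have kL2: "in_L2 k" and FL2: "in_L2 F" using k by (auto simp: plancherel_transform_def)
  obtain t where t1: "\<And>j::nat. in_L1 (t j)" and t2: "\<And>j. in_L2 (t j)"
    and tk: "(\<lambda>j. L2_norm (\<lambda>x. t j x - k x)) \<longlonglongrightarrow> 0"
    and tF2: "\<And>j. in_L2 (\<lambda>u. fourier (t j) u - F u)"
    and tF: "(\<lambda>j. L2_norm (\<lambda>u. fourier (t j) u - F u)) \<longlonglongrightarrow> 0"
    using k unfolding plancherel_transform_def by blast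
  have hi: "integrable lborel h" using h1 by (simp add: in_L1_def)
  have ti: "integrable lborel (t j)" for j using t1 by (simp add: in_L1_def)
  have km: "k \<in> borel_measurable borel" using kL2 by (simp add: in_L2_def)
  have [measurable]: "h \<in> borel_measurable borel" "k \<in> borel_measurable borel" "F \<in> borel_measurable borel"
    using h2 kL2 FL2 by (auto simp: in_L2_def)
  have tm [measurable]: "t j \<in> borel_measurable borel" for j using t2 by (auto simp: in_L2_def)
  have h_fin: "(\<integral>\<^sup>+x. ennreal ((h x)\<^sup>2) \<partial>lborel) < \<infinity>" using h2 by (simp add: in_L2_iff_nn)
  have k_fin: "(\<integral>\<^sup>+x. ennreal ((k x)\<^sup>2) \<partial>lborel) < \<infinity>" using kL2 by (simp add: in_L2_iff_nn)
  have t_fin: "(\<integral>\<^sup>+x. ennreal ((t j x)\<^sup>2) \<partial>lborel) < \<infinity>" for j using t2[of j] by (simp add: in_L2_iff_nn)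
  have tk2: "in_L2 (\<lambda>x. t j x - k x)" for j
    unfolding in_L2_iff_nn
  proof
    have "(\<integral>\<^sup>+x. ennreal ((t j x + - k x)\<^sup>2) \<partial>lborel) \<le> 2 * (\<integral>\<^sup>+x. ennreal ((t j x)\<^sup>2) \<partial>lborel) + 2 * (\<integral>\<^sup>+x. ennreal ((- k x)\<^sup>2) \<partial>lborel)"
      by (rule L2_triangle) measurable
    also have "\<dots> < \<infinity>" using t_fin[of j] k_fin by (simp add: ennreal_mult_less_top)
    finally show "(\<integral>\<^sup>+x. ennreal ((t j x - k x)\<^sup>2) \<partial>lborel) < \<infinity>" by simp
  qed measurable
  define I where "I = (\<integral>\<^sup>+u. ennreal ((cmod (1 - F u))\<^sup>2 * (cmod (fourier h u))\<^sup>2) \<partial>lborel)"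
  define a where "a = (\<lambda>j. (L2_norm (\<lambda>x. t j x - k x))\<^sup>2 * ?H)"
  define b where "b = (\<lambda>j. (L2_norm (\<lambda>u. fourier (t j) u - F u))\<^sup>2 * ?H)"
  have bound: "?P * (\<integral>\<^sup>+x. ennreal ((h x - convol k h x)\<^sup>2) \<partial>lborel)
     \<le> 4 * I + (4 * ennreal (b j) + ?P * (2 * ennreal (a j)))" for j
  proof -
    let ?v = "\<lambda>x. h x - convol (t j) h x"
    have tc: "(\<integral>\<^sup>+x. ennreal ((convol (\<lambda>x. t j x - k x) h x)\<^sup>2) \<partial>lborel) \<le> ennreal (a j)"
    proof -
      have "(\<integral>\<^sup>+x. ennreal ((convol (\<lambda>x. t j x - k x) h x)\<^sup>2) \<partial>lborel)
         \<le> (\<integral>\<^sup>+x. ennreal ((t j x - k x)\<^sup>2) \<partial>lborel) * ennreal ?H"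
        by (rule convol_L2_bound[OF _ hi]) measurable
      also have "(\<integral>\<^sup>+x. ennreal ((t j x - k x)\<^sup>2) \<partial>lborel) = ennreal ((L2_norm (\<lambda>x. t j x - k x))\<^sup>2)"
        using L2_normD[OF tk2[of j]] by simp
      finally show ?thesis by (simp add: a_def ennreal_mult)
    qed
    have vi: "integrable lborel ?v" using hi convol_integrable(2)[OF ti hi] by simp
    have v_fin: "(\<integral>\<^sup>+x. ennreal ((?v x)\<^sup>2) \<partial>lborel) < \<infinity>"
    proof -
      have "(\<integral>\<^sup>+x. ennreal ((h x + - convol (t j) h x)\<^sup>2) \<partial>lborel)
         \<le> 2 * (\<integral>\<^sup>+x. ennreal ((h x)\<^sup>2) \<partial>lborel) + 2 * (\<integral>\<^sup>+x. ennreal ((- convol (t j) h x)\<^sup>2) \<partial>lborel)"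
        by (rule L2_triangle) measurable
      also have "(\<integral>\<^sup>+x. ennreal ((- convol (t j) h x)\<^sup>2) \<partial>lborel) \<le> (\<integral>\<^sup>+x. ennreal ((t j x)\<^sup>2) \<partial>lborel) * ennreal ?H"
        unfolding power2_minus by (rule convol_L2_bound[OF _ hi]) measurable
      also have "2 * (\<integral>\<^sup>+x. ennreal ((h x)\<^sup>2) \<partial>lborel) + 2 * ((\<integral>\<^sup>+x. ennreal ((t j x)\<^sup>2) \<partial>lborel) * ennreal ?H) < \<infinity>"
        using t_fin[of j] h_fin by (simp add: ennreal_mult_less_top)
      finally show ?thesis by (simp add: add_left_mono mult_left_mono)
    qed
    have v2: "integrable lborel (\<lambda>x. (?v x)\<^sup>2)"
      by (rule integrableI_bounded) (use v_fin in auto)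
    have fv: "fourier ?v u = (1 - fourier (t j) u) * fourier h u" for u
    proof -
      have "fourier ?v u = (LINT x|lborel. complex_of_real (h x) * iexp (x \<bullet> u) - complex_of_real (convol (t j) h x) * iexp (x \<bullet> u))"
        unfolding fourier_def by (intro Bochner_Integration.integral_cong refl) (simp add: left_diff_distrib)
      also have "\<dots> = fourier h u - fourier (convol (t j) h) u"
        unfolding fourier_def
        by (rule Bochner_Integration.integral_diff) (intro fourier_integrable hi convol_integrable(2)[OF ti hi])+
      finally show ?thesis unfolding convol_integrable(3)[OF ti hi] by (simp add: algebra_simps)
    qed
    have "?P * (\<integral>\<^sup>+x. ennreal ((?v x)\<^sup>2) \<partial>lborel) \<le> (\<integral>\<^sup>+u. ennreal ((cmod (fourier ?v u))\<^sup>2) \<partial>lborel)"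
      by (rule plancherel_le[OF vi v2])
    also have "\<dots> \<le> (\<integral>\<^sup>+u. 2 * ennreal ((cmod (1 - F u))\<^sup>2 * (cmod (fourier h u))\<^sup>2)
        + 2 * (ennreal ((norm (fourier (t j) u - F u))\<^sup>2) * ennreal ?H) \<partial>lborel)"
    proof (intro nn_integral_mono)
      fix u
      have fh: "(cmod (fourier h u))\<^sup>2 \<le> ?H" using fourier_bound[OF hi, of u] by (intro power_mono) auto
      have "(cmod (fourier ?v u))\<^sup>2 = (cmod ((1 - F u) + (F u - fourier (t j) u)))\<^sup>2 * (cmod (fourier h u))\<^sup>2"
        unfolding fv by (simp add: norm_mult power_mult_distrib)
      also have "\<dots> \<le> (2 * (cmod (1 - F u))\<^sup>2 + 2 * (cmod (F u - fourier (t j) u))\<^sup>2) * (cmod (fourier h u))\<^sup>2"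
        by (intro mult_right_mono cmod_power2_sum_le) simp
      also have "\<dots> = 2 * ((cmod (1 - F u))\<^sup>2 * (cmod (fourier h u))\<^sup>2) + 2 * ((cmod (F u - fourier (t j) u))\<^sup>2 * (cmod (fourier h u))\<^sup>2)"
        by (simp add: algebra_simps)
      also have "\<dots> \<le> 2 * ((cmod (1 - F u))\<^sup>2 * (cmod (fourier h u))\<^sup>2) + 2 * ((cmod (F u - fourier (t j) u))\<^sup>2 * ?H)"
        by (intro add_left_mono mult_left_mono fh) auto
      finally have "ennreal ((cmod (fourier ?v u))\<^sup>2)
        \<le> ennreal (2 * ((cmod (1 - F u))\<^sup>2 * (cmod (fourier h u))\<^sup>2) + 2 * ((cmod (F u - fourier (t j) u))\<^sup>2 * ?H))"
        by (rule ennreal_leI)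
      then show "ennreal ((cmod (fourier ?v u))\<^sup>2) \<le> 2 * ennreal ((cmod (1 - F u))\<^sup>2 * (cmod (fourier h u))\<^sup>2)
        + 2 * (ennreal ((norm (fourier (t j) u - F u))\<^sup>2) * ennreal ?H)"
        by (simp add: numeral_mult_ennreal norm_minus_commute flip: ennreal_mult' ennreal_plus)
    qed
    also have "\<dots> = 2 * I + 2 * ((\<integral>\<^sup>+u. ennreal ((norm (fourier (t j) u - F u))\<^sup>2) \<partial>lborel) * ennreal ?H)"
      unfolding I_def by (simp add: nn_integral_add nn_integral_cmult nn_integral_multc)
    also have "(\<integral>\<^sup>+u. ennreal ((norm (fourier (t j) u - F u))\<^sup>2) \<partial>lborel) * ennreal ?H = ennreal (b j)"
      unfolding L2_normD[OF tF2[of j]] b_def by (simp add: ennreal_mult)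
    finally have V: "?P * (\<integral>\<^sup>+x. ennreal ((?v x)\<^sup>2) \<partial>lborel) \<le> 2 * I + 2 * ennreal (b j)" .
    have "(\<integral>\<^sup>+x. ennreal ((h x - convol k h x)\<^sup>2) \<partial>lborel) = (\<integral>\<^sup>+x. ennreal ((?v x + convol (\<lambda>x. t j x - k x) h x)\<^sup>2) \<partial>lborel)"
    proof (rule nn_integral_cong_AE)
      show "AE x in lborel. ennreal ((h x - convol k h x)\<^sup>2) = ennreal ((?v x + convol (\<lambda>x. t j x - k x) h x)\<^sup>2)"
        using convol_AE_integrable[OF tm hi t_fin[of j]] convol_AE_integrable[OF km hi k_fin]
      proof eventually_elim
        case (elim x)
        have "convol (\<lambda>x. t j x - k x) h x = convol (t j) h x - convol k h x"
          unfolding convol_def left_diff_distrib by (rule Bochner_Integration.integral_diff[OF elim])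
        then show ?case by simp
      qed
    qed
    also have "\<dots> \<le> 2 * (\<integral>\<^sup>+x. ennreal ((?v x)\<^sup>2) \<partial>lborel) + 2 * (\<integral>\<^sup>+x. ennreal ((convol (\<lambda>x. t j x - k x) h x)\<^sup>2) \<partial>lborel)"
      by (rule L2_triangle) measurable
    also have "\<dots> \<le> 2 * (\<integral>\<^sup>+x. ennreal ((?v x)\<^sup>2) \<partial>lborel) + 2 * ennreal (a j)"
      by (intro add_left_mono mult_left_mono tc) simp
    finally have "?P * (\<integral>\<^sup>+x. ennreal ((h x - convol k h x)\<^sup>2) \<partial>lborel)
       \<le> ?P * (2 * (\<integral>\<^sup>+x. ennreal ((?v x)\<^sup>2) \<partial>lborel) + 2 * ennreal (a j))"
      by (rule mult_left_mono) simp
    also have "\<dots> = 2 * (?P * (\<integral>\<^sup>+x. ennreal ((?v x)\<^sup>2) \<partial>lborel)) + ?P * (2 * ennreal (a j))"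
      by (simp only: distrib_left mult.left_commute)
    also have "\<dots> \<le> 2 * (2 * I + 2 * ennreal (b j)) + ?P * (2 * ennreal (a j))"
      by (intro add_right_mono mult_left_mono V) simp
    also have "\<dots> = 4 * I + (4 * ennreal (b j) + ?P * (2 * ennreal (a j)))"
    proof -
      have "2 * (2 * x) = 4 * x" for x :: ennreal by (simp flip: mult.assoc)
      then show ?thesis by (simp only: distrib_left add.assoc)
    qed
    finally show ?thesis .
  qed
  have a0: "a \<longlonglongrightarrow> 0" and b0: "b \<longlonglongrightarrow> 0"
    unfolding a_def b_def using tendsto_mult[OF tendsto_power[OF tk, of 2] tendsto_const[of ?H]]
      tendsto_mult[OF tendsto_power[OF tF, of 2] tendsto_const[of ?H]] by simp_all
  have nn: "0 \<le> a j" "0 \<le> b j" for j by (simp_all add: a_def b_def)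
  have "(\<lambda>j. 4 * I + ennreal (4 * b j + (2 * pi) ^ DIM('a) * (2 * a j))) \<longlonglongrightarrow> 4 * I + ennreal (4 * 0 + (2 * pi) ^ DIM('a) * (2 * 0))"
    by (intro tendsto_add tendsto_const tendsto_ennrealI tendsto_mult a0 b0)
  moreover have "4 * ennreal (b j) + ?P * (2 * ennreal (a j)) = ennreal (4 * b j + (2 * pi) ^ DIM('a) * (2 * a j))" for j
  proof -
    have "2 * ennreal (a j) = ennreal (2 * a j)" "4 * ennreal (b j) = ennreal (4 * b j)" using nn by (auto intro: numeral_mult_ennreal)
    moreover have "?P * ennreal (2 * a j) = ennreal ((2 * pi) ^ DIM('a) * (2 * a j))" using nn by (simp add: ennreal_mult)
    ultimately show ?thesis using nn by (simp add: ennreal_plus)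
  qed
  ultimately have "(\<lambda>j. 4 * I + (4 * ennreal (b j) + ?P * (2 * ennreal (a j)))) \<longlonglongrightarrow> 4 * I" by simp
  then show ?thesis unfolding I_def [symmetric] using bound by (intro LIMSEQ_le_const) auto
qed

section \<open>The two-sample model\<close>

lemma intensity_measure_eq:
  assumes [measurable]: "f \<in> borel_measurable borel" and "0 \<le> n"
  shows "intensity_measure n f = density lborel (\<lambda>x. ennreal (n * f x))"
proof (rule measure_eqI)
  fix A assume "A \<in> sets (intensity_measure n f)"
  then have [measurable]: "A \<in> sets borel" by (simp add: intensity_measure_def)
  have "emeasure (intensity_measure n f) A = ennreal n * (\<integral>\<^sup>+x. ennreal (f x) * indicator A x \<partial>lborel)"
    unfolding intensity_measure_def by (subst emeasure_density) (auto simp: nn_integral_scale_measure)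
  also have "\<dots> = (\<integral>\<^sup>+x. ennreal n * (ennreal (f x) * indicator A x) \<partial>lborel)"
    by (rule nn_integral_cmult [symmetric]) measurable
  also have "\<dots> = emeasure (density lborel (\<lambda>x. ennreal (n * f x))) A"
    using assms(2) by (subst emeasure_density) (auto simp: ennreal_mult' mult.assoc)
  finally show "emeasure (intensity_measure n f) A = emeasure (density lborel (\<lambda>x. ennreal (n * f x))) A" .
qed (simp add: intensity_measure_def)

lemma intensity_le_sup_norm:
  assumes "intensity f"
  shows "f x \<le> sup_norm f"
proof -
  have "bdd_above (range (\<lambda>x. \<bar>f x\<bar>))" using assms by (simp add: intensity_def)
  from cSUP_upper[OF UNIV_I this, of x] show ?thesis
    using assms by (simp add: sup_norm_def intensity_def)
qed

locale two_sample =
  fixes n :: real and f g :: "'a::euclidean_space \<Rightarrow> real"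
    and P :: "('a set \<times> 'a set) measure" and R' R'' :: real
  assumes n: "0 < n" and f: "intensity f" and g: "intensity g"
    and model: "prob_space P" "sets P = sets (config_space \<Otimes>\<^sub>M config_space)"
      "poisson_process P fst (intensity_measure n f)" "poisson_process P snd (intensity_measure n g)"
      "prob_space.indep_var P config_space fst config_space snd"
    and L1_le: "L1_norm f \<le> R'" "L1_norm g \<le> R'" and sup_le: "sup_norm f \<le> R''" "sup_norm g \<le> R''"
begin

definition l :: "'a \<Rightarrow> real" where "l x = n * (f x + g x)"
definition h :: "'a \<Rightarrow> real" where "h x = f x - g x"
text \<open>
  Where \<open>f + g\<close> vanishes the quotient is 0, an arbitrary value on a null set of \<open>Lam\<close>.
\<close>

definition \<theta> :: "'a \<Rightarrow> real" where "\<theta> x = (f x - g x) / (f x + g x)"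
definition L :: "bool \<Rightarrow> 'a measure" where "L b = intensity_measure n (if b then f else g)"

lemma nonneg: "0 \<le> f x" "0 \<le> g x" using f g by (simp_all add: intensity_def)
lemma integrable_fg: "integrable lborel f" "integrable lborel g" using f g by (simp_all add: intensity_def)
lemma measurable_fg [measurable]: "f \<in> borel_measurable borel" "g \<in> borel_measurable borel"
  using borel_measurable_integrable[OF integrable_fg(1)] borel_measurable_integrable[OF integrable_fg(2)] by simp_all

lemma l_bounds: "0 \<le> l x" "l x \<le> 2 * n * R''"
proof -
  show "0 \<le> l x" using nonneg n by (simp add: l_def)
  have "f x + g x \<le> 2 * R''"
    using intensity_le_sup_norm[OF f, of x] intensity_le_sup_norm[OF g, of x] sup_le by linarith
  then have "n * (f x + g x) \<le> n * (2 * R'')" using n by (intro mult_left_mono) auto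
  then show "l x \<le> 2 * n * R''" by (simp add: l_def)
qed

lemma l_theta: "l x * \<theta> x = n * h x"
  using nonneg[of x] by (cases "f x + g x = 0") (auto simp: l_def \<theta>_def h_def)

lemma h_measurable [measurable]: "h \<in> borel_measurable borel" unfolding h_def[abs_def] by measurable

lemma l_density: "finite_density l"
proof
  show "0 \<le> l x" for x by (rule l_bounds)
  show "integrable lborel l" unfolding l_def[abs_def] using integrable_fg by simp
qed

sublocale signed_poisson_pair P L l \<theta>
proof (intro signed_poisson_pair.intro signed_poisson_pair_axioms.intro l_density)
  have fm: "finite_measure (L b)" for b
  proof
    have ib: "integrable lborel (if b then f else g)" using integrable_fg by simp
    have "emeasure (L b) (space (L b)) = (\<integral>\<^sup>+x. ennreal (n * (if b then f else g) x) \<partial>lborel)"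
      unfolding L_def using n by (subst (1 2) intensity_measure_eq) (auto simp: emeasure_density)
    also have "\<dots> = ennreal (LINT x|lborel. n * (if b then f else g) x)"
      using ib nonneg n by (intro nn_integral_eq_integral) auto
    finally show "emeasure (L b) (space (L b)) \<noteq> \<infinity>" by simp
  qed
  show "poisson_pair P L"
  proof (rule poisson_pair.intro)
    show "prob_space P" "sets P = sets (config_space \<Otimes>\<^sub>M config_space)" "prob_space.indep_var P config_space fst config_space snd"
      by (fact model)+
    show "poisson_process P (proc b) (L b)" for b using model(3,4) by (simp add: proc_def L_def)
    show "sets (L b) = sets borel" for b by (simp add: L_def intensity_measure_def)
    show "finite_measure (L b)" for b by (rule fm)
  qed
  interpret finite_density l by (rule l_density)
  show tm [measurable]: "\<theta> \<in> borel_measurable borel" unfolding \<theta>_def[abs_def] by measurable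
  show "\<bar>\<theta> x\<bar> \<le> 1" for x
    using nonneg[of x] by (auto simp: \<theta>_def divide_le_eq abs_le_iff)
  show "L b = density Lam (\<lambda>x. ennreal ((1 + sg b * \<theta> x) / 2))" for b
  proof -
    have "l x * ((1 + sg b * \<theta> x) / 2) = n * (if b then f else g) x" for x
    proof -
      have "l x * ((1 + sg b * \<theta> x) / 2) = (l x + sg b * (l x * \<theta> x)) / 2" by (simp add: algebra_simps)
      also have "\<dots> = n * (if b then f else g) x" unfolding l_theta by (simp add: l_def h_def sg_def algebra_simps)
      finally show ?thesis .
    qed
    then have "ennreal (n * (if b then f else g) x) = ennreal (l x) * ennreal ((1 + sg b * \<theta> x) / 2)" for x
      using l_bounds(1)[of x] by (simp add: ennreal_mult' [symmetric])
    then show ?thesis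
      unfolding L_def Lam_def using n by (subst intensity_measure_eq) (auto simp: density_density_eq)
  qed
qed

lemma nn_integral_Lam_le:
  assumes [measurable]: "F \<in> borel_measurable borel"
  shows "(\<integral>\<^sup>+x. F x \<partial>Lam) \<le> ennreal (2 * n * R'') * (\<integral>\<^sup>+x. F x \<partial>lborel)"
proof -
  have "(\<integral>\<^sup>+x. F x \<partial>Lam) = (\<integral>\<^sup>+x. ennreal (l x) * F x \<partial>lborel)"
    unfolding Lam_def by (rule nn_integral_density) auto
  also have "\<dots> \<le> (\<integral>\<^sup>+x. ennreal (2 * n * R'') * F x \<partial>lborel)"
    by (intro nn_integral_mono mult_right_mono ennreal_leI l_bounds) auto
  also have "\<dots> = ennreal (2 * n * R'') * (\<integral>\<^sup>+x. F x \<partial>lborel)" by (rule nn_integral_cmult) auto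
  finally show ?thesis .
qed

lemma emeasure_Lam_le: "emeasure Lam UNIV \<le> ennreal (2 * n * R')"
proof -
  have "emeasure Lam UNIV = (\<integral>\<^sup>+x. ennreal (l x) \<partial>lborel)" unfolding Lam_def by (simp add: emeasure_density)
  also have "\<dots> = ennreal (LINT x|lborel. l x)" using l_integrable l_bounds by (intro nn_integral_eq_integral) auto
  also have "(LINT x|lborel. l x) = n * (L1_norm f + L1_norm g)"
    unfolding l_def L1_norm_def using integrable_fg nonneg by simp
  also have "ennreal \<dots> \<le> ennreal (n * (R' + R'))" using L1_le n by (intro ennreal_leI mult_left_mono) auto
  finally show ?thesis by (simp add: algebra_simps)
qed

lemma sup_nonneg: "0 \<le> R''" using intensity_le_sup_norm[OF f, of 0] nonneg(1)[of 0] sup_le by linarith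
lemma L1_nonneg: "0 \<le> R'"
proof -
  have "0 \<le> L1_norm f" unfolding L1_norm_def by (rule Bochner_Integration.integral_nonneg) simp
  then show ?thesis using L1_le by linarith
qed

definition ker :: "('a \<Rightarrow> real) \<Rightarrow> 'a \<times> 'a \<Rightarrow> real" where "ker \<kappa> z = \<kappa> (fst z - snd z)"

context
  fixes \<kappa> :: "'a \<Rightarrow> real" and V :: real
  assumes \<kappa>m [measurable]: "\<kappa> \<in> borel_measurable borel" and even: "\<And>x. \<kappa> (- x) = \<kappa> x"
    and V: "(\<integral>\<^sup>+x. ennreal ((\<kappa> x)\<^sup>2) \<partial>lborel) \<le> ennreal V" "0 < V"
begin

lemma ker_measurable [measurable]: "ker \<kappa> \<in> borel_measurable (borel \<Otimes>\<^sub>M borel)"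
  unfolding ker_def[abs_def] by measurable

text \<open>
  In one variable the intensity is bounded by \<open>2 * n * R''\<close>, in the other its total mass is at most
  \<open>2 * n * R'\<close>.
\<close>

lemma ker_L2: "(\<integral>\<^sup>+z. ennreal ((ker \<kappa> z)\<^sup>2) \<partial>LL) \<le> ennreal (4 * n\<^sup>2 * R' * R'' * V)"
proof -
  have "(\<integral>\<^sup>+z. ennreal ((ker \<kappa> z)\<^sup>2) \<partial>LL) = (\<integral>\<^sup>+x. (\<integral>\<^sup>+y. ennreal ((\<kappa> (x - y))\<^sup>2) \<partial>Lam) \<partial>Lam)"
    by (subst Lam.nn_integral_fst [symmetric]) (auto intro!: measurable_LL simp: ker_def)
  also have "\<dots> \<le> (\<integral>\<^sup>+x. ennreal (2 * n * R'' * V) \<partial>Lam)"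
  proof (intro nn_integral_mono)
    fix x
    have "(\<integral>\<^sup>+y. ennreal ((\<kappa> (x - y))\<^sup>2) \<partial>Lam) \<le> ennreal (2 * n * R'') * (\<integral>\<^sup>+y. ennreal ((\<kappa> (x - y))\<^sup>2) \<partial>lborel)"
      by (rule nn_integral_Lam_le) measurable
    also have "(\<integral>\<^sup>+y. ennreal ((\<kappa> (x - y))\<^sup>2) \<partial>lborel) = (\<integral>\<^sup>+y. ennreal ((\<kappa> y)\<^sup>2) \<partial>lborel)"
      by (rule nn_integral_reflect[of "\<lambda>y. ennreal ((\<kappa> y)\<^sup>2)"]) measurable
    also have "ennreal (2 * n * R'') * \<dots> \<le> ennreal (2 * n * R'') * ennreal V" by (intro mult_left_mono V) simp
    also have "\<dots> = ennreal (2 * n * R'' * V)" using n sup_nonneg V by (simp add: ennreal_mult')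
    finally show "(\<integral>\<^sup>+y. ennreal ((\<kappa> (x - y))\<^sup>2) \<partial>Lam) \<le> ennreal (2 * n * R'' * V)" .
  qed
  also have "\<dots> = ennreal (2 * n * R'' * V) * emeasure Lam UNIV" by simp
  also have "\<dots> \<le> ennreal (2 * n * R'' * V) * ennreal (2 * n * R')" by (intro mult_left_mono emeasure_Lam_le) simp
  also have "\<dots> = ennreal (2 * n * R'' * V * (2 * n * R'))" using n L1_nonneg by (intro ennreal_mult'' [symmetric]) simp
  also have "2 * n * R'' * V * (2 * n * R') = 4 * n\<^sup>2 * R' * R'' * V" by (simp add: power2_eq_square)
  finally show ?thesis .
qed

lemma integral_Lam_theta:
  assumes [measurable]: "F \<in> borel_measurable borel"
  shows "(LINT y|Lam. F y * \<theta> y) = n * (LINT y|lborel. F y * h y)"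
proof -
  have "(LINT y|Lam. F y * \<theta> y) = (LINT y|lborel. l y *\<^sub>R (F y * \<theta> y))"
    unfolding Lam_def using l_bounds by (intro integral_density) auto
  also have "\<dots> = (LINT y|lborel. n * (F y * h y))"
  proof (intro Bochner_Integration.integral_cong refl)
    fix y
    have "l y *\<^sub>R (F y * \<theta> y) = F y * (l y * \<theta> y)" by simp
    then show "l y *\<^sub>R (F y * \<theta> y) = n * (F y * h y)" by (simp only: l_theta) simp
  qed
  finally show ?thesis by simp
qed

lemma linear_part_ker: "linear_part (ker \<kappa>) x = 2 * n * convol \<kappa> h x"
proof -
  have "\<kappa> (y - x) = \<kappa> (x - y)" for y using even[of "x - y"] by simp
  then have "linear_part (ker \<kappa>) x = (LINT y|Lam. (2 * \<kappa> (x - y)) * \<theta> y)"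
    unfolding linear_part_def ker_def by simp
  also have "\<dots> = n * (LINT y|lborel. (2 * \<kappa> (x - y)) * h y)" by (rule integral_Lam_theta) measurable
  finally show ?thesis by (simp add: convol_def mult.assoc)
qed

lemma linear_part_ker_L2:
  "(\<integral>\<^sup>+x. ennreal ((linear_part (ker \<kappa>) x)\<^sup>2) \<partial>Lam)
    \<le> ennreal (8 * R'' * n ^ 3) * (\<integral>\<^sup>+x. ennreal ((convol \<kappa> h x)\<^sup>2) \<partial>lborel)"
proof -
  have "(\<integral>\<^sup>+x. ennreal ((linear_part (ker \<kappa>) x)\<^sup>2) \<partial>Lam) = (\<integral>\<^sup>+x. ennreal (4 * n\<^sup>2) * ennreal ((convol \<kappa> h x)\<^sup>2) \<partial>Lam)"
    unfolding linear_part_ker by (intro nn_integral_cong) (simp add: power_mult_distrib ennreal_mult)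
  also have "\<dots> \<le> ennreal (2 * n * R'') * (\<integral>\<^sup>+x. ennreal (4 * n\<^sup>2) * ennreal ((convol \<kappa> h x)\<^sup>2) \<partial>lborel)"
    by (rule nn_integral_Lam_le) measurable
  also have "\<dots> = ennreal (2 * n * R'') * (ennreal (4 * n\<^sup>2) * (\<integral>\<^sup>+x. ennreal ((convol \<kappa> h x)\<^sup>2) \<partial>lborel))"
    by (subst nn_integral_cmult) auto
  also have "\<dots> = ennreal (2 * n * R'' * (4 * n\<^sup>2)) * (\<integral>\<^sup>+x. ennreal ((convol \<kappa> h x)\<^sup>2) \<partial>lborel)"
    by (subst mult.assoc [symmetric], subst ennreal_mult'' [symmetric]) auto
  also have "2 * n * R'' * (4 * n\<^sup>2) = 8 * R'' * n ^ 3" by (simp add: power2_eq_square power3_eq_cube)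
  finally show ?thesis .
qed

lemma mean_form_ker: "mean_form (ker \<kappa>) = n\<^sup>2 * (LINT x|lborel. convol \<kappa> h x * h x)"
proof -
  have fin: "(\<integral>\<^sup>+z. ennreal ((ker \<kappa> z)\<^sup>2) \<partial>LL) < \<infinity>" using ker_L2 by (simp add: le_less_trans less_top)
  have ki: "integrable LL (ker \<kappa>)" using fin by (intro LL.integrable_of_square measurable_LL) auto
  have int: "integrable LL (\<lambda>z. ker \<kappa> z * \<theta> (fst z) * \<theta> (snd z))"
  proof (rule Bochner_Integration.integrable_bound[OF ki])
    show "(\<lambda>z. ker \<kappa> z * \<theta> (fst z) * \<theta> (snd z)) \<in> borel_measurable LL" by (rule measurable_LL) measurable
    show "AE z in LL. norm (ker \<kappa> z * \<theta> (fst z) * \<theta> (snd z)) \<le> norm (ker \<kappa> z)"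
    proof (rule AE_I2)
      fix z
      have "\<bar>\<theta> (fst z)\<bar> * \<bar>\<theta> (snd z)\<bar> \<le> 1" using theta_bound[of "fst z"] theta_bound[of "snd z"] by (intro mult_le_one) auto
      then have "\<bar>ker \<kappa> z\<bar> * (\<bar>\<theta> (fst z)\<bar> * \<bar>\<theta> (snd z)\<bar>) \<le> \<bar>ker \<kappa> z\<bar> * 1" by (intro mult_left_mono) auto
      then show "norm (ker \<kappa> z * \<theta> (fst z) * \<theta> (snd z)) \<le> norm (ker \<kappa> z)" by (simp add: abs_mult mult.assoc)
    qed
  qed
  have "mean_form (ker \<kappa>) = (LINT x|Lam. LINT y|Lam. ker \<kappa> (x, y) * \<theta> x * \<theta> y)"
    unfolding mean_form_def using LL.integral_fst'[OF int] by simp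
  also have "\<dots> = (LINT x|Lam. (n * convol \<kappa> h x) * \<theta> x)"
  proof (rule Bochner_Integration.integral_cong[OF refl])
    fix x
    have "(LINT y|Lam. ker \<kappa> (x, y) * \<theta> x * \<theta> y) = (LINT y|Lam. (\<theta> x * \<kappa> (x - y)) * \<theta> y)"
      by (intro Bochner_Integration.integral_cong refl) (simp add: ker_def)
    also have "\<dots> = n * (LINT y|lborel. (\<theta> x * \<kappa> (x - y)) * h y)" by (rule integral_Lam_theta) measurable
    finally show "(LINT y|Lam. ker \<kappa> (x, y) * \<theta> x * \<theta> y) = (n * convol \<kappa> h x) * \<theta> x" by (simp add: convol_def mult_ac)
  qed
  also have "\<dots> = n * (LINT x|lborel. (n * convol \<kappa> h x) * h x)" by (rule integral_Lam_theta) measurable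
  finally show ?thesis by (simp add: power2_eq_square mult.assoc)
qed

end
end

lemma off_diagonal_point_pairs_sum:
  assumes fin: "finite (fst N)" "finite (snd N)" and dis: "fst N \<inter> snd N = {}"
  shows "(\<Sum>(x, y)\<in>off_diagonal (fst N \<union> snd N). F x y) = (\<Sum>b\<in>UNIV. \<Sum>c\<in>UNIV. \<Sum>(x, y)\<in>point_pairs b c N. (F x y :: real))"
proof -
  let ?S = "off_diagonal (fst N \<union> snd N)" let ?g = "\<lambda>z. (fst z \<in> fst N, snd z \<in> fst N)"
  have "(\<Sum>z\<in>?S. case z of (x, y) \<Rightarrow> F x y) = (\<Sum>p\<in>UNIV \<times> UNIV. \<Sum>z\<in>{z\<in>?S. ?g z = p}. case z of (x, y) \<Rightarrow> F x y)"
    by (rule sum.group [symmetric]) (use fin in auto)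
  also have "\<dots> = (\<Sum>b\<in>UNIV. \<Sum>c\<in>UNIV. \<Sum>z\<in>{z\<in>?S. ?g z = (b, c)}. case z of (x, y) \<Rightarrow> F x y)"
    by (rule sum.cartesian_product')
  also have "\<dots> = (\<Sum>b\<in>UNIV. \<Sum>c\<in>UNIV. \<Sum>(x, y)\<in>point_pairs b c N. F x y)"
  proof (intro sum.cong refl)
    fix b c
    show "{z\<in>?S. ?g z = (b, c)} = point_pairs b c N"
      using dis by (cases b; cases c) (auto simp: off_diagonal_def point_pairs_def proc_def)
  qed
  finally show ?thesis .
qed

lemma T_hat_eq_signed_sum:
  assumes fin: "finite (fst N)" "finite (snd N)" and dis: "fst N \<inter> snd N = {}"
  shows "T_hat K N = signed_sum (\<lambda>z. K (fst z) (snd z)) N"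
proof -
  have m: "marks N x = sg b" if "x \<in> proc b N" for b x using that dis by (auto simp: marks_def proc_def sg_def split: if_splits)
  have "T_hat K N = (\<Sum>(x, y)\<in>off_diagonal (fst N \<union> snd N). K x y * marks N x * marks N y)"
    unfolding T_hat_def sign_form_def using fin by (intro off_diagonal_sum) auto
  also have "\<dots> = (\<Sum>b\<in>UNIV. \<Sum>c\<in>UNIV. \<Sum>(x, y)\<in>point_pairs b c N. K x y * marks N x * marks N y)"
    by (rule off_diagonal_point_pairs_sum[OF assms])
  also have "\<dots> = (\<Sum>b\<in>UNIV. \<Sum>c\<in>UNIV. \<Sum>z\<in>point_pairs b c N. sg b * sg c * K (fst z) (snd z))"
    by (intro sum.cong refl) (auto simp: point_pairs_def m)
  finally show ?thesis by (simp add: signed_sum_def pair_sum_def sum_distrib_left)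
qed

section \<open>Bias of a rescaled kernel\<close>

text \<open>
  Near the origin the approximation property of order \<open>m\<close> suffices because \<open>\<delta> \<le> m\<close>; away from it \<open>F\<close> is
  bounded while \<open>norm v powr \<delta>\<close> is at least 1.
\<close>

lemma transform_deviation:
  fixes F :: "'a::euclidean_space \<Rightarrow> complex"
  assumes b: "esssup lborel (\<lambda>u. ereal (cmod (F u))) < \<infinity>"
    and C: "esssup (restrict_space lborel (UNIV - {0})) (\<lambda>u. ereal (cmod (1 - F u) / norm u ^ m)) \<le> ereal C"
    and \<delta>: "0 < \<delta>" "\<delta> \<le> real m"
  shows "\<exists>B\<ge>0. AE v in lborel. cmod (1 - F v) \<le> B * norm v powr \<delta>"
proof -
  obtain b where b: "AE v in lborel. cmod (F v) \<le> b"
  proof (cases "esssup lborel (\<lambda>u. ereal (cmod (F u)))")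
    case (real r)
    have "AE v in lborel. cmod (F v) \<le> r"
      using esssup_AE[of "\<lambda>u. ereal (cmod (F u))" lborel] unfolding real by simp
    then show ?thesis by (rule that)
  next
    case MInf
    have "AE v in lborel. cmod (F v) \<le> 0"
      using esssup_AE[of "\<lambda>u. ereal (cmod (F u))" lborel] unfolding MInf by eventually_elim simp
    then show ?thesis by (rule that)
  qed (use b in simp)
  have "AE v in restrict_space lborel (UNIV - {0 :: 'a}). ereal (cmod (1 - F v) / norm v ^ m) \<le> ereal C"
    using esssup_AE[of "\<lambda>u. ereal (cmod (1 - F u) / norm u ^ m)" "restrict_space lborel (UNIV - {0 :: 'a})"]
    by eventually_elim (use C order_trans in blast)
  then have "AE v in lborel. v \<in> UNIV - {0} \<longrightarrow> cmod (1 - F v) / norm v ^ m \<le> C"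
    by (subst (asm) AE_restrict_space_iff) auto
  moreover have "AE v in lborel. v \<noteq> (0 :: 'a)" by (rule AE_lborel_singleton)
  ultimately have "AE v in lborel. cmod (1 - F v) \<le> (\<bar>C\<bar> + 1 + \<bar>b\<bar>) * norm v powr \<delta>"
    using b
  proof eventually_elim
    case (elim v)
    have v: "0 < norm v" using elim by simp
    show ?case
    proof (cases "norm v \<le> 1")
      case True
      have "cmod (1 - F v) \<le> C * norm v ^ m" using elim v by (simp add: divide_le_eq)
      also have "\<dots> = C * norm v powr (real m)" using v by (simp add: powr_realpow)
      also have "\<dots> \<le> \<bar>C\<bar> * norm v powr (real m)" by (intro mult_right_mono) auto
      also have "\<dots> \<le> \<bar>C\<bar> * norm v powr \<delta>" using True v \<delta> by (intro mult_left_mono powr_mono') auto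
      also have "\<dots> \<le> (\<bar>C\<bar> + 1 + \<bar>b\<bar>) * norm v powr \<delta>" by (intro mult_right_mono) auto
      finally show ?thesis .
    next
      case False
      have "cmod (1 - F v) \<le> 1 + cmod (F v)" using norm_triangle_ineq4[of 1 "F v"] by simp
      also have "\<dots> \<le> (\<bar>C\<bar> + 1 + \<bar>b\<bar>) * 1" using elim by simp
      also have "\<dots> \<le> (\<bar>C\<bar> + 1 + \<bar>b\<bar>) * norm v powr \<delta>"
        using False \<delta> by (intro mult_left_mono ge_one_powr_ge_zero) auto
      finally show ?thesis .
    qed
  qed
  then show ?thesis by (intro exI[of _ "\<bar>C\<bar> + 1 + \<bar>b\<bar>"]) auto
qed

lemma fourier_dilation:
  fixes h :: "'a::euclidean_space \<Rightarrow> real"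
  assumes [measurable]: "h \<in> borel_measurable borel" and M: "0 < M"
  shows "fourier (\<lambda>x. h (x /\<^sub>R M)) v = complex_of_real (M ^ DIM('a)) * fourier h (M *\<^sub>R v)"
proof -
  let ?f = "\<lambda>x. complex_of_real (h (x /\<^sub>R M)) * iexp (x \<bullet> v)"
  have "fourier (\<lambda>x. h (x /\<^sub>R M)) v = (\<bar>M\<bar> ^ DIM('a)) *\<^sub>R (LINT x|lborel. ?f (0 + M *\<^sub>R x))"
    unfolding fourier_def by (rule integral_affine) (use M in auto)
  also have "(LINT x|lborel. ?f (0 + M *\<^sub>R x)) = fourier h (M *\<^sub>R v)"
    unfolding fourier_def using M by (intro Bochner_Integration.integral_cong) auto
  finally show ?thesis using M by (simp add: scaleR_conv_of_real)
qed

text \<open>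
  Stretching \<open>h\<close> by the factor \<open>M\<close> turns the rescaled kernel into \<open>k\<close> itself. The Sobolev integral of
  the stretched function is smaller by the factor \<open>M powr (- 2 * \<delta>)\<close>, apart from the Jacobian, which
  appears on both sides.
\<close>

lemma bandwidth_bias:
  fixes k h :: "'a::euclidean_space \<Rightarrow> real"
  assumes k: "plancherel_transform k F" and B: "0 \<le> B" "AE v in lborel. cmod (1 - F v) \<le> B * norm v powr \<delta>"
    and h: "h \<in> sobolev_ball \<delta> R" and M: "0 < M"
  shows "(\<integral>\<^sup>+x. ennreal ((h x - convol (\<lambda>x. M ^ DIM('a) * k (M *\<^sub>R x)) h x)\<^sup>2) \<partial>lborel)
    \<le> ennreal (4 * B\<^sup>2 * R\<^sup>2 * M powr (- 2 * \<delta>))"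
proof -
  let ?d = "DIM('a)" and ?\<kappa> = "\<lambda>x. M ^ DIM('a) * k (M *\<^sub>R x)"
  define hs where "hs = (\<lambda>x. h (x /\<^sub>R M))"
  have h1: "integrable lborel h" and h2: "in_L2 h" using h by (auto simp: sobolev_ball_def in_L1_def)
  have [measurable]: "h \<in> borel_measurable borel" using h2 by (simp add: in_L2_def)
  have [measurable]: "k \<in> borel_measurable borel" "F \<in> borel_measurable borel"
    using k by (auto simp: plancherel_transform_def in_L2_def)
  have hsm [measurable]: "hs \<in> borel_measurable borel" unfolding hs_def by measurable
  have scale: "(\<integral>\<^sup>+x. G x \<partial>lborel) = ennreal (M ^ ?d) * (\<integral>\<^sup>+x. G (M *\<^sub>R x) \<partial>lborel)"
    if "G \<in> borel_measurable borel" for G :: "'a \<Rightarrow> ennreal"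
    using nn_integral_affine[OF that, of M 0] M by simp
  have hs1: "in_L1 hs"
    unfolding in_L1_def
  proof (rule integrableI_bounded)
    have "(\<integral>\<^sup>+x. ennreal (norm (hs x)) \<partial>lborel) = ennreal (M ^ ?d) * (\<integral>\<^sup>+x. ennreal (norm (h x)) \<partial>lborel)"
      using scale[of "\<lambda>x. ennreal (norm (hs x))"] M by (simp add: hs_def)
    also have "\<dots> < \<infinity>" using h1 by (simp add: integrable_iff_bounded ennreal_mult_less_top)
    finally show "(\<integral>\<^sup>+x. ennreal (norm (hs x)) \<partial>lborel) < \<infinity>" .
  qed measurable
  have hs2: "in_L2 hs"
    unfolding in_L2_iff_nn
  proof
    have "(\<integral>\<^sup>+x. ennreal ((hs x)\<^sup>2) \<partial>lborel) = ennreal (M ^ ?d) * (\<integral>\<^sup>+x. ennreal ((h x)\<^sup>2) \<partial>lborel)"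
      using scale[of "\<lambda>x. ennreal ((hs x)\<^sup>2)"] M by (simp add: hs_def)
    also have "\<dots> < \<infinity>" using h2 by (simp add: in_L2_iff_nn ennreal_mult_less_top)
    finally show "(\<integral>\<^sup>+x. ennreal ((hs x)\<^sup>2) \<partial>lborel) < \<infinity>" .
  qed measurable
  have conv: "convol k hs (M *\<^sub>R x) = convol ?\<kappa> h x" for x
  proof -
    let ?f = "\<lambda>y. k (M *\<^sub>R x - y) * hs y"
    have "convol k hs (M *\<^sub>R x) = (\<bar>M\<bar> ^ ?d) *\<^sub>R (LINT y|lborel. ?f (0 + M *\<^sub>R y))"
      unfolding convol_def by (rule integral_affine) (use M in auto)
    also have "\<dots> = (LINT y|lborel. (\<bar>M\<bar> ^ ?d) *\<^sub>R ?f (0 + M *\<^sub>R y))" by simp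
    also have "\<dots> = convol ?\<kappa> h x"
      unfolding convol_def using M
      by (intro Bochner_Integration.integral_cong refl) (simp add: hs_def scaleR_diff_right)
    finally show ?thesis .
  qed
  define X where "X = (\<integral>\<^sup>+x. ennreal ((h x - convol ?\<kappa> h x)\<^sup>2) \<partial>lborel)"
  have lhs: "(\<integral>\<^sup>+x. ennreal ((hs x - convol k hs x)\<^sup>2) \<partial>lborel) = ennreal (M ^ ?d) * X"
  proof -
    have "hs (M *\<^sub>R x) = h x" for x using M by (simp add: hs_def)
    then show ?thesis
      unfolding X_def using scale[of "\<lambda>x. ennreal ((hs x - convol k hs x)\<^sup>2)"] by (simp add: conv)
  qed
  let ?P = "ennreal ((2 * pi) ^ ?d)"
  let ?G = "\<lambda>u. ennreal (norm u powr (2 * \<delta>) * (cmod (fourier h u))\<^sup>2)"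
  have sob: "(\<integral>\<^sup>+u. ?G u \<partial>lborel) \<le> ennreal ((2 * pi) ^ ?d * R\<^sup>2)" using h by (simp add: sobolev_ball_def)
  have "?P * (ennreal (M ^ ?d) * X) \<le> 4 * (\<integral>\<^sup>+v. ennreal ((cmod (1 - F v))\<^sup>2 * (cmod (fourier hs v))\<^sup>2) \<partial>lborel)"
    using convol_error_le[OF k hs1 hs2] unfolding lhs .
  also have "(\<integral>\<^sup>+v. ennreal ((cmod (1 - F v))\<^sup>2 * (cmod (fourier hs v))\<^sup>2) \<partial>lborel)
      \<le> (\<integral>\<^sup>+v. ennreal (B\<^sup>2 * (M ^ ?d)\<^sup>2 * M powr (- 2 * \<delta>)) * ?G (M *\<^sub>R v) \<partial>lborel)"
  proof (rule nn_integral_mono_AE)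
    show "AE v in lborel. ennreal ((cmod (1 - F v))\<^sup>2 * (cmod (fourier hs v))\<^sup>2)
       \<le> ennreal (B\<^sup>2 * (M ^ ?d)\<^sup>2 * M powr (- 2 * \<delta>)) * ?G (M *\<^sub>R v)"
      using B(2)
    proof eventually_elim
      case (elim v)
      have "(cmod (1 - F v))\<^sup>2 \<le> (B * norm v powr \<delta>)\<^sup>2" using elim by (intro power_mono) auto
      also have "\<dots> = B\<^sup>2 * norm v powr (2 * \<delta>)"
      proof -
        have "(norm v powr \<delta>)\<^sup>2 = norm v powr (2 * \<delta>)" by (simp only: power2_eq_square powr_add [symmetric] mult_2)
        then show ?thesis by (simp only: power_mult_distrib)
      qed
      also have "norm v powr (2 * \<delta>) = M powr (- 2 * \<delta>) * norm (M *\<^sub>R v) powr (2 * \<delta>)"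
      proof -
        have "M powr (- 2 * \<delta>) * norm (M *\<^sub>R v) powr (2 * \<delta>) = (M powr (- 2 * \<delta>) * M powr (2 * \<delta>)) * norm v powr (2 * \<delta>)"
          using M by (simp add: powr_mult)
        also have "M powr (- 2 * \<delta>) * M powr (2 * \<delta>) = 1" using M by (simp flip: powr_add)
        finally show ?thesis by simp
      qed
      finally have 1: "(cmod (1 - F v))\<^sup>2 \<le> B\<^sup>2 * (M powr (- 2 * \<delta>) * norm (M *\<^sub>R v) powr (2 * \<delta>))" .
      have 2: "(cmod (fourier hs v))\<^sup>2 = (M ^ ?d)\<^sup>2 * (cmod (fourier h (M *\<^sub>R v)))\<^sup>2"
      proof -
        have "fourier hs v = complex_of_real (M ^ ?d) * fourier h (M *\<^sub>R v)"
          unfolding hs_def by (rule fourier_dilation[OF _ M]) measurable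
        then have "cmod (fourier hs v) = M ^ ?d * cmod (fourier h (M *\<^sub>R v))"
          using M by (simp only: norm_mult norm_of_real) simp
        then show ?thesis by (simp only: power_mult_distrib)
      qed
      have "(cmod (1 - F v))\<^sup>2 * (cmod (fourier hs v))\<^sup>2
         \<le> (B\<^sup>2 * (M powr (- 2 * \<delta>) * norm (M *\<^sub>R v) powr (2 * \<delta>))) * ((M ^ ?d)\<^sup>2 * (cmod (fourier h (M *\<^sub>R v)))\<^sup>2)"
        unfolding 2 by (intro mult_right_mono 1) simp
      also have "\<dots> = (B\<^sup>2 * (M ^ ?d)\<^sup>2 * M powr (- 2 * \<delta>)) * (norm (M *\<^sub>R v) powr (2 * \<delta>) * (cmod (fourier h (M *\<^sub>R v)))\<^sup>2)"
        by (simp only: mult_ac)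
      finally have "ennreal ((cmod (1 - F v))\<^sup>2 * (cmod (fourier hs v))\<^sup>2)
         \<le> ennreal ((B\<^sup>2 * (M ^ ?d)\<^sup>2 * M powr (- 2 * \<delta>)) * (norm (M *\<^sub>R v) powr (2 * \<delta>) * (cmod (fourier h (M *\<^sub>R v)))\<^sup>2))"
        by (rule ennreal_leI)
      also have "\<dots> = ennreal (B\<^sup>2 * (M ^ ?d)\<^sup>2 * M powr (- 2 * \<delta>)) * ?G (M *\<^sub>R v)"
        by (rule ennreal_mult) auto
      finally show ?case .
    qed
  qed
  also have "\<dots> = ennreal (B\<^sup>2 * (M ^ ?d)\<^sup>2 * M powr (- 2 * \<delta>)) * (\<integral>\<^sup>+v. ?G (M *\<^sub>R v) \<partial>lborel)"
    by (rule nn_integral_cmult) measurable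
  also have "4 * \<dots> = ennreal (4 * B\<^sup>2 * M ^ ?d * M powr (- 2 * \<delta>)) * (\<integral>\<^sup>+u. ?G u \<partial>lborel)"
  proof -
    have "ennreal (B\<^sup>2 * (M ^ ?d)\<^sup>2 * M powr (- 2 * \<delta>)) = ennreal (B\<^sup>2 * M ^ ?d * M powr (- 2 * \<delta>)) * ennreal (M ^ ?d)"
    proof -
      have "B\<^sup>2 * (M ^ ?d)\<^sup>2 * M powr (- 2 * \<delta>) = (B\<^sup>2 * M ^ ?d * M powr (- 2 * \<delta>)) * M ^ ?d"
        by (simp only: power2_eq_square[of "M ^ ?d"] mult_ac)
      moreover have "0 \<le> B\<^sup>2 * M ^ ?d * M powr (- 2 * \<delta>)" "0 \<le> M ^ ?d"
        using zero_le_power[OF less_imp_le[OF M]] by auto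
      ultimately show ?thesis by (simp only: ennreal_mult)
    qed
    moreover have "4 * ennreal (B\<^sup>2 * M ^ ?d * M powr (- 2 * \<delta>)) = ennreal (4 * B\<^sup>2 * M ^ ?d * M powr (- 2 * \<delta>))"
      using M by (subst numeral_mult_ennreal) (auto simp: mult.assoc)
    moreover have "(\<integral>\<^sup>+u. ?G u \<partial>lborel) = ennreal (M ^ ?d) * (\<integral>\<^sup>+v. ?G (M *\<^sub>R v) \<partial>lborel)"
      by (rule scale) measurable
    ultimately show ?thesis by (simp only: mult.assoc [symmetric])
  qed
  also have "\<dots> \<le> ennreal (4 * B\<^sup>2 * M ^ ?d * M powr (- 2 * \<delta>)) * ennreal ((2 * pi) ^ ?d * R\<^sup>2)"
    by (intro mult_left_mono sob) simp
  also have "\<dots> = ennreal ((4 * B\<^sup>2 * M ^ ?d * M powr (- 2 * \<delta>)) * ((2 * pi) ^ ?d * R\<^sup>2))"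
    using M by (intro ennreal_mult [symmetric]) auto
  also have "(4 * B\<^sup>2 * M ^ ?d * M powr (- 2 * \<delta>)) * ((2 * pi) ^ ?d * R\<^sup>2)
    = (2 * pi) ^ ?d * (M ^ ?d * (4 * B\<^sup>2 * R\<^sup>2 * M powr (- 2 * \<delta>)))" by (simp only: mult_ac)
  also have "ennreal \<dots> = ?P * ennreal (M ^ ?d * (4 * B\<^sup>2 * R\<^sup>2 * M powr (- 2 * \<delta>)))"
    using M by (intro ennreal_mult) auto
  also have "ennreal (M ^ ?d * (4 * B\<^sup>2 * R\<^sup>2 * M powr (- 2 * \<delta>)))
    = ennreal (M ^ ?d) * ennreal (4 * B\<^sup>2 * R\<^sup>2 * M powr (- 2 * \<delta>))"
    using M by (intro ennreal_mult) auto
  finally have "?P * (ennreal (M ^ ?d) * X) \<le> ?P * (ennreal (M ^ ?d) * ennreal (4 * B\<^sup>2 * R\<^sup>2 * M powr (- 2 * \<delta>)))"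
    by this (auto intro: mult_left_mono)
  then show ?thesis
    unfolding X_def [symmetric] using M by (simp add: ennreal_mult_le_mult_iff)
qed

section \<open>Error of the second kind for a single kernel\<close>

context two_sample
begin

text \<open>
  Let \<open>E\<close> be the mean of the statistic, \<open>w\<close> and \<open>S\<close> the quantities of \<open>signed_sum_tail\<close>, and \<open>Q\<close> the
  sum of the squares of the kernel over the pairs of points. The exceptional set consists of three events:
  the statistic deviates from \<open>E\<close> by at least the distance \<open>3 * a\<close> between \<open>E\<close> and the threshold \<open>t\<close>
  (probability at most \<open>\<beta> / 2\<close>, by Chebyshev), \<open>Q\<close> is at least \<open>2 * S / \<beta>\<close>, where \<open>S\<close> bounds its mean (at most
  \<open>\<beta> / 2\<close>, by Markov), and the processes meet (a null set). Outside of it the quantile is at most \<open>t\<close>.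
  The hypothesis \<open>sep\<close> makes \<open>E - t\<close> large enough: \<open>w\<close> grows with the norm of the convolution \<open>?G\<close>, but
  so does \<open>E\<close>, and \<open>2 * x * y \<le> x\<^sup>2 + y\<^sup>2\<close> compensates the one by the other at the price
  \<open>576 * R'' / (\<beta> * n)\<close>.
\<close>

lemma second_kind_error:
  fixes \<kappa> :: "'a \<Rightarrow> real"
  assumes \<kappa>m [measurable]: "\<kappa> \<in> borel_measurable borel" and even: "\<And>x. \<kappa> (- x) = \<kappa> x"
    and V: "(\<integral>\<^sup>+x. ennreal ((\<kappa> x)\<^sup>2) \<partial>lborel) \<le> ennreal V" "0 < V"
    and h2: "in_L2 h" and bias: "(\<integral>\<^sup>+x. ennreal ((h x - convol \<kappa> h x)\<^sup>2) \<partial>lborel) \<le> ennreal b" "0 \<le> b"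
    and p: "1 \<le> p" and \<beta>: "0 < \<beta>" and pos: "0 < R'" "0 < R''"
    and sep: "b + 576 * R'' / (\<beta> * n) + (48 + 16 * real p * exp 1) * sqrt (R' * R'' * V / \<beta>) / n \<le> (L2_norm h)\<^sup>2"
  shows "\<exists>A\<in>sets P. measure P A \<le> \<beta> \<and> (\<forall>N\<in>space P - A. \<forall>r. exp (- 2 * real p) \<le> 1 - r \<longrightarrow>
    bootstrap_quantile (\<lambda>x y. \<kappa> (x - y)) (fst N \<union> snd N) r < ereal (T_hat (\<lambda>x y. \<kappa> (x - y)) N))"
proof -
  let ?K = "\<lambda>x y. \<kappa> (x - y)" and ?G = "convol \<kappa> h"
  define S where "S = 4 * n\<^sup>2 * R' * R'' * V"
  have S: "0 < S" using n pos V by (simp add: S_def)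
  have hm [measurable]: "h \<in> borel_measurable borel" by (rule h_measurable)
  have h_fin: "(\<integral>\<^sup>+x. ennreal ((h x)\<^sup>2) \<partial>lborel) < \<infinity>" using h2 by (simp add: in_L2_iff_nn)
  have d_fin: "(\<integral>\<^sup>+x. ennreal ((h x - ?G x)\<^sup>2) \<partial>lborel) < \<infinity>" using bias(1) by (simp add: le_less_trans less_top)
  have G_fin: "(\<integral>\<^sup>+x. ennreal ((?G x)\<^sup>2) \<partial>lborel) < \<infinity>"
  proof -
    have "(\<integral>\<^sup>+x. ennreal ((h x + - (h x - ?G x))\<^sup>2) \<partial>lborel)
       \<le> 2 * (\<integral>\<^sup>+x. ennreal ((h x)\<^sup>2) \<partial>lborel) + 2 * (\<integral>\<^sup>+x. ennreal ((- (h x - ?G x))\<^sup>2) \<partial>lborel)"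
      by (rule L2_triangle) measurable
    also have "\<dots> < \<infinity>" using h_fin d_fin unfolding power2_minus by (simp add: ennreal_mult_less_top)
    finally show ?thesis by simp
  qed
  have hi: "integrable lborel (\<lambda>x. (h x)\<^sup>2)" and Gi: "integrable lborel (\<lambda>x. (?G x)\<^sup>2)"
    and di: "integrable lborel (\<lambda>x. (h x - ?G x)\<^sup>2)"
    by (rule integrableI_bounded; use h_fin G_fin d_fin in simp)+
  define H where "H = (LINT x|lborel. (h x)\<^sup>2)"
  define g2 where "g2 = (LINT x|lborel. (?G x)\<^sup>2)"
  have H: "(L2_norm h)\<^sup>2 = H"
    unfolding L2_norm_def H_def by (subst real_sqrt_pow2) (auto intro!: Bochner_Integration.integral_nonneg)
  have g2: "0 \<le> g2" unfolding g2_def by (rule Bochner_Integration.integral_nonneg) simp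
  have d_le: "(LINT x|lborel. (h x - ?G x)\<^sup>2) \<le> b"
  proof -
    have "ennreal (LINT x|lborel. (h x - ?G x)\<^sup>2) \<le> ennreal b"
      using bias(1) nn_integral_eq_integral[OF di] by simp
    then show ?thesis using bias(2) by (simp add: ennreal_le_iff)
  qed
  define E where "E = mean_form (ker \<kappa>)"
  have E_ge: "n\<^sup>2 / 2 * (H + g2 - b) \<le> E"
  proof -
    have "(LINT x|lborel. ?G x * h x) = (LINT x|lborel. ((h x)\<^sup>2 + (?G x)\<^sup>2 - (h x - ?G x)\<^sup>2) / 2)"
      by (intro Bochner_Integration.integral_cong refl) (simp add: power2_diff)
    also have "\<dots> = (H + g2 - (LINT x|lborel. (h x - ?G x)\<^sup>2)) / 2"
      unfolding H_def g2_def using hi Gi di by simp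
    finally have "(LINT x|lborel. ?G x * h x) = (H + g2 - (LINT x|lborel. (h x - ?G x)\<^sup>2)) / 2" .
    then have "(H + g2 - b) / 2 \<le> (LINT x|lborel. ?G x * h x)" using d_le by simp
    then have "n\<^sup>2 * ((H + g2 - b) / 2) \<le> E"
      unfolding E_def mean_form_ker[OF \<kappa>m even V] by (rule mult_left_mono) simp
    then show ?thesis by simp
  qed
  (* The bound on the bootstrap quantile when Q is at most 2 * S / \<beta>. *)
  define t where "t = 4 * real p * exp 1 * sqrt (S / \<beta>)"
  have t: "0 < t" using p S \<beta> by (simp add: t_def)
  define w where "w = 8 * R'' * n ^ 3 * g2"
  have w: "0 \<le> w" using pos n g2 by (simp add: w_def)
  define a where "a = (E - t) / 3"
  have sqrtS: "sqrt (S / \<beta>) = 2 * n * sqrt (R' * R'' * V / \<beta>)"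
  proof -
    have "S / \<beta> = (2 * n)\<^sup>2 * (R' * R'' * V / \<beta>)" by (simp add: S_def power_mult_distrib)
    then have "sqrt (S / \<beta>) = sqrt ((2 * n)\<^sup>2) * sqrt (R' * R'' * V / \<beta>)" by (simp only: real_sqrt_mult)
    then show ?thesis using n unfolding real_sqrt_abs by simp
  qed
  (* Equivalently a \<ge> 8 * sqrt (w / (8 * \<beta>)) + 4 * sqrt (S / \<beta>), hence
     a^2 \<ge> 2 * (4 * w + 8 * S) / \<beta>. *)
  have gap: "24 * sqrt (w / (8 * \<beta>)) + 12 * sqrt (S / \<beta>) \<le> E - t"
  proof -
    have w_sqrt: "24 * sqrt (w / (8 * \<beta>)) \<le> n\<^sup>2 / 2 * (g2 + 576 * R'' / (\<beta> * n))"
    proof -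
      have "2 * (sqrt g2 * sqrt (576 * R'' / (\<beta> * n))) \<le> (sqrt g2)\<^sup>2 + (sqrt (576 * R'' / (\<beta> * n)))\<^sup>2"
        using sum_squares_bound[of "sqrt g2" "sqrt (576 * R'' / (\<beta> * n))"] by (simp add: mult.assoc)
      also have "\<dots> = g2 + 576 * R'' / (\<beta> * n)" using g2 pos \<beta> n by simp
      finally have 1: "sqrt g2 * sqrt (576 * R'' / (\<beta> * n)) \<le> (g2 + 576 * R'' / (\<beta> * n)) / 2" by simp
      have "24 * sqrt (w / (8 * \<beta>)) = sqrt (24\<^sup>2 * (w / (8 * \<beta>)))"
        unfolding real_sqrt_mult[of "24\<^sup>2"] real_sqrt_abs by simp
      also have "24\<^sup>2 * (w / (8 * \<beta>)) = (n\<^sup>2)\<^sup>2 * (g2 * (576 * R'' / (\<beta> * n)))"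
        using n \<beta> by (simp add: w_def power2_eq_square power3_eq_cube)
      also have "sqrt \<dots> = n\<^sup>2 * (sqrt g2 * sqrt (576 * R'' / (\<beta> * n)))"
        unfolding real_sqrt_mult real_sqrt_abs by simp
      also have "\<dots> \<le> n\<^sup>2 * ((g2 + 576 * R'' / (\<beta> * n)) / 2)" by (rule mult_left_mono[OF 1]) simp
      finally show ?thesis by simp
    qed
    have "n\<^sup>2 / 2 * (b + 576 * R'' / (\<beta> * n) + (48 + 16 * real p * exp 1) * sqrt (R' * R'' * V / \<beta>) / n) \<le> n\<^sup>2 / 2 * H"
      using sep unfolding H by (rule mult_left_mono) simp
    moreover have "n\<^sup>2 / 2 * ((48 + 16 * real p * exp 1) * sqrt (R' * R'' * V / \<beta>) / n) = 12 * sqrt (S / \<beta>) + t"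
      unfolding t_def sqrtS using n by (simp add: power2_eq_square distrib_left distrib_right add_divide_distrib)
    ultimately show ?thesis using w_sqrt E_ge unfolding distrib_left right_diff_distrib by linarith
  qed
  have a: "0 < a" and a2: "(4 * w + 8 * S) / a\<^sup>2 \<le> \<beta> / 2"
  proof -
    have sS: "0 < sqrt (S / \<beta>)" using S \<beta> by simp
    have sw: "0 \<le> sqrt (w / (8 * \<beta>))" using w \<beta> by simp
    have "0 < 24 * sqrt (w / (8 * \<beta>)) + 12 * sqrt (S / \<beta>)"
      using sS sw by (intro add_nonneg_pos mult_nonneg_nonneg mult_pos_pos) auto
    then show a: "0 < a" using gap unfolding a_def by (simp only: zero_less_divide_iff) simp
    let ?u = "8 * sqrt (w / (8 * \<beta>))" and ?v = "4 * sqrt (S / \<beta>)"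
    have "?u + ?v \<le> a" using gap unfolding a_def by simp
    then have "(?u + ?v)\<^sup>2 \<le> a\<^sup>2" using sS sw by (intro power_mono) auto
    moreover have "?u\<^sup>2 + ?v\<^sup>2 \<le> (?u + ?v)\<^sup>2" using sS sw by (simp add: power2_sum)
    moreover have "?u\<^sup>2 = 8 * w / \<beta>" "?v\<^sup>2 = 16 * S / \<beta>" using w S \<beta> by (simp_all add: power_mult_distrib)
    ultimately have "(8 * w + 16 * S) / \<beta> \<le> a\<^sup>2" by (simp add: add_divide_distrib)
    then have "8 * w + 16 * S \<le> a\<^sup>2 * \<beta>" using \<beta> by (simp add: divide_le_eq)
    then show "(4 * w + 8 * S) / a\<^sup>2 \<le> \<beta> / 2" using a by (simp add: divide_le_eq mult.commute)
  qed
  have km [measurable]: "ker \<kappa> \<in> borel_measurable (borel \<Otimes>\<^sub>M borel)" by (rule ker_measurable[OF \<kappa>m even V])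
  have kS: "(\<integral>\<^sup>+z. ennreal ((ker \<kappa> z)\<^sup>2) \<partial>LL) \<le> ennreal S" unfolding S_def by (rule ker_L2[OF \<kappa>m even V])
  have kw: "(\<integral>\<^sup>+x. ennreal ((linear_part (ker \<kappa>) x)\<^sup>2) \<partial>Lam) \<le> ennreal w"
  proof -
    have "(\<integral>\<^sup>+x. ennreal ((linear_part (ker \<kappa>) x)\<^sup>2) \<partial>Lam) \<le> ennreal (8 * R'' * n ^ 3) * ennreal g2"
      using linear_part_ker_L2[OF \<kappa>m even V] nn_integral_eq_integral[OF Gi] unfolding g2_def by simp
    also have "\<dots> = ennreal w" using g2 by (simp add: w_def ennreal_mult'')
    finally show ?thesis .
  qed
  define A1 where "A1 = {N \<in> space P. 3 * a \<le> \<bar>signed_sum (ker \<kappa>) N - E\<bar>}"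
  have A1: "A1 \<in> sets P" unfolding A1_def by measurable
  have pA1: "prob A1 \<le> \<beta> / 2"
    using signed_sum_tail[OF km kS less_imp_le[OF S] kw w a] a2 unfolding A1_def E_def by linarith
  define Q where "Q = (\<lambda>N. \<Sum>b\<in>UNIV. \<Sum>c\<in>UNIV. pair_sum b c (\<lambda>z. (ker \<kappa> z)\<^sup>2) N)"
  have Qm [measurable]: "Q \<in> borel_measurable P" unfolding Q_def by measurable
  define A2 where "A2 = {N \<in> space P. 1 \<le> ennreal (\<beta> / (2 * S)) * ennreal (Q N)}"
  have A2: "A2 \<in> sets P" unfolding A2_def by measurable
  have pA2: "prob A2 \<le> \<beta> / 2"
  proof -
    have "emeasure P A2 \<le> ennreal (\<beta> / (2 * S)) * (\<integral>\<^sup>+N. ennreal (Q N) * indicator (space P) N \<partial>P)"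
      unfolding A2_def by (rule nn_integral_Markov_inequality) auto
    also have "(\<integral>\<^sup>+N. ennreal (Q N) * indicator (space P) N \<partial>P) = (\<integral>\<^sup>+N. ennreal (Q N) \<partial>P)"
      by (intro nn_integral_cong) simp
    also have "\<dots> = (\<integral>\<^sup>+z. ennreal ((ker \<kappa> z)\<^sup>2) \<partial>LL)"
      unfolding Q_def by (rule nn_integral_pair_sums) auto
    also have "ennreal (\<beta> / (2 * S)) * \<dots> \<le> ennreal (\<beta> / (2 * S)) * ennreal S" by (intro mult_left_mono kS) simp
    also have "\<dots> = ennreal (\<beta> / 2)" using S \<beta> by (subst ennreal_mult [symmetric]) auto
    finally show ?thesis using \<beta> by (simp add: emeasure_eq_measure)
  qed
  obtain A3 where A3: "A3 \<in> null_sets P" and dis: "\<And>N. N \<in> space P - A3 \<Longrightarrow> fst N \<inter> snd N = {}"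
    using AE_disjoint unfolding eventually_ae_filter by blast
  have "prob (A1 \<union> A2 \<union> A3) \<le> prob (A1 \<union> A2) + prob A3" by (rule measure_Un_le) (use A1 A2 A3 in auto)
  also have "prob (A1 \<union> A2) \<le> prob A1 + prob A2" by (rule measure_Un_le) (use A1 A2 in auto)
  also have "prob A3 = 0" using A3 by (simp add: measure_def null_setsD1)
  finally have "prob (A1 \<union> A2 \<union> A3) \<le> \<beta>" using pA1 pA2 by simp
  moreover have "A1 \<union> A2 \<union> A3 \<in> sets P" using A1 A2 A3 by auto
  moreover have "bootstrap_quantile ?K (fst N \<union> snd N) r < ereal (T_hat ?K N)"
    if N: "N \<in> space P - (A1 \<union> A2 \<union> A3)" and r: "exp (- 2 * real p) \<le> 1 - r" for N r
  proof -
    have d: "fst N \<inter> snd N = {}" using dis N by blast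
    have fin: "finite (fst N)" "finite (snd N)" using N by (auto simp: space_P)
    have T: "T_hat ?K N = signed_sum (ker \<kappa>) N"
      using T_hat_eq_signed_sum[OF fin d, of ?K] by (simp add: ker_def[abs_def])
    have Qeq: "(\<Sum>x\<in>fst N \<union> snd N. \<Sum>y\<in>fst N \<union> snd N - {x}. (?K x y)\<^sup>2) = Q N"
    proof -
      have "(\<Sum>x\<in>fst N \<union> snd N. \<Sum>y\<in>fst N \<union> snd N - {x}. (?K x y)\<^sup>2) = (\<Sum>(x, y)\<in>off_diagonal (fst N \<union> snd N). (?K x y)\<^sup>2)"
        using fin by (intro off_diagonal_sum) auto
      also have "\<dots> = (\<Sum>b\<in>UNIV. \<Sum>c\<in>UNIV. \<Sum>(x, y)\<in>point_pairs b c N. (?K x y)\<^sup>2)"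
        by (rule off_diagonal_point_pairs_sum[OF fin d])
      finally show ?thesis by (simp add: Q_def pair_sum_def ker_def case_prod_unfold)
    qed
    have Q0: "0 \<le> Q N" unfolding Qeq [symmetric] by (intro sum_nonneg) auto
    have "\<not> 1 \<le> \<beta> / (2 * S) * Q N"
      using N Q0 \<beta> S by (auto simp: A2_def ennreal_mult' [symmetric])
    then have Qle: "Q N \<le> 2 * S / \<beta>" using \<beta> S by (simp add: field_simps)
    have "bootstrap_quantile ?K (fst N \<union> snd N) r \<le> ereal t"
    proof (rule bootstrap_quantile_le[OF _ p t _ r])
      show "finite (fst N \<union> snd N)" using fin by simp
      have "8 * (real p * exp 1)\<^sup>2 * Q N \<le> 8 * (real p * exp 1)\<^sup>2 * (2 * S / \<beta>)"
        by (intro mult_left_mono Qle) simp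
      also have "\<dots> = t\<^sup>2" using S \<beta> by (simp add: t_def power_mult_distrib)
      finally show "8 * (real p * exp 1)\<^sup>2 * (\<Sum>x\<in>fst N \<union> snd N. \<Sum>y\<in>fst N \<union> snd N - {x}. (?K x y)\<^sup>2) \<le> t\<^sup>2"
        unfolding Qeq .
    qed
    also have "ereal t < ereal (T_hat ?K N)"
    proof -
      have "\<bar>signed_sum (ker \<kappa>) N - E\<bar> < E - t" using N by (auto simp: A1_def a_def)
      then show ?thesis unfolding T by simp
    qed
    finally show ?thesis .
  qed
  ultimately show ?thesis by blast
qed

end

section \<open>Choice of the bandwidth and the rate\<close>

lemma scaled_kernel_eq:
  "scaled_kernel k (m1, m2) = (\<lambda>x (x'::'a::euclidean_space). (2 ^ m2) ^ DIM('a) * k m1 (2 ^ m2 *\<^sub>R (x - x')))"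
proof -
  have "1 / (2::real) powr (- real (DIM('a) * m2)) = (2 ^ m2) ^ DIM('a)"
    by (simp add: powr_minus_divide powr_realpow mult.commute flip: power_mult of_nat_mult)
  moreover have "inverse ((2::real) powr (- real m2)) = 2 ^ m2"
    by (simp add: powr_minus powr_realpow)
  ultimately show ?thesis by (simp only: scaled_kernel_def prod.case)
qed

text \<open>
  \<open>m\<close> is the least exponent for which \<open>2 ^ m\<close> is at least \<open>x powr (- 2 / (d + 4 * \<delta>))\<close>. With
  \<open>x = ln (ln n) / n\<close> the three bounds control the bias, the quantile and the weight.
\<close>

lemma dyadic_bandwidth:
  fixes x \<delta> d :: real
  assumes x: "0 < x" "x < 1" and \<delta>: "0 < \<delta>" and d: "1 \<le> d"
  shows "\<exists>m::nat. (2 ^ m) powr (- 2 * \<delta>) \<le> x powr (4 * \<delta> / (d + 4 * \<delta>)) \<and>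
    (2 ^ m) powr (d / 2) * x \<le> 2 powr (d / 2) * x powr (4 * \<delta> / (d + 4 * \<delta>)) \<and>
    real m + 1 \<le> 4 * ln (1 / x) + 2"
proof -
  define e where "e = d + 4 * \<delta>"
  have e: "1 \<le> e" using \<delta> d by (simp add: e_def)
  define y where "y = 2 / e * log 2 (1 / x)"
  have y0: "0 \<le> y" using x e by (simp add: y_def)
  define m where "m = nat \<lceil>y\<rceil>"
  have m: "y \<le> real m" "real m \<le> y + 1"
    using y0 ceiling_correct[of y] by (auto simp: m_def)
  have powr_y: "2 powr y = x powr (- 2 / e)"
  proof -
    have "2 powr y = (2 powr log 2 (1 / x)) powr (2 / e)" by (simp add: powr_powr y_def mult.commute)
    also have "\<dots> = (1 / x) powr (2 / e)" using x by simp
    also have "\<dots> = x powr (- 2 / e)" using x by (simp add: powr_divide powr_minus_divide)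
    finally show ?thesis .
  qed
  have M: "(2::real) ^ m = 2 powr real m" by (simp add: powr_realpow)
  have "((2::real) ^ m) powr (- 2 * \<delta>) \<le> (2 powr y) powr (- 2 * \<delta>)"
    unfolding M using m(1) \<delta> by (intro powr_mono2') auto
  also have "\<dots> = x powr (4 * \<delta> / e)" unfolding powr_y by (simp add: powr_powr mult.commute)
  finally have 1: "(2 ^ m) powr (- 2 * \<delta>) \<le> x powr (4 * \<delta> / e)" .
  have "((2::real) ^ m) powr (d / 2) \<le> (2 * 2 powr y) powr (d / 2)"
  proof -
    have "2 powr real m \<le> 2 powr (1 + y)" using m(2) by (intro powr_mono) auto
    also have "\<dots> = 2 * 2 powr y" by (simp add: powr_add)
    finally show ?thesis unfolding M using d by (intro powr_mono2) auto
  qed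
  also have "\<dots> = 2 powr (d / 2) * x powr (- d / e)"
    unfolding powr_y by (simp add: powr_mult powr_powr)
  finally have "((2::real) ^ m) powr (d / 2) * x \<le> 2 powr (d / 2) * x powr (- d / e) * x"
    using x by (intro mult_right_mono) auto
  also have "\<dots> = 2 powr (d / 2) * x powr (- d / e + 1)"
    using x by (simp only: powr_add powr_one mult.assoc)
  also have "- d / e + 1 = 4 * \<delta> / e" using e by (simp add: e_def field_simps)
  finally have 2: "((2::real) ^ m) powr (d / 2) * x \<le> 2 powr (d / 2) * x powr (4 * \<delta> / e)" .
  have ln2: "1 / 2 \<le> ln (2::real)" using ln2_ge_two_thirds by linarith
  have l: "0 \<le> ln (1 / x)" using x by simp
  have "y \<le> 2 * log 2 (1 / x)"
  proof -
    have "2 / e \<le> 2" using e by (simp add: divide_le_eq)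
    moreover have "0 \<le> log 2 (1 / x)" using x by simp
    ultimately show ?thesis unfolding y_def by (rule mult_right_mono)
  qed
  also have "\<dots> \<le> 4 * ln (1 / x)"
  proof -
    have "ln (1 / x) / ln 2 \<le> ln (1 / x) / (1 / 2)" using l ln2 by (intro divide_left_mono) auto
    then show ?thesis by (simp only: log_def) simp
  qed
  finally have "real m + 1 \<le> 4 * ln (1 / x) + 2" using m(2) by linarith
  with 1 2 show ?thesis unfolding e_def by blast
qed

text \<open>
  The order \<open>p\<close> is half of \<open>weight (m1, m2) + ln (1 / \<alpha>)\<close>, rounded up. The weight depends on \<open>m2\<close>
  through \<open>2 * ln (m2 + 1)\<close> only, so it is of order \<open>ln y\<close> if \<open>m2\<close> is of order \<open>y\<close>; below,
  \<open>y = ln n\<close>.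
\<close>

lemma moment_order:
  assumes \<alpha>: "0 < \<alpha>" "\<alpha> < 1" and m1: "1 \<le> m1" and m2: "real m2 + 1 \<le> 5 * y" and y: "0 < y" "1 \<le> ln y"
  shows "\<exists>p\<ge>1. exp (- 2 * real p) \<le> \<alpha> * exp (- weight (m1, m2)) \<and>
    real p \<le> (ln (real m1) + ln 5 + ln (pi\<^sup>2 / 6) + ln (1 / \<alpha>) / 2 + 3) * ln y"
proof -
  define z where "z = (weight (m1, m2) + ln (1 / \<alpha>)) / 2"
  have pi: "0 \<le> ln (pi\<^sup>2 / 6)"
  proof -
    have "3 * 3 \<le> pi * pi" using pi_gt3 by (intro mult_mono) auto
    then show ?thesis by (simp add: power2_eq_square)
  qed
  have la: "0 \<le> ln (1 / \<alpha>)" using \<alpha> by simp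
  have lm: "0 \<le> ln (real m1)" using m1 by simp
  have w: "weight (m1, m2) = 2 * (ln (real m1) + ln (real m2 + 1) + ln (pi\<^sup>2 / 6))"
  proof -
    have "ln (real (m1 * (m2 + 1))) = ln (real m1 * (real m2 + 1))" by (simp add: algebra_simps)
    also have "\<dots> = ln (real m1) + ln (real m2 + 1)" using m1 by (intro ln_mult_pos) auto
    finally show ?thesis by (simp only: weight_def prod.case)
  qed
  have z: "z = ln (real m1) + ln (real m2 + 1) + ln (pi\<^sup>2 / 6) + ln (1 / \<alpha>) / 2" unfolding z_def w by simp
  have "0 \<le> ln (real m2 + 1)" by simp
  then have z0: "0 \<le> z" using pi la lm unfolding z by simp
  define p where "p = nat \<lceil>z\<rceil> + 1"
  have p: "z \<le> real p" "real p \<le> z + 2"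
    using z0 ceiling_correct[of z] unfolding p_def by linarith+
  have "exp (- 2 * real p) \<le> exp (- 2 * z)" using p by simp
  also have "- 2 * z = ln \<alpha> + - weight (m1, m2)" using \<alpha> by (simp add: z_def ln_div)
  also have "exp \<dots> = \<alpha> * exp (- weight (m1, m2))" using \<alpha> by (simp only: exp_add exp_ln)
  finally have 1: "exp (- 2 * real p) \<le> \<alpha> * exp (- weight (m1, m2))" .
  have "ln (real m2 + 1) \<le> ln (5 * y)" using m2 by (subst ln_le_cancel_iff) auto
  also have "\<dots> = ln 5 + ln y" using y by (simp add: ln_mult)
  finally have "real p \<le> (ln (real m1) + ln 5 + ln (pi\<^sup>2 / 6) + ln (1 / \<alpha>) / 2 + 2) * 1 + ln y"
    using p(2) unfolding z by simp
  also have "\<dots> \<le> (ln (real m1) + ln 5 + ln (pi\<^sup>2 / 6) + ln (1 / \<alpha>) / 2 + 2) * ln y + ln y"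
    using pi la lm y by (intro add_right_mono mult_left_mono) auto
  finally have "real p \<le> (ln (real m1) + ln 5 + ln (pi\<^sup>2 / 6) + ln (1 / \<alpha>) / 2 + 3) * ln y"
    by (simp add: algebra_simps)
  with 1 show ?thesis by (intro exI[of _ p]) (simp add: p_def)
qed

context two_sample
begin

text \<open>
  The acceptance region of the aggregated test is contained in the measurable exceptional set of the
  single member \<open>(m1, m2)\<close>.
\<close>

lemma Phi3_second_kind_error:
  fixes k :: "nat \<Rightarrow> 'a \<Rightarrow> real"
  assumes m1: "1 \<le> m1" and k: "plancherel_transform (k m1) F" and even: "\<And>x. k m1 x = k m1 (- x)"
    and B: "0 \<le> B" "AE v in lborel. cmod (1 - F v) \<le> B * norm v powr \<delta>"
    and h: "h \<in> sobolev_ball \<delta> R"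
    and \<alpha>: "0 < \<alpha>" "\<alpha> < 1" and \<beta>: "0 < \<beta>" and pos: "0 < R'" "0 < R''"
    and V: "(LINT x|lborel. (k m1 x)\<^sup>2) \<le> V" "0 < V"
    and p: "1 \<le> p" "exp (- 2 * real p) \<le> \<alpha> * exp (- weight (m1, m2))"
    and sep: "4 * B\<^sup>2 * R\<^sup>2 * (2 ^ m2) powr (- 2 * \<delta>) + 576 * R'' / (\<beta> * n)
      + (48 + 16 * real p * exp 1) * sqrt (R' * R'' * ((2 ^ m2) ^ DIM('a) * V) / \<beta>) / n \<le> (L2_norm h)\<^sup>2"
  shows "emeasure P {N \<in> space P. Phi3 k \<alpha> N = 0} \<le> ennreal \<beta>"
proof -
  define M :: real where "M = 2 ^ m2"
  have M: "0 < M" by (simp add: M_def)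
  define \<kappa> where "\<kappa> x = M ^ DIM('a) * k m1 (M *\<^sub>R x)" for x
  have kL2: "in_L2 (k m1)" using k by (simp add: plancherel_transform_def)
  then have [measurable]: "k m1 \<in> borel_measurable borel" by (simp add: in_L2_def)
  have \<kappa>m: "\<kappa> \<in> borel_measurable borel" unfolding \<kappa>_def[abs_def] by measurable
  have \<kappa>e: "\<kappa> (- x) = \<kappa> x" for x using even[of "M *\<^sub>R x"] by (simp add: \<kappa>_def)
  have \<kappa>V: "(\<integral>\<^sup>+x. ennreal ((\<kappa> x)\<^sup>2) \<partial>lborel) \<le> ennreal (M ^ DIM('a) * V)"
  proof -
    have "(\<integral>\<^sup>+x. ennreal ((\<kappa> x)\<^sup>2) \<partial>lborel)
      = (\<integral>\<^sup>+x. ennreal (M ^ DIM('a)) * (ennreal (M ^ DIM('a)) * ennreal ((k m1 (0 + M *\<^sub>R x))\<^sup>2)) \<partial>lborel)"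
      using M by (intro nn_integral_cong) (simp add: \<kappa>_def power2_eq_square mult_ac flip: ennreal_mult)
    also have "\<dots> = ennreal (M ^ DIM('a)) * (ennreal (\<bar>M\<bar> ^ DIM('a)) * (\<integral>\<^sup>+x. ennreal ((k m1 (0 + M *\<^sub>R x))\<^sup>2) \<partial>lborel))"
      using M by (simp add: nn_integral_cmult)
    also have "ennreal (\<bar>M\<bar> ^ DIM('a)) * (\<integral>\<^sup>+x. ennreal ((k m1 (0 + M *\<^sub>R x))\<^sup>2) \<partial>lborel)
      = (\<integral>\<^sup>+x. ennreal ((k m1 x)\<^sup>2) \<partial>lborel)"
      by (rule nn_integral_affine [symmetric]) (use M in auto)
    also have "\<dots> = ennreal (LINT x|lborel. (k m1 x)\<^sup>2)"
      using kL2 by (intro nn_integral_eq_integral) (auto simp: in_L2_def)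
    also have "ennreal (M ^ DIM('a)) * \<dots> \<le> ennreal (M ^ DIM('a)) * ennreal V"
      by (intro mult_left_mono ennreal_leI V) simp
    also have "\<dots> = ennreal (M ^ DIM('a) * V)" using M V by (intro ennreal_mult [symmetric]) auto
    finally show ?thesis .
  qed
  have bias: "(\<integral>\<^sup>+x. ennreal ((h x - convol \<kappa> h x)\<^sup>2) \<partial>lborel) \<le> ennreal (4 * B\<^sup>2 * R\<^sup>2 * M powr (- 2 * \<delta>))"
    unfolding \<kappa>_def[abs_def] by (rule bandwidth_bias[OF k B h M])
  obtain A where A: "A \<in> sets P" "measure P A \<le> \<beta>" and
    off: "\<And>N r. N \<in> space P - A \<Longrightarrow> exp (- 2 * real p) \<le> 1 - r \<Longrightarrow>
      bootstrap_quantile (\<lambda>x y. \<kappa> (x - y)) (fst N \<union> snd N) r < ereal (T_hat (\<lambda>x y. \<kappa> (x - y)) N)"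
    using second_kind_error[OF \<kappa>m \<kappa>e \<kappa>V _ _ bias _ p(1) \<beta> pos] sep h M V
    by (auto simp: sobolev_ball_def M_def)
  have K: "scaled_kernel k (m1, m2) = (\<lambda>x y. \<kappa> (x - y))"
    unfolding scaled_kernel_eq by (simp add: \<kappa>_def M_def)
  have "{N \<in> space P. Phi3 k \<alpha> N = 0} \<subseteq> A"
  proof
    fix N assume N: "N \<in> {N \<in> space P. Phi3 k \<alpha> N = 0}"
    have "ereal (T_hat (scaled_kernel k (m1, m2)) N)
      \<le> bootstrap_quantile (scaled_kernel k (m1, m2)) (fst N \<union> snd N) (1 - \<alpha> * exp (- weight (m1, m2)))"
      by (rule aggregated_test_eq_0D[OF _ _ nn_integral_exp_neg_weight \<alpha>]) (use m1 N in \<open>auto simp: Phi3_def\<close>)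
    then show "N \<in> A"
      using off[of N "1 - \<alpha> * exp (- weight (m1, m2))"] p(2) N unfolding K by (auto simp flip: not_le)
  qed
  then have "emeasure P {N \<in> space P. Phi3 k \<alpha> N = 0} \<le> emeasure P A" by (rule emeasure_mono) (rule A)
  also have "\<dots> \<le> ennreal \<beta>" using A(2) by (simp add: emeasure_eq_measure ennreal_leI)
  finally show ?thesis .
qed

end

lemma separation_rate_le:
  assumes "0 < \<rho>"
    and "\<And>f g. (f, g) \<in> S \<Longrightarrow> \<rho> < L2_norm (\<lambda>x. f x - g x) \<Longrightarrow>
      emeasure (P f g) {\<omega> \<in> space (P f g). \<Phi> \<omega> = 0} \<le> ennreal \<beta>"
  shows "separation_rate P \<Phi> S \<beta> \<le> ennreal \<rho>"
  unfolding separation_rate_def using assms by (intro Inf_lower) (auto intro!: exI[of _ \<rho>] SUP_least)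

theorem corollary2:
  fixes k :: "nat \<Rightarrow> real ^ 'd \<Rightarrow> real"
    and khat :: "nat \<Rightarrow> real ^ 'd \<Rightarrow> complex"
    and \<alpha> \<beta> \<delta> R R' R'' :: real
  assumes k_L2: "\<And>m. 1 \<le> m \<Longrightarrow> in_L2 (k m)"
    and k_even: "\<And>m x. 1 \<le> m \<Longrightarrow> k m x = k m (- x)"
    and khat: "\<And>m. 1 \<le> m \<Longrightarrow> plancherel_transform (k m) (khat m)"
    and khat_bounded: "\<And>m. 1 \<le> m \<Longrightarrow> esssup lborel (\<lambda>u. ereal (cmod (khat m u))) < \<infinity>"
    and khat_approx: "\<And>m. 1 \<le> m \<Longrightarrow> \<exists>C>0.
          esssup (restrict_space lborel (UNIV - {0}))
            (\<lambda>u. ereal (cmod (1 - khat m u) / norm u ^ m)) \<le> ereal C"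
    and "0 < \<alpha>" "\<alpha> < 1" "0 < \<beta>" "\<beta> < 1"
    and "0 < \<delta>" "0 < R" "0 < R'" "0 < R''"
  shows "\<exists>C>0. \<forall>n>1. ln (ln n) \<ge> 1 \<longrightarrow>
    (\<forall>P. two_sample_model n P \<longrightarrow>
      separation_rate P (Phi3 k \<alpha>) (sobolev_class \<delta> R R' R'') \<beta>
        \<le> ennreal (C * (ln (ln n) / n) powr (2 * \<delta> / (real CARD('d) + 4 * \<delta>))))"
proof -
  let ?d = "CARD('d)"
  define m1 where "m1 = max 1 (nat \<lceil>\<delta>\<rceil>)"
  have m1: "1 \<le> m1" by (simp add: m1_def)
  have "\<delta> \<le> real m1" using le_of_int_ceiling[of \<delta>] \<open>0 < \<delta>\<close> unfolding m1_def by linarith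
  then obtain B where B: "0 \<le> B" "AE v in lborel. cmod (1 - khat m1 v) \<le> B * norm v powr \<delta>"
    using transform_deviation[OF khat_bounded[OF m1]] khat_approx[OF m1] \<open>0 < \<delta>\<close> by blast
  (* The summand 1 only serves to make V positive. *)
  define V where "V = (LINT x|lborel. (k m1 x)\<^sup>2) + 1"
  have V: "0 < V" "(LINT x|lborel. (k m1 x)\<^sup>2) \<le> V"
    using Bochner_Integration.integral_nonneg[of lborel "\<lambda>x. (k m1 x)\<^sup>2"] unfolding V_def by (simp_all add: add_nonneg_pos)
  define c where "c = ln (real m1) + ln 5 + ln (pi\<^sup>2 / 6) + ln (1 / \<alpha>) / 2 + 3"
  define s where "s = sqrt (R' * R'' * V / \<beta>)"
  have s: "0 \<le> s" using assms V by (simp add: s_def)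
  (* The contributions of the bias, of the linear part of the variance, and of the quantile together
     with the quadratic part of the variance; ln (ln n) \<ge> 1 is used to bound 48 by 48 * ln (ln n). *)
  define D where "D = 4 * B\<^sup>2 * R\<^sup>2 + 576 * R'' / \<beta> + (48 + 16 * c * exp 1) * s * 2 powr (real ?d / 2)"
  (* The maximum only keeps C positive. *)
  define C where "C = sqrt (max 1 D)"
  have C: "0 < C" "D \<le> C\<^sup>2" by (auto simp: C_def)
  have "separation_rate P (Phi3 k \<alpha>) (sobolev_class \<delta> R R' R'') \<beta>
      \<le> ennreal (C * (ln (ln n) / n) powr (2 * \<delta> / (real ?d + 4 * \<delta>)))"
    if n: "1 < n" and ll: "1 \<le> ln (ln n)" and model: "two_sample_model n P" for n P
  proof -
    define y where "y = ln n"
    have y: "2 \<le> y" "0 < y" "1 \<le> ln y"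
    proof -
      show "0 < y" "1 \<le> ln y" using n ll by (auto simp: y_def)
      then have "exp 1 \<le> y" by (simp add: ln_ge_iff)
      then show "2 \<le> y" using exp_ge_add_one_self[of 1] by linarith
    qed
    define x where "x = ln y / n"
    have x_lt: "ln y < n" using less_trans[OF ln_less_self[of y]] ln_less_self[of n] y(2) n unfolding y_def by simp
    have x: "0 < x" "x < 1" "1 / n \<le> x"
      using y n x_lt by (auto simp: x_def divide_simps)
    define X where "X = x powr (4 * \<delta> / (real ?d + 4 * \<delta>))"
    have xX: "x \<le> X"
    proof -
      have "x powr 1 \<le> X" unfolding X_def using x \<open>0 < \<delta>\<close> by (intro powr_mono') auto
      then show ?thesis using x by simp
    qed
    have X0: "0 \<le> X" by (simp add: X_def)
    obtain m2 :: nat where m2: "(2 ^ m2) powr (- 2 * \<delta>) \<le> X"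
      "(2 ^ m2) powr (real ?d / 2) * x \<le> 2 powr (real ?d / 2) * X"
      "real m2 + 1 \<le> 4 * ln (1 / x) + 2"
      using dyadic_bandwidth[of x \<delta> "real ?d"] x \<open>0 < \<delta>\<close> unfolding X_def by auto
    have "ln (1 / x) \<le> ln n" using x n by (subst ln_le_cancel_iff) (auto simp: divide_simps mult.commute)
    then have "real m2 + 1 \<le> 5 * y" using m2(3) y(1) unfolding y_def by linarith
    then obtain p where p: "1 \<le> p" "exp (- 2 * real p) \<le> \<alpha> * exp (- weight (m1, m2))" "real p \<le> c * ln y"
      using moment_order[of \<alpha> m1 m2 y] assms m1 y unfolding c_def by blast
    have sep: "4 * B\<^sup>2 * R\<^sup>2 * (2 ^ m2) powr (- 2 * \<delta>) + 576 * R'' / (\<beta> * n)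
      + (48 + 16 * real p * exp 1) * sqrt (R' * R'' * ((2 ^ m2) ^ ?d * V) / \<beta>) / n \<le> C\<^sup>2 * X"
    proof -
      let ?Md = "(2 ^ m2) powr (real ?d / 2)"
      have Md: "sqrt ((2 ^ m2) ^ ?d) = ?Md"
      proof -
        have "(2 ^ m2) ^ ?d = ((2 ^ m2) powr real ?d :: real)" by (simp add: powr_realpow)
        then show ?thesis by (simp only: powr_half_sqrt_powr zero_le_power zero_le_numeral)
      qed
      have "sqrt (R' * R'' * ((2 ^ m2) ^ ?d * V) / \<beta>) = sqrt (R' * R'' * V / \<beta> * (2 ^ m2) ^ ?d)"
        by (rule arg_cong[where f=sqrt]) simp
      also have "\<dots> = s * ?Md" by (simp only: real_sqrt_mult s_def Md)
      finally have root: "sqrt (R' * R'' * ((2 ^ m2) ^ ?d * V) / \<beta>) = s * ?Md" .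
      have "48 + 16 * real p * exp 1 \<le> (48 + 16 * c * exp 1) * ln y"
      proof -
        have "real p * exp 1 \<le> c * ln y * exp 1" using p(3) by (intro mult_right_mono) auto
        then have "48 + 16 * (real p * exp 1) \<le> 48 * ln y + 16 * (c * ln y * exp 1)" using y(3) by linarith
        then show ?thesis by (simp add: algebra_simps)
      qed
      then have "(48 + 16 * real p * exp 1) * (s * ?Md / n) \<le> (48 + 16 * c * exp 1) * ln y * (s * ?Md / n)"
        using s n by (intro mult_right_mono) auto
      also have "\<dots> = (48 + 16 * c * exp 1) * s * (?Md * x)" by (simp add: x_def)
      also have "\<dots> \<le> (48 + 16 * c * exp 1) * s * (2 powr (real ?d / 2) * X)"
      proof -
        have "0 \<le> c * ln y" using p by linarith
        then have "0 \<le> c" using y by (simp add: zero_le_mult_iff)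
        then show ?thesis using s by (intro mult_left_mono m2) auto
      qed
      finally have 1: "(48 + 16 * real p * exp 1) * (s * ?Md) / n \<le> (48 + 16 * c * exp 1) * s * 2 powr (real ?d / 2) * X"
        by (simp add: mult.assoc)
      have 2: "576 * R'' / (\<beta> * n) \<le> 576 * R'' / \<beta> * X"
      proof -
        have "576 * R'' / \<beta> * (1 / n) \<le> 576 * R'' / \<beta> * X"
          using assms x xX by (intro mult_left_mono) auto
        then show ?thesis by simp
      qed
      have 3: "4 * B\<^sup>2 * R\<^sup>2 * (2 ^ m2) powr (- 2 * \<delta>) \<le> 4 * B\<^sup>2 * R\<^sup>2 * X"
        by (intro mult_left_mono m2) auto
      have "4 * B\<^sup>2 * R\<^sup>2 * X + 576 * R'' / \<beta> * X + (48 + 16 * c * exp 1) * s * 2 powr (real ?d / 2) * X = D * X"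
        by (simp add: D_def distrib_right)
      also have "\<dots> \<le> C\<^sup>2 * X" using C X0 by (intro mult_right_mono) auto
      finally show ?thesis unfolding root using 1 2 3 by linarith
    qed
    define \<rho> where "\<rho> = C * x powr (2 * \<delta> / (real ?d + 4 * \<delta>))"
    have \<rho>: "0 < \<rho>" "\<rho>\<^sup>2 = C\<^sup>2 * X"
    proof -
      show "0 < \<rho>" using C x by (simp add: \<rho>_def)
      have "(x powr (2 * \<delta> / (real ?d + 4 * \<delta>)))\<^sup>2 = X"
        using x unfolding X_def by (simp add: power2_eq_square flip: powr_add)
      then show "\<rho>\<^sup>2 = C\<^sup>2 * X" by (simp add: \<rho>_def power_mult_distrib)
    qed
    have "separation_rate P (Phi3 k \<alpha>) (sobolev_class \<delta> R R' R'') \<beta> \<le> ennreal \<rho>"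
    proof (rule separation_rate_le[OF \<rho>(1)])
      fix f g :: "real ^ 'd \<Rightarrow> real"
      assume fg: "(f, g) \<in> sobolev_class \<delta> R R' R''" and far: "\<rho> < L2_norm (\<lambda>x. f x - g x)"
      have fgc: "intensity f" "intensity g" "(\<lambda>x. f x - g x) \<in> sobolev_ball \<delta> R"
        "L1_norm f \<le> R'" "L1_norm g \<le> R'" "sup_norm f \<le> R''" "sup_norm g \<le> R''"
        using fg by (simp_all add: sobolev_class_def)
      have "0 < n" using n by simp
      moreover note fgc(1,2)
      moreover have "prob_space (P f g)" "sets (P f g) = sets (config_space \<Otimes>\<^sub>M config_space)"
        "poisson_process (P f g) fst (intensity_measure n f)" "poisson_process (P f g) snd (intensity_measure n g)"
        "prob_space.indep_var (P f g) config_space fst config_space snd"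
        using model[unfolded two_sample_model_def, rule_format, OF fgc(1,2)] by blast+
      moreover note fgc(4-)
      ultimately interpret two_sample n f g "P f g" R' R'' by (rule two_sample.intro)
      have h: "h = (\<lambda>x. f x - g x)" by (rule ext) (simp add: h_def)
      have "\<rho>\<^sup>2 \<le> (L2_norm h)\<^sup>2" using far \<rho>(1) unfolding h by (intro power_mono) auto
      then have far': "C\<^sup>2 * X \<le> (L2_norm h)\<^sup>2" unfolding \<rho>(2) .
      have hS: "h \<in> sobolev_ball \<delta> R" unfolding h by (rule fgc)
      show "emeasure (P f g) {N \<in> space (P f g). Phi3 k \<alpha> N = 0} \<le> ennreal \<beta>"
        by (rule Phi3_second_kind_error[where k = k, OF m1 khat[OF m1] k_even[OF m1] B hS])
           (use assms V p order_trans[OF sep far'] in simp_all)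
    qed
    then show ?thesis unfolding \<rho>_def x_def y_def by simp
  qed
  with C(1) show ?thesis by blast
qed

end
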